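(* Let $1<p<\infty$. (1) If $p>2$ and $\omega\in A_1$, then $$\|\mathcal{B}:L^{p,2}(\omega)\to F^{p,2}_0(\omega)\|\le C(p,n)\,[\omega]_{A_1}^{1/2}.$$ (2) If $1<p<2$ and $\omega'=\omega^{1-p'}\in A_1$, then $$\|\mathcal{B}:L^{p,2}(\omega)\to F^{p,2}_0(\omega)\|\le C(p,n)\,[\omega']_{A_1}^{1/2}.$$ Here $C(p,n)$ depends only on $p$ and $n$. In both cases the estimate is sharp, in the sense that the exponent $1/2$ of $[\omega]_{A_1}$ (respectively of $[\omega']_{A_1}$) cannot be replaced by a smaller one (with a constant independent of $\omega$).
   Context: $\mathbb{B}$ is the open unit ball of $\mathbb{C}^n$, $n\ge1$, $\mathbb{S}=\partial\mathbb{B}$; $d\nu$ and $d\sigma$ are the normalized Lebesgue measures on $\mathbb{B}$ and $\mathbb{S}$; $z\overline w=\sum_j z_j\overline{w_j}$; $|E|=\sigma(E)$ for $E\subset\mathbb{S}$. $p'$ is the conjugate exponent of $p$. A weight on $\mathbb{S}$ is a function $\omega\in L^1(\mathbb{S},d\sigma)$ with $\omega>0$ a.e.; all $\omega$ are weights. Nonisotropic balls: $B(\zeta,r)=\{\eta\in\mathbb{S}:|1-\zeta\overline\eta|<r\}$. The Hardy–Littlewood maximal function is $M(\psi)(\zeta)=\sup_{\zeta\in B}\frac1{|B|}\int_B|\psi|\,d\sigma$ (supremum over nonisotropic balls $B\ni\zeta$). $\omega\in A_1$ means that $M(\omega)\le C\omega$ a.e. for some $C>0$, and $[\omega]_{A_1}=\operatorname{ess\,sup}_{\zeta\in\mathbb{S}}\frac{M(\omega)(\zeta)}{\omega(\zeta)}$.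 $L^{p,2}(\omega)$ is the space of measurable functions $\varphi$ on $\mathbb{B}$ with $$\|\varphi\|_{L^{p,2}(\omega)}^p=\int_{\mathbb{S}}\Big(\int_0^1|\varphi(r\zeta)|^2\frac{2nr^{2n-1}dr}{1-r^2}\Big)^{p/2}\omega(\zeta)\,d\sigma(\zeta)<\infty.$$ $F^{p,2}_0(\omega)$ is the space of holomorphic functions $f$ on $\mathbb{B}$ with $\|f\|_{F^{p,2}_0(\omega)}=\big\|(1-|z|^2)\big(I+\frac Rn\big)f(z)\big\|_{L^{p,2}(\omega)}<\infty$, where $I$ is the identity and $R=\sum_{j=1}^n z_j\frac{\partial}{\partial z_j}$. The Bergman operator is $\mathcal{B}(\varphi)(z)=\int_{\mathbb{B}}\frac{\varphi(w)}{(1-z\overline w)^{n+1}}d\nu(w)$, $z\in\mathbb{B}$. $\|\mathcal{B}:X\to Y\|$ is the operator norm. *)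

theory Defs
  imports "HOL-Analysis.Analysis" "HOL-Probability.Essential_Supremum"
begin

text \<open>
  Complex \<open>n\<close>-space is \<^typ>\<open>complex^'n\<close> with \<open>n = CARD('n)\<close>; its norm is the Euclidean (Hermitian)
  one, so \<open>ball 0 1\<close> and \<open>sphere 0 1\<close> are the unit ball and the unit sphere.
\<close>

definition hdot :: "complex^'n \<Rightarrow> complex^'n \<Rightarrow> complex" where
  "hdot z w = (\<Sum>j\<in>UNIV. z $ j * cnj (w $ j))"

definition ball_measure :: "(complex^'n) measure" where
  "ball_measure = uniform_measure (lebesgue_on (ball 0 1)) (ball 0 1)"

text \<open>
  Normalized surface measure, by polar coordinates: a subset \<open>E\<close> of the sphere has the measure of the
  cone \<open>{z \<in> ball 0 1. z / |z| \<in> E}\<close> under normalized Lebesgue measure. It is completed so that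
  Lebesgue measurable functions on the sphere are measurable. The value \<open>sgn 0 = 0\<close> lies off the
  sphere, but affects only a null set.
\<close>
definition sphere_measure :: "(complex^'n) measure" where
  "sphere_measure =
     completion (restrict_space (distr (uniform_measure lborel (ball 0 1)) borel sgn) (sphere 0 1))"

definition weight :: "(complex^'n \<Rightarrow> real) \<Rightarrow> bool" where
  "weight \<omega> \<longleftrightarrow> integrable sphere_measure \<omega> \<and> (AE \<zeta> in sphere_measure. 0 < \<omega> \<zeta>)"

definition nball :: "complex^'n \<Rightarrow> real \<Rightarrow> (complex^'n) set" where
  "nball \<zeta> r = {\<eta> \<in> sphere 0 1. norm (1 - hdot \<zeta> \<eta>) < r}"

definition HL_maximal :: "(complex^'n \<Rightarrow> real) \<Rightarrow> complex^'n \<Rightarrow> ennreal" where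
  "HL_maximal \<psi> \<zeta> =
     (SUP B \<in> {nball \<xi> r | \<xi> r. \<xi> \<in> sphere 0 1 \<and> 0 < r \<and> \<zeta> \<in> nball \<xi> r}.
        (\<integral>\<^sup>+\<eta>\<in>B. ennreal \<bar>\<psi> \<eta>\<bar> \<partial>sphere_measure) / emeasure sphere_measure B)"

definition A1 :: "(complex^'n \<Rightarrow> real) set" where
  "A1 = {\<omega>. weight \<omega> \<and>
     (\<exists>C>0. AE \<zeta> in sphere_measure. HL_maximal \<omega> \<zeta> \<le> ennreal (C * \<omega> \<zeta>))}"

text \<open>The essential supremum is finite for \<open>\<omega> \<in> A1\<close>, the only case in which this real number is used.\<close>
definition A1_const :: "(complex^'n \<Rightarrow> real) \<Rightarrow> real" where
  "A1_const \<omega> = enn2real (esssup sphere_measure (\<lambda>\<zeta>. HL_maximal \<omega> \<zeta> / ennreal (\<omega> \<zeta>)))"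

text \<open>Power with a positive exponent \<open>a\<close>, so that \<open>\<infinity>\<close> is mapped to itself.\<close>
definition epowr :: "ennreal \<Rightarrow> real \<Rightarrow> ennreal" where
  "epowr x a = (if x = \<infinity> then \<infinity> else ennreal (enn2real x powr a))"

definition Lp2_norm :: "real \<Rightarrow> (complex^'n \<Rightarrow> real) \<Rightarrow> (complex^'n \<Rightarrow> complex) \<Rightarrow> ennreal" where
  "Lp2_norm p \<omega> \<phi> =
     epowr (\<integral>\<^sup>+\<zeta>. epowr (\<integral>\<^sup>+r\<in>{0<..<1}.
                 ennreal ((norm (\<phi> (r *\<^sub>R \<zeta>)))\<^sup>2
                   * (2 * real CARD('n) * r ^ (2 * CARD('n) - 1) / (1 - r\<^sup>2))) \<partial>lebesgue) (p / 2)
               * ennreal (\<omega> \<zeta>) \<partial>sphere_measure) (1 / p)"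

definition Lp2 :: "real \<Rightarrow> (complex^'n \<Rightarrow> real) \<Rightarrow> (complex^'n \<Rightarrow> complex) set" where
  "Lp2 p \<omega> = {\<phi>. \<phi> \<in> borel_measurable (lebesgue_on (ball 0 1)) \<and> Lp2_norm p \<omega> \<phi> < \<infinity>}"

text \<open>Holomorphy in several variables: complex Frechet differentiability on an open set.\<close>
definition cholomorphic_on :: "(complex^'n \<Rightarrow> complex) \<Rightarrow> (complex^'n) set \<Rightarrow> bool" where
  "cholomorphic_on f U \<longleftrightarrow>
     (\<forall>z\<in>U. \<exists>D. (f has_derivative D) (at z) \<and> (\<forall>c v. D (c *s v) = c * D v))"

definition cpartial :: "'n \<Rightarrow> (complex^'n \<Rightarrow> complex) \<Rightarrow> complex^'n \<Rightarrow> complex" where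
  "cpartial j f z = deriv (\<lambda>t. f (\<chi> i. if i = j then t else z $ i)) (z $ j)"

definition radial_deriv :: "(complex^'n \<Rightarrow> complex) \<Rightarrow> complex^'n \<Rightarrow> complex" where
  "radial_deriv f z = (\<Sum>j\<in>UNIV. z $ j * cpartial j f z)"

definition Fp2_norm :: "real \<Rightarrow> (complex^'n \<Rightarrow> real) \<Rightarrow> (complex^'n \<Rightarrow> complex) \<Rightarrow> ennreal" where
  "Fp2_norm p \<omega> f =
     Lp2_norm p \<omega> (\<lambda>z. of_real (1 - (norm z)\<^sup>2) * (f z + radial_deriv f z / of_nat CARD('n)))"

definition Fp2 :: "real \<Rightarrow> (complex^'n \<Rightarrow> real) \<Rightarrow> (complex^'n \<Rightarrow> complex) set" where
  "Fp2 p \<omega> = {f. cholomorphic_on f (ball 0 1) \<and> Fp2_norm p \<omega> f < \<infinity>}"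

definition bergman :: "(complex^'n \<Rightarrow> complex) \<Rightarrow> complex^'n \<Rightarrow> complex" where
  "bergman \<phi> z = (LINT w|ball_measure. \<phi> w / (1 - hdot z w) ^ (CARD('n) + 1))"

definition op_norm ::
  "'a set \<Rightarrow> ('a \<Rightarrow> ennreal) \<Rightarrow> ('b \<Rightarrow> ennreal) \<Rightarrow> ('a \<Rightarrow> 'b) \<Rightarrow> ennreal" where
  "op_norm X normX normY T = (SUP x \<in> {x \<in> X. normX x \<le> 1}. normY (T x))"

definition bergman_norm :: "real \<Rightarrow> (complex^'n \<Rightarrow> real) \<Rightarrow> ennreal" where
  "bergman_norm p \<omega> = op_norm (Lp2 p \<omega>) (Lp2_norm p \<omega>) (Fp2_norm p \<omega>) bergman"

definition conj_exponent :: "real \<Rightarrow> real" where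
  "conj_exponent p = p / (p - 1)"

definition dual_weight :: "real \<Rightarrow> (complex^'n \<Rightarrow> real) \<Rightarrow> complex^'n \<Rightarrow> real" where
  "dual_weight p \<omega> = (\<lambda>\<zeta>. \<omega> \<zeta> powr (1 - conj_exponent p))"

end

theory Submission
  imports Defs "HOL-Probability.Probability" "HOL-Complex_Analysis.Complex_Analysis"
begin

text \<open>
  Let \<open>n\<close> be the dimension and \<open>T = (1 - |z|\<^sup>2) (I + R/n) B\<close>, where \<open>B\<close> is the Bergman operator. Differentiating under
  the integral sign shows that \<open>T\<close> is the integral operator with kernel \<open>(1 - |z|\<^sup>2) k(u)\<close>, where
  \<open>k(u) = (1 + u/n) / (1 - u)^(n+2)\<close> and \<open>u\<close> is the Hermitian product of \<open>z\<close> and \<open>w\<close>; the norm of \<open>B\<close> in the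
  theorem is the norm of \<open>T\<close> on the weighted space of functions with square integrable radial restrictions
  (\<open>bergman_radial\<close>, \<open>bergman_norm_leI\<close>, \<open>bergman_norm_leD\<close>).

  For \<open>p > 2\<close> the upper bound uses the size of the kernel only. A Schur test (\<open>schur_pointwise\<close>) and an integration
  along the radius dominate the square function of \<open>T \<phi>\<close> at \<open>\<zeta>\<close> by a convergent sum, over apertures
  \<open>l = 2^k\<close>, of averages of \<open>|\<phi>|\<^sup>2 / (1 - |w|)\<close> over the tents of all \<open>w\<close> with \<open>|1 - u| < l (1 - |w|)\<close>, where now
  \<open>u\<close> is the product of \<open>\<zeta>\<close> and \<open>w\<close> (\<open>energy_le_tentsums\<close>). It remains to bound the \<open>q\<close>-th moment of such an
  average by \<open>C A^q\<close> times that of the radial integral, where \<open>q = p/2 > 1\<close> and \<open>A\<close> is the \<open>A1\<close> constant;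
  the \<open>p\<close>-th root of \<open>A^q\<close> is the square root in the theorem. To see this, order the points of a tent by
  height. If \<open>w\<close> and \<open>v\<close> lie in the tent over \<open>\<zeta>\<close> and \<open>v\<close> is the higher one, then \<open>v\<close> lies in a tent of six times
  the aperture over the projection \<open>w / |w|\<close>. A median inequality (\<open>median_power\<close>) bounds the \<open>q\<close>-th power of an
  integral by the integral of its density times the \<open>(q-1)\<close>-st power of the part above the current
  point. After these two steps \<open>\<zeta>\<close> occurs only in the average of the weight over a ball around \<open>w / |w|\<close>, which is at most
  \<open>A\<close> times the weight at \<open>w / |w|\<close> (\<open>tentsum_power_le\<close>). Young's inequality leaves half of the same quantity with six times the
  aperture, and the supremum over all apertures absorbs it (\<open>tentsum_bounded_estimate\<close>). The \<open>A1\<close> condition enters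
  once, so no maximal theorem is involved.

  For \<open>p < 2\<close> the bound follows by duality: \<open>T\<close> is symmetric for the pairing with density \<open>1 / (1 - |z|\<^sup>2)\<close>, for
  which the spaces with exponents \<open>p\<close>, \<open>p'\<close> and weights \<open>\<omega>\<close>, \<open>\<omega> powr (1 - p')\<close> are dual (\<open>wenergy_duality\<close>).

  For the sharpness take the weight \<open>|1 - \<zeta>\<^sub>1| powr (- n (1 - \<epsilon>))\<close>, whose \<open>A1\<close> constant is \<open>O(1/\<epsilon>)\<close>
  (\<open>pweight_A1\<close>), and a function equal to one on a sparse sequence of shells, one for each scale \<open>l^k\<close>, in
  which both the height \<open>1 - |w|\<close> and the distance \<open>|1 - \<zeta>\<^sub>1|\<close> of the projection \<open>\<zeta> = w / |w|\<close> are comparable to the scale.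
  A radius meets at most one shell, so the square function of this function is bounded. But every shell makes \<open>T\<close>
  large at its own scale above the axis (\<open>Top_lacunary_lower\<close>), so that the square function of the
  image is at least a constant times the square root of \<open>N\<close> where \<open>|1 - \<zeta>\<^sub>1| < b l^N\<close>. For \<open>\<epsilon> = 1/N\<close> this
  set carries a fixed proportion of the mass of the weight; hence the norm is at least \<open>c \<epsilon> powr (-1/2)\<close>
  (\<open>lacunary_blowup\<close>). Duality transfers the example to \<open>p < 2\<close>.
\<close>

section \<open>Polar coordinates and rotation invariance\<close>

definition nu :: "(complex^'n) measure" where
  "nu = uniform_measure lborel (ball 0 1)"

text \<open>
  The push-forward on the whole space: unlike \<^const>\<open>sphere_measure\<close> it is a Borel measure, so that Fubini's theorem and
  the measurability prover apply without restriction to the sphere.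
\<close>
definition sig :: "(complex^'n) measure" where
  "sig = distr nu borel sgn"

text \<open>
  Density of the norm of a point that is uniformly distributed in the ball.
\<close>
definition rd :: "nat \<Rightarrow> real \<Rightarrow> real" where
  "rd n r = (if 0 < r \<and> r < 1 then 2 * real n * r ^ (2 * n - 1) else 0)"

lemma rd_nonneg [simp]: "0 \<le> rd n r"
  by (simp add: rd_def)

lemma rd_measurable [measurable]: "rd n \<in> borel_measurable borel"
  unfolding rd_def[abs_def] by measurable

lemma nu_sets [simp, measurable_cong]: "sets (nu :: (complex^'n) measure) = sets borel"
  by (simp add: nu_def)

lemma nu_space [simp]: "space (nu :: (complex^'n) measure) = UNIV"
  by (simp add: nu_def)

lemma sig_sets [simp, measurable_cong]: "sets (sig :: (complex^'n) measure) = sets borel"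
  by (simp add: sig_def)

lemma sig_space [simp]: "space (sig :: (complex^'n) measure) = UNIV"
  by (simp add: sig_def)

lemma pred_ball [measurable]: "Measurable.pred borel (\<lambda>x. x \<in> ball (0 :: complex^'n) r)"
  unfolding mem_ball dist_0_norm by measurable

lemma pred_greaterThan [measurable (raw)]:
  fixes f g :: "'a \<Rightarrow> real"
  assumes [measurable]: "f \<in> borel_measurable M" "g \<in> borel_measurable M"
  shows "Measurable.pred M (\<lambda>x. f x \<in> {g x<..})"
  unfolding greaterThan_iff by measurable

definition volB :: "'n::finite itself \<Rightarrow> real" where
  "volB _ = measure lborel (ball 0 1 :: (complex^'n) set)"

lemma volB_pos: "0 < volB TYPE('n::finite)"
  unfolding volB_def by (rule content_ball_pos) simp

lemma emeasure_volB: "emeasure lborel (ball 0 1 :: (complex^'n) set) = ennreal (volB TYPE('n))"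
  unfolding volB_def by (rule emeasure_eq_ennreal_measure) (use emeasure_lborel_ball_finite[of "0::complex^'n" 1] in auto)

lemma prob_nu: "prob_space (nu :: (complex^'n) measure)"
  unfolding nu_def
  by (rule prob_space_uniform_measure) (use volB_pos[where 'n='n] in \<open>auto simp: emeasure_volB\<close>)

interpretation nu: prob_space "nu :: (complex^'n) measure"
  by (rule prob_nu)

lemma prob_sig: "prob_space (sig :: (complex^'n) measure)"
  unfolding sig_def by (rule nu.prob_space_distr) measurable

interpretation sig: prob_space "sig :: (complex^'n) measure"
  by (rule prob_sig)

interpretation nu_sig: pair_sigma_finite "nu :: (complex^'n) measure" "sig :: (complex^'n) measure" ..
interpretation nu_nu: pair_sigma_finite "nu :: (complex^'n) measure" "nu :: (complex^'n) measure" ..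
interpretation lborel_nu: pair_sigma_finite "lborel :: real measure" "nu :: (complex^'n) measure" ..

lemma nn_integral_nu:
  fixes f :: "complex^'n \<Rightarrow> ennreal"
  assumes [measurable]: "f \<in> borel_measurable borel"
  shows "(\<integral>\<^sup>+w. f w \<partial>nu) = ennreal (1 / volB TYPE('n)) * (\<integral>\<^sup>+w. f w * indicator (ball 0 1) w \<partial>lborel)"
  unfolding nu_def
  by (subst nn_integral_uniform_measure)
     (use volB_pos[where 'n='n] in \<open>auto simp: emeasure_volB divide_ennreal_def inverse_ennreal mult.commute inverse_eq_divide\<close>)

lemma AE_nu: "(AE w in nu. P w) \<longleftrightarrow> (AE w in lborel. norm w < 1 \<longrightarrow> P (w :: complex^'n))"
  unfolding nu_def
  by (subst AE_uniform_measure) (use volB_pos[where 'n='n] in \<open>auto simp: emeasure_volB\<close>)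

lemma AE_nu_in_ball: "AE w in nu. norm (w :: complex^'n) < 1 \<and> w \<noteq> 0"
proof -
  have "AE w in lborel. w \<noteq> (0 :: complex^'n)"
    by (rule AE_I[where N = "{0}"]) auto
  then show ?thesis unfolding AE_nu by (rule eventually_mono) auto
qed

lemma nn_integral_sig:
  fixes f :: "complex^'n \<Rightarrow> ennreal"
  assumes [measurable]: "f \<in> borel_measurable borel"
  shows "(\<integral>\<^sup>+\<zeta>. f \<zeta> \<partial>sig) = (\<integral>\<^sup>+w. f (sgn w) \<partial>nu)"
  unfolding sig_def by (rule nn_integral_distr) measurable

lemma AE_sig_nu: "(AE \<zeta> in sig. P \<zeta>) \<Longrightarrow> (AE w in nu. P (sgn w :: complex^'n))"
  unfolding sig_def by (rule AE_distrD) measurable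

lemma AE_sig_norm: "AE \<zeta> in sig. norm (\<zeta> :: complex^'n) = 1"
  unfolding sig_def by (subst AE_distr_iff) (use AE_nu_in_ball in \<open>auto simp: norm_sgn elim!: eventually_mono\<close>)

lemma nn_integral_nu_mono:
  "(\<And>w :: complex^'n. norm w < 1 \<and> w \<noteq> 0 \<Longrightarrow> f w \<le> g w) \<Longrightarrow> (\<integral>\<^sup>+w. f w \<partial>nu) \<le> (\<integral>\<^sup>+w. g w \<partial>nu)"
  by (rule nn_integral_mono_AE, rule AE_mp[OF AE_nu_in_ball]) (auto intro: AE_I2)

lemma nn_integral_nu_cong:
  "(\<And>w :: complex^'n. norm w < 1 \<and> w \<noteq> 0 \<Longrightarrow> f w = g w) \<Longrightarrow> (\<integral>\<^sup>+w. f w \<partial>nu) = (\<integral>\<^sup>+w. g w \<partial>nu)"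
  by (rule nn_integral_cong_AE, rule AE_mp[OF AE_nu_in_ball]) (auto intro: AE_I2)

lemma nn_integral_sig_mono:
  "(\<And>\<zeta> :: complex^'n. norm \<zeta> = 1 \<Longrightarrow> f \<zeta> \<le> g \<zeta>) \<Longrightarrow> (\<integral>\<^sup>+\<zeta>. f \<zeta> \<partial>sig) \<le> (\<integral>\<^sup>+\<zeta>. g \<zeta> \<partial>sig)"
  by (rule nn_integral_mono_AE, rule AE_mp[OF AE_sig_norm]) (auto intro: AE_I2)

lemma nn_integral_sig_cong:
  "(\<And>\<zeta> :: complex^'n. norm \<zeta> = 1 \<Longrightarrow> f \<zeta> = g \<zeta>) \<Longrightarrow> (\<integral>\<^sup>+\<zeta>. f \<zeta> \<partial>sig) = (\<integral>\<^sup>+\<zeta>. g \<zeta> \<partial>sig)"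
  by (rule nn_integral_cong_AE, rule AE_mp[OF AE_sig_norm]) (auto intro: AE_I2)

lemma nn_integral_lborel_scale:
  fixes g :: "complex^'n \<Rightarrow> ennreal"
  assumes [measurable]: "g \<in> borel_measurable borel" and c: "c > 0"
  shows "(\<integral>\<^sup>+w. g (c *\<^sub>R w) \<partial>lborel) = ennreal (1 / c ^ (2 * CARD('n))) * (\<integral>\<^sup>+w. g w \<partial>lborel)"
proof -
  have "(\<integral>\<^sup>+w. g w \<partial>lborel) = ennreal (c ^ (2 * CARD('n))) * (\<integral>\<^sup>+w. g (c *\<^sub>R w) \<partial>lborel)"
    using c by (subst lborel_affine[of c 0])
      (simp_all add: nn_integral_density nn_integral_distr nn_integral_cmult nn_integral_multc mult.commute)
  then show ?thesis using c
    by (simp add: mult.assoc[symmetric] ennreal_mult[symmetric])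
qed

lemma nn_integral_powr_to_inf:
  fixes a e :: real
  assumes "a > 0" "e < -1"
  shows "(\<integral>\<^sup>+s. ennreal (s powr e) * indicator {a<..} s \<partial>lborel) = ennreal (a powr (e + 1) / (- e - 1))"
proof -
  have "((\<lambda>s. if s \<in> {a..} then s powr e else 0) has_integral -(a powr (e+1)) / (e+1)) UNIV"
    using has_integral_powr_to_inf[OF assms(2,1)] by (simp only: has_integral_restrict_UNIV)
  then have "(\<integral>\<^sup>+s. ennreal (if s \<in> {a..} then s powr e else 0) \<partial>lborel) = ennreal (-(a powr (e+1)) / (e+1))"
    by (intro nn_integral_has_integral_lborel) auto
  moreover have "(\<integral>\<^sup>+s. ennreal (s powr e) * indicator {a<..} s \<partial>lborel)
     = (\<integral>\<^sup>+s. ennreal (if s \<in> {a..} then s powr e else 0) \<partial>lborel)"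
    by (rule nn_integral_cong_AE, rule AE_mp[OF AE_lborel_singleton[of a]]) (auto split: split_indicator)
  moreover have "-(a powr (e+1)) / (e+1) = a powr (e + 1) / (- e - 1)"
    using assms by (simp add: field_simps)
  ultimately show ?thesis by simp
qed

lemma nn_integral_powr_from_0:
  fixes a e :: real
  assumes "a \<ge> 0" "e > -1"
  shows "(\<integral>\<^sup>+s. ennreal (s powr e) * indicator {0<..<a} s \<partial>lborel) = ennreal (a powr (e + 1) / (e + 1))"
proof -
  have "((\<lambda>s. if s \<in> {0..a} then s powr e else 0) has_integral (a powr (e+1)) / (e+1)) UNIV"
    using has_integral_powr_from_0[OF assms(2,1)] by (simp only: has_integral_restrict_UNIV)
  then have "(\<integral>\<^sup>+s. ennreal (if s \<in> {0..a} then s powr e else 0) \<partial>lborel) = ennreal ((a powr (e+1)) / (e+1))"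
    by (intro nn_integral_has_integral_lborel) auto
  moreover have "(\<integral>\<^sup>+s. ennreal (s powr e) * indicator {0<..<a} s \<partial>lborel)
     = (\<integral>\<^sup>+s. ennreal (if s \<in> {0..a} then s powr e else 0) \<partial>lborel)"
    by (rule nn_integral_cong_AE, rule AE_mp[OF AE_lborel_singleton[of a]], rule AE_mp[OF AE_lborel_singleton[of 0]])
       (auto split: split_indicator)
  ultimately show ?thesis by simp
qed

text \<open>
  Writing the outer integral over directions as an integral over the ball and substituting \<open>s = r / |w|\<close>
  exchanges the roles of \<open>w\<close> and \<open>v = s w\<close>; for fixed \<open>v\<close> the remaining integral over \<open>s\<close> is elementary.
  Thus polar coordinates follow from Fubini's theorem and the scaling of Lebesgue measure.
\<close>
lemma polar:
  fixes f :: "complex^'n \<Rightarrow> ennreal"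
  assumes [measurable]: "f \<in> borel_measurable borel"
  shows "(\<integral>\<^sup>+w. f w \<partial>nu) = (\<integral>\<^sup>+\<zeta>. (\<integral>\<^sup>+r. f (r *\<^sub>R \<zeta>) * ennreal (rd CARD('n) r) \<partial>lborel) \<partial>sig)"
proof -
  define c where "c = ennreal (1 / volB TYPE('n))"
  define n where "n = CARD('n)"
  have n: "n > 0" by (simp add: n_def)
  define B where "B = (indicator (ball 0 1) :: complex^'n \<Rightarrow> ennreal)"
  have [measurable]: "B \<in> borel_measurable borel" unfolding B_def by measurable
  have "(\<integral>\<^sup>+\<zeta>. (\<integral>\<^sup>+r. f (r *\<^sub>R \<zeta>) * ennreal (rd n r) \<partial>lborel) \<partial>sig)
     = (\<integral>\<^sup>+w. (\<integral>\<^sup>+r. f (r *\<^sub>R sgn w) * ennreal (rd n r) \<partial>lborel) \<partial>nu)"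
    by (rule nn_integral_sig) measurable
  also have "\<dots> = c * (\<integral>\<^sup>+w. (\<integral>\<^sup>+r. f (r *\<^sub>R sgn w) * ennreal (rd n r) \<partial>lborel) * B w \<partial>lborel)"
    unfolding c_def B_def by (rule nn_integral_nu) measurable
  also have "(\<integral>\<^sup>+w. (\<integral>\<^sup>+r. f (r *\<^sub>R sgn w) * ennreal (rd n r) \<partial>lborel) * B w \<partial>lborel)
     = (\<integral>\<^sup>+w. (\<integral>\<^sup>+s. f (s *\<^sub>R w) * ennreal (rd n (norm w * s) * norm w) * B w \<partial>lborel) \<partial>lborel)"
  proof (rule nn_integral_cong_AE, rule AE_mp[OF AE_lborel_singleton[of 0]], intro AE_I2 impI)
    fix w :: "complex^'n" assume w: "w \<noteq> 0"
    have "(\<integral>\<^sup>+r. f (r *\<^sub>R sgn w) * ennreal (rd n r) \<partial>lborel)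
       = ennreal \<bar>norm w\<bar> * (\<integral>\<^sup>+s. f ((0 + norm w * s) *\<^sub>R sgn w) * ennreal (rd n (0 + norm w * s)) \<partial>lborel)"
      by (rule nn_integral_real_affine) (use w in auto)
    also have "\<dots> = (\<integral>\<^sup>+s. f (s *\<^sub>R w) * ennreal (rd n (norm w * s) * norm w) \<partial>lborel)"
      using w by (subst nn_integral_cmult[symmetric], measurable)
        (auto intro!: nn_integral_cong simp: sgn_div_norm ennreal_mult mult_ac)
    finally show "(\<integral>\<^sup>+r. f (r *\<^sub>R sgn w) * ennreal (rd n r) \<partial>lborel) * B w
      = (\<integral>\<^sup>+s. f (s *\<^sub>R w) * ennreal (rd n (norm w * s) * norm w) * B w \<partial>lborel)"
      by (simp add: nn_integral_multc)
  qed
  also have "\<dots> = (\<integral>\<^sup>+s. (\<integral>\<^sup>+w. f (s *\<^sub>R w) * ennreal (rd n (norm w * s) * norm w) * B w \<partial>lborel) \<partial>lborel)"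
    by (rule pair_sigma_finite.Fubini') (unfold_locales, measurable)
  also have "\<dots> = (\<integral>\<^sup>+s. (\<integral>\<^sup>+v. f v * ennreal (rd n (norm v) * norm v) * 
                     (ennreal (s powr (- real (2 * n) - 1)) * indicator {norm v<..} s) \<partial>lborel) \<partial>lborel)"
  proof (rule nn_integral_cong)
    fix s :: real
    show "(\<integral>\<^sup>+w. f (s *\<^sub>R w) * ennreal (rd n (norm w * s) * norm w) * B w \<partial>lborel)
       = (\<integral>\<^sup>+v. f v * ennreal (rd n (norm v) * norm v) * (ennreal (s powr (- real (2 * n) - 1)) * indicator {norm v<..} s) \<partial>lborel)"
    proof (cases "s > 0")
      case False
      then have "rd n (norm w * s) = 0" for w :: "complex^'n"
        by (auto simp: rd_def zero_less_mult_iff)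
      moreover have "indicator {norm v<..} s = (0::ennreal)" for v :: "complex^'n"
        using False norm_ge_zero[of v] by (auto split: split_indicator simp del: norm_ge_zero)
      ultimately show ?thesis by simp
    next
      case True
      have "(\<integral>\<^sup>+w. f (s *\<^sub>R w) * ennreal (rd n (norm w * s) * norm w) * B w \<partial>lborel)
         = (\<integral>\<^sup>+w. (\<lambda>v. f v * ennreal (rd n (norm v) * (norm v / s)) * indicator {norm v<..} s) (s *\<^sub>R w) \<partial>lborel)"
        using True by (intro nn_integral_cong) (auto simp: B_def mult_ac split: split_indicator)
      also have "\<dots> = ennreal (1 / s ^ (2 * CARD('n))) * (\<integral>\<^sup>+v. f v * ennreal (rd n (norm v) * (norm v / s)) * indicator {norm v<..} s \<partial>lborel)"
      proof (rule nn_integral_lborel_scale)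
        show "(\<lambda>v. f v * ennreal (rd n (norm v) * (norm v / s)) * indicator {norm v<..} s) \<in> borel_measurable borel"
          by measurable
      qed (fact True)
      also have "\<dots> = (\<integral>\<^sup>+v. f v * ennreal (rd n (norm v) * norm v) * (ennreal (s powr (- real (2 * n) - 1)) * indicator {norm v<..} s) \<partial>lborel)"
      proof (subst nn_integral_cmult[symmetric])
        have "s powr (- real (2 * n) - 1) = s powr (- real (2 * n)) / s powr 1"
          by (rule powr_diff)
        also have "s powr (- real (2 * n)) = inverse (s ^ (2 * n))"
          unfolding powr_minus powr_realpow[OF True] ..
        finally have e: "s powr (- real (2 * n) - 1) = 1 / s ^ (2 * CARD('n)) * (1 / s)"
          using True by (simp add: n_def inverse_eq_divide)
        have "ennreal (1 / s ^ (2 * CARD('n))) * ennreal (rd n (norm v) * (norm v / s))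
            = ennreal (rd n (norm v) * norm v) * ennreal (s powr (- real (2 * n) - 1))" for v :: "complex^'n"
          unfolding e using True by (subst (1 2) ennreal_mult[symmetric]) (simp_all add: mult_ac)
        moreover have "A * (F * B' * I) = F * C * (S * I)" if "A * B' = C * S" for A F B' I C S :: ennreal
        proof -
          have "A * (F * B' * I) = (A * B') * (F * I)" by (simp only: mult_ac)
          also have "\<dots> = F * C * (S * I)" unfolding that by (simp only: mult_ac)
          finally show ?thesis .
        qed
        ultimately show "(\<integral>\<^sup>+v. ennreal (1 / s ^ (2 * CARD('n))) * (f v * ennreal (rd n (norm v) * (norm v / s)) * indicator {norm v<..} s) \<partial>lborel) =
           (\<integral>\<^sup>+v. f v * ennreal (rd n (norm v) * norm v) * (ennreal (s powr (- real (2 * n) - 1)) * indicator {norm v<..} s) \<partial>lborel)"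
          by (intro nn_integral_cong) blast
      qed measurable
      finally show ?thesis .
    qed
  qed
  also have "\<dots> = (\<integral>\<^sup>+v. (\<integral>\<^sup>+s. f v * ennreal (rd n (norm v) * norm v) * 
                     (ennreal (s powr (- real (2 * n) - 1)) * indicator {norm v<..} s) \<partial>lborel) \<partial>lborel)"
    by (rule pair_sigma_finite.Fubini') (unfold_locales, measurable)
  also have "\<dots> = (\<integral>\<^sup>+v. f v * B v \<partial>lborel)"
  proof (rule nn_integral_cong_AE, rule AE_mp[OF AE_lborel_singleton[of 0]], intro AE_I2 impI)
    fix v :: "complex^'n" assume v: "v \<noteq> 0"
    have "(\<integral>\<^sup>+s. f v * ennreal (rd n (norm v) * norm v) * (ennreal (s powr (- real (2 * n) - 1)) * indicator {norm v<..} s) \<partial>lborel)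
       = f v * ennreal (rd n (norm v) * norm v) * ennreal (norm v powr ((- real (2 * n) - 1) + 1) / (- (- real (2 * n) - 1) - 1))"
      using v n by (subst nn_integral_cmult, measurable) (subst nn_integral_powr_to_inf, auto)
    also have "\<dots> = f v * ennreal ((rd n (norm v) * norm v) * (norm v powr ((- real (2 * n) - 1) + 1) / (- (- real (2 * n) - 1) - 1)))"
      using n by (subst ennreal_mult) (auto simp: mult.assoc)
    also have "(rd n (norm v) * norm v) * (norm v powr ((- real (2 * n) - 1) + 1) / (- (- real (2 * n) - 1) - 1))
       = indicator (ball 0 1) v"
    proof -
      have "norm v ^ (2 * n - 1) * norm v = norm v ^ (2 * n)"
        using n by (intro power_minus_mult) simp
      moreover have "norm v powr (- real (2 * n)) = 1 / norm v ^ (2 * n)"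
        using v by (simp add: powr_minus_divide powr_realpow[symmetric])
      moreover have "rd n (norm v) * norm v = 2 * real n * (norm v ^ (2 * n - 1) * norm v) * indicator (ball 0 1) v"
        using v by (simp add: rd_def indicator_def)
      ultimately show ?thesis using v n by simp
    qed
    finally show "(\<integral>\<^sup>+s. f v * ennreal (rd n (norm v) * norm v) * (ennreal (s powr (- real (2 * n) - 1)) * indicator {norm v<..} s) \<partial>lborel) = f v * B v"
      by (simp add: B_def ennreal_indicator)
  qed
  also have "c * (\<integral>\<^sup>+v. f v * B v \<partial>lborel) = (\<integral>\<^sup>+w. f w \<partial>nu)"
    unfolding c_def B_def by (rule nn_integral_nu[symmetric]) measurable
  finally show ?thesis by (simp add: n_def)
qed

lemma nn_integral_lborel_translate:
  fixes g :: "complex^'n \<Rightarrow> ennreal"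
  assumes [measurable]: "g \<in> borel_measurable borel"
  shows "(\<integral>\<^sup>+w. g (w + a) \<partial>lborel) = (\<integral>\<^sup>+w. g w \<partial>lborel)"
proof -
  have "(\<integral>\<^sup>+w. g w \<partial>lborel) = (\<integral>\<^sup>+w. g w \<partial>distr lborel borel ((+) a))"
    by (simp add: lborel_distr_plus)
  also have "\<dots> = (\<integral>\<^sup>+w. g (a + w) \<partial>lborel)"
    by (rule nn_integral_distr) measurable
  finally show ?thesis by (simp add: add.commute)
qed

lemma nn_integral_lborel_reflect:
  fixes g :: "complex^'n \<Rightarrow> ennreal"
  assumes [measurable]: "g \<in> borel_measurable borel"
  shows "(\<integral>\<^sup>+w. g (a - w) \<partial>lborel) = (\<integral>\<^sup>+w. g w \<partial>lborel)"
proof -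
  have "(\<integral>\<^sup>+w. g w \<partial>lborel) = (\<integral>\<^sup>+w. g (a - w) \<partial>lborel)"
    by (subst lborel_affine[of "-1" a])
      (simp_all add: nn_integral_density nn_integral_distr nn_integral_cmult)
  then show ?thesis by simp
qed

text \<open>
  Convolving with the indicator of the unit ball, which is invariant under \<open>f\<close>, reduces the claim to the
  translation and reflection invariance of Lebesgue measure.
\<close>
lemma nn_integral_lborel_isometry:
  fixes f :: "complex^'n \<Rightarrow> complex^'n" and g :: "complex^'n \<Rightarrow> ennreal"
  assumes lin: "linear f" and iso: "\<And>x. norm (f x) = norm x"
    and g [measurable]: "g \<in> borel_measurable borel"
  shows "(\<integral>\<^sup>+x. g (f x) \<partial>lborel) = (\<integral>\<^sup>+x. g x \<partial>lborel)"
proof -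
  have [measurable]: "f \<in> borel_measurable borel"
    by (intro borel_measurable_continuous_onI linear_continuous_on linear_conv_bounded_linear[THEN iffD1] lin)
  have "inj f"
    using iso by (intro linear_injective_0[OF lin, THEN iffD2]) (metis norm_eq_zero)
  then have "surj f"
    by (rule linear_inj_imp_surj[OF lin])
  define B where "B = (indicator (ball 0 1) :: complex^'n \<Rightarrow> ennreal)"
  have [measurable]: "B \<in> borel_measurable borel" unfolding B_def by measurable
  define v where "v = (\<integral>\<^sup>+y. B y \<partial>lborel)"
  have v: "v = ennreal (volB TYPE('n))"
    by (simp add: v_def B_def emeasure_volB)
  have "(\<integral>\<^sup>+x. g (f x) \<partial>lborel) * v = (\<integral>\<^sup>+y. (\<integral>\<^sup>+x. g (f x) \<partial>lborel) * B y \<partial>lborel)"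
    unfolding v_def by (rule nn_integral_cmult[symmetric]) measurable
  also have "\<dots> = (\<integral>\<^sup>+y. (\<integral>\<^sup>+x. g (f x + y) * B y \<partial>lborel) \<partial>lborel)"
  proof (rule nn_integral_cong)
    fix y :: "complex^'n"
    obtain u where u: "y = f u" using \<open>surj f\<close> by (metis surjD)
    have "(\<integral>\<^sup>+x. g (f x) \<partial>lborel) = (\<integral>\<^sup>+x. g (f (x + u)) \<partial>lborel)"
      by (rule nn_integral_lborel_translate[symmetric]) measurable
    also have "\<dots> = (\<integral>\<^sup>+x. g (f x + y) \<partial>lborel)"
      using lin by (simp add: linear_add u)
    finally show "(\<integral>\<^sup>+x. g (f x) \<partial>lborel) * B y = (\<integral>\<^sup>+x. g (f x + y) * B y \<partial>lborel)"
      by (simp add: nn_integral_multc)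
  qed
  also have "\<dots> = (\<integral>\<^sup>+x. (\<integral>\<^sup>+y. g (f x + y) * B y \<partial>lborel) \<partial>lborel)"
    by (rule lborel_pair.Fubini') measurable
  also have "\<dots> = (\<integral>\<^sup>+x. (\<integral>\<^sup>+y. g y * B (y - f x) \<partial>lborel) \<partial>lborel)"
  proof (rule nn_integral_cong)
    fix x
    have "(\<integral>\<^sup>+y. (\<lambda>y. g y * B (y - f x)) (y + f x) \<partial>lborel) = (\<integral>\<^sup>+y. g y * B (y - f x) \<partial>lborel)"
      by (rule nn_integral_lborel_translate) measurable
    then show "(\<integral>\<^sup>+y. g (f x + y) * B y \<partial>lborel) = (\<integral>\<^sup>+y. g y * B (y - f x) \<partial>lborel)"
      by (simp add: add.commute)
  qed
  also have "\<dots> = (\<integral>\<^sup>+y. (\<integral>\<^sup>+x. g y * B (y - f x) \<partial>lborel) \<partial>lborel)"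
    by (rule lborel_pair.Fubini'[symmetric]) measurable
  also have "\<dots> = (\<integral>\<^sup>+y. g y * v \<partial>lborel)"
  proof (rule nn_integral_cong)
    fix y :: "complex^'n"
    obtain u where u: "y = f u" using \<open>surj f\<close> by (metis surjD)
    have "B (y - f x) = B (u - x)" for x
      using iso[of "u - x"] lin by (simp add: B_def u linear_diff indicator_def)
    then have "(\<integral>\<^sup>+x. B (y - f x) \<partial>lborel) = (\<integral>\<^sup>+x. B (u - x) \<partial>lborel)"
      by simp
    also have "\<dots> = v"
      unfolding v_def by (rule nn_integral_lborel_reflect) measurable
    finally show "(\<integral>\<^sup>+x. g y * B (y - f x) \<partial>lborel) = g y * v"
      by (simp add: nn_integral_cmult)
  qed
  also have "\<dots> = (\<integral>\<^sup>+x. g x \<partial>lborel) * v"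
    by (rule nn_integral_multc) measurable
  finally have "v * (\<integral>\<^sup>+x. g (f x) \<partial>lborel) = v * (\<integral>\<^sup>+x. g x \<partial>lborel)"
    by (simp add: mult.commute)
  moreover have "v \<noteq> 0" "v \<noteq> \<infinity>" using v volB_pos[where 'n='n] by auto
  ultimately show ?thesis
    by (simp add: ennreal_mult_cancel_left)
qed

lemma nn_integral_nu_isometry:
  fixes f :: "complex^'n \<Rightarrow> complex^'n" and g :: "complex^'n \<Rightarrow> ennreal"
  assumes lin: "linear f" and iso: "\<And>x. norm (f x) = norm x"
    and [measurable]: "g \<in> borel_measurable borel"
  shows "(\<integral>\<^sup>+x. g (f x) \<partial>nu) = (\<integral>\<^sup>+x. g x \<partial>nu)"
proof -
  have [measurable]: "f \<in> borel_measurable borel"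
    by (intro borel_measurable_continuous_onI linear_continuous_on linear_conv_bounded_linear[THEN iffD1] lin)
  have "(\<integral>\<^sup>+x. g (f x) * indicator (ball 0 1) x \<partial>lborel) = (\<integral>\<^sup>+x. (\<lambda>x. g x * indicator (ball 0 1) x) (f x) \<partial>lborel)"
    by (simp add: indicator_def iso)
  also have "\<dots> = (\<integral>\<^sup>+x. g x * indicator (ball 0 1) x \<partial>lborel)"
    by (rule nn_integral_lborel_isometry[OF lin iso]) measurable
  finally show ?thesis by (simp add: nn_integral_nu)
qed

lemma nn_integral_sig_isometry:
  fixes f :: "complex^'n \<Rightarrow> complex^'n" and g :: "complex^'n \<Rightarrow> ennreal"
  assumes lin: "linear f" and iso: "\<And>x. norm (f x) = norm x"
    and [measurable]: "g \<in> borel_measurable borel"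
  shows "(\<integral>\<^sup>+x. g (f x) \<partial>sig) = (\<integral>\<^sup>+x. g x \<partial>sig)"
proof -
  have [measurable]: "f \<in> borel_measurable borel"
    by (intro borel_measurable_continuous_onI linear_continuous_on linear_conv_bounded_linear[THEN iffD1] lin)
  have "f (sgn w) = sgn (f w)" for w
    by (simp add: sgn_div_norm iso linear_scale[OF lin])
  then show ?thesis
    using nn_integral_nu_isometry[OF lin iso, of "\<lambda>x. g (sgn x)"]
    by (simp add: nn_integral_sig)
qed

section \<open>Hermitian geometry\<close>

lemma hdot_add_left: "hdot (x + y) z = hdot x z + hdot y z"
  by (simp add: hdot_def sum.distrib distrib_right)

lemma hdot_diff_left: "hdot (x - y) z = hdot x z - hdot y z"
  by (simp add: hdot_def sum_subtractf left_diff_distrib)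

lemma hdot_mult_left: "hdot (c *s x) y = c * hdot x y"
  by (simp add: hdot_def sum_distrib_left mult.assoc)

lemma hdot_scaleR_left: "hdot (r *\<^sub>R x) y = of_real r * hdot x y"
  by (simp add: hdot_def sum_distrib_left scaleR_conv_of_real[where 'a=complex] mult.assoc)

lemma hdot_commute: "hdot y x = cnj (hdot x y)"
  by (simp add: hdot_def mult.commute)

lemma hdot_diff_right: "hdot z (x - y) = hdot z x - hdot z y"
  by (simp add: hdot_def sum_subtractf right_diff_distrib)

lemma hdot_mult_right: "hdot x (c *s y) = cnj c * hdot x y"
  by (simp add: hdot_def sum_distrib_left mult_ac)

lemma hdot_scaleR_right: "hdot x (r *\<^sub>R y) = of_real r * hdot x y"
  by (simp add: hdot_def sum_distrib_left scaleR_conv_of_real[where 'a=complex] mult_ac)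

lemma hdot_zero_left [simp]: "hdot 0 y = 0" and hdot_zero_right [simp]: "hdot x 0 = 0"
  by (simp_all add: hdot_def)

lemma Re_hdot: "Re (hdot x y) = x \<bullet> y"
  by (simp add: hdot_def inner_vec_def inner_complex_def)

lemma hdot_self: "hdot x x = of_real ((norm x)\<^sup>2)"
proof -
  have "Im (hdot x x) = 0"
    by (simp add: hdot_def)
  then show ?thesis
    by (simp add: complex_eq_iff Re_hdot power2_norm_eq_inner)
qed

lemma norm_mult_vec: "norm (c *s (x :: complex^'n)) = norm c * norm x"
proof -
  have "complex_of_real ((norm (c *s x))\<^sup>2) = (c * cnj c) * hdot x x"
    unfolding hdot_self[symmetric] hdot_mult_left hdot_mult_right by (simp only: mult_ac)
  also have "\<dots> = of_real ((norm c * norm x)\<^sup>2)"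
    unfolding hdot_self complex_norm_square[symmetric] by (simp add: power_mult_distrib)
  finally have "complex_of_real ((norm (c *s x))\<^sup>2) = of_real ((norm c * norm x)\<^sup>2)" .
  then have "(norm (c *s x))\<^sup>2 = (norm c * norm x)\<^sup>2"
    using of_real_eq_iff by blast
  then show ?thesis by (simp add: power2_eq_iff_nonneg)
qed

lemma hdot_cauchy_schwarz: "norm (hdot x y) \<le> norm x * norm y"
proof (cases "hdot x y = 0")
  case False
  define c where "c = cnj (hdot x y) / norm (hdot x y)"
  have c: "norm c = 1" using False by (simp add: c_def norm_divide)
  have "c * hdot x y = norm (hdot x y)"
    using False by (simp add: c_def mult.commute complex_norm_square[symmetric] power2_eq_square)
  then have "norm (hdot x y) = Re (hdot (c *s x) y)"
    by (simp add: hdot_mult_left)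
  also have "\<dots> \<le> norm (c *s x) * norm y"
    unfolding Re_hdot by (rule norm_cauchy_schwarz)
  finally show ?thesis by (simp add: norm_mult_vec c)
qed simp

lemma hdot_measurable [measurable (raw)]:
  fixes f g :: "'a \<Rightarrow> complex^'n"
  assumes [measurable]: "f \<in> borel_measurable M" "g \<in> borel_measurable M"
  shows "(\<lambda>x. hdot (f x) (g x)) \<in> borel_measurable M"
proof -
  have [measurable]: "(\<lambda>v :: complex^'n. v $ j) \<in> borel_measurable borel" for j
    by (intro borel_measurable_continuous_onI continuous_intros)
  have [measurable]: "cnj \<in> borel_measurable borel"
    by (intro borel_measurable_continuous_onI continuous_intros)
  show ?thesis unfolding hdot_def by measurable
qed

lemma norm_one_minus_hdot_commute: "norm (1 - hdot x y) = norm (1 - hdot y x)"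
  by (subst hdot_commute) (metis complex_cnj_diff complex_cnj_one complex_mod_cnj)

lemma norm_one_minus_hdot_ge: "1 - norm x * norm y \<le> norm (1 - hdot x y)"
proof -
  have "1 = norm ((1 - hdot x y) + hdot x y)" by simp
  also have "\<dots> \<le> norm (1 - hdot x y) + norm (hdot x y)" by (rule norm_triangle_ineq)
  finally show ?thesis using hdot_cauchy_schwarz[of x y] by linarith
qed

text \<open>
  Split \<open>a\<close> and \<open>b\<close> into their components along \<open>c\<close> and orthogonal to \<open>c\<close>. The product of the orthogonal components is controlled by
  Cauchy-Schwarz, because the squared norm of each is at most twice the distance of its vector from \<open>c\<close>.
\<close>
lemma norm_one_minus_hdot_triangle:
  fixes a b c :: "complex^'n"
  assumes "norm a \<le> 1" "norm b \<le> 1" "norm c = 1"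
  shows "norm (1 - hdot a b) \<le> 2 * (norm (1 - hdot a c) + norm (1 - hdot c b))"
proof -
  define \<alpha> where "\<alpha> = hdot a c"
  define \<beta> where "\<beta> = hdot c b"
  define x where "x = norm (1 - \<alpha>)"
  define y where "y = norm (1 - \<beta>)"
  define a' where "a' = a - \<alpha> *s c"
  define b' where "b' = b - cnj \<beta> *s c"
  have cc: "hdot c c = 1" using assms by (simp add: hdot_self)
  have \<beta>': "hdot b c = cnj \<beta>" unfolding \<beta>_def by (rule hdot_commute)
  have \<alpha>': "hdot c a = cnj \<alpha>" unfolding \<alpha>_def by (rule hdot_commute)
  have ab': "hdot a' b' = hdot a b - \<alpha> * \<beta>"
    by (simp add: a'_def b'_def hdot_diff_left hdot_diff_right hdot_mult_left hdot_mult_right cc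
        \<alpha>_def[symmetric] \<beta>_def[symmetric] algebra_simps)
  have key: "(norm v)\<^sup>2 \<le> 2 * norm (1 - \<gamma>)"
    if "norm u \<le> 1" "hdot u c = \<gamma>" "v = u - \<gamma> *s c" for u v :: "complex^'n" and \<gamma>
  proof -
    have "hdot c u = cnj \<gamma>" using that hdot_commute[of c u] by simp
    then have "complex_of_real ((norm v)\<^sup>2) = of_real ((norm u)\<^sup>2 - (norm \<gamma>)\<^sup>2)"
      using that by (simp only: hdot_self[symmetric] of_real_diff complex_norm_square[of \<gamma>])
        (simp add: hdot_diff_left hdot_diff_right hdot_mult_left hdot_mult_right cc algebra_simps)
    then have "(norm v)\<^sup>2 = (norm u)\<^sup>2 - (norm \<gamma>)\<^sup>2" using of_real_eq_iff by blast
    also have "\<dots> \<le> 1 - (norm \<gamma>)\<^sup>2" using that(1) by (simp add: power_le_one)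
    also have "\<dots> = (1 - norm \<gamma>) * (1 + norm \<gamma>)" by (simp add: power2_eq_square algebra_simps)
    also have "\<dots> \<le> norm (1 - \<gamma>) * 2"
    proof (rule mult_mono')
      show "1 + norm \<gamma> \<le> 2" using hdot_cauchy_schwarz[of u c] that assms by simp
      show "1 - norm \<gamma> \<le> norm (1 - \<gamma>)" using norm_triangle_ineq2[of 1 \<gamma>] by simp
      show "0 \<le> 1 - norm \<gamma>" using hdot_cauchy_schwarz[of u c] that assms by simp
    qed simp
    finally show ?thesis by simp
  qed
  have a'2: "(norm a')\<^sup>2 \<le> 2 * x"
    unfolding x_def by (rule key[of a]) (simp_all add: assms \<alpha>_def a'_def)
  have b'2: "(norm b')\<^sup>2 \<le> 2 * norm (1 - cnj \<beta>)"
    by (rule key[of b]) (simp_all add: assms \<beta>' b'_def)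
  moreover have "norm (1 - cnj \<beta>) = y"
    unfolding y_def by (metis complex_cnj_diff complex_cnj_one complex_mod_cnj)
  ultimately have b'2: "(norm b')\<^sup>2 \<le> 2 * y" by simp
  have "2 * (norm a' * norm b') \<le> (norm a')\<^sup>2 + (norm b')\<^sup>2"
    using sum_squares_bound[of "norm a'" "norm b'"] by simp
  then have 1: "norm (hdot a' b') \<le> x + y"
    using a'2 b'2 hdot_cauchy_schwarz[of a' b'] by linarith
  have "norm (1 - \<alpha> * \<beta>) = norm ((1 - \<alpha>) + \<alpha> * (1 - \<beta>))" by (simp add: algebra_simps)
  also have "\<dots> \<le> x + norm \<alpha> * y"
    unfolding x_def y_def by (rule order_trans[OF norm_triangle_ineq]) (simp add: norm_mult)
  also have "\<dots> \<le> x + 1 * y"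
    using hdot_cauchy_schwarz[of a c] assms
    by (intro add_left_mono mult_right_mono) (auto simp: \<alpha>_def y_def)
  finally have 2: "norm (1 - \<alpha> * \<beta>) \<le> x + y" by simp
  have "1 - hdot a b = (1 - \<alpha> * \<beta>) - hdot a' b'" by (simp add: ab')
  then have "norm (1 - hdot a b) \<le> norm (1 - \<alpha> * \<beta>) + norm (hdot a' b')"
    by (metis norm_triangle_ineq4)
  then show ?thesis using 1 2 by (simp add: x_def y_def \<alpha>_def \<beta>_def)
qed

lemma norm_one_minus_shrink:
  fixes u :: complex
  assumes "norm u \<le> 1" "0 \<le> r" "r \<le> 1"
  shows "1 - r \<le> norm (1 - of_real r * u)" "norm (1 - u) \<le> 2 * norm (1 - of_real r * u)"
proof -
  have "1 = norm ((1 - of_real r * u) + of_real r * u)" by simp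
  also have "\<dots> \<le> norm (1 - of_real r * u) + norm (of_real r * u)" by (rule norm_triangle_ineq)
  also have "norm (of_real r * u) \<le> r * 1"
    using assms by (auto simp: norm_mult intro: mult_left_mono mult_left_le)
  finally show 1: "1 - r \<le> norm (1 - of_real r * u)" by simp
  have "1 - u = (1 - of_real r * u) - of_real (1 - r) * u" by (simp add: algebra_simps)
  then have "norm (1 - u) \<le> norm (1 - of_real r * u) + norm (of_real (1 - r) * u)"
    by (metis norm_triangle_ineq4)
  also have "norm (of_real (1 - r) * u) \<le> (1 - r) * 1"
    using assms unfolding norm_mult norm_of_real by (intro mult_mono) auto
  finally show "norm (1 - u) \<le> 2 * norm (1 - of_real r * u)" using 1 by simp
qed

text \<open>
  An arbitrary coordinate direction; by rotation invariance the choice does not matter.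
\<close>
definition e1 :: "complex^'n" where "e1 = axis (SOME j. True) 1"
definition j1 :: "'n::finite" where "j1 = (SOME j. True)"

lemma hdot_e1: "hdot (z :: complex^'n) e1 = z $ j1"
proof -
  have "hdot z e1 = (\<Sum>j\<in>UNIV. if j = j1 then z $ j else 0)"
    unfolding hdot_def e1_def j1_def[symmetric] by (intro sum.cong) (auto simp: axis_def)
  then show ?thesis by simp
qed

lemma e1_nth: "(e1 :: complex^'n) $ i = (if i = j1 then 1 else 0)"
  by (simp add: e1_def axis_def j1_def)

lemma norm_e1 [simp]: "norm (e1 :: complex^'n) = 1"
proof -
  have "complex_of_real ((norm (e1 :: complex^'n))\<^sup>2) = 1"
    unfolding hdot_self[symmetric] hdot_e1 by (simp add: e1_nth)
  then have "(norm (e1 :: complex^'n))\<^sup>2 = 1" using of_real_eq_1_iff by blast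
  then show ?thesis using norm_ge_zero[of "e1 :: complex^'n"] by (smt (verit) power2_eq_1_iff)
qed

text \<open>
  This reduces statements on balls with arbitrary centre to the centre \<^term>\<open>e1\<close>.
\<close>
lemma unitary_to_e1:
  fixes \<xi> :: "complex^'n"
  assumes "norm \<xi> = 1"
  obtains U :: "complex^'n \<Rightarrow> complex^'n"
  where "linear U" "\<And>x y. hdot (U x) (U y) = hdot x y" "U \<xi> = e1"
proof -
  define \<alpha> where "\<alpha> = hdot \<xi> e1"
  define c where "c = (if \<alpha> = 0 then 1 else cnj \<alpha> / norm \<alpha>)"
  have c: "norm c = 1" by (simp add: c_def norm_divide)
  have cc: "c * cnj c = 1" "cnj c * c = 1" using c by (simp_all add: complex_norm_square[symmetric] mult.commute)
  define \<xi>' where "\<xi>' = c *s \<xi>"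
  have "c * \<alpha> = norm \<alpha>"
    by (simp add: c_def mult.commute complex_norm_square[symmetric] power2_eq_square)
  then have re: "hdot \<xi>' e1 = of_real (norm \<alpha>)"
    by (simp add: \<xi>'_def hdot_mult_left \<alpha>_def)
  have n1: "norm \<xi>' = 1" by (simp add: \<xi>'_def norm_mult_vec c assms)
  have hc: "hdot (c *s x) (c *s y) = hdot x y" for x y :: "complex^'n"
    by (simp add: hdot_mult_left hdot_mult_right cc flip: mult.assoc)
  define v where "v = \<xi>' - e1"
  have vv: "hdot v v = of_real (2 - 2 * norm \<alpha>)"
    using hdot_commute[of e1 \<xi>'] unfolding v_def hdot_diff_left hdot_diff_right
    by (simp add: re hdot_self n1)
  have xv: "hdot \<xi>' v = of_real (1 - norm \<alpha>)"
    by (simp add: v_def hdot_diff_right re hdot_self n1)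
  define H where "H x = x - (2 * hdot x v / hdot v v) *s v" for x
  have HH: "hdot (H x) (H y) = hdot x y" for x y
  proof (cases "hdot v v = 0")
    case True
    then show ?thesis by (simp add: H_def)
  next
    case False
    have "cnj (hdot v v) = hdot v v" by (metis hdot_commute)
    moreover have "cnj (hdot y v) = hdot v y" by (metis hdot_commute)
    ultimately show ?thesis using False
      by (simp add: H_def hdot_diff_left hdot_diff_right hdot_mult_left hdot_mult_right field_simps)
  qed
  show ?thesis
  proof (rule that[of "\<lambda>x. H (c *s x)"])
    have hr: "hdot (r *\<^sub>R x) v = of_real r * hdot x v" for r x by (rule hdot_scaleR_left)
    show "linear (\<lambda>x. H (c *s x))"
      by (rule linearI) (simp_all add: H_def vec_eq_iff hdot_mult_left hdot_add_left hr
          field_simps scaleR_conv_of_real[where 'a=complex] add_divide_distrib)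
    show "hdot (H (c *s x)) (H (c *s y)) = hdot x y" for x y
      by (simp add: HH hc)
    show "H (c *s \<xi>) = e1"
    proof (cases "norm \<alpha> = 1")
      case True
      then have "norm v = 0" using vv by (simp add: hdot_self)
      then show ?thesis by (simp add: H_def v_def flip: \<xi>'_def)
    next
      case False
      then have "2 * hdot \<xi>' v / hdot v v = 1"
        unfolding vv xv by (simp add: field_simps complex_eq_iff)
      then show ?thesis unfolding \<xi>'_def[symmetric] H_def by (simp add: v_def)
    qed
  qed
qed

section \<open>The measure of nonisotropic balls\<close>

lemma sqrt_power_even: "0 \<le> r \<Longrightarrow> sqrt r ^ (2 * n - 2) = r ^ (n - 1)"
proof -
  assume "0 \<le> r"
  moreover have "2 * n - 2 = 2 * (n - 1)" by simp
  ultimately show ?thesis by (simp only: power_mult) simp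
qed

lemma prod_Basis_e1:
  fixes a b :: real
  shows "(\<Prod>u\<in>(Basis :: (complex^'n) set). if u = axis j1 1 then a else if u = axis j1 \<i> then b else c)
     = a * b * c ^ (2 * CARD('n) - 2)"
proof -
  let ?A = "{axis j1 1, axis j1 \<i>} :: (complex^'n) set"
  have sub: "?A \<subseteq> Basis" by (auto simp: axis_in_Basis_iff Basis_complex_def)
  have ne: "axis j1 1 \<noteq> (axis j1 \<i> :: complex^'n)" by (simp add: axis_eq_axis)
  have "card (Basis - ?A) = card (Basis :: (complex^'n) set) - card ?A"
    by (rule card_Diff_subset) (use sub in auto)
  also have "\<dots> = 2 * CARD('n) - 2" using ne by simp
  finally have card: "card (Basis - ?A) = 2 * CARD('n) - 2" .
  have "(\<Prod>u\<in>(Basis :: (complex^'n) set). if u = axis j1 1 then a else if u = axis j1 \<i> then b else c)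
     = (\<Prod>u\<in>Basis - ?A. c) * (\<Prod>u\<in>?A. if u = axis j1 1 then a else if u = axis j1 \<i> then b else c)"
    by (subst prod.subset_diff[OF sub]) (auto intro!: arg_cong2[where f = "(*)"] prod.cong)
  also have "\<dots> = a * b * c ^ (2 * CARD('n) - 2)"
    using ne card by simp
  finally show ?thesis .
qed

lemma sum_norm_nth_le: "norm (z $ j1) ^ 2 + norm (z $ i) ^ 2 \<le> (norm (z :: complex^'n))\<^sup>2" if "i \<noteq> j1"
proof -
  have "(\<Sum>k\<in>{j1, i}. norm (z $ k) ^ 2) \<le> (\<Sum>k\<in>UNIV. norm (z $ k) ^ 2)"
    by (rule sum_mono2) auto
  then show ?thesis using that by (simp add: norm_vec_def L2_set_def sum_nonneg)
qed

lemma emeasure_nu_eq: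
  assumes [measurable]: "A \<in> sets borel"
  shows "emeasure nu A = ennreal (1 / volB TYPE('n)) * emeasure lborel (A \<inter> ball 0 1 :: (complex^'n) set)"
proof -
  have "emeasure nu A = (\<integral>\<^sup>+w. indicator A w \<partial>nu)" by simp
  also have "\<dots> = ennreal (1 / volB TYPE('n)) * (\<integral>\<^sup>+w. indicator A w * indicator (ball 0 1) w \<partial>lborel)"
    by (rule nn_integral_nu) measurable
  also have "(\<integral>\<^sup>+w. indicator A w * indicator (ball 0 1 :: (complex^'n) set) w \<partial>lborel) = (\<integral>\<^sup>+w. indicator (A \<inter> ball 0 1) w \<partial>lborel)"
    by (simp add: indicator_inter_arith)
  finally show ?thesis by simp
qed

text \<open>
  In the ball all coordinates other than the distinguished one are of size \<open>O(sqrt r)\<close>; so the set lies in a box with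
  two sides of length \<open>O(r)\<close> and \<open>2 n - 2\<close> sides of length \<open>O(sqrt r)\<close>.
\<close>
lemma nu_tent_upper:
  "\<exists>C>0. \<forall>r>0. emeasure nu {w :: complex^'n. norm (1 - w $ j1) < r} \<le> ennreal (C * r ^ (CARD('n) + 1))"
proof -
  define n where "n = CARD('n)"
  have n: "n \<ge> 1" by (simp add: n_def Suc_le_eq)
  define C where "C = (1 / volB TYPE('n)) * (4 * (2 * sqrt 2) ^ (2 * n - 2))"
  have "emeasure nu {w :: complex^'n. norm (1 - w $ j1) < r} \<le> ennreal (C * r ^ (CARD('n) + 1))" if r: "r > 0" for r
  proof -
    define h :: "complex^'n" where "h = (\<chi> i. if i = j1 then Complex r r else Complex (sqrt (2*r)) (sqrt (2*r)))"
    have "{w :: complex^'n. norm (1 - w $ j1) < r} \<inter> ball 0 1 \<subseteq> cbox (e1 - h) (e1 + h)"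
    proof
      fix w :: "complex^'n" assume w: "w \<in> {w. norm (1 - w $ j1) < r} \<inter> ball 0 1"
      have "\<bar>Re (w $ j1) - 1\<bar> < r" "\<bar>Im (w $ j1)\<bar> < r"
        using w abs_Re_le_cmod[of "1 - w $ j1"] abs_Im_le_cmod[of "1 - w $ j1"] by auto
      moreover have "\<bar>Re (w $ i)\<bar> \<le> sqrt (2 * r) \<and> \<bar>Im (w $ i)\<bar> \<le> sqrt (2 * r)" if i: "i \<noteq> j1" for i
      proof -
        have nw: "norm w \<le> 1" using w by auto
        have "(norm (w $ i))\<^sup>2 \<le> 1 - (norm (w $ j1))\<^sup>2"
          using sum_norm_nth_le[OF i, of w] power_le_one[OF _ nw, of 2] by simp
        also have "\<dots> = (1 - norm (w $ j1)) * (1 + norm (w $ j1))"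
          by (simp add: power2_eq_square algebra_simps)
        also have "\<dots> \<le> r * 2"
        proof (rule mult_mono)
          show "1 - norm (w $ j1) \<le> r" using w norm_triangle_ineq2[of 1 "w $ j1"] by simp
          show "1 + norm (w $ j1) \<le> 2" using Finite_Cartesian_Product.norm_nth_le[of w j1] nw by simp
        qed (use r in auto)
        finally have "norm (w $ i) \<le> sqrt (2 * r)" by (simp add: real_le_rsqrt mult.commute)
        then show ?thesis using abs_Re_le_cmod[of "w $ i"] abs_Im_le_cmod[of "w $ i"] by linarith
      qed
      ultimately show "w \<in> cbox (e1 - h) (e1 + h)"
        by (auto simp: mem_box Basis_vec_def inner_axis h_def e1_nth Basis_complex_def inner_complex_def abs_le_iff abs_less_iff)
           (smt (verit))+
    qed
    then have "emeasure lborel ({w :: complex^'n. norm (1 - w $ j1) < r} \<inter> ball 0 1) \<le> emeasure lborel (cbox (e1 - h) (e1 + h))"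
      by (rule emeasure_mono) simp
    also have "\<dots> = ennreal (\<Prod>u\<in>Basis. ((e1 + h) - (e1 - h)) \<bullet> u)"
      by (subst emeasure_lborel_cbox_eq)
        (use r in \<open>auto simp: Basis_vec_def inner_axis h_def e1_nth Basis_complex_def inner_complex_def inner_diff_left inner_add_left\<close>)
    also have "(\<Prod>u\<in>(Basis :: (complex^'n) set). ((e1 + h) - (e1 - h)) \<bullet> u)
        = (\<Prod>u\<in>(Basis :: (complex^'n) set). if u = axis j1 1 then 2 * r else if u = axis j1 \<i> then 2 * r else 2 * sqrt (2 * r))"
      by (intro prod.cong refl) (auto simp: Basis_vec_def inner_axis h_def e1_nth Basis_complex_def inner_complex_def axis_eq_axis)
    also have "\<dots> = 2 * r * (2 * r) * (2 * sqrt (2 * r)) ^ (2 * n - 2)"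
      unfolding n_def by (rule prod_Basis_e1)
    also have "\<dots> = (4 * (2 * sqrt 2) ^ (2 * n - 2)) * r ^ (n + 1)"
    proof -
      have "sqrt r ^ (2 * n - 2) = r ^ (n - 1)"
        using sqrt_power_even[of r n] r by simp
      moreover have "r ^ n = r * r ^ (n - 1)"
        using n by (cases n) auto
      ultimately show ?thesis using r by (simp add: real_sqrt_mult power_mult_distrib mult_ac)
    qed
    finally have le: "emeasure lborel ({w :: complex^'n. norm (1 - w $ j1) < r} \<inter> ball 0 1) \<le> ennreal ((4 * (2 * sqrt 2) ^ (2 * n - 2)) * r ^ (n + 1))" .
    have "emeasure nu {w :: complex^'n. norm (1 - w $ j1) < r} \<le> ennreal (1 / volB TYPE('n)) * emeasure lborel ({w :: complex^'n. norm (1 - w $ j1) < r} \<inter> ball 0 1)"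
      by (rule eq_refl, rule emeasure_nu_eq) (simp add: hdot_e1[symmetric])
    also have "\<dots> \<le> ennreal (1 / volB TYPE('n)) * ennreal ((4 * (2 * sqrt 2) ^ (2 * n - 2)) * r ^ (n + 1))"
      by (rule mult_left_mono[OF le]) simp
    also have "\<dots> = ennreal (C * r ^ (CARD('n) + 1))"
      using volB_pos[where 'n='n] r by (subst ennreal_mult[symmetric]) (auto simp: C_def n_def mult_ac)
    finally show ?thesis .
  qed
  moreover have "C > 0" using volB_pos[where 'n='n] by (simp add: C_def)
  ultimately show ?thesis by blast
qed

text \<open>
  A box of the same shape fits into the set. The bound on \<open>|w|\<close> keeps the box at a distance comparable to \<open>r\<close> from the sphere.
\<close>
lemma nu_tent_lower:
  "\<exists>c>0. \<forall>r. 0 < r \<and> r \<le> 1 \<longrightarrow>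
     ennreal (c * r ^ (CARD('n) + 1)) \<le> emeasure nu {w :: complex^'n. norm (1 - w $ j1) < r \<and> (norm w)\<^sup>2 \<le> 1 - r / 4}"
proof -
  define n where "n = CARD('n)"
  have n: "n \<ge> 1" by (simp add: n_def Suc_le_eq)
  define s where "s = 1 / (4 * sqrt n)"
  have s: "s > 0" "s\<^sup>2 = 1 / (16 * n)" using n by (auto simp: s_def power_divide power_mult_distrib)
  define C where "C = (1 / volB TYPE('n)) * (1 / 8 * (2 * s) ^ (2 * n - 2))"
  have "ennreal (C * r ^ (CARD('n) + 1)) \<le> emeasure nu {w :: complex^'n. norm (1 - w $ j1) < r \<and> (norm w)\<^sup>2 \<le> 1 - r / 4}"
    if r: "r > 0" "r \<le> 1" for r
  proof -
    let ?S = "{w :: complex^'n. norm (1 - w $ j1) < r \<and> (norm w)\<^sup>2 \<le> 1 - r / 4}"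
    define a :: "complex^'n" where "a = (\<chi> i. if i = j1 then Complex (1 - r / 2) (- r / 4) else Complex (- s * sqrt r) (- s * sqrt r))"
    define b :: "complex^'n" where "b = (\<chi> i. if i = j1 then Complex (1 - r / 4) (r / 4) else Complex (s * sqrt r) (s * sqrt r))"
    have sub: "cbox a b \<subseteq> ?S \<inter> ball 0 1"
    proof
      fix w assume w: "w \<in> cbox a b"
      have wi: "a \<bullet> axis i u \<le> w \<bullet> axis i u \<and> w \<bullet> axis i u \<le> b \<bullet> axis i u" if "u \<in> Basis" for i u
        using w that by (simp add: mem_box axis_in_Basis_iff)
      have R: "1 - r / 2 \<le> Re (w $ j1)" "Re (w $ j1) \<le> 1 - r / 4" and I: "\<bar>Im (w $ j1)\<bar> \<le> r / 4"
        using wi[of 1 j1] wi[of \<i> j1] by (auto simp: inner_axis a_def b_def Basis_complex_def inner_complex_def)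
      have oth: "(norm (w $ i))\<^sup>2 \<le> 2 * (s\<^sup>2 * r)" if "i \<noteq> j1" for i
      proof -
        have "\<bar>Re (w $ i)\<bar> \<le> s * sqrt r" "\<bar>Im (w $ i)\<bar> \<le> s * sqrt r"
          using wi[of 1 i] wi[of \<i> i] that by (auto simp: inner_axis a_def b_def Basis_complex_def inner_complex_def)
        then have "(Re (w $ i))\<^sup>2 \<le> (s * sqrt r)\<^sup>2" "(Im (w $ i))\<^sup>2 \<le> (s * sqrt r)\<^sup>2"
          by (metis abs_ge_zero power2_abs power_mono)+
        then show ?thesis using r by (simp add: cmod_power2 power_mult_distrib)
      qed
      have "(norm w)\<^sup>2 = (\<Sum>k\<in>UNIV. (norm (w $ k))\<^sup>2)"
        by (simp add: norm_vec_def L2_set_def sum_nonneg)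
      also have "\<dots> = (norm (w $ j1))\<^sup>2 + (\<Sum>k\<in>UNIV - {j1}. (norm (w $ k))\<^sup>2)"
        by (subst sum.remove[of _ j1]) auto
      also have "(\<Sum>k\<in>UNIV - {j1}. (norm (w $ k))\<^sup>2) \<le> (\<Sum>k\<in>UNIV - {j1 :: 'n}. 2 * (s\<^sup>2 * r))"
        by (rule sum_mono) (use oth in auto)
      also have "\<dots> \<le> real n * (2 * (s\<^sup>2 * r))"
        unfolding sum_constant using r s by (intro mult_right_mono) (auto simp: n_def card_Diff_subset)
      also have "\<dots> = r / 8" using s n by simp
      also have "(norm (w $ j1))\<^sup>2 \<le> 1 - r / 2 + r / 8"
      proof -
        have "(Re (w $ j1))\<^sup>2 \<le> (1 - r / 4)\<^sup>2" using R r by (intro power_mono) auto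
        moreover have "(Im (w $ j1))\<^sup>2 \<le> (r / 4)\<^sup>2" using I by (metis abs_ge_zero power2_abs power_mono)
        moreover have "(1 - r / 4)\<^sup>2 + (r / 4)\<^sup>2 = 1 - r / 2 + r * r / 8" by (simp add: power2_eq_square algebra_simps)
        moreover have "r * r \<le> r * 1" using r by (intro mult_left_mono) auto
        ultimately show ?thesis by (simp add: cmod_power2)
      qed
      finally have nw: "(norm w)\<^sup>2 \<le> 1 - r / 4" by simp
      then have "(norm w)\<^sup>2 < 1\<^sup>2" using r by simp
      then have "norm w < 1" by (rule power2_less_imp_less) simp
      moreover have "norm (1 - w $ j1) < r"
        using cmod_le[of "1 - w $ j1"] R I r by simp
      ultimately show "w \<in> ?S \<inter> ball 0 1" using nw by simp
    qed
    have [measurable]: "?S \<in> sets borel" by (simp add: hdot_e1[symmetric])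
    have "ennreal (1 / 8 * (2 * s) ^ (2 * n - 2) * r ^ (n + 1)) = emeasure lborel (cbox a b)"
    proof -
      have "emeasure lborel (cbox a b) = ennreal (\<Prod>u\<in>Basis. (b - a) \<bullet> u)"
        by (subst emeasure_lborel_cbox_eq)
          (use r s in \<open>auto simp: Basis_vec_def inner_axis a_def b_def Basis_complex_def inner_complex_def\<close>)
      also have "(\<Prod>u\<in>(Basis :: (complex^'n) set). (b - a) \<bullet> u)
          = (\<Prod>u\<in>(Basis :: (complex^'n) set). if u = axis j1 1 then r / 4 else if u = axis j1 \<i> then r / 2 else 2 * s * sqrt r)"
        by (intro prod.cong refl) (auto simp: Basis_vec_def inner_axis a_def b_def Basis_complex_def inner_complex_def axis_eq_axis)
      also have "\<dots> = r / 4 * (r / 2) * (2 * s * sqrt r) ^ (2 * n - 2)"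
        unfolding n_def by (rule prod_Basis_e1)
      also have "\<dots> = (1 / 8 * (2 * s) ^ (2 * n - 2)) * r ^ (n + 1)"
      proof -
        have "sqrt r ^ (2 * n - 2) = r ^ (n - 1)"
          using sqrt_power_even[of r n] r by simp
        moreover have "r ^ n = r * r ^ (n - 1)"
          using n by (cases n) auto
        ultimately show ?thesis using r by (simp add: power_mult_distrib mult_ac)
      qed
      finally show ?thesis by simp
    qed
    also have "\<dots> \<le> emeasure lborel (?S \<inter> ball 0 1)"
      by (rule emeasure_mono[OF sub]) measurable
    finally have le: "ennreal (1 / 8 * (2 * s) ^ (2 * n - 2) * r ^ (n + 1)) \<le> emeasure lborel (?S \<inter> ball 0 1)" .
    have "ennreal (C * r ^ (CARD('n) + 1)) = ennreal (1 / volB TYPE('n)) * ennreal (1 / 8 * (2 * s) ^ (2 * n - 2) * r ^ (n + 1))"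
      using volB_pos[where 'n='n] r s by (subst ennreal_mult[symmetric]) (auto simp: C_def n_def mult_ac)
    also have "\<dots> \<le> ennreal (1 / volB TYPE('n)) * emeasure lborel (?S \<inter> ball 0 1)"
      by (rule mult_left_mono[OF le]) simp
    also have "\<dots> = emeasure nu ?S"
      by (rule emeasure_nu_eq[symmetric]) measurable
    finally show ?thesis .
  qed
  moreover have "C > 0" using volB_pos[where 'n='n] s by (simp add: C_def)
  ultimately show ?thesis by blast
qed

lemma sgn_scaleR_unit: "norm \<zeta> = 1 \<Longrightarrow> 0 < r \<Longrightarrow> sgn (r *\<^sub>R \<zeta>) = (\<zeta> :: complex^'n)"
  by (simp add: sgn_div_norm)

lemma nth_eq_norm_sgn: "(w :: complex^'n) $ j = of_real (norm w) * sgn w $ j"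
  by (cases "w = 0") (simp_all add: sgn_div_norm scaleR_conv_of_real[where 'a=complex])

lemma polar_product:
  fixes f :: "complex^'n \<Rightarrow> ennreal" and g :: "real \<Rightarrow> ennreal"
  assumes [measurable]: "f \<in> borel_measurable borel" "g \<in> borel_measurable borel"
  shows "(\<integral>\<^sup>+w. f (sgn w) * g (norm w) \<partial>nu) = (\<integral>\<^sup>+\<zeta>. f \<zeta> \<partial>sig) * (\<integral>\<^sup>+r. g r * ennreal (rd CARD('n) r) \<partial>lborel)"
proof -
  have "(\<integral>\<^sup>+w. f (sgn w) * g (norm w) \<partial>nu)
      = (\<integral>\<^sup>+\<zeta>. (\<integral>\<^sup>+r. f (sgn (r *\<^sub>R \<zeta>)) * g (norm (r *\<^sub>R \<zeta>)) * ennreal (rd CARD('n) r) \<partial>lborel) \<partial>sig)"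
    by (rule polar) measurable
  also have "\<dots> = (\<integral>\<^sup>+\<zeta>. f \<zeta> * (\<integral>\<^sup>+r. g r * ennreal (rd CARD('n) r) \<partial>lborel) \<partial>sig)"
  proof (rule nn_integral_sig_cong)
    fix \<zeta> :: "complex^'n" assume z: "norm \<zeta> = 1"
    have "(\<integral>\<^sup>+r. f (sgn (r *\<^sub>R \<zeta>)) * g (norm (r *\<^sub>R \<zeta>)) * ennreal (rd CARD('n) r) \<partial>lborel)
        = (\<integral>\<^sup>+r. f \<zeta> * (g r * ennreal (rd CARD('n) r)) \<partial>lborel)"
      by (rule nn_integral_cong) (use z in \<open>auto simp: rd_def sgn_scaleR_unit mult.assoc\<close>)
    also have "\<dots> = f \<zeta> * (\<integral>\<^sup>+r. g r * ennreal (rd CARD('n) r) \<partial>lborel)"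
      by (rule nn_integral_cmult) measurable
    finally show "(\<integral>\<^sup>+r. f (sgn (r *\<^sub>R \<zeta>)) * g (norm (r *\<^sub>R \<zeta>)) * ennreal (rd CARD('n) r) \<partial>lborel)
        = f \<zeta> * (\<integral>\<^sup>+r. g r * ennreal (rd CARD('n) r) \<partial>lborel)" .
  qed
  also have "\<dots> = (\<integral>\<^sup>+\<zeta>. f \<zeta> \<partial>sig) * (\<integral>\<^sup>+r. g r * ennreal (rd CARD('n) r) \<partial>lborel)"
    by (rule nn_integral_multc) measurable
  finally show ?thesis .
qed

lemma sig_ball_rotate:
  fixes \<xi> :: "complex^'n"
  assumes "norm \<xi> = 1"
  shows "emeasure sig {\<eta>. norm (1 - hdot \<xi> \<eta>) < r} = emeasure sig {\<eta> :: complex^'n. norm (1 - hdot e1 \<eta>) < r}"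
proof -
  obtain U :: "complex^'n \<Rightarrow> complex^'n" where U: "linear U" "\<And>x y. hdot (U x) (U y) = hdot x y" "U \<xi> = e1"
    using unitary_to_e1[OF assms] by blast
  have n: "norm (U x) = norm x" for x
  proof -
    have "complex_of_real ((norm (U x))\<^sup>2) = of_real ((norm x)\<^sup>2)"
      using U(2)[of x x] unfolding hdot_self .
    then have "(norm (U x))\<^sup>2 = (norm x)\<^sup>2" using of_real_eq_iff by blast
    then show ?thesis by (simp add: power2_eq_iff_nonneg)
  qed
  define g where "g = (indicator {\<eta> :: complex^'n. norm (1 - hdot e1 \<eta>) < r} :: _ \<Rightarrow> ennreal)"
  have [measurable]: "g \<in> borel_measurable borel" unfolding g_def by measurable
  have "emeasure sig {\<eta>. norm (1 - hdot \<xi> \<eta>) < r} = (\<integral>\<^sup>+\<eta>. indicator {\<eta>. norm (1 - hdot \<xi> \<eta>) < r} \<eta> \<partial>sig)"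
    by (rule nn_integral_indicator[symmetric]) measurable
  also have "\<dots> = (\<integral>\<^sup>+\<eta>. g (U \<eta>) \<partial>sig)"
    using U(2)[of \<xi>] U(3) by (simp add: g_def indicator_def)
  also have "\<dots> = (\<integral>\<^sup>+\<eta>. g \<eta> \<partial>sig)"
    by (rule nn_integral_sig_isometry[OF U(1) n]) measurable
  also have "\<dots> = emeasure sig {\<eta> :: complex^'n. norm (1 - hdot e1 \<eta>) < r}"
    unfolding g_def by simp
  finally show ?thesis .
qed

text \<open>
  A ball of radius \<open>r\<close> on the sphere, thickened radially by \<open>r\<close>, lies in the set of \<open>nu_tent_upper\<close> with radius \<open>2 r\<close>, and the
  thickening contributes one factor \<open>r\<close>.
\<close>
lemma sig_ball_upper:
  "\<exists>C>0. \<forall>(\<xi> :: complex^'n) r. norm \<xi> = 1 \<longrightarrow> 0 < r \<longrightarrow>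
     emeasure sig {\<eta>. norm (1 - hdot \<xi> \<eta>) < r} \<le> ennreal (C * r ^ CARD('n))"
proof -
  define n where "n = CARD('n)"
  have n: "n \<ge> 1" by (simp add: n_def Suc_le_eq)
  obtain C0 where C0: "C0 > 0" "\<And>r. r > 0 \<Longrightarrow> emeasure nu {w :: complex^'n. norm (1 - w $ j1) < r} \<le> ennreal (C0 * r ^ (n + 1))"
    using nu_tent_upper[where 'n='n] unfolding n_def by blast
  define c0 where "c0 = 2 * real n * (1/2) ^ (2 * n - 1)"
  have c0: "c0 > 0" using n by (simp add: c0_def)
  define C where "C = max (2 ^ n) (C0 * 2 ^ (n + 1) / c0)"
  have main: "emeasure sig {\<eta> :: complex^'n. norm (1 - hdot e1 \<eta>) < r} \<le> ennreal (C * r ^ n)" if r: "r > 0" for r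
  proof (cases "r \<le> 1/2")
    case False
    have "1 \<le> (2 * r) ^ n" using False by (intro one_le_power) simp
    also have "\<dots> \<le> C * r ^ n"
      unfolding power_mult_distrib using r by (intro mult_right_mono) (auto simp: C_def)
    finally have "1 \<le> ennreal (C * r ^ n)" using ennreal_leI[of 1] by (simp only: ennreal_1)
    then show ?thesis using sig.emeasure_le_1 order_trans by blast
  next
    case True
    let ?S = "{\<eta> :: complex^'n. norm (1 - hdot e1 \<eta>) < r}"
    have "emeasure sig ?S * ennreal (c0 * r) \<le> (\<integral>\<^sup>+\<zeta>. indicator ?S \<zeta> \<partial>sig) * (\<integral>\<^sup>+x. indicator {1 - r<..<1} x * ennreal (rd n x) \<partial>lborel)"
    proof (rule mult_mono)
      have "ennreal (c0 * r) = (\<integral>\<^sup>+x. ennreal c0 * indicator {1 - r<..<1} x \<partial>lborel)"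
        using r c0 by (subst nn_integral_cmult) (auto simp: ennreal_mult)
      also have "\<dots> \<le> (\<integral>\<^sup>+x. indicator {1 - r<..<1} x * ennreal (rd n x) \<partial>lborel)"
      proof (rule nn_integral_mono)
        fix x :: real
        show "ennreal c0 * indicator {1 - r<..<1} x \<le> indicator {1 - r<..<1} x * ennreal (rd n x)"
        proof (cases "x \<in> {1 - r<..<1}")
          case x: True
          then have "(1/2) ^ (2 * n - 1) \<le> x ^ (2 * n - 1)" using True by (intro power_mono) auto
          then have "c0 \<le> rd n x" using x True by (auto simp: c0_def rd_def mult_left_mono)
          then show ?thesis using x by (simp add: ennreal_leI)
        qed simp
      qed
      finally show "ennreal (c0 * r) \<le> (\<integral>\<^sup>+x. indicator {1 - r<..<1} x * ennreal (rd n x) \<partial>lborel)" .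
    qed auto
    also have "\<dots> = (\<integral>\<^sup>+w. indicator ?S (sgn w) * indicator {1 - r<..<1} (norm w) \<partial>nu)"
      unfolding n_def by (rule polar_product[symmetric]) measurable
    also have "\<dots> \<le> (\<integral>\<^sup>+w. indicator {w :: complex^'n. norm (1 - w $ j1) < 2 * r} w \<partial>nu)"
    proof (rule nn_integral_nu_mono)
      fix w :: "complex^'n" assume w: "norm w < 1 \<and> w \<noteq> 0"
      have "norm (1 - w $ j1) < 2 * r" if a: "norm (1 - hdot e1 (sgn w)) < r" and b: "1 - r < norm w"
      proof -
        define u where "u = sgn w $ j1"
        have u: "norm (1 - u) < r"
          using a unfolding norm_one_minus_hdot_commute[of e1] hdot_e1 u_def .
        have nu: "norm u \<le> 1"
          using Finite_Cartesian_Product.norm_nth_le[of "sgn w" j1] w by (simp add: u_def norm_sgn)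
        have "w $ j1 = of_real (norm w) * u" unfolding u_def
          by (rule nth_eq_norm_sgn)
        then have "1 - w $ j1 = (1 - u) + of_real (1 - norm w) * u" by (simp add: algebra_simps)
        then have "norm (1 - w $ j1) \<le> norm (1 - u) + norm (of_real (1 - norm w) * u)"
          by (metis norm_triangle_ineq)
        also have "norm (of_real (1 - norm w) * u) \<le> (1 - norm w) * 1"
          using w nu unfolding norm_mult norm_of_real by (intro mult_mono) auto
        finally show ?thesis using u b by simp
      qed
      then show "indicator ?S (sgn w) * indicator {1 - r<..<1} (norm w) \<le> (indicator {w :: complex^'n. norm (1 - w $ j1) < 2 * r} w :: ennreal)"
        by (auto simp: indicator_def)
    qed
    also have "\<dots> = emeasure nu {w :: complex^'n. norm (1 - w $ j1) < 2 * r}"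
      by (rule nn_integral_indicator) (simp add: hdot_e1[symmetric])
    also have "\<dots> \<le> ennreal (C0 * (2 * r) ^ (n + 1))" using C0(2)[of "2 * r"] r by simp
    finally have "measure sig ?S * (c0 * r) \<le> C0 * (2 * r) ^ (n + 1)"
      using c0 r C0(1) by (simp add: sig.emeasure_eq_measure ennreal_mult[symmetric])
    then have "(measure sig ?S * c0) * r \<le> (C0 * 2 ^ (n + 1) * r ^ n) * r"
      by (simp add: power_mult_distrib mult_ac)
    then have "measure sig ?S * c0 \<le> C0 * 2 ^ (n + 1) * r ^ n"
      using r by (rule mult_right_le_imp_le)
    then have "measure sig ?S \<le> C0 * 2 ^ (n + 1) / c0 * r ^ n"
      using c0 by (simp add: pos_le_divide_eq)
    also have "\<dots> \<le> C * r ^ n" using r by (intro mult_right_mono) (auto simp: C_def)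
    finally show ?thesis by (simp add: sig.emeasure_eq_measure ennreal_leI)
  qed
  have "C > 0" by (simp add: C_def less_max_iff_disj)
  then show ?thesis
    by (intro exI[of _ C] conjI allI impI) (simp_all only: sig_ball_rotate main n_def[symmetric])
qed

lemma sig_ball_lower:
  "\<exists>c>0. \<forall>(\<xi> :: complex^'n) r. norm \<xi> = 1 \<longrightarrow> 0 < r \<longrightarrow> r \<le> 3 \<longrightarrow>
     ennreal (c * r ^ CARD('n)) \<le> emeasure sig {\<eta>. norm (1 - hdot \<xi> \<eta>) < r}"
proof -
  define n where "n = CARD('n)"
  have n: "n \<ge> 1" by (simp add: n_def Suc_le_eq)
  obtain c0 where c0: "c0 > 0" "\<And>r. 0 < r \<Longrightarrow> r \<le> 1 \<Longrightarrow>
      ennreal (c0 * r ^ (n + 1)) \<le> emeasure nu {w :: complex^'n. norm (1 - w $ j1) < r \<and> (norm w)\<^sup>2 \<le> 1 - r / 4}"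
    using nu_tent_lower[where 'n='n] unfolding n_def by blast
  define c where "c = c0 / (2 * n) / 3 ^ n"
  have main: "ennreal (c * r ^ n) \<le> emeasure sig {\<eta> :: complex^'n. norm (1 - hdot e1 \<eta>) < r}" if r: "r > 0" "r \<le> 3" for r
  proof -
    define s where "s = r / 3"
    have s: "0 < s" "s \<le> 1" "2 * s \<le> r" using r by (auto simp: s_def)
    let ?S = "{\<eta> :: complex^'n. norm (1 - hdot e1 \<eta>) < r}"
    have "ennreal (c0 * s ^ (n + 1)) \<le> emeasure nu {w :: complex^'n. norm (1 - w $ j1) < s \<and> (norm w)\<^sup>2 \<le> 1 - s / 4}"
      by (rule c0(2)) (use s in auto)
    also have "\<dots> = (\<integral>\<^sup>+w. indicator {w :: complex^'n. norm (1 - w $ j1) < s \<and> (norm w)\<^sup>2 \<le> 1 - s / 4} w \<partial>nu)"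
      by (rule nn_integral_indicator[symmetric]) (simp add: hdot_e1[symmetric])
    also have "\<dots> \<le> (\<integral>\<^sup>+w. indicator ?S (sgn w) * indicator {1 - s<..<1} (norm w) \<partial>nu)"
    proof (rule nn_integral_nu_mono)
      fix w :: "complex^'n" assume w: "norm w < 1 \<and> w \<noteq> 0"
      have "norm (1 - hdot e1 (sgn w)) < r \<and> 1 - s < norm w" if a: "norm (1 - w $ j1) < s"
      proof
        define u where "u = sgn w $ j1"
        have nu: "norm u \<le> 1"
          using Finite_Cartesian_Product.norm_nth_le[of "sgn w" j1] w by (simp add: u_def norm_sgn)
        have "w $ j1 = of_real (norm w) * u" unfolding u_def
          by (rule nth_eq_norm_sgn)
        then have "norm (1 - u) \<le> 2 * norm (1 - w $ j1)" "1 - norm w \<le> norm (1 - w $ j1)"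
          using norm_one_minus_shrink[OF nu, of "norm w"] w by auto
        then show "1 - s < norm w" "norm (1 - hdot e1 (sgn w)) < r"
          using a s unfolding norm_one_minus_hdot_commute[of e1] hdot_e1 u_def by auto
      qed
      then have "indicator ?S (sgn w) = (1 :: ennreal) \<and> indicator {1 - s<..<1} (norm w) = (1 :: ennreal)"
        if "norm (1 - w $ j1) < s"
        using w that by simp
      then show "(indicator {w :: complex^'n. norm (1 - w $ j1) < s \<and> (norm w)\<^sup>2 \<le> 1 - s / 4} w :: ennreal)
          \<le> indicator ?S (sgn w) * indicator {1 - s<..<1} (norm w)"
        by (cases "norm (1 - w $ j1) < s") (auto split: split_indicator)
    qed
    also have "\<dots> = (\<integral>\<^sup>+\<zeta>. indicator ?S \<zeta> \<partial>sig) * (\<integral>\<^sup>+x. indicator {1 - s<..<1} x * ennreal (rd n x) \<partial>lborel)"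
      unfolding n_def by (rule polar_product) measurable
    also have "\<dots> \<le> emeasure sig ?S * ennreal (2 * n * s)"
    proof (rule mult_mono)
      have "(\<integral>\<^sup>+x. indicator {1 - s<..<1} x * ennreal (rd n x) \<partial>lborel) \<le> (\<integral>\<^sup>+x. ennreal (2 * n) * indicator {1 - s<..<1} x \<partial>lborel)"
      proof (rule nn_integral_mono)
        fix x :: real
        have "rd n x \<le> 2 * n"
          by (simp add: rd_def mult_left_le power_le_one)
        then show "indicator {1 - s<..<1} x * ennreal (rd n x) \<le> ennreal (2 * n) * indicator {1 - s<..<1} x"
          by (cases "x \<in> {1 - s<..<1}") (simp_all add: ennreal_leI)
      qed
      also have "\<dots> = ennreal (2 * n * s)"
        using s by (subst nn_integral_cmult) (auto simp: ennreal_mult)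
      finally show "(\<integral>\<^sup>+x. indicator {1 - s<..<1} x * ennreal (rd n x) \<partial>lborel) \<le> ennreal (2 * n * s)" .
    qed auto
    finally have "c0 * s ^ (n + 1) \<le> measure sig ?S * (2 * n * s)"
      using c0(1) s by (simp add: sig.emeasure_eq_measure ennreal_mult[symmetric])
    then have "(c0 * s ^ n) * s \<le> (measure sig ?S * (2 * n)) * s"
      by (simp add: mult_ac)
    then have "c0 * s ^ n \<le> measure sig ?S * (2 * n)"
      using s(1) by (rule mult_right_le_imp_le)
    then have "c0 / (2 * n) * s ^ n \<le> measure sig ?S"
      using n by (simp add: pos_divide_le_eq)
    then have "c * r ^ n \<le> measure sig ?S" by (simp add: c_def s_def power_divide)
    then show ?thesis by (simp add: sig.emeasure_eq_measure ennreal_leI)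
  qed
  have "c > 0" using c0(1) n by (simp add: c_def)
  then show ?thesis
    by (intro exI[of _ c] conjI allI impI) (simp_all only: sig_ball_rotate main n_def[symmetric])
qed

section \<open>Kernel estimates\<close>

lemma nn_integral_radial_kernel:
  fixes a b h :: real
  assumes "a > -1" "b > a + 1" "h > 0"
  shows "(\<integral>\<^sup>+r. ennreal ((1 - r) powr a * max (1 - r) h powr (- b)) * indicator {0<..<1} r \<partial>lborel)
     \<le> ennreal ((1 / (a + 1) + 1 / (b - a - 1)) * h powr (a + 1 - b))"
proof -
  have "(\<integral>\<^sup>+r. ennreal ((1 - r) powr a * max (1 - r) h powr (- b)) * indicator {0<..<1} r \<partial>lborel)
     = (\<integral>\<^sup>+s. ennreal (s powr a * max s h powr (- b)) * indicator {0<..<1} s \<partial>lborel)"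
    by (subst nn_integral_real_affine[of _ "-1" 1])
      (auto intro!: nn_integral_cong split: split_indicator)
  also have "\<dots> \<le> (\<integral>\<^sup>+s. ennreal (h powr (- b)) * (ennreal (s powr a) * indicator {0<..<h} s)
        + ennreal (s powr (a - b)) * indicator {h<..} s \<partial>lborel)"
  proof (rule nn_integral_mono_AE, rule AE_mp[OF AE_lborel_singleton[of h]], intro AE_I2 impI)
    fix s :: real assume "s \<noteq> h"
    then consider "s \<le> 0" | "0 < s" "s < h" | "0 < s" "h < s" by linarith
    then show "ennreal (s powr a * max s h powr (- b)) * indicator {0<..<1} s
        \<le> ennreal (h powr (- b)) * (ennreal (s powr a) * indicator {0<..<h} s) + ennreal (s powr (a - b)) * indicator {h<..} s"
    proof cases
      case 2
      then show ?thesis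
        by (auto simp: max_def ennreal_mult mult.commute split: split_indicator)
    next
      case 3
      then show ?thesis
        by (auto simp: max_def powr_add[symmetric] split: split_indicator)
    qed simp
  qed
  also have "\<dots> = ennreal (h powr (- b)) * ennreal (h powr (a + 1) / (a + 1)) + ennreal (h powr (a - b + 1) / (- (a - b) - 1))"
    using assms
    by (subst nn_integral_add, measurable) (simp add: nn_integral_cmult nn_integral_powr_from_0 nn_integral_powr_to_inf)
  also have "\<dots> = ennreal ((1 / (a + 1) + 1 / (b - a - 1)) * h powr (a + 1 - b))"
  proof -
    have "h powr (- b) * (h powr (a + 1) / (a + 1)) = h powr (a + 1 - b) / (a + 1)"
      by (simp add: powr_add[symmetric])
    moreover have "h powr (a - b + 1) / (- (a - b) - 1) = h powr (a + 1 - b) / (b - a - 1)"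
      by (simp add: algebra_simps)
    ultimately show ?thesis
      using assms by (simp add: ennreal_mult[symmetric] ennreal_plus[symmetric] distrib_right del: ennreal_plus)
  qed
  finally show ?thesis .
qed

lemma polar_decomp: obtains \<eta> :: "complex^'n" where "norm \<eta> = 1" "w = norm w *\<^sub>R \<eta>"
proof (cases "w = 0")
  case True
  then show ?thesis using that[of e1] by simp
next
  case False
  then show ?thesis using that[of "sgn w"] by (simp add: norm_sgn sgn_div_norm)
qed

lemma hdot_shrink_le:
  fixes \<zeta> \<eta> :: "complex^'n"
  assumes "norm \<zeta> = 1" "norm \<eta> = 1" "0 \<le> r" "r \<le> 1"
  shows "norm (1 - hdot \<zeta> \<eta>) \<le> 2 * norm (1 - hdot \<zeta> (r *\<^sub>R \<eta>))"
    "norm (1 - hdot \<zeta> \<eta>) \<le> 2 * norm (1 - hdot (r *\<^sub>R \<zeta>) \<eta>)"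
  using norm_one_minus_shrink(2)[of "hdot \<zeta> \<eta>" r] hdot_cauchy_schwarz[of \<zeta> \<eta>] assms
  by (simp_all add: hdot_scaleR_right hdot_scaleR_left)

lemma sphere_kernel_upper:
  "\<exists>C>0. \<forall>w :: complex^'n. norm w < 1 \<longrightarrow>
     (\<integral>\<^sup>+\<zeta>. ennreal (norm (1 - hdot \<zeta> w) powr (- (real CARD('n) + 2))) \<partial>sig) \<le> ennreal (C * (1 - norm w) powr (-2))"
proof -
  define n where "n = CARD('n)"
  obtain C where C: "C > 0" and CU: "\<And>(\<xi> :: complex^'n) r. norm \<xi> = 1 \<Longrightarrow> 0 < r \<Longrightarrow>
     emeasure sig {\<eta>. norm (1 - hdot \<xi> \<eta>) < r} \<le> ennreal (C * r ^ n)"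
    using sig_ball_upper[where 'n='n] unfolding n_def by blast
  define C1 where "C1 = (real n + 2) * C * 2 ^ n / 2"
  have "(\<integral>\<^sup>+\<zeta>. ennreal (norm (1 - hdot \<zeta> w) powr (- (real n + 2))) \<partial>sig) \<le> ennreal (C1 * (1 - norm w) powr (-2))"
    if w: "norm w < 1" for w :: "complex^'n"
  proof -
    define D where "D \<zeta> = norm (1 - hdot \<zeta> w)" for \<zeta>
    have [measurable]: "D \<in> borel_measurable borel" unfolding D_def by measurable
    define h where "h = 1 - norm w"
    have h: "h > 0" using w by (simp add: h_def)
    obtain \<eta> where \<eta>: "norm \<eta> = 1" "w = norm w *\<^sub>R \<eta>" using polar_decomp by blast
    have D: "D \<zeta> \<ge> h" "norm (1 - hdot \<eta> \<zeta>) \<le> 2 * D \<zeta>" if "norm \<zeta> = 1" for \<zeta>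
      using norm_one_minus_hdot_ge[of \<zeta> w] hdot_shrink_le(1)[OF that \<eta>(1), of "norm w"] w that \<eta>(2)
      by (simp_all add: D_def h_def norm_one_minus_hdot_commute[of \<eta>])
    have "(\<integral>\<^sup>+\<zeta>. ennreal (D \<zeta> powr (- (real n + 2))) \<partial>sig)
       = (\<integral>\<^sup>+\<zeta>. ennreal (real n + 2) * (\<integral>\<^sup>+s. ennreal (s powr (- (real n + 3))) * indicator {D \<zeta><..} s \<partial>lborel) \<partial>sig)"
    proof (rule nn_integral_sig_cong)
      fix \<zeta> :: "complex^'n" assume "norm \<zeta> = 1"
      then have "D \<zeta> > 0" using D(1) h by fastforce
      then have "(\<integral>\<^sup>+s. ennreal (s powr (- (real n + 3))) * indicator {D \<zeta><..} s \<partial>lborel)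
         = ennreal (D \<zeta> powr (- (real n + 3) + 1) / (- (- (real n + 3)) - 1))"
        by (rule nn_integral_powr_to_inf) simp
      also have "- (real n + 3) + 1 = - (real n + 2)" by simp
      also have "- (- (real n + 3)) - 1 = real n + 2" by simp
      finally show "ennreal (D \<zeta> powr (- (real n + 2))) = ennreal (real n + 2) * (\<integral>\<^sup>+s. ennreal (s powr (- (real n + 3))) * indicator {D \<zeta><..} s \<partial>lborel)"
        by (simp add: ennreal_mult[symmetric] del: ennreal_plus)
    qed
    also have "\<dots> = ennreal (real n + 2) * (\<integral>\<^sup>+\<zeta>. (\<integral>\<^sup>+s. ennreal (s powr (- (real n + 3))) * indicator {D \<zeta><..} s \<partial>lborel) \<partial>sig)"
      by (rule nn_integral_cmult) measurable
    also have "(\<integral>\<^sup>+\<zeta>. (\<integral>\<^sup>+s. ennreal (s powr (- (real n + 3))) * indicator {D \<zeta><..} s \<partial>lborel) \<partial>sig)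
       = (\<integral>\<^sup>+s. (\<integral>\<^sup>+\<zeta>. ennreal (s powr (- (real n + 3))) * indicator {D \<zeta><..} s \<partial>sig) \<partial>lborel)"
      by (rule pair_sigma_finite.Fubini'[symmetric]) (unfold_locales, measurable)
    also have "\<dots> \<le> (\<integral>\<^sup>+s. ennreal (C * 2 ^ n) * (ennreal (s powr (-3)) * indicator {h<..} s) \<partial>lborel)"
    proof (rule nn_integral_mono)
      fix s :: real
      show "(\<integral>\<^sup>+\<zeta>. ennreal (s powr (- (real n + 3))) * indicator {D \<zeta><..} s \<partial>sig)
          \<le> ennreal (C * 2 ^ n) * (ennreal (s powr (-3)) * indicator {h<..} s)"
      proof (cases "s > h")
        case False
        have "(\<integral>\<^sup>+\<zeta>. ennreal (s powr (- (real n + 3))) * indicator {D \<zeta><..} s \<partial>sig) = (\<integral>\<^sup>+\<zeta>. 0 \<partial>(sig :: (complex^'n) measure))"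
        proof (rule nn_integral_sig_cong)
          fix \<zeta> :: "complex^'n" assume "norm \<zeta> = 1"
          then have "\<not> D \<zeta> < s" using D(1) False by fastforce
          then show "ennreal (s powr (- (real n + 3))) * indicator {D \<zeta><..} s = 0" by simp
        qed
        then show ?thesis by simp
      next
        case True
        have s: "s > 0" using True h by simp
        have "(\<integral>\<^sup>+\<zeta>. ennreal (s powr (- (real n + 3))) * indicator {D \<zeta><..} s \<partial>sig)
          \<le> (\<integral>\<^sup>+\<zeta>. ennreal (s powr (- (real n + 3))) * indicator {\<zeta>. norm (1 - hdot \<eta> \<zeta>) < 2 * s} \<zeta> \<partial>sig)"
        proof (rule nn_integral_sig_mono)
          fix \<zeta> :: "complex^'n" assume "norm \<zeta> = 1"
          then show "ennreal (s powr (- (real n + 3))) * indicator {D \<zeta><..} s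
             \<le> ennreal (s powr (- (real n + 3))) * indicator {\<zeta>. norm (1 - hdot \<eta> \<zeta>) < 2 * s} \<zeta>"
            using D(2)[of \<zeta>] by (intro mult_left_mono) (auto split: split_indicator)
        qed
        also have "\<dots> = ennreal (s powr (- (real n + 3))) * emeasure sig {\<zeta>. norm (1 - hdot \<eta> \<zeta>) < 2 * s}"
          by (rule nn_integral_cmult_indicator) measurable
        also have "\<dots> \<le> ennreal (s powr (- (real n + 3))) * ennreal (C * (2 * s) ^ n)"
          by (intro mult_left_mono CU) (use \<eta> s in auto)
        also have "\<dots> = ennreal (C * 2 ^ n) * ennreal (s powr (-3))"
        proof -
          have "s powr (- (real n + 3)) * s ^ n = s powr (-3)"
            using s by (simp add: powr_realpow[symmetric] powr_add[symmetric])
          then have "s powr (- (real n + 3)) * (C * (2 * s) ^ n) = C * 2 ^ n * s powr (-3)"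
            by (simp add: power_mult_distrib mult_ac)
          then show ?thesis using s C by (simp add: ennreal_mult[symmetric])
        qed
        finally show ?thesis using True by simp
      qed
    qed
    also have "\<dots> = ennreal (C * 2 ^ n) * ennreal (h powr (-2) / 2)"
      using h by (subst nn_integral_cmult, measurable) (simp add: nn_integral_powr_to_inf)
    finally have "(\<integral>\<^sup>+\<zeta>. ennreal (D \<zeta> powr (- (real n + 2))) \<partial>sig) \<le> ennreal (real n + 2) * (ennreal (C * 2 ^ n) * ennreal (h powr (-2) / 2))"
      by (simp add: mult_left_mono)
    also have "\<dots> = ennreal (C1 * h powr (-2))"
      using C by (simp add: C1_def ennreal_mult[symmetric] mult_ac del: ennreal_plus)
    finally show ?thesis by (simp add: D_def h_def)
  qed
  moreover have "C1 > 0" using C by (simp add: C1_def)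
  ultimately show ?thesis unfolding n_def by blast
qed

abbreviation kern :: "complex^'n \<Rightarrow> complex^'n \<Rightarrow> real" where
  "kern z w \<equiv> norm (1 - hdot z w) powr (- (real CARD('n) + 2))"

lemma ball_kernel_upper:
  assumes a: "-1 < a" "a < 1"
  shows "\<exists>C>0. \<forall>z :: complex^'n. norm z < 1 \<longrightarrow>
     (\<integral>\<^sup>+w. ennreal ((1 - norm w) powr a * kern z w) \<partial>nu) \<le> ennreal (C * (1 - norm z) powr (a - 1))"
proof -
  define n where "n = CARD('n)"
  have n: "n \<ge> 1" by (simp add: n_def Suc_le_eq)
  obtain C where C: "C > 0" and CU: "\<And>w :: complex^'n. norm w < 1 \<Longrightarrow>
     (\<integral>\<^sup>+\<zeta>. ennreal (norm (1 - hdot \<zeta> w) powr (- (real n + 2))) \<partial>sig) \<le> ennreal (C * (1 - norm w) powr (-2))"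
    using sphere_kernel_upper[where 'n='n] unfolding n_def by blast
  define C0 where "C0 = 1 / (a + 1) + 1 / (2 - a - 1)"
  have C0: "C0 > 0" using a by (auto simp: C0_def intro!: add_pos_pos)
  define C1 where "C1 = 2 * n * C * C0"
  have "(\<integral>\<^sup>+w. ennreal ((1 - norm w) powr a * kern z w) \<partial>nu) \<le> ennreal (C1 * (1 - norm z) powr (a - 1))"
    if z: "norm z < 1" for z :: "complex^'n"
  proof -
    define h where "h = 1 - norm z"
    have h: "h > 0" using z by (simp add: h_def)
    have "(\<integral>\<^sup>+w. ennreal ((1 - norm w) powr a * kern z w) \<partial>nu)
      = (\<integral>\<^sup>+\<zeta>. (\<integral>\<^sup>+r. ennreal ((1 - norm (r *\<^sub>R \<zeta>)) powr a * kern z (r *\<^sub>R \<zeta>)) * ennreal (rd CARD('n) r) \<partial>lborel) \<partial>sig)"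
      by (rule polar) measurable
    also have "\<dots> = (\<integral>\<^sup>+\<zeta>. (\<integral>\<^sup>+r. ennreal ((1 - r) powr a * rd n r) * ennreal (norm (1 - hdot \<zeta> (r *\<^sub>R z)) powr (- (real n + 2))) \<partial>lborel) \<partial>sig)"
    proof (rule nn_integral_sig_cong, rule nn_integral_cong)
      fix \<zeta> :: "complex^'n" and r :: real assume 1: "norm \<zeta> = 1"
      have "norm (1 - hdot z (r *\<^sub>R \<zeta>)) = norm (1 - hdot \<zeta> (r *\<^sub>R z))"
        by (subst norm_one_minus_hdot_commute) (simp add: hdot_scaleR_left hdot_scaleR_right)
      then show "ennreal ((1 - norm (r *\<^sub>R \<zeta>)) powr a * kern z (r *\<^sub>R \<zeta>)) * ennreal (rd CARD('n) r)
         = ennreal ((1 - r) powr a * rd n r) * ennreal (norm (1 - hdot \<zeta> (r *\<^sub>R z)) powr (- (real n + 2)))"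
        using 1 by (cases "0 < r") (simp_all add: ennreal_mult[symmetric] n_def mult_ac rd_def)
    qed
    also have "\<dots> = (\<integral>\<^sup>+r. (\<integral>\<^sup>+\<zeta>. ennreal ((1 - r) powr a * rd n r) * ennreal (norm (1 - hdot \<zeta> (r *\<^sub>R z)) powr (- (real n + 2))) \<partial>sig) \<partial>lborel)"
      by (rule pair_sigma_finite.Fubini'[symmetric]) (unfold_locales, measurable)
    also have "\<dots> \<le> (\<integral>\<^sup>+r. ennreal (2 * n * C) * (ennreal ((1 - r) powr a * max (1 - r) h powr (- 2)) * indicator {0<..<1} r) \<partial>lborel)"
    proof (rule nn_integral_mono)
      fix r :: real
      show "(\<integral>\<^sup>+\<zeta>. ennreal ((1 - r) powr a * rd n r) * ennreal (norm (1 - hdot \<zeta> (r *\<^sub>R z)) powr (- (real n + 2))) \<partial>sig)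
          \<le> ennreal (2 * n * C) * (ennreal ((1 - r) powr a * max (1 - r) h powr (- 2)) * indicator {0<..<1} r)"
      proof (cases "0 < r \<and> r < 1")
        case False
        then show ?thesis by (auto simp: rd_def)
      next
        case True
        have rz1: "r * norm z \<le> norm z" "r * norm z \<le> r"
          using True z by (simp_all add: mult_left_le_one_le mult_left_le)
        then have rz: "norm (r *\<^sub>R z) < 1" using True z by simp
        have rd: "rd n r \<le> 2 * n" using True by (auto simp: rd_def intro!: mult_left_le power_le_one)
        have "max (1 - r) h \<le> 1 - norm (r *\<^sub>R z)"
          using rz1 True by (auto simp: h_def)
        then have m: "(1 - norm (r *\<^sub>R z)) powr (- 2) \<le> max (1 - r) h powr (- 2)"
          using h by (intro powr_mono2') auto
        have "(\<integral>\<^sup>+\<zeta>. ennreal ((1 - r) powr a * rd n r) * ennreal (norm (1 - hdot \<zeta> (r *\<^sub>R z)) powr (- (real n + 2))) \<partial>sig)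
          = ennreal ((1 - r) powr a * rd n r) * (\<integral>\<^sup>+\<zeta>. ennreal (norm (1 - hdot \<zeta> (r *\<^sub>R z)) powr (- (real n + 2))) \<partial>sig)"
          by (rule nn_integral_cmult) measurable
        also have "\<dots> \<le> ennreal ((1 - r) powr a * rd n r) * ennreal (C * (1 - norm (r *\<^sub>R z)) powr (-2))"
          by (intro mult_left_mono CU rz) simp
        also have "\<dots> = ennreal (((1 - r) powr a * rd n r) * (C * (1 - norm (r *\<^sub>R z)) powr (-2)))"
          using C by (simp add: ennreal_mult)
        also have "\<dots> \<le> ennreal (((1 - r) powr a * (2 * n)) * (C * max (1 - r) h powr (- 2)))"
          using C rd m by (intro ennreal_leI mult_mono) auto
        also have "\<dots> = ennreal (2 * n * C) * (ennreal ((1 - r) powr a * max (1 - r) h powr (- 2)) * indicator {0<..<1} r)"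
          using C True by (simp add: ennreal_mult[symmetric] mult_ac)
        finally show ?thesis .
      qed
    qed
    also have "\<dots> = ennreal (2 * n * C) * (\<integral>\<^sup>+r. ennreal ((1 - r) powr a * max (1 - r) h powr (- 2)) * indicator {0<..<1} r \<partial>lborel)"
      by (rule nn_integral_cmult) measurable
    also have "\<dots> \<le> ennreal (2 * n * C) * ennreal (C0 * h powr (a + 1 - 2))"
      unfolding C0_def using h a by (intro mult_left_mono nn_integral_radial_kernel) auto
    also have "\<dots> = ennreal (2 * n * C * (C0 * h powr (a + 1 - 2)))"
      using C C0 by (subst ennreal_mult[symmetric]) auto
    also have "\<dots> = ennreal (C1 * h powr (a - 1))"
      by (simp add: C1_def mult_ac)
    finally show ?thesis by (simp add: h_def)
  qed
  moreover have "C1 > 0" using C n C0 by (simp add: C1_def)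
  ultimately show ?thesis by blast
qed

text \<open>
  Schur test with the test function \<open>(1 - |w|) powr (-1/4)\<close>.
\<close>
lemma schur_pointwise:
  "\<exists>C>0. \<forall>(z :: complex^'n) (\<phi> :: complex^'n \<Rightarrow> complex). norm z < 1 \<longrightarrow> \<phi> \<in> borel_measurable borel \<longrightarrow>
     (\<integral>\<^sup>+w. ennreal (norm (\<phi> w) * kern z w) \<partial>nu)\<^sup>2 \<le>
     ennreal (C * (1 - norm z) powr (- (3/2))) * (\<integral>\<^sup>+w. ennreal ((norm (\<phi> w))\<^sup>2 * (1 - norm w) powr (1/2) * kern z w) \<partial>nu)"
proof -
  obtain C where C: "C > 0" and CU: "\<And>z :: complex^'n. norm z < 1 \<Longrightarrow>
     (\<integral>\<^sup>+w. ennreal ((1 - norm w) powr (- (1/2)) * kern z w) \<partial>nu) \<le> ennreal (C * (1 - norm z) powr (- (3/2)))"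
    using ball_kernel_upper[of "- (1/2)", where 'n='n] by auto
  have "(\<integral>\<^sup>+w. ennreal (norm (\<phi> w) * kern z w) \<partial>nu)\<^sup>2 \<le>
     ennreal (C * (1 - norm z) powr (- (3/2))) * (\<integral>\<^sup>+w. ennreal ((norm (\<phi> w))\<^sup>2 * (1 - norm w) powr (1/2) * kern z w) \<partial>nu)"
    if z: "norm z < 1" and [measurable]: "\<phi> \<in> borel_measurable borel" for z :: "complex^'n" and \<phi>
  proof -
    define f where "f w = norm (\<phi> w) * (1 - norm w) powr (1/4) * sqrt (kern z w)" for w
    define g where "g w = (1 - norm w) powr (- (1/4)) * sqrt (kern z w)" for w
    have [measurable]: "f \<in> borel_measurable borel" "g \<in> borel_measurable borel"
      unfolding f_def g_def by measurable
    have fg: "f w * g w = norm (\<phi> w) * kern z w" "(f w)\<^sup>2 = (norm (\<phi> w))\<^sup>2 * (1 - norm w) powr (1/2) * kern z w"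
      "(g w)\<^sup>2 = (1 - norm w) powr (- (1/2)) * kern z w" if "norm w < 1" for w
    proof -
      have "(1 - norm w) powr (1/4) * (1 - norm w) powr (- (1/4)) = 1"
        using that by (simp add: powr_add[symmetric])
      then show "f w * g w = norm (\<phi> w) * kern z w"
      proof -
        assume 1: "(1 - norm w) powr (1/4) * (1 - norm w) powr (- (1/4)) = 1"
        have "f w * g w = norm (\<phi> w) * ((1 - norm w) powr (1/4) * (1 - norm w) powr (- (1/4))) * (sqrt (kern z w) * sqrt (kern z w))"
          unfolding f_def g_def by (simp only: mult_ac)
        then show ?thesis unfolding 1 by simp
      qed
      have "((1 - norm w) powr a)\<^sup>2 = (1 - norm w) powr (2 * a)" for a
        using that by (simp add: power2_eq_square powr_add[symmetric])
      then show "(f w)\<^sup>2 = (norm (\<phi> w))\<^sup>2 * (1 - norm w) powr (1/2) * kern z w"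
        "(g w)\<^sup>2 = (1 - norm w) powr (- (1/2)) * kern z w"
        by (simp_all add: f_def g_def power_mult_distrib)
    qed
    have nn: "0 \<le> f w" "0 \<le> g w" for w by (simp_all add: f_def g_def)
    have "(\<integral>\<^sup>+w. ennreal (norm (\<phi> w) * kern z w) \<partial>nu)\<^sup>2 = (\<integral>\<^sup>+w. ennreal (f w) * ennreal (g w) \<partial>nu)\<^sup>2"
    proof (rule arg_cong[where f = "\<lambda>x. x\<^sup>2"], rule nn_integral_cong_AE, rule AE_mp[OF AE_nu_in_ball], intro AE_I2 impI)
      fix w :: "complex^'n" assume "norm w < 1 \<and> w \<noteq> 0"
      then show "ennreal (norm (\<phi> w) * kern z w) = ennreal (f w) * ennreal (g w)"
        using fg(1)[of w] nn by (simp add: ennreal_mult[symmetric])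
    qed
    also have "\<dots> \<le> (\<integral>\<^sup>+w. (ennreal (f w))\<^sup>2 \<partial>nu) * (\<integral>\<^sup>+w. (ennreal (g w))\<^sup>2 \<partial>nu)"
      by (rule Cauchy_Schwarz_nn_integral) measurable
    also have "(\<integral>\<^sup>+w. (ennreal (f w))\<^sup>2 \<partial>nu) = (\<integral>\<^sup>+w. ennreal ((norm (\<phi> w))\<^sup>2 * (1 - norm w) powr (1/2) * kern z w) \<partial>nu)"
      by (rule nn_integral_nu_cong)
        (use fg(2) nn in \<open>simp add: ennreal_power\<close>)
    also have "(\<integral>\<^sup>+w. (ennreal (g w))\<^sup>2 \<partial>nu) = (\<integral>\<^sup>+w. ennreal ((1 - norm w) powr (- (1/2)) * kern z w) \<partial>nu)"
      by (rule nn_integral_nu_cong)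
        (use fg(3) nn in \<open>simp add: ennreal_power\<close>)
    also have "(\<integral>\<^sup>+w. ennreal ((norm (\<phi> w))\<^sup>2 * (1 - norm w) powr (1/2) * kern z w) \<partial>nu) * (\<integral>\<^sup>+w. ennreal ((1 - norm w) powr (- (1/2)) * kern z w) \<partial>nu)
       \<le> (\<integral>\<^sup>+w. ennreal ((norm (\<phi> w))\<^sup>2 * (1 - norm w) powr (1/2) * kern z w) \<partial>nu) * ennreal (C * (1 - norm z) powr (- (3/2)))"
      by (rule mult_left_mono[OF CU[OF z]]) simp
    finally show ?thesis by (simp add: mult.commute)
  qed
  with C show ?thesis by blast
qed

section \<open>Powers of extended nonnegative reals\<close>

lemma epowr_ennreal: "0 \<le> x \<Longrightarrow> epowr (ennreal x) a = ennreal (x powr a)"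
  by (simp add: epowr_def)

lemma epowr_top [simp]: "epowr top a = top"
  by (simp add: epowr_def)

lemma epowr_zero [simp]: "epowr 0 a = 0"
  by (simp add: epowr_def)

lemma epowr_one [simp]: "epowr x 1 = x"
  by (cases x) (auto simp: epowr_def)

lemma epowr_mono: "0 \<le> a \<Longrightarrow> x \<le> y \<Longrightarrow> epowr x a \<le> epowr y a"
  by (cases x; cases y) (auto simp: epowr_def top_unique intro!: ennreal_leI powr_mono2)

lemma epowr_mult:
  assumes "0 < a" shows "epowr (x * y) a = epowr x a * epowr y a"
proof (cases "x = 0 \<or> y = 0")
  case False
  then show ?thesis
    by (cases x; cases y) (auto simp: epowr_def ennreal_mult[symmetric] powr_mult ennreal_mult_eq_top_iff ennreal_top_mult ennreal_mult_top)
qed auto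

lemma epowr_epowr: "0 < a \<Longrightarrow> 0 < b \<Longrightarrow> epowr (epowr x a) b = epowr x (a * b)"
  by (cases x) (auto simp: epowr_def powr_powr)

lemma epowr_measurable [measurable (raw)]:
  assumes [measurable]: "f \<in> borel_measurable M"
  shows "(\<lambda>x. epowr (f x) a) \<in> borel_measurable M"
  unfolding epowr_def by measurable

lemma epowr_SUP:
  assumes "0 < a"
  shows "epowr (SUP i\<in>I. f i) a = (SUP i\<in>I. epowr (f i) a)"
proof (rule antisym)
  have "f i \<le> epowr (SUP i\<in>I. epowr (f i) a) (1 / a)" if "i \<in> I" for i
  proof -
    have "epowr (epowr (f i) a) (1 / a) \<le> epowr (SUP i\<in>I. epowr (f i) a) (1 / a)"
      using assms that by (intro epowr_mono SUP_upper) auto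
    then show ?thesis using assms by (simp add: epowr_epowr)
  qed
  then have "(SUP i\<in>I. f i) \<le> epowr (SUP i\<in>I. epowr (f i) a) (1 / a)"
    by (rule SUP_least)
  then have "epowr (SUP i\<in>I. f i) a \<le> epowr (epowr (SUP i\<in>I. epowr (f i) a) (1 / a)) a"
    using assms by (intro epowr_mono) auto
  then show "epowr (SUP i\<in>I. f i) a \<le> (SUP i\<in>I. epowr (f i) a)"
    using assms by (simp add: epowr_epowr)
  show "(SUP i\<in>I. epowr (f i) a) \<le> epowr (SUP i\<in>I. f i) a"
    using assms by (intro SUP_least epowr_mono SUP_upper) auto
qed

text \<open>
  Compare \<open>y\<close> with \<open>M x\<close>: the larger one dominates both factors.
\<close>
lemma epowr_young:
  assumes q: "1 < q" and M: "0 < M"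
  shows "x * epowr y (q - 1) \<le> ennreal (M powr (q - 1)) * epowr x q + ennreal (1 / M) * epowr y q"
proof (cases "x = \<infinity> \<or> y = \<infinity>")
  case True
  then show ?thesis using M by (auto simp: ennreal_mult_top ennreal_top_mult)
next
  case False
  then obtain a b where ab: "x = ennreal a" "y = ennreal b" "0 \<le> a" "0 \<le> b"
    by (cases x; cases y) auto
  have "a * b powr (q - 1) \<le> M powr (q - 1) * a powr q + 1 / M * b powr q"
  proof (cases "b \<le> M * a")
    case True
    have "b powr (q - 1) \<le> (M * a) powr (q - 1)" using True q ab by (intro powr_mono2) auto
    then have "a * b powr (q - 1) \<le> a * (M powr (q - 1) * a powr (q - 1))"
      using ab M by (intro mult_left_mono) (auto simp: powr_mult)
    also have "\<dots> = M powr (q - 1) * a powr q"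
      using ab by (cases "a = 0") (auto simp: powr_diff)
    finally show ?thesis using M by (simp add: add_increasing2)
  next
    case False
    then have "a * b powr (q - 1) \<le> (b / M) * b powr (q - 1)"
      using M by (intro mult_right_mono) (auto simp: field_simps)
    also have "\<dots> = 1 / M * b powr q"
      using ab by (cases "b = 0") (auto simp: powr_diff)
    finally show ?thesis using M by (simp add: add_increasing)
  qed
  then show ?thesis using ab M
    by (simp add: epowr_ennreal ennreal_mult[symmetric] ennreal_plus[symmetric] del: ennreal_plus)
qed

lemma ennreal_absorb_half:
  assumes S: "S < \<infinity>" and le: "S \<le> Y + ennreal (1/2) * S"
  shows "S \<le> ennreal 2 * Y"
proof (cases Y)
  case (real y)
  obtain x where x: "S = ennreal x" "0 \<le> x" using S by (cases S) auto
  have "ennreal (1/2) * S = ennreal (1/2 * x)" unfolding x(1) using x(2) by (intro ennreal_mult[symmetric]) auto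
  then have "ennreal x \<le> ennreal (y + 1/2 * x)"
    using le x real by (subst ennreal_plus) auto
  then have "x \<le> y + 1/2 * x" using x real by (subst (asm) ennreal_le_iff) auto
  then have "ennreal x \<le> ennreal (2 * y)" by (intro ennreal_leI) simp
  also have "\<dots> = ennreal 2 * ennreal y" using real by (intro ennreal_mult) auto
  finally show ?thesis unfolding x(1) real(2) .
qed (simp add: ennreal_mult_top)

lemma ennreal_mult3:
  "0 \<le> a \<Longrightarrow> 0 \<le> b \<Longrightarrow> 0 \<le> c \<Longrightarrow> ennreal a * (ennreal b * x) * ennreal c = ennreal (a * b * c) * x"
  by (simp add: ennreal_mult mult_ac)

lemma ennreal_mult_triple:
  "0 \<le> a \<Longrightarrow> 0 \<le> b \<Longrightarrow> 0 \<le> c \<Longrightarrow> ennreal (a * b * c) = ennreal a * ennreal b * ennreal c"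
  by (simp add: ennreal_mult)

section \<open>A median inequality\<close>

text \<open>
  The points with at most half of the mass at or above their level carry at most half of the mass. At all other
  points the inner integral is at least half of the total one.
\<close>
lemma median_power:
  fixes k :: "'a \<Rightarrow> ennreal" and t :: "'a \<Rightarrow> real"
  assumes [measurable]: "k \<in> borel_measurable M" "t \<in> borel_measurable M"
    and sf: "sigma_finite_measure M"
    and t0: "\<And>w. 0 \<le> t w" and q: "1 < q" and fin: "(\<integral>\<^sup>+w. k w \<partial>M) < \<infinity>"
  shows "epowr (\<integral>\<^sup>+w. k w \<partial>M) q \<le> ennreal (2 powr q) *
     (\<integral>\<^sup>+w. k w * epowr (\<integral>\<^sup>+v. k v * (if t w \<le> t v then 1 else 0) \<partial>M) (q - 1) \<partial>M)"
proof -
  interpret sigma_finite_measure M by fact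
  define N where "N = density M k"
  define m where "m = enn2real (\<integral>\<^sup>+w. k w \<partial>M)"
  have m: "(\<integral>\<^sup>+w. k w \<partial>M) = ennreal m" "0 \<le> m" using fin by (auto simp: m_def less_top)
  have [measurable_cong]: "sets N = sets M" by (simp add: N_def)
  have sp: "space N = space M" by (simp add: N_def)
  have NS: "emeasure N (space N) = ennreal m"
    unfolding sp N_def by (subst emeasure_density) (auto simp: m(1)[symmetric] intro!: nn_integral_cong)
  interpret N: finite_measure N by (rule finite_measureI) (simp add: NS)
  have mN: "measure N (space N) = m" using NS m(2) by (simp add: measure_def)
  define F where "F w = (\<integral>\<^sup>+v. k v * (if t w \<le> t v then 1 else 0) \<partial>M)" for w
  have [measurable]: "F \<in> borel_measurable M" unfolding F_def by measurable
  have FN: "F w = ennreal (measure N {v \<in> space M. t w \<le> t v})" for w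
  proof -
    have "F w = (\<integral>\<^sup>+v. k v * indicator {v \<in> space M. t w \<le> t v} v \<partial>M)"
      unfolding F_def by (intro nn_integral_cong) (auto simp: indicator_def)
    also have "\<dots> = emeasure N {v \<in> space M. t w \<le> t v}"
      unfolding N_def by (subst emeasure_density) auto
    finally show ?thesis by (simp add: N.emeasure_eq_measure)
  qed
  define A where "A = {w \<in> space M. F w \<le> ennreal (m / 2)}"
  have [measurable]: "A \<in> sets M" unfolding A_def by measurable
  have Aw: "measure N {v \<in> space M. t w \<le> t v} \<le> m / 2" if "w \<in> A" for w
    using that m by (simp add: A_def FN)
  have NA: "measure N A \<le> m / 2"
  proof (cases "A = {}")
    case True then show ?thesis using m by simp
  next
    case False
    define s where "s = Inf (t ` A)"
    have bdd: "bdd_below (t ` A)" using t0 by (intro bdd_belowI[of _ 0]) auto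
    have sA: "s \<le> t w" if "w \<in> A" for w unfolding s_def using that bdd by (intro cInf_lower) auto
    \<comment> \<open>If the infimum is not attained, then the increasing sets where \<open>t\<close> exceeds it by at least \<open>1 / (i + 1)\<close> cover \<open>A\<close>.\<close>
    show ?thesis
    proof (cases "s \<in> t ` A")
      case True
      then obtain w where w: "w \<in> A" "t w = s" by auto
      have "measure N A \<le> measure N {v \<in> space M. t w \<le> t v}"
        using sA w by (intro N.finite_measure_mono) (auto simp: A_def)
      also have "\<dots> \<le> m / 2" by (rule Aw[OF w(1)])
      finally show ?thesis .
    next
      case False': False
      define B where "B i = {v \<in> space M. s + 1 / Suc i \<le> t v}" for i
      have Bm [measurable]: "B i \<in> sets N" for i unfolding B_def by measurable
      have Bi: "measure N (B i) \<le> m / 2" for i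
      proof -
        have "Inf (t ` A) < s + 1 / Suc i" by (simp add: s_def)
        then obtain w where w: "w \<in> A" "t w < s + 1 / Suc i"
          using \<open>A \<noteq> {}\<close> bdd by (subst (asm) cInf_less_iff) auto
        have "measure N (B i) \<le> measure N {v \<in> space M. t w \<le> t v}"
          using w by (intro N.finite_measure_mono) (auto simp: B_def)
        also have "\<dots> \<le> m / 2" using Aw w by simp
        finally show ?thesis .
      qed
      have inc: "incseq B"
      proof (rule incseq_SucI, rule subsetI)
        fix i v assume "v \<in> B i"
        moreover have "1 / real (Suc (Suc i)) \<le> 1 / real (Suc i)" by (simp add: frac_le)
        ultimately show "v \<in> B (Suc i)" by (simp add: B_def)
      qed
      have "A \<subseteq> (\<Union>i. B i)"
      proof
        fix w assume w: "w \<in> A"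
        then have "s < t w" using sA[OF w] False' by (metis imageI order_le_less)
        then obtain i where "1 / Suc i < t w - s"
          using nat_approx_posE[of "t w - s"] by auto
        then show "w \<in> (\<Union>i. B i)" using w by (auto simp: B_def A_def intro!: exI[of _ i])
      qed
      then have "measure N A \<le> measure N (\<Union>i. B i)"
        by (intro N.finite_measure_mono) auto
      also have "\<dots> \<le> m / 2"
      proof (rule LIMSEQ_le_const2)
        show "(\<lambda>i. measure N (B i)) \<longlonglongrightarrow> measure N (\<Union>i. B i)"
          using Bm inc by (intro N.finite_Lim_measure_incseq) blast+
      qed (use Bi in blast)
      finally show ?thesis .
    qed
  qed
  have "measure N (space N - A) = m - measure N A"
    using mN by (subst N.finite_measure_compl) auto
  then have NC: "m / 2 \<le> measure N (space N - A)" using NA by simp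
  have "ennreal ((m / 2) powr q) = ennreal ((m / 2) powr (q - 1)) * ennreal (m / 2)"
    using m by (cases "m = 0") (auto simp: ennreal_mult[symmetric] powr_diff)
  also have "\<dots> \<le> ennreal ((m / 2) powr (q - 1)) * emeasure N (space N - A)"
    using NC by (intro mult_left_mono) (auto simp: N.emeasure_eq_measure)
  also have "emeasure N (space N - A) = (\<integral>\<^sup>+w. k w * indicator (space M - A) w \<partial>M)"
    unfolding sp N_def by (subst emeasure_density) auto
  also have "ennreal ((m / 2) powr (q - 1)) * \<dots> = (\<integral>\<^sup>+w. ennreal ((m / 2) powr (q - 1)) * (k w * indicator (space M - A) w) \<partial>M)"
    by (rule nn_integral_cmult[symmetric]) measurable
  also have "\<dots> \<le> (\<integral>\<^sup>+w. k w * epowr (F w) (q - 1) \<partial>M)"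
  proof (rule nn_integral_mono)
    fix w assume w: "w \<in> space M"
    show "ennreal ((m / 2) powr (q - 1)) * (k w * indicator (space M - A) w) \<le> k w * epowr (F w) (q - 1)"
    proof (cases "w \<in> A")
      case False
      then have "ennreal (m / 2) \<le> F w" using w by (auto simp: A_def)
      then have "epowr (ennreal (m / 2)) (q - 1) \<le> epowr (F w) (q - 1)"
        using q by (intro epowr_mono) auto
      then have "ennreal ((m / 2) powr (q - 1)) \<le> epowr (F w) (q - 1)"
        using m by (simp add: epowr_ennreal)
      from mult_right_mono[OF this, of "k w"] show ?thesis
        using False w by (simp add: mult.commute)
    qed simp
  qed
  finally have le: "ennreal ((m / 2) powr q) \<le> (\<integral>\<^sup>+w. k w * epowr (F w) (q - 1) \<partial>M)" .
  have "epowr (\<integral>\<^sup>+w. k w \<partial>M) q = ennreal (2 powr q) * ennreal ((m / 2) powr q)"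
    using m by (simp add: epowr_ennreal ennreal_mult[symmetric] powr_divide)
  also have "\<dots> \<le> ennreal (2 powr q) * (\<integral>\<^sup>+w. k w * epowr (F w) (q - 1) \<partial>M)"
    by (rule mult_left_mono[OF le]) simp
  finally show ?thesis by (simp add: F_def)
qed

section \<open>Square functions and averages over tents\<close>

text \<open>
  The square of the square function in the norm of \<^const>\<open>Lp2\<close>; the range \<open>0 < r < 1\<close> is encoded in \<^const>\<open>rd\<close>.
\<close>
definition energy :: "(complex^'n \<Rightarrow> complex) \<Rightarrow> complex^'n \<Rightarrow> ennreal" where
  "energy \<phi> \<zeta> = (\<integral>\<^sup>+r. ennreal ((norm (\<phi> (r *\<^sub>R \<zeta>)))\<^sup>2 * (rd CARD('n) r / (1 - r\<^sup>2))) \<partial>lborel)"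

text \<open>
  Normalized indicator, as a function of \<open>w\<close>, of the tent of aperture \<open>l\<close> over \<open>\<zeta>\<close>.
\<close>
definition kap :: "real \<Rightarrow> complex^'n \<Rightarrow> complex^'n \<Rightarrow> ennreal" where
  "kap l w \<zeta> = (if norm (1 - hdot \<zeta> w) < l * (1 - norm w) then ennreal ((l * (1 - norm w)) powr (- real CARD('n))) else 0)"

definition tentsum :: "real \<Rightarrow> (complex^'n \<Rightarrow> ennreal) \<Rightarrow> complex^'n \<Rightarrow> ennreal" where
  "tentsum l g \<zeta> = (\<integral>\<^sup>+w. g w * kap l w \<zeta> \<partial>nu)"

lemma energy_measurable [measurable]:
  assumes [measurable]: "\<phi> \<in> borel_measurable borel"
  shows "energy \<phi> \<in> borel_measurable borel"
  unfolding energy_def by measurable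

lemma kap_measurable [measurable (raw)]:
  assumes [measurable]: "f \<in> borel_measurable M" "g \<in> borel_measurable M"
  shows "(\<lambda>x. kap l (f x) (g x)) \<in> borel_measurable M"
  unfolding kap_def by measurable

lemma tentsum_measurable [measurable]:
  assumes [measurable]: "g \<in> borel_measurable borel"
  shows "tentsum l g \<in> borel_measurable borel"
  unfolding tentsum_def by measurable

text \<open>
  If \<open>2^j\<close> is the ratio of \<open>|1 - u|\<close> to \<open>1 - |w|\<close>, up to a factor two, then the term with \<open>k = j + 1\<close> alone dominates.
\<close>
lemma tent_kernel_dyadic:
  fixes w \<zeta> :: "complex^'n"
  assumes w: "norm w < 1" and z: "norm \<zeta> = 1"
  shows "ennreal ((1 - norm w) powr (3/2) * norm (1 - hdot \<zeta> w) powr (- (real CARD('n) + 3/2)))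
     \<le> ennreal (2 powr (real CARD('n) + 3/2)) * (\<Sum>k. ennreal (2 powr (- (3/2) * real k)) * kap (2 ^ k) w \<zeta>)"
proof -
  define n where "n = real CARD('n)"
  have n: "n > 0" by (simp add: n_def)
  define t where "t = 1 - norm w"
  define x where "x = norm (1 - hdot \<zeta> w) / t"
  have t: "t > 0" using w by (simp add: t_def)
  have "t \<le> norm (1 - hdot \<zeta> w)"
    using norm_one_minus_hdot_ge[of \<zeta> w] z by (simp add: t_def)
  then have x: "1 \<le> x" using t by (simp add: x_def)
  have D: "norm (1 - hdot \<zeta> w) = x * t" using t by (simp add: x_def)
  obtain j :: nat where j: "2 ^ j \<le> x" "x < 2 ^ Suc j"
  proof -
    obtain i :: nat where "x < 2 ^ i" using real_arch_pow[of 2 x] by auto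
    then obtain i where i: "x < 2 ^ i" "\<And>k. k < i \<Longrightarrow> \<not> x < 2 ^ k"
      using exists_least_iff[of "\<lambda>i. x < 2 ^ i"] by auto
    then have "i \<noteq> 0" using x by (intro notI) auto
    then show ?thesis using that[of "i - 1"] i by (metis Suc_diff_1 lessI not_gr_zero not_le)
  qed
  define k where "k = Suc j"
  have "t powr (3/2) * (x * t) powr (- (n + 3/2)) = t powr (- n) * x powr (- (n + 3/2))"
    using t x by (simp add: powr_mult powr_add[symmetric] mult_ac)
  also have "\<dots> \<le> t powr (- n) * (2 ^ j) powr (- (n + 3/2))"
    using j n by (intro mult_left_mono powr_mono2') auto
  also have "\<dots> = 2 powr (n + 3/2) * (2 powr (- (3/2) * real k) * (2 ^ k * t) powr (- n))"
  proof -
    have "(2 ^ j :: real) powr (- (n + 3/2)) = 2 powr (- (n + 3/2) * real j)"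
      by (simp add: powr_realpow[symmetric] powr_powr mult.commute)
    also have "\<dots> = 2 powr (n + 3/2) * (2 powr (- (3/2) * real k) * 2 powr (- n * real k))"
      by (simp add: powr_add[symmetric] k_def algebra_simps add_divide_distrib)
    also have "2 powr (- n * real k) = (2 ^ k :: real) powr (- n)"
      by (simp add: powr_realpow[symmetric] powr_powr mult.commute)
    finally show ?thesis using t by (simp add: powr_mult mult_ac)
  qed
  finally have le: "ennreal (t powr (3/2) * (x * t) powr (- (n + 3/2))) \<le> ennreal (2 powr (n + 3/2)) * (ennreal (2 powr (- (3/2) * real k)) * ennreal ((2 ^ k * t) powr (- n)))"
    by (simp add: ennreal_mult[symmetric] ennreal_leI)
  also have "ennreal ((2 ^ k * t) powr (- n)) = kap (2 ^ k) w \<zeta>"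
    using j t by (simp add: kap_def D t_def[symmetric] n_def k_def)
  also have "ennreal (2 powr (- (3/2) * real k)) * kap (2 ^ k) w \<zeta> \<le> (\<Sum>k. ennreal (2 powr (- (3/2) * real k)) * kap (2 ^ k) w \<zeta>)"
    using sum_le_suminf[of "\<lambda>k. ennreal (2 powr (- (3/2) * real k)) * kap (2 ^ k) w \<zeta>" "{k}"] by simp
  finally show ?thesis by (simp add: D t_def n_def mult_left_mono)
qed

text \<open>
  The Schur test leaves the radial integral of \<open>(1 - r) powr (-1/2)\<close> times the kernel at \<open>r \<zeta>\<close>, which is
  of the size of the kernel at \<open>\<zeta>\<close> with exponent \<open>n + 3/2\<close>; this kernel is then cut into dyadic tents.
\<close>
lemma energy_le_tentsums:
  "\<exists>C>0. \<forall>(\<phi> :: complex^'n \<Rightarrow> complex) \<psi> \<zeta>. \<phi> \<in> borel_measurable borel \<longrightarrow>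
     (\<forall>z. norm z < 1 \<longrightarrow> ennreal (norm (\<psi> z)) \<le> ennreal (2 * (1 - (norm z)\<^sup>2)) * (\<integral>\<^sup>+w. ennreal (norm (\<phi> w) * kern z w) \<partial>nu)) \<longrightarrow>
     norm \<zeta> = 1 \<longrightarrow>
     energy \<psi> \<zeta> \<le> ennreal C * (\<Sum>k. ennreal (2 powr (- (3/2) * real k)) * tentsum (2 ^ k) (\<lambda>w. ennreal ((norm (\<phi> w))\<^sup>2 / (1 - norm w))) \<zeta>)"
proof -
  define n where "n = real CARD('n)"
  have n: "n \<ge> 1" by (simp add: n_def Suc_le_eq)
  obtain C where C: "C > 0" and CS: "\<And>(z :: complex^'n) (\<phi> :: complex^'n \<Rightarrow> complex). norm z < 1 \<Longrightarrow> \<phi> \<in> borel_measurable borel \<Longrightarrow>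
     (\<integral>\<^sup>+w. ennreal (norm (\<phi> w) * kern z w) \<partial>nu)\<^sup>2 \<le>
     ennreal (C * (1 - norm z) powr (- (3/2))) * (\<integral>\<^sup>+w. ennreal ((norm (\<phi> w))\<^sup>2 * (1 - norm w) powr (1/2) * kern z w) \<partial>nu)"
    using schur_pointwise[where 'n='n] by blast
  define K1 where "K1 = 16 * n * C"
  define K2 where "K2 = K1 * 2 powr (n + 2) * 3"
  define K3 where "K3 = K2 * 2 powr (n + 3/2)"
  have K: "K1 > 0" "K2 > 0" "K3 > 0" using C n by (auto simp: K1_def K2_def K3_def)
  have "energy \<psi> \<zeta> \<le> ennreal K3 * (\<Sum>k. ennreal (2 powr (- (3/2) * real k)) * tentsum (2 ^ k) (\<lambda>w. ennreal ((norm (\<phi> w))\<^sup>2 / (1 - norm w))) \<zeta>)"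
    if [measurable]: "\<phi> \<in> borel_measurable borel"
      and \<psi>: "\<And>z. norm z < 1 \<Longrightarrow> ennreal (norm (\<psi> z)) \<le> ennreal (2 * (1 - (norm z)\<^sup>2)) * (\<integral>\<^sup>+w. ennreal (norm (\<phi> w) * kern z w) \<partial>nu)"
      and z: "norm \<zeta> = 1" for \<phi> \<psi> :: "complex^'n \<Rightarrow> complex" and \<zeta> :: "complex^'n"
  proof -
    define I where "I r = (\<integral>\<^sup>+w. ennreal ((norm (\<phi> w))\<^sup>2 * (1 - norm w) powr (1/2) * kern (r *\<^sub>R \<zeta>) w) \<partial>nu)" for r
    define D where "D w = norm (1 - hdot \<zeta> w)" for w
    have "energy \<psi> \<zeta> \<le> (\<integral>\<^sup>+r. ennreal (K1 * (1 - r) powr (- (1/2))) * indicator {0<..<1} r * I r \<partial>lborel)"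
      unfolding energy_def
    proof (rule nn_integral_mono)
      fix r :: real
      show "ennreal ((norm (\<psi> (r *\<^sub>R \<zeta>)))\<^sup>2 * (rd CARD('n) r / (1 - r\<^sup>2))) \<le> ennreal (K1 * (1 - r) powr (- (1/2))) * indicator {0<..<1} r * I r"
      proof (cases "0 < r \<and> r < 1")
        case False
        then show ?thesis by (auto simp: rd_def)
      next
        case r: True
        have nz: "norm (r *\<^sub>R \<zeta>) = r" using r z by simp
        have r2: "0 < 1 - r\<^sup>2" "1 - r\<^sup>2 \<le> 2 * (1 - r)"
        proof -
          have "1 - r\<^sup>2 = (1 - r) * (1 + r)" by (simp add: power2_eq_square algebra_simps)
          moreover have "(1 - r) * (1 + r) \<le> (1 - r) * 2" using r by (intro mult_left_mono) auto
          moreover have "(1 - r) * (1 + r) > 0" using r by simp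
          ultimately show "0 < 1 - r\<^sup>2" "1 - r\<^sup>2 \<le> 2 * (1 - r)" by auto
        qed
        have rd: "rd CARD('n) r \<le> 2 * n" using r by (auto simp: rd_def n_def intro!: mult_left_le power_le_one)
        have "ennreal ((norm (\<psi> (r *\<^sub>R \<zeta>)))\<^sup>2) = (ennreal (norm (\<psi> (r *\<^sub>R \<zeta>))))\<^sup>2"
          by (simp add: ennreal_power)
        also have "\<dots> \<le> (ennreal (2 * (1 - r\<^sup>2)) * (\<integral>\<^sup>+w. ennreal (norm (\<phi> w) * kern (r *\<^sub>R \<zeta>) w) \<partial>nu))\<^sup>2"
          using \<psi>[of "r *\<^sub>R \<zeta>"] r nz by (intro power_mono) auto
        also have "\<dots> = ennreal ((2 * (1 - r\<^sup>2))\<^sup>2) * (\<integral>\<^sup>+w. ennreal (norm (\<phi> w) * kern (r *\<^sub>R \<zeta>) w) \<partial>nu)\<^sup>2"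
          using r2 by (simp add: power_mult_distrib ennreal_power)
        also have "\<dots> \<le> ennreal ((2 * (1 - r\<^sup>2))\<^sup>2) * (ennreal (C * (1 - r) powr (- (3/2))) * I r)"
          using CS[of "r *\<^sub>R \<zeta>" \<phi>] r nz by (intro mult_left_mono) (auto simp: I_def)
        finally have "ennreal ((norm (\<psi> (r *\<^sub>R \<zeta>)))\<^sup>2) * ennreal (rd CARD('n) r / (1 - r\<^sup>2))
           \<le> ennreal ((2 * (1 - r\<^sup>2))\<^sup>2) * (ennreal (C * (1 - r) powr (- (3/2))) * I r) * ennreal (rd CARD('n) r / (1 - r\<^sup>2))"
          by (rule mult_right_mono) simp
        also have "\<dots> = ennreal ((2 * (1 - r\<^sup>2))\<^sup>2 * (C * (1 - r) powr (- (3/2))) * (rd CARD('n) r / (1 - r\<^sup>2))) * I r"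
          by (rule ennreal_mult3) (use C r2 in auto)
        also have "\<dots> \<le> ennreal (K1 * (1 - r) powr (- (1/2))) * I r"
        proof (rule mult_right_mono[OF ennreal_leI])
          have "(2 * (1 - r\<^sup>2))\<^sup>2 * (C * (1 - r) powr (- (3/2))) * (rd CARD('n) r / (1 - r\<^sup>2))
              = 4 * C * (1 - r) powr (- (3/2)) * ((1 - r\<^sup>2) * rd CARD('n) r)"
          proof -
            have "(2 * x)\<^sup>2 * (C * p) * (R / x) = 4 * C * p * (x * R)" if "x > 0" for x p R :: real
              using that by (simp add: power2_eq_square)
            then show ?thesis using r2(1) by blast
          qed
          also have "\<dots> \<le> 4 * C * (1 - r) powr (- (3/2)) * ((2 * (1 - r)) * (2 * n))"
            using r2 rd C n by (intro mult_left_mono mult_mono) auto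
          also have "\<dots> = K1 * ((1 - r) powr (- (3/2)) * (1 - r) powr 1)"
            using r by (simp add: K1_def)
          also have "(1 - r) powr (- (3/2)) * (1 - r) powr 1 = (1 - r) powr (- (1/2))"
            unfolding powr_add[symmetric] by simp
          finally show "(2 * (1 - r\<^sup>2))\<^sup>2 * (C * (1 - r) powr (- (3/2))) * (rd CARD('n) r / (1 - r\<^sup>2)) \<le> K1 * (1 - r) powr (- (1/2))" .
        qed simp
        finally have "ennreal ((norm (\<psi> (r *\<^sub>R \<zeta>)))\<^sup>2) * ennreal (rd CARD('n) r / (1 - r\<^sup>2)) \<le> ennreal (K1 * (1 - r) powr (- (1/2))) * I r" .
        moreover have "ennreal ((norm (\<psi> (r *\<^sub>R \<zeta>)))\<^sup>2 * (rd CARD('n) r / (1 - r\<^sup>2)))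
            = ennreal ((norm (\<psi> (r *\<^sub>R \<zeta>)))\<^sup>2) * ennreal (rd CARD('n) r / (1 - r\<^sup>2))"
          using r2 by (intro ennreal_mult) auto
        ultimately show ?thesis using r by simp
      qed
    qed
    also have "\<dots> = (\<integral>\<^sup>+r. (\<integral>\<^sup>+w. ennreal (K1 * (1 - r) powr (- (1/2))) * indicator {0<..<1} r *
         ennreal ((norm (\<phi> w))\<^sup>2 * (1 - norm w) powr (1/2) * kern (r *\<^sub>R \<zeta>) w) \<partial>nu) \<partial>lborel)"
      unfolding I_def by (intro nn_integral_cong nn_integral_cmult[symmetric]) measurable
    also have "\<dots> = (\<integral>\<^sup>+w. (\<integral>\<^sup>+r. ennreal (K1 * (1 - r) powr (- (1/2))) * indicator {0<..<1} r *
         ennreal ((norm (\<phi> w))\<^sup>2 * (1 - norm w) powr (1/2) * kern (r *\<^sub>R \<zeta>) w) \<partial>lborel) \<partial>nu)"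
      by (rule lborel_nu.Fubini'[symmetric]) measurable
    also have "\<dots> \<le> (\<integral>\<^sup>+w. ennreal K3 * (\<Sum>k. ennreal (2 powr (- (3/2) * real k)) * (ennreal ((norm (\<phi> w))\<^sup>2 / (1 - norm w)) * kap (2 ^ k) w \<zeta>)) \<partial>nu)"
    proof (rule nn_integral_nu_mono)
      fix w :: "complex^'n" assume w: "norm w < 1 \<and> w \<noteq> 0"
      define P where "P = (norm (\<phi> w))\<^sup>2 * (1 - norm w) powr (1/2)"
      have P: "P \<ge> 0" by (simp add: P_def)
      have u: "norm (hdot \<zeta> w) \<le> 1" using hdot_cauchy_schwarz[of \<zeta> w] w z by simp
      have "1 - norm w \<le> D w" using norm_one_minus_hdot_ge[of \<zeta> w] z by (simp add: D_def)
      then have D0: "D w > 0" using w by linarith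
      have "(\<integral>\<^sup>+r. ennreal (K1 * (1 - r) powr (- (1/2))) * indicator {0<..<1} r * ennreal (P * kern (r *\<^sub>R \<zeta>) w) \<partial>lborel)
        \<le> (\<integral>\<^sup>+r. ennreal (K1 * P * 2 powr (n + 2)) * (ennreal ((1 - r) powr (- (1/2)) * max (1 - r) (D w) powr (- (n + 2))) * indicator {0<..<1} r) \<partial>lborel)"
      proof (rule nn_integral_mono)
        fix r :: real
        show "ennreal (K1 * (1 - r) powr (- (1/2))) * indicator {0<..<1} r * ennreal (P * kern (r *\<^sub>R \<zeta>) w)
          \<le> ennreal (K1 * P * 2 powr (n + 2)) * (ennreal ((1 - r) powr (- (1/2)) * max (1 - r) (D w) powr (- (n + 2))) * indicator {0<..<1} r)"
        proof (cases "0 < r \<and> r < 1")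
          case True
          have "max (1 - r) (D w) / 2 \<le> norm (1 - hdot (r *\<^sub>R \<zeta>) w)"
            using norm_one_minus_shrink[OF u, of r] True by (auto simp: D_def hdot_scaleR_left)
          then have "kern (r *\<^sub>R \<zeta>) w \<le> (max (1 - r) (D w) / 2) powr (- (n + 2))"
            using True n unfolding n_def by (intro powr_mono2') (auto simp: less_max_iff_disj)
          also have "\<dots> = 2 powr (n + 2) * max (1 - r) (D w) powr (- (n + 2))"
            using True by (simp only: powr_divide powr_minus) (simp add: field_simps)
          finally have kle: "kern (r *\<^sub>R \<zeta>) w \<le> 2 powr (n + 2) * max (1 - r) (D w) powr (- (n + 2))" .
          have "(K1 * (1 - r) powr (- (1/2))) * (P * kern (r *\<^sub>R \<zeta>) w) \<le> (K1 * (1 - r) powr (- (1/2))) * (P * (2 powr (n + 2) * max (1 - r) (D w) powr (- (n + 2))))"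
            using K P kle by (intro mult_left_mono) auto
          then show ?thesis using True K P by (simp add: ennreal_mult[symmetric] mult_ac ennreal_leI)
        qed auto
      qed
      also have "\<dots> = ennreal (K1 * P * 2 powr (n + 2)) * (\<integral>\<^sup>+r. ennreal ((1 - r) powr (- (1/2)) * max (1 - r) (D w) powr (- (n + 2))) * indicator {0<..<1} r \<partial>lborel)"
        by (rule nn_integral_cmult) measurable
      also have "\<dots> \<le> ennreal (K1 * P * 2 powr (n + 2)) * ennreal ((1 / (- (1/2) + 1) + 1 / (n + 2 - (- (1/2)) - 1)) * D w powr (- (1/2) + 1 - (n + 2)))"
        using n D0 by (intro mult_left_mono nn_integral_radial_kernel) auto
      also have "\<dots> \<le> ennreal (K1 * P * 2 powr (n + 2)) * ennreal (3 * D w powr (- (n + 3/2)))"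
      proof (intro mult_left_mono ennreal_leI)
        have "1 / (n + 2 - (- (1/2)) - 1) \<le> 1" using n by (simp add: field_simps)
        then have "(1 / (- (1/2) + 1) + 1 / (n + 2 - (- (1/2)) - 1)) * D w powr (- (1/2) + 1 - (n + 2)) \<le> 3 * D w powr (- (1/2) + 1 - (n + 2))"
          by (intro mult_right_mono) auto
        moreover have "- (1/2) + 1 - (n + 2) = - (n + 3/2)" by simp
        ultimately show "(1 / (- (1/2) + 1) + 1 / (n + 2 - (- (1/2)) - 1)) * D w powr (- (1/2) + 1 - (n + 2)) \<le> 3 * D w powr (- (n + 3/2))" by (simp only:)
      qed simp
      also have "\<dots> = ennreal (K2 * P * D w powr (- (n + 3/2)))"
        using K P by (simp add: K2_def ennreal_mult[symmetric] mult_ac)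
      also have "K2 * P * D w powr (- (n + 3/2)) = K2 * ((norm (\<phi> w))\<^sup>2 / (1 - norm w)) * ((1 - norm w) powr (3/2) * D w powr (- (n + 3/2)))"
      proof -
        have "(1 - norm w) powr (3/2) = (1 - norm w) powr (1/2) * (1 - norm w) powr 1"
          unfolding powr_add[symmetric] by simp
        then show ?thesis using w by (simp add: P_def)
      qed
      also have "ennreal \<dots> = ennreal K2 * ennreal ((norm (\<phi> w))\<^sup>2 / (1 - norm w)) * ennreal ((1 - norm w) powr (3/2) * D w powr (- (n + 3/2)))"
        by (rule ennreal_mult_triple) (use K w in auto)
      also have "\<dots> \<le> ennreal K2 * ennreal ((norm (\<phi> w))\<^sup>2 / (1 - norm w)) * (ennreal (2 powr (n + 3/2)) * (\<Sum>k. ennreal (2 powr (- (3/2) * real k)) * kap (2 ^ k) w \<zeta>))"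
        unfolding D_def n_def using w z by (intro mult_left_mono tent_kernel_dyadic) auto
      also have "\<dots> = ennreal K3 * (ennreal ((norm (\<phi> w))\<^sup>2 / (1 - norm w)) * (\<Sum>k. ennreal (2 powr (- (3/2) * real k)) * kap (2 ^ k) w \<zeta>))"
        using K by (simp add: K3_def ennreal_mult mult_ac)
      also have "ennreal ((norm (\<phi> w))\<^sup>2 / (1 - norm w)) * (\<Sum>k. ennreal (2 powr (- (3/2) * real k)) * kap (2 ^ k) w \<zeta>)
         = (\<Sum>k. ennreal (2 powr (- (3/2) * real k)) * (ennreal ((norm (\<phi> w))\<^sup>2 / (1 - norm w)) * kap (2 ^ k) w \<zeta>))"
        by (subst ennreal_suminf_cmult[symmetric]) (simp add: mult_ac)
      finally show "(\<integral>\<^sup>+r. ennreal (K1 * (1 - r) powr (- (1/2))) * indicator {0<..<1} r *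
         ennreal ((norm (\<phi> w))\<^sup>2 * (1 - norm w) powr (1/2) * kern (r *\<^sub>R \<zeta>) w) \<partial>lborel)
         \<le> ennreal K3 * (\<Sum>k. ennreal (2 powr (- (3/2) * real k)) * (ennreal ((norm (\<phi> w))\<^sup>2 / (1 - norm w)) * kap (2 ^ k) w \<zeta>))"
        by (simp only: P_def)
    qed
    also have "\<dots> = ennreal K3 * (\<Sum>k. ennreal (2 powr (- (3/2) * real k)) * tentsum (2 ^ k) (\<lambda>w. ennreal ((norm (\<phi> w))\<^sup>2 / (1 - norm w))) \<zeta>)"
      unfolding tentsum_def
      by (subst nn_integral_cmult, measurable) (simp add: nn_integral_suminf nn_integral_cmult)
    finally show ?thesis .
  qed
  then show ?thesis using K(3) by blast
qed

section \<open>The weighted inequality for averages over tents\<close>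

definition radint :: "(complex^'n \<Rightarrow> ennreal) \<Rightarrow> complex^'n \<Rightarrow> ennreal" where
  "radint g \<eta> = (\<integral>\<^sup>+r. g (r *\<^sub>R \<eta>) * ennreal (rd CARD('n) r) \<partial>lborel)"

lemma radint_measurable [measurable]:
  assumes [measurable]: "g \<in> borel_measurable borel"
  shows "radint g \<in> borel_measurable borel"
  unfolding radint_def by measurable

text \<open>
  Polar coordinates in the form in which the factor \<open>f\<close> does not see the radius.
\<close>
lemma polar_sgn:
  fixes g f :: "complex^'n \<Rightarrow> ennreal"
  assumes [measurable]: "g \<in> borel_measurable borel" "f \<in> borel_measurable borel"
  shows "(\<integral>\<^sup>+w. g w * f (sgn w) \<partial>nu) = (\<integral>\<^sup>+\<eta>. radint g \<eta> * f \<eta> \<partial>sig)"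
proof -
  have "(\<integral>\<^sup>+w. g w * f (sgn w) \<partial>nu)
      = (\<integral>\<^sup>+\<eta>. (\<integral>\<^sup>+r. g (r *\<^sub>R \<eta>) * f (sgn (r *\<^sub>R \<eta>)) * ennreal (rd CARD('n) r) \<partial>lborel) \<partial>sig)"
    by (rule polar) measurable
  also have "\<dots> = (\<integral>\<^sup>+\<eta>. radint g \<eta> * f \<eta> \<partial>sig)"
  proof (rule nn_integral_sig_cong)
    fix \<eta> :: "complex^'n" assume e: "norm \<eta> = 1"
    have "(\<integral>\<^sup>+r. g (r *\<^sub>R \<eta>) * f (sgn (r *\<^sub>R \<eta>)) * ennreal (rd CARD('n) r) \<partial>lborel)
        = (\<integral>\<^sup>+r. g (r *\<^sub>R \<eta>) * ennreal (rd CARD('n) r) * f \<eta> \<partial>lborel)"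
      by (rule nn_integral_cong) (use e in \<open>auto simp: rd_def sgn_scaleR_unit mult_ac\<close>)
    also have "\<dots> = radint g \<eta> * f \<eta>"
      unfolding radint_def by (rule nn_integral_multc) measurable
    finally show "(\<integral>\<^sup>+r. g (r *\<^sub>R \<eta>) * f (sgn (r *\<^sub>R \<eta>)) * ennreal (rd CARD('n) r) \<partial>lborel) = radint g \<eta> * f \<eta>" .
  qed
  finally show ?thesis .
qed

text \<open>
  The \<open>A1\<close> condition for balls centred at the point itself. The measure of a ball is replaced by \<open>r^n\<close>, so that
  no division occurs.
\<close>
definition A1_bound :: "(complex^'n \<Rightarrow> real) \<Rightarrow> real \<Rightarrow> bool" where
  "A1_bound \<omega> A \<longleftrightarrow> (AE \<eta> in sig. \<forall>r>0.
     (\<integral>\<^sup>+\<zeta>. ennreal (\<omega> \<zeta>) * (if norm (1 - hdot \<eta> \<zeta>) < r then 1 else 0) \<partial>sig) \<le> ennreal (A * r ^ CARD('n)) * ennreal (\<omega> \<eta>))"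

lemma tent_near:
  fixes \<zeta> w v :: "complex^'n"
  assumes z: "norm \<zeta> = 1" and w: "norm w < 1" "w \<noteq> 0" and v: "norm v < 1" and l: "1 \<le> l"
    and kw: "norm (1 - hdot \<zeta> w) < l * (1 - norm w)" and kv: "norm (1 - hdot \<zeta> v) < l * (1 - norm v)"
    and le: "norm v \<le> norm w"
  shows "norm (1 - hdot (sgn w) v) < 6 * l * (1 - norm v)"
proof -
  have s: "norm (sgn w) = 1" using w by (simp add: norm_sgn)
  have "w = norm w *\<^sub>R sgn w" using w by (simp add: sgn_div_norm)
  then have "norm (1 - hdot \<zeta> (sgn w)) \<le> 2 * norm (1 - hdot \<zeta> w)"
    using hdot_shrink_le(1)[OF z s, of "norm w"] w by simp
  then have 1: "norm (1 - hdot (sgn w) \<zeta>) < 2 * (l * (1 - norm w))"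
    using kw by (simp add: norm_one_minus_hdot_commute[of "sgn w"])
  have 2: "l * (1 - norm w) \<le> l * (1 - norm v)" using le l by (intro mult_left_mono) auto
  have "norm (1 - hdot (sgn w) v) \<le> 2 * (norm (1 - hdot (sgn w) \<zeta>) + norm (1 - hdot \<zeta> v))"
    by (rule norm_one_minus_hdot_triangle) (use s v z in auto)
  also have "\<dots> < 6 * (l * (1 - norm v))" using 1 2 kv by argo
  finally show ?thesis by (simp only: mult.assoc)
qed

text \<open>
  Apply \<open>median_power\<close> to the average, with the points ordered by height, and enlarge the part of the tent above \<open>w\<close> to the tent of
  aperture \<open>6 l\<close> over \<open>w / |w|\<close> by \<open>tent_near\<close>. What still depends on \<open>\<zeta>\<close> is the weight, integrated
  over a ball of radius \<open>2 l (1 - |w|)\<close> around \<open>w / |w|\<close>.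
\<close>
lemma tentsum_power_le:
  fixes g :: "complex^'n \<Rightarrow> ennreal" and \<omega> :: "complex^'n \<Rightarrow> real"
  assumes [measurable]: "g \<in> borel_measurable borel" "\<omega> \<in> borel_measurable borel"
    and q: "1 < q" and l: "1 \<le> l" and fin: "\<And>\<zeta>. norm \<zeta> = 1 \<Longrightarrow> tentsum l g \<zeta> < \<infinity>"
    and A: "A1_bound \<omega> A" "0 \<le> A"
  shows "(\<integral>\<^sup>+\<zeta>. epowr (tentsum l g \<zeta>) q * ennreal (\<omega> \<zeta>) \<partial>sig)
     \<le> ennreal (2 powr q * 6 powr (real CARD('n) * (q - 1)) * 2 ^ CARD('n) * A)
       * (\<integral>\<^sup>+\<eta>. radint g \<eta> * (epowr (tentsum (6 * l) g \<eta>) (q - 1) * ennreal (\<omega> \<eta>)) \<partial>sig)"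
proof -
  define n where "n = real CARD('n)"
  \<comment> \<open>The function \<open>exp (- |w|)\<close> serves as height, since \<open>median_power\<close> asks for a nonnegative one.\<close>
  define F where "F \<zeta> w = (\<integral>\<^sup>+v. g v * kap l v \<zeta> * (if exp (- norm w) \<le> exp (- norm v) then 1 else 0) \<partial>nu)" for \<zeta> w :: "complex^'n"
  define Q where "Q = 6 powr (n * (q - 1))"
  define G where "G \<eta> = epowr (tentsum (6 * l) g \<eta>) (q - 1)" for \<eta>
  have [measurable]: "G \<in> borel_measurable borel" unfolding G_def by measurable
  have kap_le: "kap l v \<zeta> * (if norm v \<le> norm w then 1 else 0) \<le> ennreal (6 powr n) * kap (6 * l) v (sgn w)"
    if "norm \<zeta> = 1" "norm w < 1" "w \<noteq> 0" "kap l w \<zeta> \<noteq> 0" "norm v < 1" for \<zeta> w v :: "complex^'n"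
  proof (cases "norm (1 - hdot \<zeta> v) < l * (1 - norm v) \<and> norm v \<le> norm w")
    case True
    have "norm (1 - hdot \<zeta> w) < l * (1 - norm w)" using that(4) by (auto simp: kap_def split: if_splits)
    then have "norm (1 - hdot (sgn w) v) < 6 * l * (1 - norm v)"
      using tent_near[of \<zeta> w v l] that True l by auto
    moreover have "(l * (1 - norm v)) powr (- n) = 6 powr n * (6 * l * (1 - norm v)) powr (- n)"
    proof -
      have "6 * l * (1 - norm v) = 6 * (l * (1 - norm v))" by simp
      then have "(6 * l * (1 - norm v)) powr (- n) = 6 powr (- n) * (l * (1 - norm v)) powr (- n)"
        using that l by (simp only: powr_mult)
      then show ?thesis by (simp add: powr_minus)
    qed
    ultimately show ?thesis using True by (simp add: kap_def n_def[symmetric] ennreal_mult[symmetric])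
  qed (auto simp: kap_def)
  have F_le: "kap l w \<zeta> * epowr (F \<zeta> w) (q - 1) \<le> kap l w \<zeta> * (ennreal Q * G (sgn w))"
    if z: "norm \<zeta> = 1" and w: "norm w < 1" "w \<noteq> 0" for \<zeta> w :: "complex^'n"
  proof (cases "kap l w \<zeta> = 0")
    case False
    have "F \<zeta> w \<le> (\<integral>\<^sup>+v. ennreal (6 powr n) * (g v * kap (6 * l) v (sgn w)) \<partial>nu)"
      unfolding F_def
    proof (rule nn_integral_nu_mono)
      fix v :: "complex^'n" assume v: "norm v < 1 \<and> v \<noteq> 0"
      have "g v * (kap l v \<zeta> * (if norm v \<le> norm w then 1 else 0)) \<le> g v * (ennreal (6 powr n) * kap (6 * l) v (sgn w))"
        by (rule mult_left_mono[OF kap_le]) (use z w False v in auto)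
      then show "g v * kap l v \<zeta> * (if exp (- norm w) \<le> exp (- norm v) then 1 else 0) \<le> ennreal (6 powr n) * (g v * kap (6 * l) v (sgn w))"
        by (simp add: mult_ac)
    qed
    also have "\<dots> = ennreal (6 powr n) * tentsum (6 * l) g (sgn w)"
      unfolding tentsum_def by (rule nn_integral_cmult) measurable
    finally have "epowr (F \<zeta> w) (q - 1) \<le> epowr (ennreal (6 powr n) * tentsum (6 * l) g (sgn w)) (q - 1)"
      using q by (intro epowr_mono) auto
    also have "\<dots> = ennreal Q * G (sgn w)"
      using q by (simp add: epowr_mult epowr_ennreal powr_powr Q_def G_def)
    finally show ?thesis by (rule mult_left_mono) simp
  qed simp
  have "(\<integral>\<^sup>+\<zeta>. epowr (tentsum l g \<zeta>) q * ennreal (\<omega> \<zeta>) \<partial>sig)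
     \<le> (\<integral>\<^sup>+\<zeta>. (\<integral>\<^sup>+w. ennreal (2 powr q * Q) * (g w * kap l w \<zeta> * G (sgn w)) * ennreal (\<omega> \<zeta>) \<partial>nu) \<partial>sig)"
  proof (rule nn_integral_sig_mono)
    fix \<zeta> :: "complex^'n" assume z: "norm \<zeta> = 1"
    have "epowr (tentsum l g \<zeta>) q \<le> ennreal (2 powr q) * (\<integral>\<^sup>+w. g w * kap l w \<zeta> * epowr (F \<zeta> w) (q - 1) \<partial>nu)"
      unfolding tentsum_def F_def
    proof (rule median_power)
      show "(\<integral>\<^sup>+w. g w * kap l w \<zeta> \<partial>nu) < \<infinity>" using fin[OF z] by (simp add: tentsum_def)
    qed (use q in \<open>auto intro: nu.sigma_finite_measure_axioms\<close>)
    also have "\<dots> \<le> ennreal (2 powr q) * (\<integral>\<^sup>+w. ennreal Q * (g w * kap l w \<zeta> * G (sgn w)) \<partial>nu)"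
    proof (rule mult_left_mono, rule nn_integral_mono_AE, rule AE_mp[OF AE_nu_in_ball], intro AE_I2 impI)
      fix w :: "complex^'n" assume w: "norm w < 1 \<and> w \<noteq> 0"
      have "g w * (kap l w \<zeta> * epowr (F \<zeta> w) (q - 1)) \<le> g w * (kap l w \<zeta> * (ennreal Q * G (sgn w)))"
        by (rule mult_left_mono[OF F_le]) (use z w in auto)
      then show "g w * kap l w \<zeta> * epowr (F \<zeta> w) (q - 1) \<le> ennreal Q * (g w * kap l w \<zeta> * G (sgn w))"
        by (simp add: mult_ac)
    qed simp
    also have "\<dots> = (\<integral>\<^sup>+w. ennreal (2 powr q) * (ennreal Q * (g w * kap l w \<zeta> * G (sgn w))) \<partial>nu)"
      by (rule nn_integral_cmult[symmetric]) measurable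
    finally have "epowr (tentsum l g \<zeta>) q * ennreal (\<omega> \<zeta>) \<le> (\<integral>\<^sup>+w. ennreal (2 powr q) * (ennreal Q * (g w * kap l w \<zeta> * G (sgn w))) \<partial>nu) * ennreal (\<omega> \<zeta>)"
      by (rule mult_right_mono) simp
    also have "\<dots> = (\<integral>\<^sup>+w. ennreal (2 powr q) * (ennreal Q * (g w * kap l w \<zeta> * G (sgn w))) * ennreal (\<omega> \<zeta>) \<partial>nu)"
      by (rule nn_integral_multc[symmetric]) measurable
    also have "\<dots> = (\<integral>\<^sup>+w. ennreal (2 powr q * Q) * (g w * kap l w \<zeta> * G (sgn w)) * ennreal (\<omega> \<zeta>) \<partial>nu)"
      by (simp add: ennreal_mult Q_def mult.assoc)
    finally show "epowr (tentsum l g \<zeta>) q * ennreal (\<omega> \<zeta>) \<le> (\<integral>\<^sup>+w. ennreal (2 powr q * Q) * (g w * kap l w \<zeta> * G (sgn w)) * ennreal (\<omega> \<zeta>) \<partial>nu)" .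
  qed
  also have "\<dots> = (\<integral>\<^sup>+w. (\<integral>\<^sup>+\<zeta>. ennreal (2 powr q * Q) * (g w * kap l w \<zeta> * G (sgn w)) * ennreal (\<omega> \<zeta>) \<partial>sig) \<partial>nu)"
    by (rule nu_sig.Fubini') measurable
  also have "\<dots> = (\<integral>\<^sup>+w. ennreal (2 powr q * Q) * (g w * G (sgn w)) * (\<integral>\<^sup>+\<zeta>. kap l w \<zeta> * ennreal (\<omega> \<zeta>) \<partial>sig) \<partial>nu)"
    by (rule nn_integral_cong, subst nn_integral_cmult[symmetric], measurable)
      (auto intro!: nn_integral_cong simp: mult_ac)
  also have "\<dots> \<le> (\<integral>\<^sup>+w. ennreal (2 powr q * Q) * (g w * G (sgn w)) * (ennreal (2 ^ CARD('n) * A) * ennreal (\<omega> (sgn w))) \<partial>nu)"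
  proof (rule nn_integral_mono_AE, rule AE_mp[OF AE_nu_in_ball], rule AE_mp[OF AE_sig_nu[OF A(1)[unfolded A1_bound_def]]], intro AE_I2 impI)
    fix w :: "complex^'n" assume w: "norm w < 1 \<and> w \<noteq> 0"
      and a: "\<forall>r>0. (\<integral>\<^sup>+\<zeta>. ennreal (\<omega> \<zeta>) * (if norm (1 - hdot (sgn w) \<zeta>) < r then 1 else 0) \<partial>sig) \<le> ennreal (A * r ^ CARD('n)) * ennreal (\<omega> (sgn w))"
    define t where "t = l * (1 - norm w)"
    have t: "t > 0" using w l by (simp add: t_def)
    have s: "norm (sgn w) = 1" using w by (simp add: norm_sgn)
    have wn: "w = norm w *\<^sub>R sgn w" using w by (simp add: sgn_div_norm)
    have "(\<integral>\<^sup>+\<zeta>. kap l w \<zeta> * ennreal (\<omega> \<zeta>) \<partial>sig)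
       \<le> (\<integral>\<^sup>+\<zeta>. ennreal (t powr (- n)) * (ennreal (\<omega> \<zeta>) * (if norm (1 - hdot (sgn w) \<zeta>) < 2 * t then 1 else 0)) \<partial>sig)"
    proof (rule nn_integral_sig_mono)
      fix \<zeta> :: "complex^'n" assume z: "norm \<zeta> = 1"
      have "norm (1 - hdot (sgn w) \<zeta>) \<le> 2 * norm (1 - hdot \<zeta> w)"
        using hdot_shrink_le(1)[OF z s, of "norm w"] wn w by (simp add: norm_one_minus_hdot_commute[of "sgn w"])
      then show "kap l w \<zeta> * ennreal (\<omega> \<zeta>) \<le> ennreal (t powr (- n)) * (ennreal (\<omega> \<zeta>) * (if norm (1 - hdot (sgn w) \<zeta>) < 2 * t then 1 else 0))"
        by (auto simp: kap_def t_def n_def)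
    qed
    also have "\<dots> = ennreal (t powr (- n)) * (\<integral>\<^sup>+\<zeta>. ennreal (\<omega> \<zeta>) * (if norm (1 - hdot (sgn w) \<zeta>) < 2 * t then 1 else 0) \<partial>sig)"
      by (rule nn_integral_cmult) measurable
    also have "\<dots> \<le> ennreal (t powr (- n)) * (ennreal (A * (2 * t) ^ CARD('n)) * ennreal (\<omega> (sgn w)))"
      using a[rule_format, of "2 * t"] t by (intro mult_left_mono) auto
    also have "\<dots> = ennreal (2 ^ CARD('n) * A) * ennreal (\<omega> (sgn w))"
    proof -
      have "t powr (- n) * t ^ CARD('n) = 1"
        using t by (simp add: n_def powr_minus powr_realpow)
      then have "t powr (- n) * (A * (2 * t) ^ CARD('n)) = 2 ^ CARD('n) * A"
        by (simp add: power_mult_distrib mult_ac)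
      moreover have "ennreal (t powr (- n)) * ennreal (A * (2 * t) ^ CARD('n)) = ennreal (t powr (- n) * (A * (2 * t) ^ CARD('n)))"
        using t A(2) by (intro ennreal_mult[symmetric]) auto
      ultimately show ?thesis by (simp only: mult.assoc[symmetric])
    qed
    finally show "ennreal (2 powr q * Q) * (g w * G (sgn w)) * (\<integral>\<^sup>+\<zeta>. kap l w \<zeta> * ennreal (\<omega> \<zeta>) \<partial>sig)
       \<le> ennreal (2 powr q * Q) * (g w * G (sgn w)) * (ennreal (2 ^ CARD('n) * A) * ennreal (\<omega> (sgn w)))"
      by (rule mult_left_mono) simp
  qed
  also have "\<dots> = (\<integral>\<^sup>+w. ennreal (2 powr q * Q * 2 ^ CARD('n) * A) * (g w * (\<lambda>\<eta>. G \<eta> * ennreal (\<omega> \<eta>)) (sgn w)) \<partial>nu)"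
    using A(2) by (simp add: ennreal_mult Q_def mult_ac)
  also have "\<dots> = ennreal (2 powr q * Q * 2 ^ CARD('n) * A) * (\<integral>\<^sup>+w. g w * (\<lambda>\<eta>. G \<eta> * ennreal (\<omega> \<eta>)) (sgn w) \<partial>nu)"
    by (rule nn_integral_cmult) measurable
  also have "(\<integral>\<^sup>+w. g w * (\<lambda>\<eta>. G \<eta> * ennreal (\<omega> \<eta>)) (sgn w) \<partial>nu) = (\<integral>\<^sup>+\<eta>. radint g \<eta> * (G \<eta> * ennreal (\<omega> \<eta>)) \<partial>sig)"
    by (rule polar_sgn) measurable
  finally show ?thesis by (simp add: G_def Q_def n_def)
qed

text \<open>
  For \<open>g\<close> bounded and supported away from the sphere the tent averages are bounded uniformly in the aperture, so the
  supremum \<open>S\<close> of their moments is finite and can be absorbed.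
\<close>
lemma tentsum_bounded_estimate:
  fixes g :: "complex^'n \<Rightarrow> ennreal" and \<omega> :: "complex^'n \<Rightarrow> real"
  assumes [measurable]: "g \<in> borel_measurable borel" "\<omega> \<in> borel_measurable borel"
    and q: "1 < q" and A: "A1_bound \<omega> A" "0 < A" and l: "1 \<le> l"
    and \<omega>: "(\<integral>\<^sup>+\<zeta>. ennreal (\<omega> \<zeta>) \<partial>sig) < \<infinity>"
    and \<rho>: "\<rho> < 1" and b: "0 \<le> b" and g: "\<And>w. g w \<le> ennreal b * (if norm w \<le> \<rho> then 1 else 0)"
  shows "(\<integral>\<^sup>+\<zeta>. epowr (tentsum l g \<zeta>) q * ennreal (\<omega> \<zeta>) \<partial>sig)
     \<le> ennreal (2 powr q * (2 powr q * 6 powr (real CARD('n) * (q - 1)) * 2 ^ CARD('n) * A) powr q)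
       * (\<integral>\<^sup>+\<eta>. epowr (radint g \<eta>) q * ennreal (\<omega> \<eta>) \<partial>sig)"
proof -
  define n where "n = real CARD('n)"
  define K where "K = 2 powr q * 6 powr (n * (q - 1)) * 2 ^ CARD('n) * A"
  have K: "K > 0" using A by (simp add: K_def)
  define a where "a l = (\<integral>\<^sup>+\<zeta>. epowr (tentsum l g \<zeta>) q * ennreal (\<omega> \<zeta>) \<partial>sig)" for l
  define X where "X = (\<integral>\<^sup>+\<eta>. epowr (radint g \<eta>) q * ennreal (\<omega> \<eta>) \<partial>sig)"
  define B where "B = b * (1 - \<rho>) powr (- n)"
  have B: "B \<ge> 0" using b by (simp add: B_def)
  have tb: "tentsum l g \<zeta> \<le> ennreal B" if l: "1 \<le> l" for l and \<zeta> :: "complex^'n"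
  proof -
    have "tentsum l g \<zeta> \<le> (\<integral>\<^sup>+w. ennreal B \<partial>(nu :: (complex^'n) measure))"
      unfolding tentsum_def
    proof (rule nn_integral_mono)
      fix w :: "complex^'n"
      show "g w * kap l w \<zeta> \<le> ennreal B"
      proof (cases "norm w \<le> \<rho>")
        case True
        have "1 - \<rho> \<le> 1 * (1 - norm w)" using True by simp
        also have "\<dots> \<le> l * (1 - norm w)" using l True \<rho> by (intro mult_right_mono) auto
        finally have "(l * (1 - norm w)) powr (- n) \<le> (1 - \<rho>) powr (- n)"
          using \<rho> by (intro powr_mono2') (auto simp: n_def)
        then have "kap l w \<zeta> \<le> ennreal ((1 - \<rho>) powr (- n))"
          by (auto simp: kap_def n_def intro!: ennreal_leI)
        then have "g w * kap l w \<zeta> \<le> ennreal b * ennreal ((1 - \<rho>) powr (- n))"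
          using g[of w] True by (intro mult_mono) auto
        then show ?thesis using b by (simp add: B_def ennreal_mult)
      next
        case False
        then have "g w = 0" using g[of w] by simp
        then show ?thesis by simp
      qed
    qed
    also have "\<dots> = ennreal B" by (simp add: nu.emeasure_space_1[simplified])
    finally show ?thesis .
  qed
  \<comment> \<open>Young's inequality with the coefficient one half for the term of aperture \<open>6 l\<close>.\<close>
  have step: "a l \<le> ennreal (2 powr (q - 1) * K powr q) * X + ennreal (1 / 2) * a (6 * l)" if l: "1 \<le> l" for l
  proof -
    have "a l \<le> ennreal K * (\<integral>\<^sup>+\<eta>. radint g \<eta> * (epowr (tentsum (6 * l) g \<eta>) (q - 1) * ennreal (\<omega> \<eta>)) \<partial>sig)"
      unfolding a_def K_def n_def
    proof (rule tentsum_power_le)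
      show "tentsum l g \<zeta> < \<infinity>" for \<zeta> using tb[OF l, of \<zeta>] by (auto simp: less_top[symmetric] top_unique)
    qed (use q l A in auto)
    also have "\<dots> = (\<integral>\<^sup>+\<eta>. ennreal K * (radint g \<eta> * (epowr (tentsum (6 * l) g \<eta>) (q - 1) * ennreal (\<omega> \<eta>))) \<partial>sig)"
      by (rule nn_integral_cmult[symmetric]) measurable
    also have "\<dots> \<le> (\<integral>\<^sup>+\<eta>. ennreal (2 powr (q - 1) * K powr q) * (epowr (radint g \<eta>) q * ennreal (\<omega> \<eta>))
         + ennreal (1 / 2) * (epowr (tentsum (6 * l) g \<eta>) q * ennreal (\<omega> \<eta>)) \<partial>sig)"
    proof (rule nn_integral_mono)
      fix \<eta> :: "complex^'n"
      have "(ennreal K * radint g \<eta>) * epowr (tentsum (6 * l) g \<eta>) (q - 1)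
         \<le> ennreal (2 powr (q - 1)) * epowr (ennreal K * radint g \<eta>) q + ennreal (1 / 2) * epowr (tentsum (6 * l) g \<eta>) q"
        by (rule epowr_young) (use q in auto)
      also have "epowr (ennreal K * radint g \<eta>) q = ennreal (K powr q) * epowr (radint g \<eta>) q"
        using q K by (simp add: epowr_mult epowr_ennreal)
      finally have "(ennreal K * radint g \<eta>) * epowr (tentsum (6 * l) g \<eta>) (q - 1) * ennreal (\<omega> \<eta>)
         \<le> (ennreal (2 powr (q - 1)) * (ennreal (K powr q) * epowr (radint g \<eta>) q) + ennreal (1 / 2) * epowr (tentsum (6 * l) g \<eta>) q) * ennreal (\<omega> \<eta>)"
        by (rule mult_right_mono) simp
      then show "ennreal K * (radint g \<eta> * (epowr (tentsum (6 * l) g \<eta>) (q - 1) * ennreal (\<omega> \<eta>)))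
        \<le> ennreal (2 powr (q - 1) * K powr q) * (epowr (radint g \<eta>) q * ennreal (\<omega> \<eta>))
         + ennreal (1 / 2) * (epowr (tentsum (6 * l) g \<eta>) q * ennreal (\<omega> \<eta>))"
        by (simp add: ennreal_mult distrib_right mult.assoc)
    qed
    also have "\<dots> = ennreal (2 powr (q - 1) * K powr q) * X + ennreal (1 / 2) * a (6 * l)"
      unfolding X_def a_def by (subst nn_integral_add, measurable) (simp add: nn_integral_cmult)
    finally show ?thesis .
  qed
  define S where "S = (SUP l\<in>{1..}. a l)"
  have "S \<le> ennreal (B powr q) * (\<integral>\<^sup>+\<zeta>. ennreal (\<omega> \<zeta>) \<partial>sig)"
    unfolding S_def
  proof (rule SUP_least)
    fix l :: real assume "l \<in> {1..}"
    then have "a l \<le> (\<integral>\<^sup>+\<zeta>. ennreal (B powr q) * ennreal (\<omega> \<zeta>) \<partial>sig)"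
      unfolding a_def using q B tb[of l] epowr_mono[of q _ "ennreal B"]
      by (intro nn_integral_mono mult_right_mono) (auto simp: epowr_ennreal)
    then show "a l \<le> ennreal (B powr q) * (\<integral>\<^sup>+\<zeta>. ennreal (\<omega> \<zeta>) \<partial>sig)"
      by (simp add: nn_integral_cmult)
  qed
  also have "\<dots> < \<infinity>" using \<omega> by (simp add: ennreal_mult_less_top)
  finally have Sfin: "S < \<infinity>" .
  have aS: "a l \<le> S" if "1 \<le> l" for l unfolding S_def using that by (intro SUP_upper) auto
  have "S \<le> ennreal (2 powr (q - 1) * K powr q) * X + ennreal (1 / 2) * S"
    unfolding S_def
  proof (rule SUP_least, unfold S_def[symmetric])
    fix l :: real assume l: "l \<in> {1..}"
    then have "a l \<le> ennreal (2 powr (q - 1) * K powr q) * X + ennreal (1 / 2) * a (6 * l)"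
      by (intro step) auto
    also have "\<dots> \<le> ennreal (2 powr (q - 1) * K powr q) * X + ennreal (1 / 2) * S"
      using l by (intro add_left_mono mult_left_mono aS) auto
    finally show "a l \<le> ennreal (2 powr (q - 1) * K powr q) * X + ennreal (1 / 2) * S" .
  qed
  then have "S \<le> ennreal 2 * (ennreal (2 powr (q - 1) * K powr q) * X)"
    by (rule ennreal_absorb_half[OF Sfin])
  also have "\<dots> = ennreal (2 powr q * K powr q) * X"
  proof -
    have "2 * (2 powr (q - 1) * K powr q) = 2 powr q * K powr q" by (simp add: powr_diff)
    moreover have "ennreal 2 * ennreal (2 powr (q - 1) * K powr q) = ennreal (2 * (2 powr (q - 1) * K powr q))"
      by (intro ennreal_mult[symmetric]) auto
    ultimately show ?thesis by (simp only: mult.assoc[symmetric])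
  qed
  finally have "a l \<le> ennreal (2 powr q * K powr q) * X" using aS[OF l] by simp
  then show ?thesis by (simp add: a_def X_def K_def n_def)
qed

text \<open>
  Monotone convergence removes the two restrictions on \<open>g\<close>.
\<close>
lemma tentsum_estimate:
  fixes g :: "complex^'n \<Rightarrow> ennreal" and \<omega> :: "complex^'n \<Rightarrow> real"
  assumes [measurable]: "g \<in> borel_measurable borel" "\<omega> \<in> borel_measurable borel"
    and q: "1 < q" and A: "A1_bound \<omega> A" "0 < A" and l: "1 \<le> l"
    and \<omega>: "(\<integral>\<^sup>+\<zeta>. ennreal (\<omega> \<zeta>) \<partial>sig) < \<infinity>"
  shows "(\<integral>\<^sup>+\<zeta>. epowr (tentsum l g \<zeta>) q * ennreal (\<omega> \<zeta>) \<partial>sig)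
     \<le> ennreal (2 powr q * (2 powr q * 6 powr (real CARD('n) * (q - 1)) * 2 ^ CARD('n) * A) powr q)
       * (\<integral>\<^sup>+\<eta>. epowr (radint g \<eta>) q * ennreal (\<omega> \<eta>) \<partial>sig)"
    (is "_ \<le> ?K * ?X")
proof -
  define h where "h i w = min (g w) (of_nat i) * (if norm w \<le> 1 - 1 / real (Suc i) then 1 else 0)" for i :: nat and w
  have [measurable]: "h i \<in> borel_measurable borel" for i unfolding h_def by measurable
  have h_le: "h i w \<le> g w" for i w by (simp add: h_def)
  have h_inc: "incseq (\<lambda>i. h i w)" for w
  proof (rule incseq_SucI)
    fix i
    have "1 / real (Suc (Suc i)) \<le> 1 / real (Suc i)" by (simp add: frac_le)
    moreover have "min (g w) (of_nat i) \<le> min (g w) (of_nat (Suc i))"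
      by (intro min.mono) (auto simp: of_nat_le_iff simp del: of_nat_Suc)
    ultimately show "h i w \<le> h (Suc i) w" by (auto simp: h_def)
  qed
  have h_sup: "(SUP i. h i w) = g w" if w: "norm w < 1" for w
  proof (rule antisym)
    show "(SUP i. h i w) \<le> g w" by (intro SUP_least h_le)
    obtain i0 where i0: "1 / real (Suc i0) < 1 - norm w"
      using nat_approx_posE[of "1 - norm w"] w by auto
    have ge: "h i w = min (g w) (of_nat i)" if "i0 \<le> i" for i
    proof -
      have "1 / real (Suc i) \<le> 1 / real (Suc i0)" using that by (simp add: frac_le)
      then show ?thesis using i0 by (simp add: h_def)
    qed
    show "g w \<le> (SUP i. h i w)"
    proof (cases "g w")
      case (real x)
      obtain j :: nat where j: "x \<le> real j" using real_arch_simple by blast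
      have "g w \<le> of_nat (max i0 j)" using j real
        by (metis ennreal_leI ennreal_of_nat_eq_real_of_nat max.cobounded2 of_nat_mono order_trans)
      then have "h (max i0 j) w = g w" by (subst ge) (auto simp: min_def)
      then show ?thesis by (metis SUP_upper UNIV_I)
    next
      case top
      have "of_nat i \<le> (SUP i. h i w)" for i
      proof -
        have "of_nat i \<le> (of_nat (max i0 i) :: ennreal)" by (rule of_nat_mono) simp
        also have "\<dots> = h (max i0 i) w" by (subst ge) (auto simp: top)
        also have "\<dots> \<le> (SUP i. h i w)" by (rule SUP_upper) simp
        finally show ?thesis .
      qed
      then have "(SUP i. of_nat i) \<le> (SUP i. h i w)" by (intro SUP_least)
      then show ?thesis by (simp add: ennreal_SUP_of_nat_eq_top top_unique top)
    qed
  qed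
  have tS: "tentsum l g \<zeta> = (SUP i. tentsum l (h i) \<zeta>)" for \<zeta>
  proof -
    have "tentsum l g \<zeta> = (\<integral>\<^sup>+w. (SUP i. h i w * kap l w \<zeta>) \<partial>nu)"
      unfolding tentsum_def
      by (rule nn_integral_nu_cong)
        (simp add: SUP_mult_right_ennreal[symmetric] h_sup)
    also have "\<dots> = (SUP i. \<integral>\<^sup>+w. h i w * kap l w \<zeta> \<partial>nu)"
      by (rule nn_integral_monotone_convergence_SUP)
        (use h_inc in \<open>auto simp: incseq_def le_fun_def intro!: mult_right_mono\<close>)
    finally show ?thesis by (simp add: tentsum_def)
  qed
  have t_inc: "tentsum l (h i) \<zeta> \<le> tentsum l (h j) \<zeta>" if "i \<le> j" for i j \<zeta>
    unfolding tentsum_def using h_inc that by (intro nn_integral_mono mult_right_mono) (auto simp: incseq_def)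
  have bd: "(\<integral>\<^sup>+\<zeta>. epowr (tentsum l (h i) \<zeta>) q * ennreal (\<omega> \<zeta>) \<partial>sig) \<le> ?K * ?X" for i
  proof -
    have "(\<integral>\<^sup>+\<zeta>. epowr (tentsum l (h i) \<zeta>) q * ennreal (\<omega> \<zeta>) \<partial>sig)
      \<le> ?K * (\<integral>\<^sup>+\<eta>. epowr (radint (h i) \<eta>) q * ennreal (\<omega> \<eta>) \<partial>sig)"
    proof (rule tentsum_bounded_estimate[where \<rho> = "1 - 1 / real (Suc i)" and b = "real i"])
      show "h i w \<le> ennreal (real i) * (if norm w \<le> 1 - 1 / real (Suc i) then 1 else 0)" for w
        by (simp add: h_def ennreal_of_nat_eq_real_of_nat)
    qed (use q A l \<omega> in auto)
    also have "\<dots> \<le> ?K * ?X"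
      using q h_le unfolding radint_def
      by (intro mult_left_mono nn_integral_mono mult_right_mono epowr_mono) auto
    finally show ?thesis .
  qed
  have "(\<integral>\<^sup>+\<zeta>. epowr (tentsum l g \<zeta>) q * ennreal (\<omega> \<zeta>) \<partial>sig)
     = (\<integral>\<^sup>+\<zeta>. (SUP i. epowr (tentsum l (h i) \<zeta>) q * ennreal (\<omega> \<zeta>)) \<partial>sig)"
    using q by (simp add: tS epowr_SUP SUP_mult_right_ennreal)
  also have "\<dots> = (SUP i. \<integral>\<^sup>+\<zeta>. epowr (tentsum l (h i) \<zeta>) q * ennreal (\<omega> \<zeta>) \<partial>sig)"
    by (rule nn_integral_monotone_convergence_SUP)
      (use t_inc q in \<open>auto simp: incseq_def le_fun_def intro!: mult_right_mono epowr_mono\<close>)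
  also have "\<dots> \<le> ?K * ?X" by (intro SUP_least bd)
  finally show ?thesis .
qed

section \<open>The upper bound for exponents larger than two\<close>

definition wenergy :: "real \<Rightarrow> (complex^'n \<Rightarrow> real) \<Rightarrow> (complex^'n \<Rightarrow> complex) \<Rightarrow> ennreal" where
  "wenergy p \<omega> \<phi> = (\<integral>\<^sup>+\<zeta>. epowr (energy \<phi> \<zeta>) (p / 2) * ennreal (\<omega> \<zeta>) \<partial>sig)"

lemma radint_le_energy:
  fixes \<phi> :: "complex^'n \<Rightarrow> complex"
  assumes [measurable]: "\<phi> \<in> borel_measurable borel" and z: "norm \<zeta> = 1"
  shows "radint (\<lambda>w. ennreal ((norm (\<phi> w))\<^sup>2 / (1 - norm w))) \<zeta> \<le> ennreal 2 * energy \<phi> \<zeta>"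
proof -
  have "radint (\<lambda>w. ennreal ((norm (\<phi> w))\<^sup>2 / (1 - norm w))) \<zeta>
     \<le> (\<integral>\<^sup>+r. ennreal 2 * ennreal ((norm (\<phi> (r *\<^sub>R \<zeta>)))\<^sup>2 * (rd CARD('n) r / (1 - r\<^sup>2))) \<partial>lborel)"
    unfolding radint_def
  proof (rule nn_integral_mono)
    fix r :: real
    show "ennreal ((norm (\<phi> (r *\<^sub>R \<zeta>)))\<^sup>2 / (1 - norm (r *\<^sub>R \<zeta>))) * ennreal (rd CARD('n) r)
       \<le> ennreal 2 * ennreal ((norm (\<phi> (r *\<^sub>R \<zeta>)))\<^sup>2 * (rd CARD('n) r / (1 - r\<^sup>2)))"
    proof (cases "0 < r \<and> r < 1")
      case True
      have r2: "1 - r\<^sup>2 = (1 - r) * (1 + r)" by (simp add: power2_eq_square algebra_simps)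
      have r2': "1 - r\<^sup>2 > 0" unfolding r2 using True by simp
      have "1 / (1 - r) \<le> 2 / (1 - r\<^sup>2)"
      proof -
        have "1 / (1 - r) = (1 + r) / ((1 - r) * (1 + r))" using True by simp
        also have "\<dots> \<le> 2 / ((1 - r) * (1 + r))" using True by (intro divide_right_mono) auto
        finally show ?thesis unfolding r2 .
      qed
      then have "((norm (\<phi> (r *\<^sub>R \<zeta>)))\<^sup>2 * rd CARD('n) r) * (1 / (1 - r)) \<le> ((norm (\<phi> (r *\<^sub>R \<zeta>)))\<^sup>2 * rd CARD('n) r) * (2 / (1 - r\<^sup>2))"
        by (rule mult_left_mono) simp
      then have "ennreal ((norm (\<phi> (r *\<^sub>R \<zeta>)))\<^sup>2 / (1 - r) * rd CARD('n) r) \<le> ennreal (2 * ((norm (\<phi> (r *\<^sub>R \<zeta>)))\<^sup>2 * (rd CARD('n) r / (1 - r\<^sup>2))))"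
        by (intro ennreal_leI) (simp add: mult_ac)
      moreover have "ennreal ((norm (\<phi> (r *\<^sub>R \<zeta>)))\<^sup>2 / (1 - r) * rd CARD('n) r) = ennreal ((norm (\<phi> (r *\<^sub>R \<zeta>)))\<^sup>2 / (1 - norm (r *\<^sub>R \<zeta>))) * ennreal (rd CARD('n) r)"
        using True z by (subst ennreal_mult) auto
      moreover have "ennreal (2 * ((norm (\<phi> (r *\<^sub>R \<zeta>)))\<^sup>2 * (rd CARD('n) r / (1 - r\<^sup>2)))) = ennreal 2 * ennreal ((norm (\<phi> (r *\<^sub>R \<zeta>)))\<^sup>2 * (rd CARD('n) r / (1 - r\<^sup>2)))"
        using r2' by (intro ennreal_mult) auto
      ultimately show ?thesis by (simp only:)
    qed (auto simp: rd_def)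
  qed
  also have "\<dots> = ennreal 2 * energy \<phi> \<zeta>"
    unfolding energy_def by (rule nn_integral_cmult) measurable
  finally show ?thesis .
qed

text \<open>
  The sum is at most the supremum of the \<open>a^k x k\<close> times a geometric series, and the power of a supremum is at most the sum of the powers.
\<close>
lemma suminf_power_le:
  fixes x :: "nat \<Rightarrow> ennreal" and a :: real
  assumes a: "0 < a" "a < 1" and q: "0 < q"
  shows "epowr (\<Sum>k. ennreal (a ^ k) * (ennreal (a ^ k) * x k)) q
     \<le> ennreal ((1 / (1 - a)) powr q) * (\<Sum>k. ennreal ((a powr q) ^ k) * epowr (x k) q)"
proof -
  define s where "s = (SUP k. ennreal (a ^ k) * x k)"
  have "(\<Sum>k. ennreal (a ^ k) * (ennreal (a ^ k) * x k)) \<le> (\<Sum>k. ennreal (a ^ k) * s)"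
    unfolding s_def by (intro suminf_le summableI mult_left_mono SUP_upper) auto
  also have "\<dots> = (\<Sum>k. ennreal (a ^ k)) * s"
    by (rule ennreal_suminf_multc)
  also have "(\<Sum>k. ennreal (a ^ k)) = ennreal (1 / (1 - a))"
    using a by (subst suminf_ennreal2) (auto simp: suminf_geometric summable_geometric)
  finally have "epowr (\<Sum>k. ennreal (a ^ k) * (ennreal (a ^ k) * x k)) q \<le> epowr (ennreal (1 / (1 - a)) * s) q"
    using q by (intro epowr_mono) auto
  also have "\<dots> = ennreal ((1 / (1 - a)) powr q) * epowr s q"
    using q a by (simp only: epowr_mult) (simp add: epowr_ennreal)
  also have "epowr s q = (SUP k. epowr (ennreal (a ^ k) * x k) q)"
    unfolding s_def using q by (rule epowr_SUP)
  also have "\<dots> = (SUP k. ennreal ((a powr q) ^ k) * epowr (x k) q)"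
  proof -
    have "(a ^ k) powr q = (a powr q) ^ k" for k
      using a by (simp add: powr_realpow[symmetric] powr_powr mult.commute)
    then show ?thesis using q a by (simp add: epowr_mult epowr_ennreal)
  qed
  also have "\<dots> \<le> (\<Sum>k. ennreal ((a powr q) ^ k) * epowr (x k) q)"
  proof (rule SUP_least)
    fix k
    show "ennreal ((a powr q) ^ k) * epowr (x k) q \<le> (\<Sum>k. ennreal ((a powr q) ^ k) * epowr (x k) q)"
      using sum_le_suminf[of "\<lambda>k. ennreal ((a powr q) ^ k) * epowr (x k) q" "{k}"] by simp
  qed
  finally show ?thesis by (simp add: mult_left_mono)
qed

text \<open>
  The moments of the tent averages are bounded independently of the aperture \<open>2^k\<close>, and the factors \<open>2 powr (-3k/2)\<close> sum.
\<close>
lemma dominated_upper: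
  fixes p :: real
  assumes p: "2 < p"
  shows "\<exists>C>0. \<forall>(\<omega> :: complex^'n \<Rightarrow> real) A (\<phi> :: complex^'n \<Rightarrow> complex) \<psi>.
     \<omega> \<in> borel_measurable borel \<longrightarrow> A1_bound \<omega> A \<longrightarrow> 0 < A \<longrightarrow> (\<integral>\<^sup>+\<zeta>. ennreal (\<omega> \<zeta>) \<partial>sig) < \<infinity> \<longrightarrow>
     \<phi> \<in> borel_measurable borel \<longrightarrow>
     (\<forall>z. norm z < 1 \<longrightarrow> ennreal (norm (\<psi> z)) \<le> ennreal (2 * (1 - (norm z)\<^sup>2)) * (\<integral>\<^sup>+w. ennreal (norm (\<phi> w) * kern z w) \<partial>nu)) \<longrightarrow>
     wenergy p \<omega> \<psi> \<le> ennreal (C * A powr (p / 2)) * wenergy p \<omega> \<phi>"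
proof -
  define q where "q = p / 2"
  have q: "1 < q" using p by (simp add: q_def)
  \<comment> \<open>The factor \<open>2 powr (-3k/2)\<close> is split evenly, as \<open>suminf_power_le\<close> requires.\<close>
  define a :: real where "a = 2 powr (- (3/4))"
  have a: "0 < a" "a < 1" by (auto simp: a_def powr_less_one)
  have aq: "0 < a powr q" "a powr q < 1" using a q powr_less_mono2[of q a 1] by auto
  have ak: "ennreal (2 powr (- (3/2) * real k)) = ennreal (a ^ k) * ennreal (a ^ k)" for k
  proof -
    have "a ^ k * a ^ k = 2 powr (- (3/2) * real k)"
      using a by (simp add: powr_realpow[symmetric] a_def powr_powr powr_add[symmetric])
    then show ?thesis using a by (simp add: ennreal_mult[symmetric])
  qed
  obtain C where C: "C > 0" and CE: "\<And>(\<phi> :: complex^'n \<Rightarrow> complex) \<psi> \<zeta>. \<phi> \<in> borel_measurable borel \<Longrightarrow>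
     (\<forall>z. norm z < 1 \<longrightarrow> ennreal (norm (\<psi> z)) \<le> ennreal (2 * (1 - (norm z)\<^sup>2)) * (\<integral>\<^sup>+w. ennreal (norm (\<phi> w) * kern z w) \<partial>nu)) \<Longrightarrow>
     norm \<zeta> = 1 \<Longrightarrow>
     energy \<psi> \<zeta> \<le> ennreal C * (\<Sum>k. ennreal (2 powr (- (3/2) * real k)) * tentsum (2 ^ k) (\<lambda>w. ennreal ((norm (\<phi> w))\<^sup>2 / (1 - norm w))) \<zeta>)"
    using energy_le_tentsums[where 'n='n] by blast
  define L where "L = 2 powr q * (2 powr q * 6 powr (real CARD('n) * (q - 1)) * 2 ^ CARD('n)) powr q"
  have L: "L > 0" by (simp add: L_def)
  define K where "K = C powr q * (1 / (1 - a)) powr q * (1 / (1 - a powr q) * (L * 2 powr q))"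
  have K: "K > 0" using C a aq L by (simp add: K_def)
  show ?thesis
  proof (intro exI[of _ K] conjI K allI impI)
    fix \<omega> :: "complex^'n \<Rightarrow> real" and A and \<phi> \<psi> :: "complex^'n \<Rightarrow> complex"
    assume [measurable]: "\<omega> \<in> borel_measurable borel" and A: "A1_bound \<omega> A" "0 < A"
      and \<omega>: "(\<integral>\<^sup>+\<zeta>. ennreal (\<omega> \<zeta>) \<partial>sig) < \<infinity>" and [measurable]: "\<phi> \<in> borel_measurable borel"
      and \<psi>: "\<forall>z. norm z < 1 \<longrightarrow> ennreal (norm (\<psi> z)) \<le> ennreal (2 * (1 - (norm z)\<^sup>2)) * (\<integral>\<^sup>+w. ennreal (norm (\<phi> w) * kern z w) \<partial>nu)"
    define g where "g w = ennreal ((norm (\<phi> w))\<^sup>2 / (1 - norm w))" for w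
    have [measurable]: "g \<in> borel_measurable borel" unfolding g_def by measurable
    define X where "X = (\<integral>\<^sup>+\<eta>. epowr (radint g \<eta>) q * ennreal (\<omega> \<eta>) \<partial>sig)"
    have X: "X \<le> ennreal (2 powr q) * wenergy p \<omega> \<phi>"
    proof -
      have "X \<le> (\<integral>\<^sup>+\<eta>. ennreal (2 powr q) * (epowr (energy \<phi> \<eta>) q * ennreal (\<omega> \<eta>)) \<partial>sig)"
        unfolding X_def
      proof (rule nn_integral_sig_mono)
        fix \<eta> :: "complex^'n" assume "norm \<eta> = 1"
        then have "epowr (radint g \<eta>) q \<le> epowr (ennreal 2 * energy \<phi> \<eta>) q"
          unfolding g_def using q by (intro epowr_mono radint_le_energy) auto
        also have "\<dots> = ennreal (2 powr q) * epowr (energy \<phi> \<eta>) q"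
          using q by (simp only: epowr_mult) (simp only: epowr_ennreal zero_le_numeral)
        finally show "epowr (radint g \<eta>) q * ennreal (\<omega> \<eta>) \<le> ennreal (2 powr q) * (epowr (energy \<phi> \<eta>) q * ennreal (\<omega> \<eta>))"
          unfolding mult.assoc[symmetric] by (rule mult_right_mono) simp
      qed
      also have "\<dots> = ennreal (2 powr q) * wenergy p \<omega> \<phi>"
        unfolding wenergy_def q_def[symmetric] by (rule nn_integral_cmult) measurable
      finally show ?thesis .
    qed
    have T: "(\<integral>\<^sup>+\<zeta>. epowr (tentsum (2 ^ k) g \<zeta>) q * ennreal (\<omega> \<zeta>) \<partial>sig) \<le> ennreal (L * A powr q) * X" for k
    proof -
      have "(\<integral>\<^sup>+\<zeta>. epowr (tentsum (2 ^ k) g \<zeta>) q * ennreal (\<omega> \<zeta>) \<partial>sig)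
        \<le> ennreal (2 powr q * (2 powr q * 6 powr (real CARD('n) * (q - 1)) * 2 ^ CARD('n) * A) powr q) * X"
        unfolding X_def by (rule tentsum_estimate) (use q A \<omega> in auto)
      also have "2 powr q * (2 powr q * 6 powr (real CARD('n) * (q - 1)) * 2 ^ CARD('n) * A) powr q = L * A powr q"
        using A(2) by (simp add: L_def powr_mult)
      finally show ?thesis .
    qed
    have "wenergy p \<omega> \<psi> \<le> (\<integral>\<^sup>+\<zeta>. (\<Sum>k. ennreal (C powr q * (1 / (1 - a)) powr q) * (ennreal ((a powr q) ^ k) * (epowr (tentsum (2 ^ k) g \<zeta>) q * ennreal (\<omega> \<zeta>)))) \<partial>sig)"
      unfolding wenergy_def q_def[symmetric]
    proof (rule nn_integral_sig_mono)
      fix \<zeta> :: "complex^'n" assume z: "norm \<zeta> = 1"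
      have "epowr (energy \<psi> \<zeta>) q \<le> epowr (ennreal C * (\<Sum>k. ennreal (2 powr (- (3/2) * real k)) * tentsum (2 ^ k) g \<zeta>)) q"
        unfolding g_def using q \<psi> z by (intro epowr_mono CE) auto
      also have "\<dots> = ennreal (C powr q) * epowr (\<Sum>k. ennreal (a ^ k) * (ennreal (a ^ k) * tentsum (2 ^ k) g \<zeta>)) q"
        unfolding ak mult.assoc using q C by (simp add: epowr_mult epowr_ennreal)
      also have "\<dots> \<le> ennreal (C powr q) * (ennreal ((1 / (1 - a)) powr q) * (\<Sum>k. ennreal ((a powr q) ^ k) * epowr (tentsum (2 ^ k) g \<zeta>) q))"
        using q a by (intro mult_left_mono suminf_power_le) auto
      also have "\<dots> = ennreal (C powr q * (1 / (1 - a)) powr q) * (\<Sum>k. ennreal ((a powr q) ^ k) * epowr (tentsum (2 ^ k) g \<zeta>) q)"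
        by (simp only: ennreal_mult powr_ge_zero mult.assoc)
      finally have "epowr (energy \<psi> \<zeta>) q * ennreal (\<omega> \<zeta>) \<le> ennreal (C powr q * (1 / (1 - a)) powr q) * (\<Sum>k. ennreal ((a powr q) ^ k) * epowr (tentsum (2 ^ k) g \<zeta>) q) * ennreal (\<omega> \<zeta>)"
        by (rule mult_right_mono) simp
      also have "\<dots> = (\<Sum>k. ennreal (C powr q * (1 / (1 - a)) powr q) * (ennreal ((a powr q) ^ k) * (epowr (tentsum (2 ^ k) g \<zeta>) q * ennreal (\<omega> \<zeta>))))"
        by (subst ennreal_suminf_cmult[symmetric], subst ennreal_suminf_multc[symmetric]) (simp only: mult.assoc)
      finally show "epowr (energy \<psi> \<zeta>) q * ennreal (\<omega> \<zeta>) \<le> (\<Sum>k. ennreal (C powr q * (1 / (1 - a)) powr q) * (ennreal ((a powr q) ^ k) * (epowr (tentsum (2 ^ k) g \<zeta>) q * ennreal (\<omega> \<zeta>))))" .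
    qed
    also have "\<dots> = (\<Sum>k. ennreal (C powr q * (1 / (1 - a)) powr q) * (ennreal ((a powr q) ^ k) * (\<integral>\<^sup>+\<zeta>. epowr (tentsum (2 ^ k) g \<zeta>) q * ennreal (\<omega> \<zeta>) \<partial>sig)))"
      by (subst nn_integral_suminf, measurable) (simp add: nn_integral_cmult)
    also have "\<dots> \<le> (\<Sum>k. ennreal (C powr q * (1 / (1 - a)) powr q) * (ennreal ((a powr q) ^ k) * (ennreal (L * A powr q) * X)))"
      by (intro suminf_le summableI mult_left_mono T) auto
    also have "\<dots> = ennreal (C powr q * (1 / (1 - a)) powr q) * ((\<Sum>k. ennreal ((a powr q) ^ k)) * (ennreal (L * A powr q) * X))"
      by (simp only: ennreal_suminf_cmult ennreal_suminf_multc)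
    also have "(\<Sum>k. ennreal ((a powr q) ^ k)) = ennreal (1 / (1 - a powr q))"
      using aq by (subst suminf_ennreal2) (auto simp: suminf_geometric summable_geometric)
    also have "ennreal (C powr q * (1 / (1 - a)) powr q) * (ennreal (1 / (1 - a powr q)) * (ennreal (L * A powr q) * X))
      \<le> ennreal (C powr q * (1 / (1 - a)) powr q) * (ennreal (1 / (1 - a powr q)) * (ennreal (L * A powr q) * (ennreal (2 powr q) * wenergy p \<omega> \<phi>)))"
      by (intro mult_left_mono X) auto
    also have "\<dots> = (ennreal (C powr q * (1 / (1 - a)) powr q) * (ennreal (1 / (1 - a powr q)) * (ennreal (L * A powr q) * ennreal (2 powr q)))) * wenergy p \<omega> \<phi>"
      by (simp only: mult.assoc)
    also have "ennreal (C powr q * (1 / (1 - a)) powr q) * (ennreal (1 / (1 - a powr q)) * (ennreal (L * A powr q) * ennreal (2 powr q)))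
       = ennreal ((C powr q * (1 / (1 - a)) powr q) * (1 / (1 - a powr q) * (L * A powr q * 2 powr q)))"
      using L aq by (simp only: ennreal_mult[symmetric] mult_nonneg_nonneg powr_ge_zero less_imp_le divide_nonneg_nonneg zero_le_one le_diff_eq add_0_left)
    also have "(C powr q * (1 / (1 - a)) powr q) * (1 / (1 - a powr q) * (L * A powr q * 2 powr q)) = K * A powr (p / 2)"
      by (simp add: K_def q_def mult_ac)
    finally show "wenergy p \<omega> \<psi> \<le> ennreal (K * A powr (p / 2)) * wenergy p \<omega> \<phi>" .
  qed
qed

section \<open>The Bergman projection of an integrable function\<close>

lemma integral_ball_measure:
  fixes f :: "complex^'n \<Rightarrow> complex"
  assumes [measurable]: "f \<in> borel_measurable borel"
  shows "(LINT w|ball_measure. f w) = (LINT w|nu. f w)"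
proof -
  let ?B = "ball 0 1 :: (complex^'n) set"
  have vB: "emeasure (lebesgue_on ?B) ?B = ennreal (volB TYPE('n))"
    by (subst emeasure_restrict_space) (auto simp: emeasure_volB)
  have ind: "indicator ?B w / ennreal (volB TYPE('n)) = ennreal (indicator ?B w / volB TYPE('n))" for w
    using volB_pos[where 'n='n] by (auto simp: divide_ennreal_def inverse_ennreal inverse_eq_divide split: split_indicator)
  have "(LINT w|ball_measure. f w) = (LINT w|lebesgue_on ?B. (indicator ?B w / volB TYPE('n)) *\<^sub>R f w)"
    unfolding ball_measure_def uniform_measure_def vB ind
  proof (rule integral_density)
    have "(\<lambda>w. indicator ?B w / volB TYPE('n) :: real) \<in> borel_measurable borel" by measurable
    then show "(\<lambda>w. indicator ?B w / volB TYPE('n) :: real) \<in> borel_measurable (lebesgue_on ?B)"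
      by (intro measurable_restrict_space1 measurable_completion) simp
    show "f \<in> borel_measurable (lebesgue_on ?B)"
      by (intro measurable_restrict_space1 measurable_completion) simp
  qed (use volB_pos[where 'n='n] in auto)
  also have "\<dots> = (LINT w|lebesgue. indicator ?B w *\<^sub>R ((indicator ?B w / volB TYPE('n)) *\<^sub>R f w))"
    by (rule integral_restrict_space) auto
  also have "\<dots> = (LINT w|lborel. indicator ?B w *\<^sub>R ((indicator ?B w / volB TYPE('n)) *\<^sub>R f w))"
    by (rule integral_completion) measurable
  also have "\<dots> = (LINT w|lborel. (indicator ?B w / volB TYPE('n)) *\<^sub>R f w)"
    by (rule Bochner_Integration.integral_cong) (auto split: split_indicator)
  also have "\<dots> = (LINT w|nu. f w)"
    unfolding nu_def uniform_measure_def emeasure_volB ind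
    by (rule integral_density[symmetric]) (use volB_pos[where 'n='n] in auto)
  finally show ?thesis .
qed

lemma one_minus_hdot_nonzero: "norm z < 1 \<Longrightarrow> norm w < 1 \<Longrightarrow> 1 - hdot z w \<noteq> 0"
  using norm_one_minus_hdot_ge[of z w] mult_strict_mono'[of "norm z" 1 "norm w" 1] by auto

text \<open>
  The result of applying \<open>I + R/n\<close> to the Bergman kernel \<open>1 / (1 - u)^(n+1)\<close>.
\<close>
definition kfun :: "nat \<Rightarrow> complex \<Rightarrow> complex" where
  "kfun n u = (1 + u / of_nat n) / (1 - u) ^ (n + 2)"

lemma kfun_measurable [measurable (raw)]:
  assumes [measurable]: "f \<in> borel_measurable M"
  shows "(\<lambda>x. kfun n (f x)) \<in> borel_measurable M"
  unfolding kfun_def by measurable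

lemma kfun_bound:
  fixes z w :: "complex^'n"
  assumes "norm z < 1" "norm w < 1"
  shows "norm (kfun CARD('n) (hdot z w)) \<le> 2 * kern z w"
proof -
  have u: "norm (hdot z w) \<le> 1"
    using hdot_cauchy_schwarz[of z w] assms mult_mono[of "norm z" 1 "norm w" 1] by simp
  have D: "norm (1 - hdot z w) > 0" using one_minus_hdot_nonzero[OF assms] by simp
  have n: "real CARD('n) \<ge> 1" by (simp add: Suc_le_eq)
  have "norm (1 + hdot z w / of_nat CARD('n)) \<le> 1 + norm (hdot z w) / real CARD('n)"
    by (rule order_trans[OF norm_triangle_ineq]) (simp add: norm_divide)
  also have "\<dots> \<le> 2"
  proof -
    have "norm (hdot z w) \<le> real CARD('n)" using u n by linarith
    then show ?thesis by (simp add: divide_le_eq)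
  qed
  finally have 1: "norm (1 + hdot z w / of_nat CARD('n)) \<le> 2" .
  have "kern z w = 1 / norm (1 - hdot z w) ^ (CARD('n) + 2)"
  proof -
    have "real CARD('n) + 2 = real (CARD('n) + 2)" by simp
    then show ?thesis by (simp only: powr_minus_divide powr_realpow[OF D])
  qed
  then show ?thesis
    unfolding kfun_def norm_divide norm_power using 1 by (simp add: divide_right_mono)
qed

definition Sop :: "(complex^'n \<Rightarrow> complex) \<Rightarrow> complex^'n \<Rightarrow> complex" where
  "Sop \<phi> z = (LINT w|nu. \<phi> w * kfun CARD('n) (hdot z w))"

text \<open>
  The operator \<open>T\<close> whose norm is to be estimated.
\<close>
definition Top :: "(complex^'n \<Rightarrow> complex) \<Rightarrow> complex^'n \<Rightarrow> complex" where
  "Top \<phi> z = of_real (1 - (norm z)\<^sup>2) * Sop \<phi> z"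

lemma Sop_measurable [measurable]:
  assumes [measurable]: "\<phi> \<in> borel_measurable borel"
  shows "Sop \<phi> \<in> borel_measurable borel"
  unfolding Sop_def by measurable

lemma Top_measurable [measurable]:
  assumes [measurable]: "\<phi> \<in> borel_measurable borel"
  shows "Top \<phi> \<in> borel_measurable borel"
  unfolding Top_def by measurable

lemma integrable_kernel:
  fixes \<phi> :: "complex^'n \<Rightarrow> complex" and k :: "complex^'n \<Rightarrow> complex"
  assumes \<phi>: "integrable nu \<phi>" and [measurable]: "k \<in> borel_measurable borel"
    and B: "\<And>w. norm w < 1 \<Longrightarrow> norm (k w) \<le> B"
  shows "integrable nu (\<lambda>w. \<phi> w * k w)"
proof (rule Bochner_Integration.integrable_bound[of nu "\<lambda>w. B * norm (\<phi> w)"])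
  have [measurable]: "\<phi> \<in> borel_measurable borel" using \<phi> by (simp add: borel_measurable_integrable)
  show "integrable nu (\<lambda>w. B * norm (\<phi> w))" using \<phi> by auto
  show "(\<lambda>w. \<phi> w * k w) \<in> borel_measurable nu" by measurable
  show "AE w in nu. norm (\<phi> w * k w) \<le> norm (B * norm (\<phi> w))"
  proof (rule AE_mp[OF AE_nu_in_ball], intro AE_I2 impI)
    fix w :: "complex^'n" assume w: "norm w < 1 \<and> w \<noteq> 0"
    then have "norm (k w) \<le> B" using B by blast
    moreover from this have "0 \<le> B" using norm_ge_zero order_trans by blast
    ultimately show "norm (\<phi> w * k w) \<le> norm (B * norm (\<phi> w))"
      using mult_left_mono[of "norm (k w)" B "norm (\<phi> w)"] by (simp add: norm_mult mult.commute)
  qed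
qed

lemma norm_one_minus_hdot_ge': "norm w < 1 \<Longrightarrow> norm z \<le> \<rho> \<Longrightarrow> 1 - \<rho> \<le> norm (1 - hdot z w)"
proof -
  assume w: "norm w < 1" and z: "norm z \<le> \<rho>"
  have "norm z * norm w \<le> norm z" using w by (simp add: mult_left_le)
  then show ?thesis using norm_one_minus_hdot_ge[of z w] z by linarith
qed

text \<open>
  A remainder bound that is uniform in the second variable of the kernel, so that the derivative can be taken under the
  integral sign without a dominated convergence argument.
\<close>
lemma taylor_bergman_kernel:
  fixes u v :: complex
  assumes "\<rho> < 1" "norm u \<le> \<rho>" "norm (u + v) \<le> \<rho>"
  shows "norm (1 / (1 - (u + v)) ^ m - 1 / (1 - u) ^ m - of_nat m * v / (1 - u) ^ (m + 1))
    \<le> of_nat m * (of_nat m + 1) / (1 - \<rho>) ^ (m + 2) * (norm v)\<^sup>2"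
proof -
  define f :: "nat \<Rightarrow> complex \<Rightarrow> complex" where
    "f i x = (if i = 0 then 1 else if i = 1 then of_nat m else of_nat m * (of_nat m + 1)) * inverse (1 - x) ^ (m + i)" for i x
  have "norm (f 0 (u + v) - (\<Sum>i\<le>1. f i u * ((u + v) - u) ^ i / (fact i)))
     \<le> (of_nat m * (of_nat m + 1) / (1 - \<rho>) ^ (m + 2)) * norm ((u + v) - u) ^ (Suc 1) / fact 1"
  proof (rule field_Taylor[of "cball 0 \<rho>"])
    fix i :: nat and x :: complex assume x: "x \<in> cball 0 \<rho>" and i: "i \<le> 1"
    then have ne: "1 - x \<noteq> 0" using assms(1) by auto
    have pw: "((\<lambda>x. c * inverse (1 - x) ^ k) has_field_derivative (c * of_nat k * inverse (1 - x) ^ (Suc k))) (at x within cball 0 \<rho>)" for c k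
    proof -
      have "((\<lambda>x. inverse (1 - x)) has_field_derivative (inverse (1 - x) * inverse (1 - x))) (at x within cball 0 \<rho>)"
        using ne by (auto intro!: derivative_eq_intros)
      from DERIV_cmult[OF DERIV_power[OF this, of k], of c]
      show ?thesis by (cases k) (simp_all add: mult_ac)
    qed
    have "i = 0 \<or> i = 1" using i by auto
    then show "(f i has_field_derivative f (Suc i) x) (at x within cball 0 \<rho>)"
    proof
      assume "i = 0"
      then show ?thesis using pw[of 1 m] by (simp add: f_def[abs_def])
    next
      assume "i = 1"
      then show ?thesis using pw[of "of_nat m" "m + 1"] by (simp add: f_def[abs_def] add.commute)
    qed
  next
    fix x :: complex assume x: "x \<in> cball 0 \<rho>"
    have "1 - \<rho> \<le> norm (1 - x)" using x norm_triangle_ineq2[of 1 x] by simp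
    then have "(1 - \<rho>) ^ (m + 2) \<le> norm (1 - x) ^ (m + 2)" using assms(1) by (intro power_mono) auto
    then have "inverse (norm (1 - x) ^ (m + 2)) \<le> inverse ((1 - \<rho>) ^ (m + 2))"
      using assms(1) by (intro le_imp_inverse_le) auto
    then have "real m * (real m + 1) * inverse (norm (1 - x) ^ (m + 2)) \<le> real m * (real m + 1) * inverse ((1 - \<rho>) ^ (m + 2))"
      by (intro mult_left_mono) auto
    moreover have "norm (of_nat m + 1 :: complex) = real m + 1"
      using norm_of_nat[of "Suc m", where 'a = complex] by (simp add: add.commute)
    then have "norm (f (Suc 1) x) = real m * (real m + 1) * inverse (norm (1 - x) ^ (m + 2))"
      by (simp add: f_def norm_mult norm_inverse norm_power power_inverse)
    ultimately show "norm (f (Suc 1) x) \<le> of_nat m * (of_nat m + 1) / (1 - \<rho>) ^ (m + 2)"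
      by (simp add: divide_inverse)
  qed (use assms in auto)
  then show ?thesis by (simp add: f_def power2_eq_square divide_inverse power_inverse algebra_simps)
qed

definition berg :: "(complex^'n \<Rightarrow> complex) \<Rightarrow> complex^'n \<Rightarrow> complex" where
  "berg \<phi> z = (LINT w|nu. \<phi> w * (1 / (1 - hdot z w) ^ (CARD('n) + 1)))"

definition bergD :: "(complex^'n \<Rightarrow> complex) \<Rightarrow> complex^'n \<Rightarrow> complex^'n \<Rightarrow> complex" where
  "bergD \<phi> z h = (LINT w|nu. \<phi> w * (of_nat (CARD('n) + 1) * hdot h w / (1 - hdot z w) ^ (CARD('n) + 2)))"

lemma inverse_power_bound:
  assumes "norm z < 1" "norm w < 1"
  shows "norm (1 / (1 - hdot z w) ^ k) \<le> 1 / (1 - norm z) ^ k"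
proof -
  have "1 - norm z \<le> norm (1 - hdot z w)" using norm_one_minus_hdot_ge'[OF assms(2) order_refl] .
  then have "(1 - norm z) ^ k \<le> norm (1 - hdot z w) ^ k" using assms by (intro power_mono) auto
  then show ?thesis using assms by (simp add: norm_divide norm_power frac_le)
qed

lemma bergD_scale:
  fixes h :: "complex^'n"
  shows "bergD \<phi> z (c *s h) = c * bergD \<phi> z h"
proof -
  have "(\<lambda>w. \<phi> w * (of_nat (CARD('n) + 1) * hdot (c *s h) w / (1 - hdot z w) ^ (CARD('n) + 2)))
    = (\<lambda>w. c * (\<phi> w * (of_nat (CARD('n) + 1) * hdot h w / (1 - hdot z w) ^ (CARD('n) + 2))))"
    by (simp add: hdot_mult_left mult_ac)
  then show ?thesis unfolding bergD_def by (simp only: integral_mult_right_zero)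
qed

lemma bergD_scaleR: "bergD \<phi> z (r *\<^sub>R h) = r *\<^sub>R bergD \<phi> z h"
proof -
  have "r *\<^sub>R h = of_real r *s h" by (simp add: vec_eq_iff scaleR_conv_of_real[where 'a=complex])
  then show ?thesis by (simp add: bergD_scale scaleR_conv_of_real)
qed

context
  fixes \<phi> :: "complex^'n \<Rightarrow> complex"
  assumes \<phi>: "integrable nu \<phi>"
begin

lemma integrable_berg: "norm z < 1 \<Longrightarrow> integrable nu (\<lambda>w. \<phi> w * (1 / (1 - hdot z w) ^ k))"
  by (rule integrable_kernel[OF \<phi>, where B = "1 / (1 - norm z) ^ k"]) (auto intro: inverse_power_bound)

lemma integrable_bergD:
  "norm z < 1 \<Longrightarrow> integrable nu (\<lambda>w. \<phi> w * (of_nat (CARD('n) + 1) * hdot h w / (1 - hdot z w) ^ (CARD('n) + 2)))"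
proof (rule integrable_kernel[OF \<phi>, where B = "real (CARD('n) + 1) * norm h * (1 / (1 - norm z) ^ (CARD('n) + 2))"])
  fix w :: "complex^'n" assume z: "norm z < 1" and w: "norm w < 1"
  have "norm (hdot h w) \<le> norm h" using hdot_cauchy_schwarz[of h w] w mult_left_le[of "norm w" "norm h"] by simp
  moreover note inverse_power_bound[OF z w, of "CARD('n) + 2"]
  ultimately have "real (CARD('n) + 1) * norm (hdot h w) * norm (1 / (1 - hdot z w) ^ (CARD('n) + 2))
      \<le> real (CARD('n) + 1) * norm h * (1 / (1 - norm z) ^ (CARD('n) + 2))"
    by (intro mult_mono) auto
  moreover have "norm (of_nat (CARD('n) + 1) * hdot h w / (1 - hdot z w) ^ (CARD('n) + 2))
    = real (CARD('n) + 1) * norm (hdot h w) * norm (1 / (1 - hdot z w) ^ (CARD('n) + 2))"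
    by (simp only: norm_mult norm_divide norm_of_nat norm_one times_divide_eq_right mult_1_right)
  ultimately show "norm (of_nat (CARD('n) + 1) * hdot h w / (1 - hdot z w) ^ (CARD('n) + 2))
    \<le> real (CARD('n) + 1) * norm h * (1 / (1 - norm z) ^ (CARD('n) + 2))" by simp
qed measurable

lemma bergD_add:
  assumes "norm z < 1" shows "bergD \<phi> z (h + h') = bergD \<phi> z h + bergD \<phi> z h'"
proof -
  have "(\<lambda>w. \<phi> w * (of_nat (CARD('n) + 1) * hdot (h + h') w / (1 - hdot z w) ^ (CARD('n) + 2)))
    = (\<lambda>w. \<phi> w * (of_nat (CARD('n) + 1) * hdot h w / (1 - hdot z w) ^ (CARD('n) + 2)) + \<phi> w * (of_nat (CARD('n) + 1) * hdot h' w / (1 - hdot z w) ^ (CARD('n) + 2)))"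
    by (simp only: hdot_add_left distrib_left add_divide_distrib)
  then show ?thesis unfolding bergD_def
    using integrable_bergD[OF assms] by simp
qed

lemma bounded_linear_bergD:
  assumes z: "norm z < 1" shows "bounded_linear (bergD \<phi> z)"
  using linear_conv_bounded_linear linearI[of "bergD \<phi> z"] bergD_add[OF z] bergD_scaleR by blast

lemma berg_has_derivative:
  assumes z: "norm z < 1"
  shows "(berg \<phi> has_derivative bergD \<phi> z) (at z)"
proof -
  define m where "m = CARD('n) + 1"
  define \<rho> where "\<rho> = (1 + norm z) / 2"
  have \<rho>: "\<rho> < 1" "norm z \<le> \<rho>" using z by (auto simp: \<rho>_def)
  define C where "C = (of_nat m * (of_nat m + 1) / (1 - \<rho>) ^ (m + 2)) * (LINT w|nu. norm (\<phi> w))"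
  show ?thesis
  proof (rule has_derivativeI_sandwich[of "(1 - norm z) / 2"])
    show "0 < (1 - norm z) / 2" using z by simp
    show "bounded_linear (bergD \<phi> z)" by (rule bounded_linear_bergD[OF z])
    show "((\<lambda>y. C * norm (y - z)) \<longlongrightarrow> 0) (at z)"
      by (auto intro!: tendsto_eq_intros)
    fix y :: "complex^'n" assume y: "y \<noteq> z" "dist y z < (1 - norm z) / 2"
    define h where "h = y - z"
    have "norm y \<le> norm z + norm h" using norm_triangle_ineq[of z "y - z"] by (simp add: h_def)
    then have ny: "norm y \<le> \<rho>" using y by (simp add: \<rho>_def h_def dist_norm field_simps)
    then have ny1: "norm y < 1" using \<rho> by simp
    have eq: "berg \<phi> y - berg \<phi> z - bergD \<phi> z h = (LINT w|nu. \<phi> w * (1 / (1 - hdot y w) ^ m) - \<phi> w * (1 / (1 - hdot z w) ^ m)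
       - \<phi> w * (of_nat m * hdot h w / (1 - hdot z w) ^ (m + 1)))"
    proof -
      have A: "integrable nu (\<lambda>w. \<phi> w * (1 / (1 - hdot y w) ^ m))" "integrable nu (\<lambda>w. \<phi> w * (1 / (1 - hdot z w) ^ m))"
        by (rule integrable_berg[OF ny1], rule integrable_berg[OF z])
      have D: "integrable nu (\<lambda>w. \<phi> w * (of_nat m * hdot h w / (1 - hdot z w) ^ (m + 1)))"
        using integrable_bergD[OF z, of h] by (simp add: m_def)
      have "bergD \<phi> z h = (LINT w|nu. \<phi> w * (of_nat m * hdot h w / (1 - hdot z w) ^ (m + 1)))"
        by (simp add: bergD_def m_def)
      moreover have "berg \<phi> y = (LINT w|nu. \<phi> w * (1 / (1 - hdot y w) ^ m))" "berg \<phi> z = (LINT w|nu. \<phi> w * (1 / (1 - hdot z w) ^ m))"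
        by (simp_all add: berg_def m_def)
      moreover have "(LINT w|nu. \<phi> w * (1 / (1 - hdot y w) ^ m) - \<phi> w * (1 / (1 - hdot z w) ^ m) - \<phi> w * (of_nat m * hdot h w / (1 - hdot z w) ^ (m + 1)))
        = (LINT w|nu. \<phi> w * (1 / (1 - hdot y w) ^ m) - \<phi> w * (1 / (1 - hdot z w) ^ m)) - (LINT w|nu. \<phi> w * (of_nat m * hdot h w / (1 - hdot z w) ^ (m + 1)))"
        by (rule Bochner_Integration.integral_diff[OF Bochner_Integration.integrable_diff[OF A] D])
      moreover have "(LINT w|nu. \<phi> w * (1 / (1 - hdot y w) ^ m) - \<phi> w * (1 / (1 - hdot z w) ^ m))
        = (LINT w|nu. \<phi> w * (1 / (1 - hdot y w) ^ m)) - (LINT w|nu. \<phi> w * (1 / (1 - hdot z w) ^ m))"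
        by (rule Bochner_Integration.integral_diff[OF A])
      ultimately show ?thesis by (simp only:)
    qed
    have "norm (berg \<phi> y - berg \<phi> z - bergD \<phi> z h) \<le> (LINT w|nu. norm (\<phi> w * (1 / (1 - hdot y w) ^ m) - \<phi> w * (1 / (1 - hdot z w) ^ m)
       - \<phi> w * (of_nat m * hdot h w / (1 - hdot z w) ^ (m + 1))))"
      unfolding eq by (rule integral_norm_bound)
    also have "\<dots> \<le> (LINT w|nu. (of_nat m * (of_nat m + 1) / (1 - \<rho>) ^ (m + 2) * (norm h)\<^sup>2) * norm (\<phi> w))"
    proof (rule integral_mono_AE)
      show "integrable nu (\<lambda>w. norm (\<phi> w * (1 / (1 - hdot y w) ^ m) - \<phi> w * (1 / (1 - hdot z w) ^ m) - \<phi> w * (of_nat m * hdot h w / (1 - hdot z w) ^ (m + 1))))"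
        using integrable_berg[OF ny1, of m] integrable_berg[OF z, of m] integrable_bergD[OF z, of h]
        by (intro integrable_norm Bochner_Integration.integrable_diff) (simp_all add: m_def)
      show "integrable nu (\<lambda>w. (of_nat m * (of_nat m + 1) / (1 - \<rho>) ^ (m + 2) * (norm h)\<^sup>2) * norm (\<phi> w))"
        using \<phi> by simp
      show "AE w in nu. norm (\<phi> w * (1 / (1 - hdot y w) ^ m) - \<phi> w * (1 / (1 - hdot z w) ^ m) - \<phi> w * (of_nat m * hdot h w / (1 - hdot z w) ^ (m + 1)))
        \<le> (of_nat m * (of_nat m + 1) / (1 - \<rho>) ^ (m + 2) * (norm h)\<^sup>2) * norm (\<phi> w)"
      proof (rule AE_mp[OF AE_nu_in_ball], intro AE_I2 impI)
        fix w :: "complex^'n" assume w: "norm w < 1 \<and> w \<noteq> 0"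
        have le: "norm (hdot x w) \<le> norm x" for x
          using hdot_cauchy_schwarz[of x w] w mult_left_le[of "norm w" "norm x"] by simp
        have yz: "hdot y w = hdot z w + hdot h w" by (simp add: h_def hdot_add_left[symmetric])
        have "norm (1 / (1 - (hdot z w + hdot h w)) ^ m - 1 / (1 - hdot z w) ^ m - of_nat m * hdot h w / (1 - hdot z w) ^ (m + 1))
          \<le> of_nat m * (of_nat m + 1) / (1 - \<rho>) ^ (m + 2) * (norm (hdot h w))\<^sup>2"
          by (rule taylor_bergman_kernel) (use \<rho> ny le[of z] le[of y] yz in auto)
        also have "\<dots> \<le> of_nat m * (of_nat m + 1) / (1 - \<rho>) ^ (m + 2) * (norm h)\<^sup>2"
          using \<rho> le[of h] by (intro mult_left_mono power_mono) auto
        finally have "norm (\<phi> w) * norm (1 / (1 - hdot y w) ^ m - 1 / (1 - hdot z w) ^ m - of_nat m * hdot h w / (1 - hdot z w) ^ (m + 1))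
          \<le> norm (\<phi> w) * (of_nat m * (of_nat m + 1) / (1 - \<rho>) ^ (m + 2) * (norm h)\<^sup>2)"
          unfolding yz by (rule mult_left_mono) simp
        moreover have "norm (a * b - a * c - a * d) = norm a * norm (b - c - d)" for a b c d :: complex
          by (simp add: norm_mult[symmetric] right_diff_distrib)
        ultimately show "norm (\<phi> w * (1 / (1 - hdot y w) ^ m) - \<phi> w * (1 / (1 - hdot z w) ^ m) - \<phi> w * (of_nat m * hdot h w / (1 - hdot z w) ^ (m + 1)))
          \<le> (of_nat m * (of_nat m + 1) / (1 - \<rho>) ^ (m + 2) * (norm h)\<^sup>2) * norm (\<phi> w)"
          by (simp only: mult.commute[of _ "norm (\<phi> w)"])
      qed
    qed
    also have "\<dots> = C * (norm h)\<^sup>2"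
      by (simp add: C_def)
    finally have "norm (berg \<phi> y - berg \<phi> z - bergD \<phi> z h) \<le> C * norm h * norm h"
      by (simp add: power2_eq_square mult.assoc)
    then show "norm (berg \<phi> y - berg \<phi> z - bergD \<phi> z (y - z)) / norm (y - z) \<le> C * norm (y - z)"
      using y(1) by (simp add: h_def divide_le_eq)
  qed
qed

end

lemma bergman_eq_berg:
  fixes \<phi> :: "complex^'n \<Rightarrow> complex"
  assumes [measurable]: "\<phi> \<in> borel_measurable borel"
  shows "bergman \<phi> = berg \<phi>"
proof
  fix z :: "complex^'n"
  have "bergman \<phi> z = (LINT w|ball_measure. \<phi> w * (1 / (1 - hdot z w) ^ (CARD('n) + 1)))"
    by (simp only: bergman_def times_divide_eq_right mult_1_right)
  also have "\<dots> = (LINT w|nu. \<phi> w * (1 / (1 - hdot z w) ^ (CARD('n) + 1)))"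
    by (rule integral_ball_measure) measurable
  finally show "bergman \<phi> z = berg \<phi> z" by (simp only: berg_def)
qed

lemma cpartial_of_derivative:
  fixes f :: "complex^'n \<Rightarrow> complex"
  assumes D: "(f has_derivative D) (at z)" and hom: "\<And>c v. D (c *s v) = c * D v"
  shows "cpartial j f z = D (axis j 1)"
proof -
  define L where "L t = (\<chi> i. if i = j then t else z $ i)" for t
  have L: "L = (\<lambda>t. (z - (z $ j) *s axis j 1) + t *s axis j 1)"
    by (auto simp: L_def vec_eq_iff axis_def)
  have "bounded_linear (\<lambda>s. s *s (axis j 1 :: complex^'n))"
  proof (rule bounded_linear_intro[where K = "norm (axis j 1 :: complex^'n)"])
    fix r and s :: complex
    show "(r *\<^sub>R s) *s (axis j 1 :: complex^'n) = r *\<^sub>R (s *s axis j 1)"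
      by (simp add: vec_eq_iff)
  qed (auto simp: norm_mult_vec vec.scale_left_distrib)
  then have "((\<lambda>s. s *s (axis j 1 :: complex^'n)) has_derivative (\<lambda>s. s *s axis j 1)) (at (z $ j))"
    by (rule bounded_linear_imp_has_derivative)
  from has_derivative_add[OF has_derivative_const this, of "z - (z $ j) *s axis j 1"]
  have L': "(L has_derivative (\<lambda>s. s *s axis j 1)) (at (z $ j))"
    unfolding L by simp
  have "L (z $ j) = z" by (simp add: L)
  then have "(f has_derivative D) (at (L (z $ j)))" using D by simp
  from diff_chain_at[OF L' this]
  have "((f \<circ> L) has_derivative (D \<circ> (\<lambda>s. s *s axis j 1))) (at (z $ j))" .
  moreover have "D \<circ> (\<lambda>s. s *s axis j 1) = (*) (D (axis j 1))"
    by (auto simp: hom mult.commute)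
  ultimately have "((f \<circ> L) has_field_derivative D (axis j 1)) (at (z $ j))"
    by (simp add: has_field_derivative_def)
  then show ?thesis
    unfolding cpartial_def L_def[symmetric] by (intro DERIV_imp_deriv) (simp add: o_def)
qed

lemma radial_deriv_of_derivative:
  fixes f :: "complex^'n \<Rightarrow> complex"
  assumes D: "(f has_derivative D) (at z)" and hom: "\<And>c v. D (c *s v) = c * D v"
  shows "radial_deriv f z = D z"
proof -
  have lin: "linear D" using D by (simp add: has_derivative_linear)
  have "radial_deriv f z = (\<Sum>j\<in>UNIV. D ((z $ j) *s axis j 1))"
    unfolding radial_deriv_def by (simp add: cpartial_of_derivative[OF D hom] hom)
  also have "\<dots> = D (\<Sum>j\<in>UNIV. (z $ j) *s axis j 1)"
    by (rule linear_sum[OF lin, symmetric])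
  also have "(\<Sum>j\<in>UNIV. (z $ j) *s axis j 1) = z"
    by (rule basis_expansion)
  finally show ?thesis .
qed

lemma bergman_holomorphic:
  fixes \<phi> :: "complex^'n \<Rightarrow> complex"
  assumes "integrable nu \<phi>"
  shows "cholomorphic_on (bergman \<phi>) (ball 0 1)"
proof -
  have [measurable]: "\<phi> \<in> borel_measurable borel" using assms by (simp add: borel_measurable_integrable)
  show ?thesis
    unfolding cholomorphic_on_def bergman_eq_berg[OF \<open>\<phi> \<in> borel_measurable borel\<close>]
  proof
    fix z :: "complex^'n" assume "z \<in> ball 0 1"
    then have "(berg \<phi> has_derivative bergD \<phi> z) (at z)" by (intro berg_has_derivative assms) simp
    then show "\<exists>D. (berg \<phi> has_derivative D) (at z) \<and> (\<forall>c v. D (c *s v) = c * D v)"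
      using bergD_scale[of \<phi> z] by blast
  qed
qed

text \<open>
  The derivative at \<open>z\<close> in the direction \<open>z\<close> multiplies the kernel by \<open>(n+1) u / (1 - u)\<close>, and
  \<open>1 + (n+1) u / (n (1 - u)) = (1 + u/n) / (1 - u)\<close>.
\<close>
lemma bergman_radial:
  fixes \<phi> :: "complex^'n \<Rightarrow> complex"
  assumes \<phi>: "integrable nu \<phi>" and z: "norm z < 1"
  shows "of_real (1 - (norm z)\<^sup>2) * (bergman \<phi> z + radial_deriv (bergman \<phi>) z / of_nat CARD('n)) = Top \<phi> z"
proof -
  have [measurable]: "\<phi> \<in> borel_measurable borel" using \<phi> by (simp add: borel_measurable_integrable)
  define N where "N = (of_nat CARD('n) :: complex)"
  have N: "N \<noteq> 0" by (simp add: N_def)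
  have eq: "bergman \<phi> = berg \<phi>" by (rule bergman_eq_berg) measurable
  have rd: "radial_deriv (berg \<phi>) z = bergD \<phi> z z"
    by (rule radial_deriv_of_derivative[OF berg_has_derivative[OF \<phi> z] bergD_scale])
  have "bergman \<phi> z + radial_deriv (bergman \<phi>) z / N = berg \<phi> z + bergD \<phi> z z / N"
    unfolding eq rd ..
  also have "\<dots> = (LINT w|nu. \<phi> w * (1 / (1 - hdot z w) ^ (CARD('n) + 1)) + \<phi> w * (of_nat (CARD('n) + 1) * hdot z w / (1 - hdot z w) ^ (CARD('n) + 2)) / N)"
  proof -
    note A = integrable_berg[OF \<phi> z, of "CARD('n) + 1"]
    note D = integrable_divide[OF integrable_bergD[OF \<phi> z, of z], of N]
    show ?thesis
      unfolding berg_def bergD_def integral_divide_zero[symmetric]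
      by (rule Bochner_Integration.integral_add[OF A D, symmetric])
  qed
  also have "\<dots> = Sop \<phi> z"
    unfolding Sop_def
  proof (rule integral_cong_AE)
    show "AE w in nu. \<phi> w * (1 / (1 - hdot z w) ^ (CARD('n) + 1)) + \<phi> w * (of_nat (CARD('n) + 1) * hdot z w / (1 - hdot z w) ^ (CARD('n) + 2)) / N
        = \<phi> w * kfun CARD('n) (hdot z w)"
    proof (rule AE_mp[OF AE_nu_in_ball], intro AE_I2 impI)
      fix w :: "complex^'n" assume w: "norm w < 1 \<and> w \<noteq> 0"
      define u where "u = hdot z w"
      have u: "1 - u \<noteq> 0" using one_minus_hdot_nonzero[of z w] z w by (simp add: u_def)
      have "1 / (1 - u) ^ (CARD('n) + 1) = (1 - u) / (1 - u) ^ (CARD('n) + 2)"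
        using u by simp
      moreover have "of_nat (CARD('n) + 1) * u / (1 - u) ^ (CARD('n) + 2) / N = ((N + 1) * u / N) / (1 - u) ^ (CARD('n) + 2)"
        by (simp add: N_def add.commute)
      moreover have "(1 - u) + (N + 1) * u / N = 1 + u / N" using N by (simp add: field_simps)
      ultimately have "1 / (1 - u) ^ (CARD('n) + 1) + of_nat (CARD('n) + 1) * u / (1 - u) ^ (CARD('n) + 2) / N = (1 + u / N) / (1 - u) ^ (CARD('n) + 2)"
        by (metis add_divide_distrib)
      then have "\<phi> w * (1 / (1 - u) ^ (CARD('n) + 1) + of_nat (CARD('n) + 1) * u / (1 - u) ^ (CARD('n) + 2) / N) = \<phi> w * kfun CARD('n) u"
        by (simp only: kfun_def N_def)
      then show "\<phi> w * (1 / (1 - hdot z w) ^ (CARD('n) + 1)) + \<phi> w * (of_nat (CARD('n) + 1) * hdot z w / (1 - hdot z w) ^ (CARD('n) + 2)) / N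
        = \<phi> w * kfun CARD('n) (hdot z w)"
        by (simp only: u_def distrib_left times_divide_eq_right)
    qed
  qed measurable
  finally show ?thesis by (simp add: Top_def N_def)
qed

lemma Top_dominated:
  fixes \<phi> :: "complex^'n \<Rightarrow> complex"
  assumes [measurable]: "\<phi> \<in> borel_measurable borel" and z: "norm z < 1"
  shows "ennreal (norm (Top \<phi> z)) \<le> ennreal (2 * (1 - (norm z)\<^sup>2)) * (\<integral>\<^sup>+w. ennreal (norm (\<phi> w) * kern z w) \<partial>nu)"
proof -
  have r2: "0 \<le> 1 - (norm z)\<^sup>2" using z by (simp add: power_le_one)
  have "ennreal (norm (Sop \<phi> z)) \<le> (\<integral>\<^sup>+w. ennreal (norm (\<phi> w * kfun CARD('n) (hdot z w))) \<partial>nu)"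
  proof (cases "integrable nu (\<lambda>w. \<phi> w * kfun CARD('n) (hdot z w))")
    case True
    then show ?thesis unfolding Sop_def by (rule integral_norm_bound_ennreal)
  qed (simp add: Sop_def not_integrable_integral_eq)
  also have "\<dots> \<le> (\<integral>\<^sup>+w. ennreal 2 * ennreal (norm (\<phi> w) * kern z w) \<partial>nu)"
  proof (rule nn_integral_nu_mono)
    fix w :: "complex^'n" assume "norm w < 1 \<and> w \<noteq> 0"
    then have "norm (\<phi> w) * norm (kfun CARD('n) (hdot z w)) \<le> norm (\<phi> w) * (2 * kern z w)"
      using z by (intro mult_left_mono kfun_bound) auto
    then have "ennreal (norm (\<phi> w * kfun CARD('n) (hdot z w))) \<le> ennreal (2 * (norm (\<phi> w) * kern z w))"
      unfolding norm_mult by (intro ennreal_leI) (simp add: mult_ac)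
    also have "\<dots> = ennreal 2 * ennreal (norm (\<phi> w) * kern z w)" by (intro ennreal_mult) auto
    finally show "ennreal (norm (\<phi> w * kfun CARD('n) (hdot z w))) \<le> ennreal 2 * ennreal (norm (\<phi> w) * kern z w)" .
  qed
  also have "\<dots> = ennreal 2 * (\<integral>\<^sup>+w. ennreal (norm (\<phi> w) * kern z w) \<partial>nu)"
    by (rule nn_integral_cmult) measurable
  finally have S: "ennreal (norm (Sop \<phi> z)) \<le> ennreal 2 * (\<integral>\<^sup>+w. ennreal (norm (\<phi> w) * kern z w) \<partial>nu)" .
  have "ennreal (norm (Top \<phi> z)) = ennreal (1 - (norm z)\<^sup>2) * ennreal (norm (Sop \<phi> z))"
    using r2 by (simp add: Top_def norm_mult ennreal_mult[symmetric] del: of_real_diff of_real_power)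
  also have "\<dots> \<le> ennreal (1 - (norm z)\<^sup>2) * (ennreal 2 * (\<integral>\<^sup>+w. ennreal (norm (\<phi> w) * kern z w) \<partial>nu))"
    by (rule mult_left_mono[OF S]) simp
  also have "\<dots> = ennreal (2 * (1 - (norm z)\<^sup>2)) * (\<integral>\<^sup>+w. ennreal (norm (\<phi> w) * kern z w) \<partial>nu)"
    using r2 by (subst ennreal_mult) (auto simp: mult_ac)
  finally show ?thesis .
qed

section \<open>From completed measures to Borel functions\<close>

lemma sphere_measure_alt: "sphere_measure = completion (restrict_space sig (sphere 0 1 :: (complex^'n) set))"
  unfolding sphere_measure_def sig_def nu_def ..

lemma sphere_Int_sets: "sphere 0 1 \<inter> space sig \<in> sets (sig :: (complex^'n) measure)"
  by simp

lemma AE_sphere_measure: "(AE \<zeta> in sphere_measure. P \<zeta>) \<longleftrightarrow> (AE \<zeta> in sig. P (\<zeta> :: complex^'n))"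
proof -
  have "(AE \<zeta> in sphere_measure. P \<zeta>) \<longleftrightarrow> (AE \<zeta> in sig. \<zeta> \<in> sphere 0 1 \<longrightarrow> P \<zeta>)"
    unfolding sphere_measure_alt AE_completion_iff by (rule AE_restrict_space_iff[OF sphere_Int_sets])
  also have "\<dots> \<longleftrightarrow> (AE \<zeta> in sig. P \<zeta>)"
  proof
    assume "AE \<zeta> in sig. \<zeta> \<in> sphere 0 1 \<longrightarrow> P \<zeta>"
    then show "AE \<zeta> in sig. P \<zeta>" using AE_sig_norm by eventually_elim simp
  qed (auto elim: eventually_mono)
  finally show ?thesis .
qed

lemma nn_integral_sphere_measure: "(\<integral>\<^sup>+\<zeta>. f \<zeta> \<partial>sphere_measure) = (\<integral>\<^sup>+\<zeta>. f (\<zeta> :: complex^'n) \<partial>sig)"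
proof -
  have "(\<integral>\<^sup>+\<zeta>. f \<zeta> \<partial>sphere_measure) = (\<integral>\<^sup>+\<zeta>. f \<zeta> * indicator (sphere 0 1) \<zeta> \<partial>sig)"
    unfolding sphere_measure_alt nn_integral_completion by (rule nn_integral_restrict_space[OF sphere_Int_sets])
  also have "\<dots> = (\<integral>\<^sup>+\<zeta>. f \<zeta> \<partial>sig)"
    by (rule nn_integral_cong_AE) (use AE_sig_norm in \<open>auto elim!: eventually_mono\<close>)
  finally show ?thesis .
qed

lemma space_sphere_measure: "space (sphere_measure :: (complex^'n) measure) = sphere 0 1"
  by (simp add: sphere_measure_alt space_restrict_space)

lemma sets_sphere_measureI: "A \<in> sets borel \<Longrightarrow> sphere 0 1 \<inter> A \<in> sets (sphere_measure :: (complex^'n) measure)"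
  by (auto simp: sphere_measure_alt sets_restrict_space intro!: sets_completionI_sets)

lemma open_nonisotropic: "open {\<eta> :: complex^'n. norm (1 - hdot \<xi> \<eta>) < r}"
  unfolding hdot_def by (intro open_Collect_less continuous_intros)

lemma nball_alt: "nball \<xi> r = sphere 0 1 \<inter> {\<eta> :: complex^'n. norm (1 - hdot \<xi> \<eta>) < r}"
  by (auto simp: nball_def)

lemma emeasure_nball: "emeasure sphere_measure (nball \<xi> r) = emeasure sig {\<eta> :: complex^'n. norm (1 - hdot \<xi> \<eta>) < r}"
proof -
  have "nball \<xi> r \<in> sets sphere_measure"
    unfolding nball_alt by (intro sets_sphere_measureI borel_open open_nonisotropic)
  then have "emeasure sphere_measure (nball \<xi> r) = (\<integral>\<^sup>+\<eta>. indicator (nball \<xi> r) \<eta> \<partial>sphere_measure)"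
    by simp
  also have "\<dots> = (\<integral>\<^sup>+\<eta>. indicator (nball \<xi> r) \<eta> \<partial>sig)"
    by (rule nn_integral_sphere_measure)
  also have "\<dots> = (\<integral>\<^sup>+\<eta>. indicator {\<eta>. norm (1 - hdot \<xi> \<eta>) < r} \<eta> \<partial>sig)"
    by (rule nn_integral_cong_AE) (use AE_sig_norm in \<open>auto simp: nball_alt indicator_def elim!: eventually_mono\<close>)
  also have "\<dots> = emeasure sig {\<eta>. norm (1 - hdot \<xi> \<eta>) < r}"
    by (rule nn_integral_indicator) measurable
  finally show ?thesis .
qed

lemma borel_version_sphere:
  fixes \<omega> :: "complex^'n \<Rightarrow> real"
  assumes "\<omega> \<in> borel_measurable sphere_measure"
  obtains \<omega>0 where "\<omega>0 \<in> borel_measurable borel" "AE \<zeta> in sig. \<omega> \<zeta> = \<omega>0 \<zeta>"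
proof -
  obtain g where g: "g \<in> borel_measurable (restrict_space sig (sphere 0 1))" "AE x in restrict_space sig (sphere 0 1). \<omega> x = g x"
    using completion_ex_borel_measurable_real[of \<omega> "restrict_space sig (sphere 0 1)"] assms
    unfolding sphere_measure_alt by blast
  define h where "h x = indicator (sphere 0 1) x *\<^sub>R g x" for x
  have "h \<in> borel_measurable sig"
    using g(1) unfolding h_def by (subst (asm) borel_measurable_restrict_space_iff) auto
  then have "h \<in> borel_measurable borel" by (simp add: measurable_def)
  moreover have "AE x in sig. \<omega> x = h x"
    using g(2) AE_sig_norm unfolding AE_restrict_space_iff[OF sphere_Int_sets]
    by eventually_elim (auto simp: h_def)
  ultimately show ?thesis using that by blast
qed

lemma borel_version_ball:
  fixes \<phi> :: "complex^'n \<Rightarrow> complex"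
  assumes "\<phi> \<in> borel_measurable (lebesgue_on (ball 0 1))"
  obtains \<phi>0 where "\<phi>0 \<in> borel_measurable borel" "AE w in nu. \<phi> w = \<phi>0 w"
proof -
  define h where "h x = indicator (ball 0 1) x *\<^sub>R \<phi> x" for x
  have h: "h \<in> borel_measurable lebesgue"
    using assms unfolding h_def by (subst (asm) borel_measurable_restrict_space_iff) auto
  then have "(\<lambda>x. Re (h x)) \<in> borel_measurable lebesgue" "(\<lambda>x. Im (h x)) \<in> borel_measurable lebesgue"
    by auto
  then obtain a b where ab: "a \<in> borel_measurable lborel" "AE x in lborel. Re (h x) = a x"
      "b \<in> borel_measurable lborel" "AE x in lborel. Im (h x) = b x"
    using completion_ex_borel_measurable_real[of "\<lambda>x. Re (h x)" lborel]
      completion_ex_borel_measurable_real[of "\<lambda>x. Im (h x)" lborel] by blast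
  have [measurable]: "a \<in> borel_measurable borel" "b \<in> borel_measurable borel" using ab by auto
  have "(\<lambda>x. complex_of_real (a x) + \<i> * complex_of_real (b x)) \<in> borel_measurable borel" by measurable
  moreover have "AE x in nu. \<phi> x = complex_of_real (a x) + \<i> * complex_of_real (b x)"
    unfolding AE_nu using ab(2,4)
    by eventually_elim (auto simp: h_def complex_eq_iff)
  ultimately show ?thesis using that by blast
qed

text \<open>
  Null sets of the ball meet almost every radius in a null set. This makes the norms insensitive to the choice of a representative.
\<close>
lemma AE_nu_radial:
  assumes "AE w in nu. P (w :: complex^'n)"
  shows "AE \<zeta> in sig. AE r in lborel. 0 < r \<and> r < 1 \<longrightarrow> P (r *\<^sub>R \<zeta>)"
proof -
  obtain N where N: "N \<in> null_sets nu" "{w \<in> space nu. \<not> P w} \<subseteq> N"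
    using assms unfolding eventually_ae_filter by auto
  have [measurable]: "N \<in> sets borel" using N(1) by (auto dest: null_setsD2)
  have "(\<integral>\<^sup>+\<zeta>. (\<integral>\<^sup>+r. indicator N (r *\<^sub>R \<zeta>) * ennreal (rd CARD('n) r) \<partial>lborel) \<partial>sig) = (\<integral>\<^sup>+w. indicator N w \<partial>nu)"
    by (rule polar[symmetric]) measurable
  also have "\<dots> = 0" using null_setsD1[OF N(1)] by simp
  finally have "AE \<zeta> in sig. (\<integral>\<^sup>+r. indicator N (r *\<^sub>R \<zeta>) * ennreal (rd CARD('n) r) \<partial>lborel) = 0"
    by (subst (asm) nn_integral_0_iff_AE) auto
  then show ?thesis
  proof (rule eventually_mono)
    fix \<zeta> :: "complex^'n"
    assume "(\<integral>\<^sup>+r. indicator N (r *\<^sub>R \<zeta>) * ennreal (rd CARD('n) r) \<partial>lborel) = 0"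
    then have "AE r in lborel. indicator N (r *\<^sub>R \<zeta>) * ennreal (rd CARD('n) r) = 0"
      by (subst (asm) nn_integral_0_iff_AE) auto
    then show "AE r in lborel. 0 < r \<and> r < 1 \<longrightarrow> P (r *\<^sub>R \<zeta>)"
      by (rule eventually_mono) (use N(2) in \<open>auto simp: rd_def split: split_indicator_asm\<close>)
  qed
qed

lemma Lp2_norm_eq:
  fixes \<phi> \<phi>0 :: "complex^'n \<Rightarrow> complex"
  assumes \<phi>: "AE w in nu. \<phi> w = \<phi>0 w" and \<omega>: "AE \<zeta> in sig. \<omega> \<zeta> = \<omega>0 \<zeta>"
  shows "Lp2_norm p \<omega> \<phi> = epowr (wenergy p \<omega>0 \<phi>0) (1 / p)"
proof -
  have "AE \<zeta> in sig. (\<integral>\<^sup>+r\<in>{0<..<1}. ennreal ((norm (\<phi> (r *\<^sub>R \<zeta>)))\<^sup>2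
                   * (2 * real CARD('n) * r ^ (2 * CARD('n) - 1) / (1 - r\<^sup>2))) \<partial>lebesgue) = energy \<phi>0 \<zeta>"
    using AE_nu_radial[OF \<phi>]
  proof (rule eventually_mono)
    fix \<zeta> :: "complex^'n"
    assume *: "AE r in lborel. 0 < r \<and> r < 1 \<longrightarrow> \<phi> (r *\<^sub>R \<zeta>) = \<phi>0 (r *\<^sub>R \<zeta>)"
    show "(\<integral>\<^sup>+r\<in>{0<..<1}. ennreal ((norm (\<phi> (r *\<^sub>R \<zeta>)))\<^sup>2
                   * (2 * real CARD('n) * r ^ (2 * CARD('n) - 1) / (1 - r\<^sup>2))) \<partial>lebesgue) = energy \<phi>0 \<zeta>"
      unfolding nn_integral_completion energy_def
    proof (rule nn_integral_cong_AE, rule AE_mp[OF *], intro AE_I2 impI)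
      fix r :: real assume "0 < r \<and> r < 1 \<longrightarrow> \<phi> (r *\<^sub>R \<zeta>) = \<phi>0 (r *\<^sub>R \<zeta>)"
      then show "ennreal ((norm (\<phi> (r *\<^sub>R \<zeta>)))\<^sup>2 * (2 * real CARD('n) * r ^ (2 * CARD('n) - 1) / (1 - r\<^sup>2))) * indicator {0<..<1} r
        = ennreal ((norm (\<phi>0 (r *\<^sub>R \<zeta>)))\<^sup>2 * (rd CARD('n) r / (1 - r\<^sup>2)))"
        by (cases "0 < r \<and> r < 1") (auto simp: rd_def)
    qed
  qed
  then have "Lp2_norm p \<omega> \<phi> = epowr (\<integral>\<^sup>+\<zeta>. epowr (energy \<phi>0 \<zeta>) (p / 2) * ennreal (\<omega>0 \<zeta>) \<partial>sig) (1 / p)"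
    unfolding Lp2_norm_def nn_integral_sphere_measure using \<omega>
  proof (intro arg_cong[where f = "\<lambda>x. epowr x (1 / p)"] nn_integral_cong_AE)
    assume 1: "AE \<zeta> in sig. (\<integral>\<^sup>+r\<in>{0<..<1}. ennreal ((norm (\<phi> (r *\<^sub>R \<zeta>)))\<^sup>2
                   * (2 * real CARD('n) * r ^ (2 * CARD('n) - 1) / (1 - r\<^sup>2))) \<partial>lebesgue) = energy \<phi>0 \<zeta>"
      and 2: "AE \<zeta> in sig. \<omega> \<zeta> = \<omega>0 \<zeta>"
    from 1 2 show "AE \<zeta> in sig. epowr (\<integral>\<^sup>+r\<in>{0<..<1}. ennreal ((norm (\<phi> (r *\<^sub>R \<zeta>)))\<^sup>2
                   * (2 * real CARD('n) * r ^ (2 * CARD('n) - 1) / (1 - r\<^sup>2))) \<partial>lebesgue) (p / 2) * ennreal (\<omega> \<zeta>)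
        = epowr (energy \<phi>0 \<zeta>) (p / 2) * ennreal (\<omega>0 \<zeta>)"
      by eventually_elim simp
  qed
  then show ?thesis by (simp add: wenergy_def)
qed

lemma bergman_cong_AE:
  fixes \<phi> \<phi>0 :: "complex^'n \<Rightarrow> complex"
  assumes \<phi>: "\<phi> \<in> borel_measurable (lebesgue_on (ball 0 1))" and \<phi>0: "\<phi>0 \<in> borel_measurable borel"
    and eq: "AE w in nu. \<phi> w = \<phi>0 w"
  shows "bergman \<phi> = bergman \<phi>0"
proof
  fix z :: "complex^'n"
  let ?B = "ball 0 1 :: (complex^'n) set"
  have m: "g \<in> borel_measurable (ball_measure :: (complex^'n) measure)" if "g \<in> borel_measurable (lebesgue_on ?B)" for g :: "complex^'n \<Rightarrow> complex"
    using that by (simp add: ball_measure_def measurable_def)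
  have b: "g \<in> borel_measurable (lebesgue_on ?B)" if "g \<in> borel_measurable borel" for g :: "complex^'n \<Rightarrow> complex"
    using that by (intro measurable_restrict_space1 measurable_completion) simp
  have k: "(\<lambda>w. 1 / (1 - hdot z w) ^ (CARD('n) + 1)) \<in> borel_measurable (ball_measure :: (complex^'n) measure)"
  proof (rule m[OF b])
    show "(\<lambda>w. 1 / (1 - hdot z w) ^ (CARD('n) + 1)) \<in> borel_measurable borel" by measurable
  qed
  have \<phi>m: "\<phi> \<in> borel_measurable ball_measure" "\<phi>0 \<in> borel_measurable ball_measure"
    by (rule m[OF \<phi>], rule m[OF b[OF \<phi>0]])
  have vB: "emeasure (lebesgue_on ?B) ?B = ennreal (volB TYPE('n))"
    by (subst emeasure_restrict_space) (auto simp: emeasure_volB)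
  have "AE w in lebesgue. w \<in> ?B \<longrightarrow> \<phi> w = \<phi>0 w"
    unfolding AE_completion_iff using eq unfolding AE_nu by (rule eventually_mono) auto
  then have "AE w in lebesgue_on ?B. \<phi> w = \<phi>0 w"
    by (subst AE_restrict_space_iff) auto
  then have ae: "AE w in ball_measure. \<phi> w = \<phi>0 w"
    unfolding ball_measure_def
  proof (subst AE_uniform_measure)
    show "AE w in lebesgue_on ?B. w \<in> ?B \<longrightarrow> \<phi> w = \<phi>0 w"
      using \<open>AE w in lebesgue_on ?B. \<phi> w = \<phi>0 w\<close> by (rule eventually_mono) simp
  qed (use volB_pos[where 'n='n] vB in auto)
  have "bergman \<phi> z = (LINT w|ball_measure. \<phi> w * (1 / (1 - hdot z w) ^ (CARD('n) + 1)))"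
    by (simp only: bergman_def times_divide_eq_right mult_1_right)
  also have "\<dots> = (LINT w|ball_measure. \<phi>0 w * (1 / (1 - hdot z w) ^ (CARD('n) + 1)))"
  proof (rule integral_cong_AE)
    show "AE w in ball_measure. \<phi> w * (1 / (1 - hdot z w) ^ (CARD('n) + 1)) = \<phi>0 w * (1 / (1 - hdot z w) ^ (CARD('n) + 1))"
      using ae by (rule eventually_mono) simp
  qed (rule borel_measurable_times[OF \<phi>m(1) k], rule borel_measurable_times[OF \<phi>m(2) k])
  also have "\<dots> = bergman \<phi>0 z" by (simp only: bergman_def times_divide_eq_right mult_1_right)
  finally show "bergman \<phi> z = bergman \<phi>0 z" .
qed

lemma Fp2_norm_bergman_eq:
  fixes \<phi> :: "complex^'n \<Rightarrow> complex"
  assumes \<phi>: "integrable nu \<phi>" and \<omega>: "AE \<zeta> in sig. \<omega> \<zeta> = \<omega>0 \<zeta>"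
  shows "Fp2_norm p \<omega> (bergman \<phi>) = epowr (wenergy p \<omega>0 (Top \<phi>)) (1 / p)"
  unfolding Fp2_norm_def
  by (rule Lp2_norm_eq[OF _ \<omega>]) (use AE_nu_in_ball bergman_radial[OF \<phi>] in \<open>auto elim!: eventually_mono\<close>)

section \<open>Duality\<close>

lemma young_powr:
  fixes a b L :: real
  assumes p: "1 < p" and a: "0 \<le> a" and b: "0 \<le> b" and L: "0 < L"
  shows "a * b \<le> L * a powr (p / (p - 1)) + L powr (- (p - 1)) * b powr p"
proof -
  define c where "c = 1 / (p - 1)"
  have c: "c > 0" "c * (p - 1) = 1" "p / (p - 1) = 1 + c" using p by (auto simp: c_def field_simps)
  show ?thesis
  proof (cases "b \<le> L * a powr c")
    case True
    then have "a * b \<le> a * (L * a powr c)" using a by (rule mult_left_mono)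
    also have "\<dots> = L * a powr (p / (p - 1))"
      using a unfolding c(3) by (cases "a = 0") (auto simp: powr_add)
    finally show ?thesis by (simp add: add_increasing2)
  next
    case False
    then have "a powr c \<le> b / L" using L by (simp add: field_simps)
    then have "(a powr c) powr (p - 1) \<le> (b / L) powr (p - 1)" using p by (intro powr_mono2) auto
    moreover have "(a powr c) powr (p - 1) = a" using a c by (simp add: powr_powr)
    moreover have "(b / L) powr (p - 1) = b powr (p - 1) * L powr (- (p - 1))"
    proof -
      have "(b / L) powr (p - 1) = b powr (p - 1) / L powr (p - 1)" by (rule powr_divide)
      then show ?thesis by (simp only: powr_minus divide_inverse)
    qed
    ultimately have "a \<le> b powr (p - 1) * L powr (- (p - 1))" by (simp only:)
    then have "a * b \<le> b powr (p - 1) * L powr (- (p - 1)) * b" using b by (rule mult_right_mono)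
    also have "\<dots> = L powr (- (p - 1)) * b powr p"
      using b by (cases "b = 0") (auto simp: powr_diff)
    finally show ?thesis using L by (simp add: add_increasing)
  qed
qed

lemma epowr_half_square: "epowr (x\<^sup>2) (1/2) = x"
proof (cases x)
  case (real a)
  then have "epowr (x\<^sup>2) (1/2) = ennreal ((a\<^sup>2) powr (1/2))"
    by (simp add: ennreal_power epowr_ennreal)
  then show ?thesis using real by (simp add: powr_half_sqrt)
qed (simp add: power2_eq_square)

lemma weighted_young:
  assumes p: "1 < p" and L: "0 < L" and u: "0 < u"
  shows "epowr x (1/2) * epowr y (1/2) \<le> ennreal L * (epowr x (p / (p - 1) / 2) * ennreal u) + ennreal (L powr (- (p - 1))) * (epowr y (p / 2) * ennreal (u powr (1 - p)))"
proof -
  define P where "P = p / (p - 1)"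
  have P: "P > 1" using p by (simp add: P_def)
  consider "x = top" | "y = top" | a b where "x = ennreal a" "y = ennreal b" "0 \<le> a" "0 \<le> b"
    by (cases x; cases y) auto
  then show ?thesis
  proof cases
    case 1
    then show ?thesis using L u by (simp add: ennreal_mult_top ennreal_top_mult)
  next
    case 2
    then show ?thesis using L u by (simp add: ennreal_mult_top ennreal_top_mult)
  next
    case 3
    define s t where "s = sqrt a * u powr (1 / P)" and "t = sqrt b * u powr (- (1 / P))"
    have st: "s \<ge> 0" "t \<ge> 0" using 3 by (auto simp: s_def t_def)
    have "sqrt a * sqrt b = s * t"
      using u by (simp add: s_def t_def powr_minus)
    also have "\<dots> \<le> L * s powr P + L powr (- (p - 1)) * t powr p"
      unfolding P_def by (rule young_powr[OF p st L])
    also have "s powr P = a powr (P / 2) * u"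
      using 3 u P by (simp add: s_def powr_mult powr_powr powr_half_sqrt[symmetric])
    also have "t powr p = b powr (p / 2) * u powr (1 - p)"
    proof -
      have "- (1 / P) * p = 1 - p" using p by (simp add: P_def field_simps)
      then show ?thesis
        using 3 u p by (simp add: t_def powr_mult powr_powr powr_half_sqrt[symmetric])
    qed
    finally have "ennreal (sqrt a * sqrt b) \<le> ennreal (L * (a powr (P / 2) * u) + L powr (- (p - 1)) * (b powr (p / 2) * u powr (1 - p)))"
      by (rule ennreal_leI)
    also have "\<dots> = ennreal L * (ennreal (a powr (P / 2)) * ennreal u) + ennreal (L powr (- (p - 1))) * (ennreal (b powr (p / 2)) * ennreal (u powr (1 - p)))"
      using L u by (subst ennreal_plus) (simp_all add: ennreal_mult)
    finally show ?thesis
      using 3 by (simp add: epowr_ennreal powr_half_sqrt ennreal_mult P_def)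
  qed
qed

lemma radial_weight_nonneg [simp]: "0 \<le> rd n r / (1 - r\<^sup>2)"
proof (cases "0 < r \<and> r < 1")
  case True
  then have "r\<^sup>2 \<le> 1" by (simp add: power_le_one)
  then show ?thesis by simp
qed (auto simp: rd_def)

text \<open>
  Cauchy-Schwarz on each radius.
\<close>
lemma pairing_le:
  fixes f g :: "complex^'n \<Rightarrow> complex"
  assumes [measurable]: "f \<in> borel_measurable borel" "g \<in> borel_measurable borel"
  shows "(\<integral>\<^sup>+z. ennreal (norm (f z) * norm (g z) / (1 - (norm z)\<^sup>2)) \<partial>nu)
    \<le> (\<integral>\<^sup>+\<zeta>. epowr (energy f \<zeta>) (1/2) * epowr (energy g \<zeta>) (1/2) \<partial>sig)"
proof -
  have "(\<integral>\<^sup>+z. ennreal (norm (f z) * norm (g z) / (1 - (norm z)\<^sup>2)) \<partial>nu)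
    = (\<integral>\<^sup>+\<zeta>. (\<integral>\<^sup>+r. ennreal (norm (f (r *\<^sub>R \<zeta>)) * norm (g (r *\<^sub>R \<zeta>)) / (1 - (norm (r *\<^sub>R \<zeta>))\<^sup>2)) * ennreal (rd CARD('n) r) \<partial>lborel) \<partial>sig)"
    by (rule polar) measurable
  also have "\<dots> \<le> (\<integral>\<^sup>+\<zeta>. epowr (energy f \<zeta>) (1/2) * epowr (energy g \<zeta>) (1/2) \<partial>sig)"
  proof (rule nn_integral_sig_mono)
    fix \<zeta> :: "complex^'n" assume z: "norm \<zeta> = 1"
    define F where "F h r = ennreal (norm (h (r *\<^sub>R \<zeta>)) * sqrt (rd CARD('n) r / (1 - r\<^sup>2)))" for h :: "complex^'n \<Rightarrow> complex" and r
    have [measurable]: "F f \<in> borel_measurable borel" "F g \<in> borel_measurable borel"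
      unfolding F_def by measurable
    have Fe: "energy h \<zeta> = (\<integral>\<^sup>+r. (F h r)\<^sup>2 \<partial>lborel)" for h :: "complex^'n \<Rightarrow> complex"
      unfolding energy_def F_def
      by (intro nn_integral_cong) (simp add: ennreal_power power_mult_distrib)
    have "ennreal (norm (f (r *\<^sub>R \<zeta>)) * norm (g (r *\<^sub>R \<zeta>)) / (1 - (norm (r *\<^sub>R \<zeta>))\<^sup>2)) * ennreal (rd CARD('n) r) = F f r * F g r" for r
    proof -
      define s where "s = rd CARD('n) r / (1 - r\<^sup>2)"
      have s: "s \<ge> 0" by (simp add: s_def)
      have ss: "sqrt s * sqrt s = s" using s by simp
      have "F f r * F g r = ennreal ((norm (f (r *\<^sub>R \<zeta>)) * sqrt s) * (norm (g (r *\<^sub>R \<zeta>)) * sqrt s))"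
        unfolding F_def s_def[symmetric] using s by (intro ennreal_mult[symmetric]) auto
      also have "(norm (f (r *\<^sub>R \<zeta>)) * sqrt s) * (norm (g (r *\<^sub>R \<zeta>)) * sqrt s) = norm (f (r *\<^sub>R \<zeta>)) * norm (g (r *\<^sub>R \<zeta>)) * s"
        using ss by (simp add: mult_ac)
      finally have 1: "F f r * F g r = ennreal (norm (f (r *\<^sub>R \<zeta>)) * norm (g (r *\<^sub>R \<zeta>)) * s)" .
      have nr: "(norm (r *\<^sub>R \<zeta>))\<^sup>2 = r\<^sup>2" using z by simp
      show ?thesis
      proof (cases "0 < r \<and> r < 1")
        case True
        then have "r\<^sup>2 < 1" by (simp add: power_less_one_iff)
        then have "ennreal (norm (f (r *\<^sub>R \<zeta>)) * norm (g (r *\<^sub>R \<zeta>)) / (1 - r\<^sup>2)) * ennreal (rd CARD('n) r) = ennreal (norm (f (r *\<^sub>R \<zeta>)) * norm (g (r *\<^sub>R \<zeta>)) / (1 - r\<^sup>2) * rd CARD('n) r)"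
          by (intro ennreal_mult[symmetric]) auto
        then show ?thesis unfolding 1 nr by (simp add: s_def)
      next
        case False
        then have "rd CARD('n) r = 0" by (auto simp: rd_def)
        then show ?thesis unfolding 1 by (simp add: s_def)
      qed
    qed
    then have "(\<integral>\<^sup>+r. ennreal (norm (f (r *\<^sub>R \<zeta>)) * norm (g (r *\<^sub>R \<zeta>)) / (1 - (norm (r *\<^sub>R \<zeta>))\<^sup>2)) * ennreal (rd CARD('n) r) \<partial>lborel)
       = epowr ((\<integral>\<^sup>+r. F f r * F g r \<partial>lborel)\<^sup>2) (1/2)"
      by (simp add: epowr_half_square)
    also have "\<dots> \<le> epowr (energy f \<zeta> * energy g \<zeta>) (1/2)"
      unfolding Fe by (intro epowr_mono Cauchy_Schwarz_nn_integral) auto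
    also have "\<dots> = epowr (energy f \<zeta>) (1/2) * epowr (energy g \<zeta>) (1/2)"
      by (rule epowr_mult) simp
    finally show "(\<integral>\<^sup>+r. ennreal (norm (f (r *\<^sub>R \<zeta>)) * norm (g (r *\<^sub>R \<zeta>)) / (1 - (norm (r *\<^sub>R \<zeta>))\<^sup>2)) * ennreal (rd CARD('n) r) \<partial>lborel)
       \<le> epowr (energy f \<zeta>) (1/2) * epowr (energy g \<zeta>) (1/2)" .
  qed
  finally show ?thesis .
qed

text \<open>
  The scaled form of the duality between the exponents \<open>p / (p - 1)\<close> and \<open>p\<close>; the parameter \<open>L\<close> replaces the normalization of \<open>f\<close> and \<open>g\<close>.
\<close>
lemma pairing_young:
  fixes f g :: "complex^'n \<Rightarrow> complex" and \<Omega> :: "complex^'n \<Rightarrow> real"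
  assumes [measurable]: "f \<in> borel_measurable borel" "g \<in> borel_measurable borel" "\<Omega> \<in> borel_measurable borel"
    and p: "1 < p" and L: "0 < L" and pos: "AE \<zeta> in sig. 0 < \<Omega> \<zeta>"
  shows "(\<integral>\<^sup>+z. ennreal (norm (f z) * norm (g z) / (1 - (norm z)\<^sup>2)) \<partial>nu)
    \<le> ennreal L * wenergy (p / (p - 1)) \<Omega> f + ennreal (L powr (- (p - 1))) * wenergy p (\<lambda>\<zeta>. \<Omega> \<zeta> powr (1 - p)) g"
proof -
  have "(\<integral>\<^sup>+z. ennreal (norm (f z) * norm (g z) / (1 - (norm z)\<^sup>2)) \<partial>nu)
    \<le> (\<integral>\<^sup>+\<zeta>. epowr (energy f \<zeta>) (1/2) * epowr (energy g \<zeta>) (1/2) \<partial>sig)"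
    by (rule pairing_le) measurable
  also have "\<dots> \<le> (\<integral>\<^sup>+\<zeta>. ennreal L * (epowr (energy f \<zeta>) (p / (p - 1) / 2) * ennreal (\<Omega> \<zeta>))
      + ennreal (L powr (- (p - 1))) * (epowr (energy g \<zeta>) (p / 2) * ennreal (\<Omega> \<zeta> powr (1 - p))) \<partial>sig)"
    by (rule nn_integral_mono_AE, rule eventually_mono[OF pos]) (rule weighted_young[OF p L])
  also have "\<dots> = ennreal L * wenergy (p / (p - 1)) \<Omega> f + ennreal (L powr (- (p - 1))) * wenergy p (\<lambda>\<zeta>. \<Omega> \<zeta> powr (1 - p)) g"
    unfolding wenergy_def by (subst nn_integral_add, measurable) (simp add: nn_integral_cmult)
  finally show ?thesis .
qed

lemma energy_bounded:
  fixes f :: "complex^'n \<Rightarrow> complex"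
  assumes f: "\<And>z. norm z < 1 \<Longrightarrow> norm (f z) \<le> M * (1 - (norm z)\<^sup>2)" and z: "norm \<zeta> = 1" and M: "0 \<le> M"
  shows "energy f \<zeta> \<le> ennreal (M\<^sup>2 * (2 * real CARD('n)))"
proof -
  have "energy f \<zeta> \<le> (\<integral>\<^sup>+r. ennreal (M\<^sup>2 * (2 * real CARD('n))) * indicator {0<..<1::real} r \<partial>lborel)"
    unfolding energy_def
  proof (rule nn_integral_mono)
    fix r :: real
    show "ennreal ((norm (f (r *\<^sub>R \<zeta>)))\<^sup>2 * (rd CARD('n) r / (1 - r\<^sup>2))) \<le> ennreal (M\<^sup>2 * (2 * real CARD('n))) * indicator {0<..<1} r"
    proof (cases "0 < r \<and> r < 1")
      case True
      then have r2: "0 < 1 - r\<^sup>2" "1 - r\<^sup>2 \<le> 1" by (simp_all add: power_less_one_iff)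
      have "norm (f (r *\<^sub>R \<zeta>)) \<le> M * (1 - r\<^sup>2)" using f[of "r *\<^sub>R \<zeta>"] True z by simp
      then have "(norm (f (r *\<^sub>R \<zeta>)))\<^sup>2 \<le> (M * (1 - r\<^sup>2))\<^sup>2" by (intro power_mono) auto
      then have "(norm (f (r *\<^sub>R \<zeta>)))\<^sup>2 * (rd CARD('n) r / (1 - r\<^sup>2)) \<le> (M * (1 - r\<^sup>2))\<^sup>2 * (rd CARD('n) r / (1 - r\<^sup>2))"
        by (intro mult_right_mono) auto
      also have "\<dots> = M\<^sup>2 * ((1 - r\<^sup>2) * rd CARD('n) r)"
        using r2 by (simp add: power2_eq_square)
      also have "\<dots> \<le> M\<^sup>2 * (1 * (2 * real CARD('n)))"
      proof (intro mult_left_mono mult_mono)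
        show "rd CARD('n) r \<le> 2 * real CARD('n)" using True by (simp add: rd_def mult_left_le power_le_one)
      qed (use r2 in auto)
      finally show ?thesis using True by (simp add: ennreal_leI)
    qed (auto simp: rd_def)
  qed
  also have "\<dots> = ennreal (M\<^sup>2 * (2 * real CARD('n)))"
    by (subst nn_integral_cmult_indicator) auto
  finally show ?thesis .
qed

lemma nn_integral_const_sig: "(\<integral>\<^sup>+\<zeta>. c \<partial>(sig :: (complex^'n) measure)) = c"
  using sig.emeasure_space_1[where 'n='n] by simp

text \<open>
  Pair \<open>\<phi>\<close> with \<open>1 - |z|\<^sup>2\<close>, whose square function is bounded.
\<close>
lemma integrable_of_wenergy:
  fixes \<phi> :: "complex^'n \<Rightarrow> complex" and \<omega> :: "complex^'n \<Rightarrow> real"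
  assumes [measurable]: "\<phi> \<in> borel_measurable borel" "\<omega> \<in> borel_measurable borel"
    and p: "1 < p" and pos: "AE \<zeta> in sig. 0 < \<omega> \<zeta>" and fin: "wenergy p \<omega> \<phi> < \<infinity>"
    and dual: "(\<integral>\<^sup>+\<zeta>. ennreal (\<omega> \<zeta> powr (1 - p / (p - 1))) \<partial>sig) < \<infinity>"
  shows "integrable nu \<phi>"
proof (rule integrableI_bounded)
  define q where "q = p / (p - 1)"
  have q: "1 < q" "q / (q - 1) = p" using p by (auto simp: q_def field_simps)
  define g :: "complex^'n \<Rightarrow> complex" where "g z = of_real (1 - (norm z)\<^sup>2)" for z
  have [measurable]: "g \<in> borel_measurable borel" unfolding g_def by measurable
  show "\<phi> \<in> borel_measurable nu" by measurable
  have gn: "norm (g z) = 1 - (norm z)\<^sup>2" if "norm z < 1" for z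
    using that unfolding g_def norm_of_real by (simp add: power_le_one)
  have "(\<integral>\<^sup>+z. ennreal (norm (\<phi> z)) \<partial>nu) = (\<integral>\<^sup>+z. ennreal (norm (\<phi> z) * norm (g z) / (1 - (norm z)\<^sup>2)) \<partial>nu)"
  proof (rule nn_integral_nu_cong)
    fix z :: "complex^'n" assume z: "norm z < 1 \<and> z \<noteq> 0"
    then have "1 - (norm z)\<^sup>2 > 0" by (simp add: power_less_one_iff)
    then show "ennreal (norm (\<phi> z)) = ennreal (norm (\<phi> z) * norm (g z) / (1 - (norm z)\<^sup>2))"
      using z gn[of z] by simp
  qed
  also have "\<dots> \<le> ennreal 1 * wenergy (q / (q - 1)) \<omega> \<phi> + ennreal (1 powr (- (q - 1))) * wenergy q (\<lambda>\<zeta>. \<omega> \<zeta> powr (1 - q)) g"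
    by (rule pairing_young) (use q pos in auto)
  also have "\<dots> < \<infinity>"
  proof -
    have "wenergy q (\<lambda>\<zeta>. \<omega> \<zeta> powr (1 - q)) g \<le> (\<integral>\<^sup>+\<zeta>. ennreal ((1\<^sup>2 * (2 * real CARD('n))) powr (q / 2)) * ennreal (\<omega> \<zeta> powr (1 - q)) \<partial>sig)"
      unfolding wenergy_def
    proof (rule nn_integral_sig_mono, rule mult_right_mono)
      fix \<zeta> :: "complex^'n" assume "norm \<zeta> = 1"
      then have "epowr (energy g \<zeta>) (q / 2) \<le> epowr (ennreal (1\<^sup>2 * (2 * real CARD('n)))) (q / 2)"
        using q gn by (intro epowr_mono energy_bounded) auto
      also have "\<dots> = ennreal ((1\<^sup>2 * (2 * real CARD('n))) powr (q / 2))" by (rule epowr_ennreal) simp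
      finally show "epowr (energy g \<zeta>) (q / 2) \<le> ennreal ((1\<^sup>2 * (2 * real CARD('n))) powr (q / 2))" .
    qed simp
    also have "\<dots> = ennreal ((1\<^sup>2 * (2 * real CARD('n))) powr (q / 2)) * (\<integral>\<^sup>+\<zeta>. ennreal (\<omega> \<zeta> powr (1 - q)) \<partial>sig)"
      by (rule nn_integral_cmult) measurable
    also have "\<dots> < \<infinity>" using dual by (simp add: ennreal_mult_less_top q_def)
    finally show ?thesis using fin q by (simp add: ennreal_mult_less_top)
  qed
  finally show "(\<integral>\<^sup>+z. ennreal (norm (\<phi> z)) \<partial>nu) < \<infinity>" .
qed

lemma wenergy_exhaust:
  fixes f :: "complex^'n \<Rightarrow> complex"
  assumes [measurable]: "f \<in> borel_measurable borel" "\<omega> \<in> borel_measurable borel" and p: "0 < p"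
    and B: "\<And>k. wenergy p \<omega> (\<lambda>z. if norm z \<le> 1 - 1 / real (Suc k) then f z else 0) \<le> B"
  shows "wenergy p \<omega> f \<le> B"
proof -
  define Q where "Q k z = (if norm z \<le> 1 - 1 / real (Suc k) then f z else 0)" for k :: nat and z
  have [measurable]: "Q k \<in> borel_measurable borel" for k unfolding Q_def by measurable
  have dec: "1 / real (Suc j) \<le> 1 / real (Suc i)" if "i \<le> j" for i j using that by (simp add: frac_le)
  have Qn: "norm (Q i z) \<le> norm (Q j z)" if "i \<le> j" for i j z
    using dec[OF that] by (auto simp: Q_def)
  have e_inc: "energy (Q i) \<zeta> \<le> energy (Q j) \<zeta>" if "i \<le> j" for i j \<zeta>
    unfolding energy_def using Qn[OF that] by (intro nn_integral_mono ennreal_leI mult_right_mono power_mono) auto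
  have e_sup: "energy f \<zeta> = (SUP k. energy (Q k) \<zeta>)" if z: "norm \<zeta> = 1" for \<zeta>
  proof -
    define F where "F k r = ennreal ((norm (Q k (r *\<^sub>R \<zeta>)))\<^sup>2 * (rd CARD('n) r / (1 - r\<^sup>2)))" for k r
    have "ennreal ((norm (f (r *\<^sub>R \<zeta>)))\<^sup>2 * (rd CARD('n) r / (1 - r\<^sup>2))) = (SUP k. F k r)" for r
    proof (rule antisym)
      show "(SUP k. F k r) \<le> ennreal ((norm (f (r *\<^sub>R \<zeta>)))\<^sup>2 * (rd CARD('n) r / (1 - r\<^sup>2)))"
        unfolding F_def by (intro SUP_least ennreal_leI mult_right_mono power_mono) (auto simp: Q_def)
      show "ennreal ((norm (f (r *\<^sub>R \<zeta>)))\<^sup>2 * (rd CARD('n) r / (1 - r\<^sup>2))) \<le> (SUP k. F k r)"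
      proof (cases "0 < r \<and> r < 1")
        case True
        then obtain k where "1 / real (Suc k) < 1 - r" using nat_approx_posE[of "1 - r"] by auto
        then have "F k r = ennreal ((norm (f (r *\<^sub>R \<zeta>)))\<^sup>2 * (rd CARD('n) r / (1 - r\<^sup>2)))"
          using True z by (simp add: F_def Q_def)
        then show ?thesis by (metis SUP_upper UNIV_I)
      qed (auto simp: rd_def)
    qed
    then have "energy f \<zeta> = (\<integral>\<^sup>+r. (SUP k. F k r) \<partial>lborel)" by (simp add: energy_def)
    also have "\<dots> = (SUP k. \<integral>\<^sup>+r. F k r \<partial>lborel)"
    proof (rule nn_integral_monotone_convergence_SUP)
      show "incseq F"
        unfolding incseq_def le_fun_def F_def using Qn by (intro allI impI ennreal_leI mult_right_mono power_mono) auto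
      show "F k \<in> borel_measurable lborel" for k unfolding F_def by measurable
    qed
    finally show ?thesis by (simp add: F_def energy_def)
  qed
  have "wenergy p \<omega> f = (\<integral>\<^sup>+\<zeta>. (SUP k. epowr (energy (Q k) \<zeta>) (p / 2) * ennreal (\<omega> \<zeta>)) \<partial>sig)"
    unfolding wenergy_def
  proof (rule nn_integral_sig_cong)
    fix \<zeta> :: "complex^'n" assume "norm \<zeta> = 1"
    then show "epowr (energy f \<zeta>) (p / 2) * ennreal (\<omega> \<zeta>) = (SUP k. epowr (energy (Q k) \<zeta>) (p / 2) * ennreal (\<omega> \<zeta>))"
      using p by (simp add: e_sup epowr_SUP SUP_mult_right_ennreal)
  qed
  also have "\<dots> = (SUP k. wenergy p \<omega> (Q k))"
    unfolding wenergy_def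
  proof (rule nn_integral_monotone_convergence_SUP)
    show "incseq (\<lambda>k \<zeta>. epowr (energy (Q k) \<zeta>) (p / 2) * ennreal (\<omega> \<zeta>))"
      unfolding incseq_def le_fun_def using e_inc p by (intro allI impI mult_right_mono epowr_mono) auto
  qed measurable
  also have "\<dots> \<le> B" by (rule SUP_least) (use B in \<open>simp add: Q_def[abs_def]\<close>)
  finally show ?thesis .
qed

lemma kfun_cnj: "cnj (kfun n (hdot z w)) = kfun n (hdot w z)"
  by (simp add: kfun_def hdot_commute[of w z])

lemma kfun_bound_cball:
  fixes z w :: "complex^'n"
  assumes "norm z \<le> \<rho>" "\<rho> < 1" "norm w < 1"
  shows "norm (kfun CARD('n) (hdot z w)) \<le> 2 * (1 - \<rho>) powr (- (real CARD('n) + 2))"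
proof -
  have "norm (kfun CARD('n) (hdot z w)) \<le> 2 * kern z w" using assms by (intro kfun_bound) auto
  also have "\<dots> \<le> 2 * (1 - \<rho>) powr (- (real CARD('n) + 2))"
    using norm_one_minus_hdot_ge'[OF assms(3,1)] assms by (intro mult_left_mono powr_mono2') auto
  finally show ?thesis .
qed

text \<open>
  The kernel is Hermitian. Off the support of \<open>\<psi>\<close> nothing is integrated, so the kernel is bounded and Fubini's theorem applies.
\<close>
lemma Sop_adjoint:
  fixes \<phi> \<psi> :: "complex^'n \<Rightarrow> complex"
  assumes \<phi>: "integrable nu \<phi>" and \<psi>: "integrable nu \<psi>" and \<rho>: "\<rho> < 1"
    and supp: "\<And>z. \<psi> z \<noteq> 0 \<Longrightarrow> norm z \<le> \<rho>"
  shows "(LINT z|nu. Sop \<phi> z * cnj (\<psi> z)) = (LINT w|nu. \<phi> w * cnj (Sop \<psi> w))"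
proof -
  have [measurable]: "\<phi> \<in> borel_measurable borel" "\<psi> \<in> borel_measurable borel"
    using \<phi> \<psi> by (simp_all add: borel_measurable_integrable)
  have [measurable]: "cnj \<in> borel_measurable borel"
    by (intro borel_measurable_continuous_onI continuous_intros)
  define K where "K = 2 * (1 - \<rho>) powr (- (real CARD('n) + 2))"
  have K: "K \<ge> 0" by (simp add: K_def)
  define H where "H z w = \<phi> w * kfun CARD('n) (hdot z w) * cnj (\<psi> z)" for z w
  have Hm: "(\<lambda>(z, w). H z w) \<in> borel_measurable (nu \<Otimes>\<^sub>M nu)"
    unfolding H_def by measurable
  have Hb: "norm (H z w) \<le> K * norm (\<phi> w) * norm (\<psi> z)" if "norm w < 1" for z w
  proof (cases "\<psi> z = 0")
    case False
    then have "norm (kfun CARD('n) (hdot z w)) \<le> K"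
      unfolding K_def using supp \<rho> that by (intro kfun_bound_cball) auto
    then have "norm (kfun CARD('n) (hdot z w)) * (norm (\<phi> w) * norm (\<psi> z)) \<le> K * (norm (\<phi> w) * norm (\<psi> z))"
      by (intro mult_right_mono) auto
    then show ?thesis by (simp add: H_def norm_mult mult_ac)
  qed (simp add: H_def)
  have "integrable (nu \<Otimes>\<^sub>M nu) (\<lambda>(z, w). H z w)"
  proof (rule integrableI_bounded[OF Hm])
    have "(\<integral>\<^sup>+x. ennreal (norm (case x of (z, w) \<Rightarrow> H z w)) \<partial>(nu \<Otimes>\<^sub>M nu)) = (\<integral>\<^sup>+z. (\<integral>\<^sup>+w. ennreal (norm (H z w)) \<partial>nu) \<partial>nu)"
      using Hm by (subst nu.nn_integral_fst[symmetric]) auto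
    also have "\<dots> \<le> (\<integral>\<^sup>+z. (\<integral>\<^sup>+w. (ennreal K * ennreal (norm (\<psi> z))) * ennreal (norm (\<phi> w)) \<partial>nu) \<partial>nu)"
    proof (intro nn_integral_mono nn_integral_mono_AE, rule AE_mp[OF AE_nu_in_ball], intro AE_I2 impI)
      fix z w :: "complex^'n" assume "norm w < 1 \<and> w \<noteq> 0"
      then have "ennreal (norm (H z w)) \<le> ennreal (K * norm (\<psi> z) * norm (\<phi> w))"
        using Hb[of w z] by (intro ennreal_leI) (simp add: mult_ac)
      also have "\<dots> = (ennreal K * ennreal (norm (\<psi> z))) * ennreal (norm (\<phi> w))"
        by (rule ennreal_mult_triple) (use K in auto)
      finally show "ennreal (norm (H z w)) \<le> (ennreal K * ennreal (norm (\<psi> z))) * ennreal (norm (\<phi> w))" .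
    qed
    also have "\<dots> = (\<integral>\<^sup>+z. (ennreal K * ennreal (norm (\<psi> z))) * (\<integral>\<^sup>+w. ennreal (norm (\<phi> w)) \<partial>nu) \<partial>nu)"
      by (intro nn_integral_cong nn_integral_cmult) measurable
    also have "\<dots> = ennreal K * (\<integral>\<^sup>+z. ennreal (norm (\<psi> z)) \<partial>nu) * (\<integral>\<^sup>+w. ennreal (norm (\<phi> w)) \<partial>nu)"
      by (subst nn_integral_multc, measurable) (simp add: nn_integral_cmult)
    also have "\<dots> < \<infinity>"
    proof -
      have "(\<integral>\<^sup>+z. ennreal (norm (\<psi> z)) \<partial>nu) < \<infinity>" "(\<integral>\<^sup>+w. ennreal (norm (\<phi> w)) \<partial>nu) < \<infinity>"
        using \<phi> \<psi> unfolding integrable_iff_bounded by blast+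
      then show ?thesis by (simp add: ennreal_mult_less_top)
    qed
    finally show "(\<integral>\<^sup>+x. ennreal (norm (case x of (z, w) \<Rightarrow> H z w)) \<partial>(nu \<Otimes>\<^sub>M nu)) < \<infinity>" .
  qed
  then have F: "(LINT w|nu. LINT z|nu. H z w) = (LINT z|nu. LINT w|nu. H z w)"
    by (rule nu_nu.Fubini_integral)
  have "(LINT z|nu. Sop \<phi> z * cnj (\<psi> z)) = (LINT z|nu. LINT w|nu. H z w)"
    unfolding Sop_def H_def by (simp only: integral_mult_left_zero)
  also have "\<dots> = (LINT w|nu. LINT z|nu. H z w)" by (rule F[symmetric])
  also have "\<dots> = (LINT w|nu. \<phi> w * cnj (Sop \<psi> w))"
  proof (rule Bochner_Integration.integral_cong[OF refl])
    fix w :: "complex^'n"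
    have "(LINT z|nu. H z w) = (LINT z|nu. \<phi> w * cnj (\<psi> z * kfun CARD('n) (hdot w z)))"
    proof (rule Bochner_Integration.integral_cong[OF refl])
      fix z
      have "cnj (kfun CARD('n) (hdot w z)) = kfun CARD('n) (hdot z w)" by (rule kfun_cnj)
      then show "H z w = \<phi> w * cnj (\<psi> z * kfun CARD('n) (hdot w z))"
        unfolding H_def complex_cnj_mult by (simp only: mult_ac)
    qed
    also have "\<dots> = \<phi> w * (LINT z|nu. cnj (\<psi> z * kfun CARD('n) (hdot w z)))"
      by (rule integral_mult_right_zero)
    also have "(LINT z|nu. cnj (\<psi> z * kfun CARD('n) (hdot w z))) = cnj (Sop \<psi> w)"
      unfolding Sop_def by (rule Bochner_Integration.integral_cnj)
    finally show "(LINT z|nu. H z w) = \<phi> w * cnj (Sop \<psi> w)" .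
  qed
  finally show ?thesis .
qed

lemma norm_integral_le_nn_integral:
  fixes f :: "'a \<Rightarrow> complex"
  shows "ennreal (norm (integral\<^sup>L M f)) \<le> (\<integral>\<^sup>+x. ennreal (norm (f x)) \<partial>M)"
proof (cases "integrable M f")
  case True
  then show ?thesis by (rule integral_norm_bound_ennreal)
qed (simp add: not_integrable_integral_eq)

text \<open>
  Let \<open>G\<close> be the square function of the truncation \<open>Q\<close> of \<open>T \<phi>\<close>. Test \<open>T \<phi>\<close> against the extremal function
  \<open>\<psi> = Q G powr (P - 2) \<Omega>\<close> of the duality, in which the last two factors are constant on radii: the pairing of \<open>Q\<close> with
  \<open>\<psi>\<close>, the weighted moment of \<open>Q\<close> and the dual moment of \<open>\<psi>\<close> are the same number \<open>X\<close>. The truncation makes \<open>X\<close>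
  finite, so that half of it can be absorbed; this costs the factor two.
\<close>
lemma wenergy_duality_truncated:
  fixes \<phi> :: "complex^'n \<Rightarrow> complex" and \<Omega> :: "complex^'n \<Rightarrow> real"
  assumes [measurable]: "\<Omega> \<in> borel_measurable borel" and p: "1 < p" and P: "P = p / (p - 1)"
    and pos: "AE \<zeta> in sig. 0 < \<Omega> \<zeta>"
    and fin: "(\<integral>\<^sup>+\<zeta>. ennreal (\<Omega> \<zeta>) \<partial>sig) < \<infinity>"
    and N: "0 < N"
    and T: "\<And>\<psi> :: complex^'n \<Rightarrow> complex. integrable nu \<psi> \<Longrightarrow> wenergy p (\<lambda>\<zeta>. \<Omega> \<zeta> powr (1 - p)) \<psi> < \<infinity> \<Longrightarrow>
      wenergy p (\<lambda>\<zeta>. \<Omega> \<zeta> powr (1 - p)) (Top \<psi>) \<le> ennreal (N powr p) * wenergy p (\<lambda>\<zeta>. \<Omega> \<zeta> powr (1 - p)) \<psi>"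
    and \<phi>: "integrable nu \<phi>" and \<rho>: "\<rho> < 1"
  shows "wenergy P \<Omega> (\<lambda>z. if norm z \<le> \<rho> then Top \<phi> z else 0) \<le> ennreal ((2 * N) powr P) * wenergy P \<Omega> \<phi>"
proof -
  have \<phi>m [measurable]: "\<phi> \<in> borel_measurable borel" using \<phi> by (simp add: borel_measurable_integrable)
  define \<omega> where "\<omega> = (\<lambda>\<zeta>. \<Omega> \<zeta> powr (1 - p))"
  have \<omega>m [measurable]: "\<omega> \<in> borel_measurable borel" unfolding \<omega>_def by measurable
  have P1: "P > 1" "P - 1 = 1 / (p - 1)" "(P - 1) * p = P" using p by (auto simp: P field_simps)
  define Q where "Q z = (if norm z \<le> \<rho> then Top \<phi> z else 0)" for z
  have Qm [measurable]: "Q \<in> borel_measurable borel" unfolding Q_def by measurable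
  define M where "M = (LINT w|nu. norm (\<phi> w)) * (2 * (1 - \<rho>) powr (- (real CARD('n) + 2)))"
  have M: "M \<ge> 0" by (simp add: M_def)
  have Sb: "norm (Sop \<phi> z) \<le> M" if z: "norm z \<le> \<rho>" for z
  proof -
    have "norm (Sop \<phi> z) \<le> (LINT w|nu. norm (\<phi> w * kfun CARD('n) (hdot z w)))"
      unfolding Sop_def by (rule integral_norm_bound)
    also have "\<dots> \<le> (LINT w|nu. norm (\<phi> w) * (2 * (1 - \<rho>) powr (- (real CARD('n) + 2))))"
    proof (rule integral_mono_AE)
      show "integrable nu (\<lambda>w. norm (\<phi> w * kfun CARD('n) (hdot z w)))"
        by (intro integrable_norm integrable_kernel[OF \<phi>, where B = "2 * (1 - \<rho>) powr (- (real CARD('n) + 2))"] kfun_bound_cball z \<rho>)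
          measurable
      show "integrable nu (\<lambda>w. norm (\<phi> w) * (2 * (1 - \<rho>) powr (- (real CARD('n) + 2))))"
        using \<phi> by (intro integrable_mult_left integrable_norm) auto
      show "AE w in nu. norm (\<phi> w * kfun CARD('n) (hdot z w)) \<le> norm (\<phi> w) * (2 * (1 - \<rho>) powr (- (real CARD('n) + 2)))"
      proof (rule AE_mp[OF AE_nu_in_ball], intro AE_I2 impI)
        fix w :: "complex^'n" assume "norm w < 1 \<and> w \<noteq> 0"
        then show "norm (\<phi> w * kfun CARD('n) (hdot z w)) \<le> norm (\<phi> w) * (2 * (1 - \<rho>) powr (- (real CARD('n) + 2)))"
          unfolding norm_mult by (intro mult_left_mono kfun_bound_cball z \<rho>) auto
      qed
    qed
    also have "\<dots> = M" unfolding M_def by (rule integral_mult_left_zero)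
    finally show ?thesis .
  qed
  have Qb: "norm (Q z) \<le> M * (1 - (norm z)\<^sup>2)" if "norm z < 1" for z
  proof -
    have r2: "0 \<le> 1 - (norm z)\<^sup>2" using that by (simp add: power_le_one)
    show ?thesis
    proof (cases "norm z \<le> \<rho>")
      case True
      have "norm (Q z) = (1 - (norm z)\<^sup>2) * norm (Sop \<phi> z)"
        using True r2 by (simp add: Q_def Top_def norm_mult del: of_real_diff of_real_power)
      also have "\<dots> \<le> (1 - (norm z)\<^sup>2) * M" using Sb[OF True] r2 by (rule mult_left_mono)
      finally show ?thesis by (simp add: mult.commute)
    next
      case False
      then show ?thesis using M r2 by (simp add: Q_def)
    qed
  qed
  define B where "B = M\<^sup>2 * (2 * real CARD('n))"
  have B: "B \<ge> 0" by (simp add: B_def)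
  have eQ: "energy Q \<zeta> \<le> ennreal B" if "norm \<zeta> = 1" for \<zeta>
    unfolding B_def by (rule energy_bounded) (use Qb M that in auto)
  define G where "G \<zeta> = sqrt (enn2real (energy Q \<zeta>))" for \<zeta>
  have Gm [measurable]: "G \<in> borel_measurable borel" unfolding G_def by measurable
  have G0: "G \<zeta> \<ge> 0" for \<zeta> by (simp add: G_def)
  have eG: "energy Q \<zeta> = ennreal ((G \<zeta>)\<^sup>2)" if "norm \<zeta> = 1" for \<zeta>
  proof -
    have "energy Q \<zeta> < top" using eQ[OF that] by (rule order_le_less_trans) simp
    then show ?thesis by (simp add: G_def)
  qed
  define c where "c \<zeta> = G \<zeta> powr (P - 2) * \<Omega> \<zeta>" for \<zeta>
  have cm [measurable]: "c \<in> borel_measurable borel" unfolding c_def by measurable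
  have cG: "c \<zeta> * G \<zeta> = G \<zeta> powr (P - 1) * \<Omega> \<zeta>" "(G \<zeta>)\<^sup>2 * c \<zeta> = G \<zeta> powr P * \<Omega> \<zeta>" for \<zeta>
  proof -
    have "G \<zeta> powr (P - 2) * G \<zeta> = G \<zeta> powr (P - 1)"
    proof (cases "G \<zeta> = 0")
      case False
      then have "G \<zeta> > 0" using G0[of \<zeta>] by simp
      then have "G \<zeta> powr (P - 2) * G \<zeta> powr 1 = G \<zeta> powr (P - 1)" unfolding powr_add[symmetric] by simp
      then show ?thesis using \<open>G \<zeta> > 0\<close> by simp
    qed simp
    then show "c \<zeta> * G \<zeta> = G \<zeta> powr (P - 1) * \<Omega> \<zeta>" by (simp add: c_def mult_ac)
    have "(G \<zeta>)\<^sup>2 * G \<zeta> powr (P - 2) = G \<zeta> powr P"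
    proof (cases "G \<zeta> = 0")
      case False
      then have "G \<zeta> > 0" using G0[of \<zeta>] by simp
      then have "G \<zeta> powr 2 * G \<zeta> powr (P - 2) = G \<zeta> powr P" unfolding powr_add[symmetric] by simp
      then show ?thesis using \<open>G \<zeta> > 0\<close> by simp
    qed simp
    then show "(G \<zeta>)\<^sup>2 * c \<zeta> = G \<zeta> powr P * \<Omega> \<zeta>" by (simp add: c_def flip: mult.assoc)
  qed
  define \<psi> where "\<psi> z = Q z * of_real (c (sgn z))" for z
  have \<psi>m [measurable]: "\<psi> \<in> borel_measurable borel" unfolding \<psi>_def by measurable
  define X where "X = (\<integral>\<^sup>+\<zeta>. ennreal (G \<zeta> powr P * \<Omega> \<zeta>) \<partial>sig)"
  have XQ: "wenergy P \<Omega> Q = X"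
    unfolding wenergy_def X_def
  proof (rule nn_integral_sig_cong)
    fix \<zeta> :: "complex^'n" assume z: "norm \<zeta> = 1"
    have "((G \<zeta>)\<^sup>2) powr (P / 2) = G \<zeta> powr P"
      using G0[of \<zeta>] by (cases "G \<zeta> = 0") (auto simp: powr_powr simp flip: powr_numeral)
    then show "epowr (energy Q \<zeta>) (P / 2) * ennreal (\<Omega> \<zeta>) = ennreal (G \<zeta> powr P * \<Omega> \<zeta>)"
      unfolding eG[OF z] by (simp add: epowr_ennreal ennreal_mult')
  qed
  have Xfin: "X < \<infinity>"
  proof -
    have "X \<le> (\<integral>\<^sup>+\<zeta>. ennreal (B powr (P / 2)) * ennreal (\<Omega> \<zeta>) \<partial>sig)"
      unfolding XQ[symmetric] wenergy_def
    proof (rule nn_integral_sig_mono, rule mult_right_mono)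
      fix \<zeta> :: "complex^'n" assume "norm \<zeta> = 1"
      then have "epowr (energy Q \<zeta>) (P / 2) \<le> epowr (ennreal B) (P / 2)"
        using P1 by (intro epowr_mono eQ) auto
      then show "epowr (energy Q \<zeta>) (P / 2) \<le> ennreal (B powr (P / 2))" using B by (simp add: epowr_ennreal)
    qed simp
    also have "\<dots> = ennreal (B powr (P / 2)) * (\<integral>\<^sup>+\<zeta>. ennreal (\<Omega> \<zeta>) \<partial>sig)"
      by (rule nn_integral_cmult) measurable
    also have "\<dots> < \<infinity>" using fin by (simp add: ennreal_mult_less_top)
    finally show ?thesis .
  qed
  have e\<psi>: "energy \<psi> \<zeta> = ennreal ((c \<zeta> * G \<zeta>)\<^sup>2)" if z: "norm \<zeta> = 1" for \<zeta>
  proof -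
    have "energy \<psi> \<zeta> = (\<integral>\<^sup>+r. ennreal ((c \<zeta>)\<^sup>2) * ennreal ((norm (Q (r *\<^sub>R \<zeta>)))\<^sup>2 * (rd CARD('n) r / (1 - r\<^sup>2))) \<partial>lborel)"
      unfolding energy_def
    proof (rule nn_integral_cong)
      fix r :: real
      show "ennreal ((norm (\<psi> (r *\<^sub>R \<zeta>)))\<^sup>2 * (rd CARD('n) r / (1 - r\<^sup>2))) = ennreal ((c \<zeta>)\<^sup>2) * ennreal ((norm (Q (r *\<^sub>R \<zeta>)))\<^sup>2 * (rd CARD('n) r / (1 - r\<^sup>2)))"
      proof (cases "0 < r")
        case True
        then have "norm (\<psi> (r *\<^sub>R \<zeta>)) = norm (Q (r *\<^sub>R \<zeta>)) * \<bar>c \<zeta>\<bar>"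
          using z by (simp add: \<psi>_def sgn_scaleR_unit norm_mult)
        then have "(norm (\<psi> (r *\<^sub>R \<zeta>)))\<^sup>2 * (rd CARD('n) r / (1 - r\<^sup>2)) = (c \<zeta>)\<^sup>2 * ((norm (Q (r *\<^sub>R \<zeta>)))\<^sup>2 * (rd CARD('n) r / (1 - r\<^sup>2)))"
          by (simp add: power_mult_distrib)
        then show ?thesis by (simp only: ennreal_mult' zero_le_power2)
      qed (simp add: rd_def)
    qed
    also have "\<dots> = ennreal ((c \<zeta>)\<^sup>2) * energy Q \<zeta>"
      unfolding energy_def by (rule nn_integral_cmult) measurable
    also have "\<dots> = ennreal ((c \<zeta> * G \<zeta>)\<^sup>2)"
      unfolding eG[OF z] by (simp add: power_mult_distrib ennreal_mult)
    finally show ?thesis .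
  qed
  have X\<psi>: "wenergy p \<omega> \<psi> = X"
    unfolding wenergy_def X_def
  proof (rule nn_integral_cong_AE, rule AE_mp[OF AE_sig_norm], rule AE_mp[OF pos], intro AE_I2 impI)
    fix \<zeta> :: "complex^'n" assume z: "norm \<zeta> = 1" and o: "0 < \<Omega> \<zeta>"
    define s where "s = G \<zeta> powr (P - 1) * \<Omega> \<zeta>"
    have s: "s \<ge> 0" using o by (simp add: s_def)
    have "(s\<^sup>2) powr (p / 2) = s powr p"
      using s by (cases "s = 0") (auto simp: powr_powr simp flip: powr_numeral)
    also have "\<dots> = G \<zeta> powr P * \<Omega> \<zeta> powr p"
      using o G0[of \<zeta>] P1 by (simp add: s_def powr_mult powr_powr)
    finally have "(s\<^sup>2) powr (p / 2) * \<Omega> \<zeta> powr (1 - p) = G \<zeta> powr P * (\<Omega> \<zeta> powr p * \<Omega> \<zeta> powr (1 - p))" by simp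
    also have "\<Omega> \<zeta> powr p * \<Omega> \<zeta> powr (1 - p) = \<Omega> \<zeta>" using o unfolding powr_add[symmetric] by simp
    finally have "(s\<^sup>2) powr (p / 2) * \<Omega> \<zeta> powr (1 - p) = G \<zeta> powr P * \<Omega> \<zeta>" .
    then show "epowr (energy \<psi> \<zeta>) (p / 2) * ennreal (\<omega> \<zeta>) = ennreal (G \<zeta> powr P * \<Omega> \<zeta>)"
      unfolding e\<psi>[OF z] cG(1) s_def[symmetric] \<omega>_def by (simp add: epowr_ennreal ennreal_mult[symmetric])
  qed
  have \<omega>pos: "AE \<zeta> in sig. 0 < \<omega> \<zeta>"
    using pos by (rule eventually_mono) (simp add: \<omega>_def)
  have \<psi>: "integrable nu \<psi>"
  proof (rule integrable_of_wenergy[OF \<psi>m \<omega>m p \<omega>pos])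
    show "wenergy p \<omega> \<psi> < \<infinity>" using X\<psi> Xfin by simp
    have "(\<integral>\<^sup>+\<zeta>. ennreal (\<omega> \<zeta> powr (1 - p / (p - 1))) \<partial>sig) = (\<integral>\<^sup>+\<zeta>. ennreal (\<Omega> \<zeta>) \<partial>sig)"
    proof (rule nn_integral_cong_AE, rule AE_mp[OF pos], intro AE_I2 impI)
      fix \<zeta> :: "complex^'n" assume "0 < \<Omega> \<zeta>"
      moreover have "(1 - p) * (1 - p / (p - 1)) = 1" using p by (simp add: field_simps)
      ultimately show "ennreal (\<omega> \<zeta> powr (1 - p / (p - 1))) = ennreal (\<Omega> \<zeta>)"
        by (simp add: \<omega>_def powr_powr)
    qed
    then show "(\<integral>\<^sup>+\<zeta>. ennreal (\<omega> \<zeta> powr (1 - p / (p - 1))) \<partial>sig) < \<infinity>" using fin by simp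
  qed
  define h where "h z = (norm (Q z))\<^sup>2 / (1 - (norm z)\<^sup>2) * c (sgn z)" for z
  have hm [measurable]: "h \<in> borel_measurable borel" unfolding h_def by measurable
  have Xh: "X = (\<integral>\<^sup>+z. ennreal (h z) \<partial>nu)"
  proof -
    have "(\<integral>\<^sup>+z. ennreal (h z) \<partial>nu) = (\<integral>\<^sup>+\<zeta>. (\<integral>\<^sup>+r. ennreal (h (r *\<^sub>R \<zeta>)) * ennreal (rd CARD('n) r) \<partial>lborel) \<partial>sig)"
      by (rule polar) measurable
    also have "\<dots> = X"
      unfolding X_def
    proof (rule nn_integral_cong_AE, rule AE_mp[OF AE_sig_norm], rule AE_mp[OF pos], intro AE_I2 impI)
      fix \<zeta> :: "complex^'n" assume z: "norm \<zeta> = 1" and o: "0 < \<Omega> \<zeta>"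
      have c0: "c \<zeta> \<ge> 0" using o by (simp add: c_def)
      have "(\<integral>\<^sup>+r. ennreal (h (r *\<^sub>R \<zeta>)) * ennreal (rd CARD('n) r) \<partial>lborel)
        = (\<integral>\<^sup>+r. ennreal ((norm (Q (r *\<^sub>R \<zeta>)))\<^sup>2 * (rd CARD('n) r / (1 - r\<^sup>2))) * ennreal (c \<zeta>) \<partial>lborel)"
      proof (rule nn_integral_cong)
        fix r :: real
        show "ennreal (h (r *\<^sub>R \<zeta>)) * ennreal (rd CARD('n) r) = ennreal ((norm (Q (r *\<^sub>R \<zeta>)))\<^sup>2 * (rd CARD('n) r / (1 - r\<^sup>2))) * ennreal (c \<zeta>)"
        proof (cases "0 < r \<and> r < 1")
          case True
          then have r2: "r\<^sup>2 < 1" by (simp add: power_less_one_iff)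
          have "h (r *\<^sub>R \<zeta>) = (norm (Q (r *\<^sub>R \<zeta>)))\<^sup>2 / (1 - r\<^sup>2) * c \<zeta>"
            using True z by (simp add: h_def sgn_scaleR_unit)
          then have "ennreal (h (r *\<^sub>R \<zeta>)) * ennreal (rd CARD('n) r) = ennreal ((norm (Q (r *\<^sub>R \<zeta>)))\<^sup>2 / (1 - r\<^sup>2) * c \<zeta>) * ennreal (rd CARD('n) r)"
            by (simp only:)
          also have "\<dots> = ennreal ((norm (Q (r *\<^sub>R \<zeta>)))\<^sup>2 / (1 - r\<^sup>2) * c \<zeta> * rd CARD('n) r)"
            using r2 c0 by (intro ennreal_mult[symmetric]) auto
          also have "(norm (Q (r *\<^sub>R \<zeta>)))\<^sup>2 / (1 - r\<^sup>2) * c \<zeta> * rd CARD('n) r = ((norm (Q (r *\<^sub>R \<zeta>)))\<^sup>2 * (rd CARD('n) r / (1 - r\<^sup>2))) * c \<zeta>"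
            by simp
          also have "ennreal \<dots> = ennreal ((norm (Q (r *\<^sub>R \<zeta>)))\<^sup>2 * (rd CARD('n) r / (1 - r\<^sup>2))) * ennreal (c \<zeta>)"
            by (intro ennreal_mult mult_nonneg_nonneg zero_le_power2 radial_weight_nonneg c0)
          finally show ?thesis .
        qed (auto simp: rd_def)
      qed
      also have "\<dots> = energy Q \<zeta> * ennreal (c \<zeta>)"
        unfolding energy_def by (rule nn_integral_multc) measurable
      also have "\<dots> = ennreal ((G \<zeta>)\<^sup>2 * c \<zeta>)"
        unfolding eG[OF z] using c0 by (simp add: ennreal_mult)
      finally show "(\<integral>\<^sup>+r. ennreal (h (r *\<^sub>R \<zeta>)) * ennreal (rd CARD('n) r) \<partial>lborel) = ennreal (G \<zeta> powr P * \<Omega> \<zeta>)"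
        unfolding cG(2) .
    qed
    finally show ?thesis by simp
  qed
  have h0: "AE z in nu. 0 \<le> h z"
  proof (rule AE_mp[OF AE_nu_in_ball], rule AE_mp[OF AE_sig_nu[OF pos]], intro AE_I2 impI)
    fix z :: "complex^'n" assume "norm z < 1 \<and> z \<noteq> 0" "0 < \<Omega> (sgn z)"
    then show "0 \<le> h z" by (simp add: h_def c_def power_le_one)
  qed
  have hint: "integrable nu h"
    by (rule integrableI_nonneg) (use h0 Xfin Xh in auto)
  have Xr: "X = ennreal (LINT z|nu. h z)"
    unfolding Xh by (rule nn_integral_eq_integral[OF hint h0])
  have "complex_of_real (LINT z|nu. h z) = (LINT z|nu. complex_of_real (h z))"
    by (rule integral_complex_of_real[symmetric])
  also have "\<dots> = (LINT z|nu. Sop \<phi> z * cnj (\<psi> z))"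
  proof (rule integral_cong_AE)
    show "AE z in nu. complex_of_real (h z) = Sop \<phi> z * cnj (\<psi> z)"
    proof (rule AE_mp[OF AE_nu_in_ball], intro AE_I2 impI)
      fix z :: "complex^'n" assume z: "norm z < 1 \<and> z \<noteq> 0"
      then have r2: "(norm z)\<^sup>2 < 1" by (simp add: power_less_one_iff)
      show "complex_of_real (h z) = Sop \<phi> z * cnj (\<psi> z)"
      proof (cases "norm z \<le> \<rho>")
        case True
        define t where "t = 1 - (norm z)\<^sup>2"
        have t: "t \<noteq> 0" using r2 by (simp add: t_def)
        have Qz: "Q z = of_real t * Sop \<phi> z" using True by (simp add: Q_def Top_def t_def)
        have "complex_of_real ((norm (Q z))\<^sup>2) = Q z * cnj (Q z)" by (rule complex_norm_square)
        then have "complex_of_real ((norm (Q z))\<^sup>2) = of_real t * (Sop \<phi> z * cnj (Q z))"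
          by (simp only: Qz mult.assoc)
        then have "complex_of_real ((norm (Q z))\<^sup>2) / of_real t = Sop \<phi> z * cnj (Q z)"
          using t by simp
        then show ?thesis
          unfolding h_def \<psi>_def t_def[symmetric] of_real_mult of_real_divide complex_cnj_mult complex_cnj_complex_of_real
          by (simp only: mult.assoc)
      qed (simp add: h_def \<psi>_def Q_def)
    qed
    have [measurable]: "cnj \<in> borel_measurable borel"
      by (intro borel_measurable_continuous_onI continuous_intros)
    show "(\<lambda>z. Sop \<phi> z * cnj (\<psi> z)) \<in> borel_measurable nu" by measurable
  qed measurable
  also have "\<dots> = (LINT w|nu. \<phi> w * cnj (Sop \<psi> w))"
    by (rule Sop_adjoint[OF \<phi> \<psi> \<rho>]) (auto simp: \<psi>_def Q_def split: if_splits)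
  finally have eq: "complex_of_real (LINT z|nu. h z) = (LINT w|nu. \<phi> w * cnj (Sop \<psi> w))" .
  have "(LINT z|nu. h z) \<le> norm (complex_of_real (LINT z|nu. h z))" by simp
  then have "X \<le> ennreal (norm (LINT w|nu. \<phi> w * cnj (Sop \<psi> w)))"
    unfolding Xr eq by (rule ennreal_leI)
  also have "\<dots> \<le> (\<integral>\<^sup>+w. ennreal (norm (\<phi> w * cnj (Sop \<psi> w))) \<partial>nu)"
    by (rule norm_integral_le_nn_integral)
  also have "\<dots> = (\<integral>\<^sup>+w. ennreal (norm (\<phi> w) * norm (Top \<psi> w) / (1 - (norm w)\<^sup>2)) \<partial>nu)"
  proof (rule nn_integral_nu_cong)
    fix w :: "complex^'n" assume "norm w < 1 \<and> w \<noteq> 0"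
    then have r2: "0 < 1 - (norm w)\<^sup>2" by (simp add: power_less_one_iff)
    have "norm (Top \<psi> w) = (1 - (norm w)\<^sup>2) * norm (Sop \<psi> w)"
      unfolding Top_def norm_mult norm_of_real using r2 by simp
    then have "norm (\<phi> w) * norm (Top \<psi> w) / (1 - (norm w)\<^sup>2) = norm (\<phi> w * cnj (Sop \<psi> w))"
      using r2 by (simp add: norm_mult)
    then show "ennreal (norm (\<phi> w * cnj (Sop \<psi> w))) = ennreal (norm (\<phi> w) * norm (Top \<psi> w) / (1 - (norm w)\<^sup>2))"
      by (simp only:)
  qed
  also have "\<dots> \<le> ennreal L * wenergy P \<Omega> \<phi> + ennreal (L powr (- (p - 1))) * wenergy p \<omega> (Top \<psi>)" if "0 < L" for L
    unfolding P \<omega>_def by (rule pairing_young) (use p pos that in auto)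
  finally have main: "X \<le> ennreal L * wenergy P \<Omega> \<phi> + ennreal (L powr (- (p - 1))) * wenergy p \<omega> (Top \<psi>)" if "0 < L" for L
    using that by blast
  have TX: "wenergy p \<omega> (Top \<psi>) \<le> ennreal (N powr p) * X"
    using T[OF \<psi>] X\<psi> Xfin by (simp add: \<omega>_def)
  \<comment> \<open>This \<open>L\<close> makes the coefficient of \<open>X\<close> on the right-hand side equal to one half.\<close>
  define L where "L = (2 * N powr p) powr (P - 1)"
  have L: "L > 0" using N by (simp add: L_def)
  have LN: "L powr (- (p - 1)) * N powr p = 1 / 2"
  proof -
    have "(P - 1) * (p - 1) = 1" using p by (simp add: P1)
    then have 1: "L powr (p - 1) = 2 * N powr p" using N by (simp add: L_def powr_powr)
    have "L powr (- (p - 1)) = inverse (2 * N powr p)" unfolding 1[symmetric] by (rule powr_minus)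
    then have "L powr (- (p - 1)) * N powr p = inverse (2 * N powr p) * N powr p" by (simp only:)
    then show ?thesis using N by simp
  qed
  have "X \<le> ennreal L * wenergy P \<Omega> \<phi> + ennreal (L powr (- (p - 1))) * (ennreal (N powr p) * X)"
    using main[OF L] mult_left_mono[OF TX, of "ennreal (L powr (- (p - 1)))"]
    by (meson add_left_mono order_trans zero_le)
  also have "ennreal (L powr (- (p - 1))) * (ennreal (N powr p) * X) = ennreal (1/2) * X"
    unfolding LN[symmetric] by (simp add: ennreal_mult mult.assoc)
  finally have half: "X \<le> ennreal L * wenergy P \<Omega> \<phi> + ennreal (1/2) * X" .
  have "X \<le> ennreal 2 * (ennreal L * wenergy P \<Omega> \<phi>)"
    by (rule ennreal_absorb_half[OF Xfin half])
  also have "\<dots> = ennreal ((2 * N) powr P) * wenergy P \<Omega> \<phi>"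
  proof -
    have "p * (P - 1) = P" using P1 by (simp add: mult.commute)
    then have "2 * L = (2 * 2 powr (P - 1)) * N powr P"
      using N by (simp add: L_def powr_mult powr_powr)
    also have "2 * 2 powr (P - 1) = 2 powr P" by (simp add: powr_diff)
    finally have "2 * L = (2 * N) powr P" using N by (simp add: powr_mult)
    moreover have "ennreal 2 * ennreal L = ennreal (2 * L)" using L by (intro ennreal_mult[symmetric]) auto
    ultimately show ?thesis by (simp only: mult.assoc[symmetric])
  qed
  finally show ?thesis unfolding XQ[symmetric] Q_def[abs_def] .
qed

lemma wenergy_duality:
  fixes \<phi> :: "complex^'n \<Rightarrow> complex" and \<Omega> :: "complex^'n \<Rightarrow> real"
  assumes \<Omega>: "\<Omega> \<in> borel_measurable borel" and p: "1 < p" and P: "P = p / (p - 1)"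
    and pos: "AE \<zeta> in sig. 0 < \<Omega> \<zeta>"
    and fin: "(\<integral>\<^sup>+\<zeta>. ennreal (\<Omega> \<zeta>) \<partial>sig) < \<infinity>"
    and N: "0 < N"
    and T: "\<And>\<psi> :: complex^'n \<Rightarrow> complex. integrable nu \<psi> \<Longrightarrow> wenergy p (\<lambda>\<zeta>. \<Omega> \<zeta> powr (1 - p)) \<psi> < \<infinity> \<Longrightarrow>
      wenergy p (\<lambda>\<zeta>. \<Omega> \<zeta> powr (1 - p)) (Top \<psi>) \<le> ennreal (N powr p) * wenergy p (\<lambda>\<zeta>. \<Omega> \<zeta> powr (1 - p)) \<psi>"
    and \<phi>: "integrable nu \<phi>"
  shows "wenergy P \<Omega> (Top \<phi>) \<le> ennreal ((2 * N) powr P) * wenergy P \<Omega> \<phi>"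
proof (rule wenergy_exhaust)
  have "\<phi> \<in> borel_measurable borel" using \<phi> by (simp add: borel_measurable_integrable)
  then show "Top \<phi> \<in> borel_measurable borel" by measurable
  show "0 < P" using p by (simp add: P)
  show "wenergy P \<Omega> (\<lambda>z. if norm z \<le> 1 - 1 / real (Suc k) then Top \<phi> z else 0) \<le> ennreal ((2 * N) powr P) * wenergy P \<Omega> \<phi>" for k
    by (rule wenergy_duality_truncated[OF \<Omega> p P pos fin N T \<phi>]) auto
qed fact

section \<open>Muckenhoupt weights\<close>

text \<open>
  The maximal function is lower semicontinuous, since balls are open.
\<close>
lemma HL_maximal_measurable: "HL_maximal \<omega> \<in> borel_measurable (sphere_measure :: (complex^'n) measure)"
proof (rule borel_measurableI_greater)
  fix y :: ennreal
  define av where "av B = (\<integral>\<^sup>+\<eta>\<in>B. ennreal \<bar>\<omega> \<eta>\<bar> \<partial>sphere_measure) / emeasure sphere_measure B" for B :: "(complex^'n) set"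
  let ?U = "\<Union>{{\<eta>. norm (1 - hdot \<xi> \<eta>) < r} | \<xi> r. \<xi> \<in> sphere 0 1 \<and> 0 < r \<and> y < av (nball \<xi> r)} :: (complex^'n) set"
  have HL: "y < HL_maximal \<omega> \<zeta> \<longleftrightarrow> (\<exists>\<xi> r. \<xi> \<in> sphere 0 1 \<and> 0 < r \<and> \<zeta> \<in> nball \<xi> r \<and> y < av (nball \<xi> r))" for \<zeta>
    unfolding HL_maximal_def av_def[symmetric] less_SUP_iff by blast
  have nb: "\<zeta> \<in> nball \<xi> r \<longleftrightarrow> \<zeta> \<in> sphere 0 1 \<and> norm (1 - hdot \<xi> \<zeta>) < r" for \<zeta> \<xi> :: "complex^'n" and r
    by (auto simp: nball_def)
  have "{\<zeta> \<in> space sphere_measure. y < HL_maximal \<omega> \<zeta>} = sphere 0 1 \<inter> ?U"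
    unfolding space_sphere_measure HL nb by blast
  moreover have "open ?U" by (auto intro!: open_Union open_nonisotropic)
  ultimately show "{\<zeta> \<in> space sphere_measure. y < HL_maximal \<omega> \<zeta>} \<in> sets sphere_measure"
    by (simp add: sets_sphere_measureI)
qed

lemma nball_measure_pos: "norm \<xi> = 1 \<Longrightarrow> 0 < r \<Longrightarrow> 0 < emeasure sig {\<eta> :: complex^'n. norm (1 - hdot \<xi> \<eta>) < r}"
proof -
  assume x: "norm \<xi> = 1" and r: "0 < r"
  obtain c where c: "c > 0" "\<And>(\<xi> :: complex^'n) r. norm \<xi> = 1 \<Longrightarrow> 0 < r \<Longrightarrow> r \<le> 3 \<Longrightarrow>
     ennreal (c * r ^ CARD('n)) \<le> emeasure sig {\<eta>. norm (1 - hdot \<xi> \<eta>) < r}"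
    using sig_ball_lower[where 'n='n] by blast
  have "0 < ennreal (c * (min r 3) ^ CARD('n))" using c r by simp
  also have "\<dots> \<le> emeasure sig {\<eta>. norm (1 - hdot \<xi> \<eta>) < min r 3}" using x r by (intro c) auto
  also have "\<dots> \<le> emeasure sig {\<eta>. norm (1 - hdot \<xi> \<eta>) < r}"
    by (intro emeasure_mono) auto
  finally show ?thesis .
qed

lemma HL_maximal_ge:
  fixes \<omega> :: "complex^'n \<Rightarrow> real"
  assumes "norm \<zeta> = 1" "0 < r" "norm \<xi> = 1" "norm (1 - hdot \<xi> \<zeta>) < r"
  shows "(\<integral>\<^sup>+\<eta>. ennreal \<bar>\<omega> \<eta>\<bar> * (if norm (1 - hdot \<xi> \<eta>) < r then 1 else 0) \<partial>sig) \<le> HL_maximal \<omega> \<zeta> * emeasure sig {\<eta>. norm (1 - hdot \<xi> \<eta>) < r}"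
proof -
  define I where "I = (\<integral>\<^sup>+\<eta>. ennreal \<bar>\<omega> \<eta>\<bar> * (if norm (1 - hdot \<xi> \<eta>) < r then 1 else 0) \<partial>sig)"
  define m where "m = emeasure sig {\<eta>. norm (1 - hdot \<xi> \<eta>) < r}"
  have m: "m \<noteq> 0" "m \<noteq> top" using nball_measure_pos[OF assms(3,2)] by (auto simp: m_def)
  have "(\<integral>\<^sup>+\<eta>\<in>nball \<xi> r. ennreal \<bar>\<omega> \<eta>\<bar> \<partial>sphere_measure) = I"
    unfolding I_def nn_integral_sphere_measure
  proof (rule nn_integral_sig_cong)
    fix \<eta> :: "complex^'n" assume "norm \<eta> = 1"
    then show "ennreal \<bar>\<omega> \<eta>\<bar> * indicator (nball \<xi> r) \<eta> = ennreal \<bar>\<omega> \<eta>\<bar> * (if norm (1 - hdot \<xi> \<eta>) < r then 1 else 0)"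
      by (simp add: nball_def indicator_def)
  qed
  then have "I / m = (\<integral>\<^sup>+\<eta>\<in>nball \<xi> r. ennreal \<bar>\<omega> \<eta>\<bar> \<partial>sphere_measure) / emeasure sphere_measure (nball \<xi> r)"
    by (simp add: emeasure_nball m_def)
  also have "\<dots> \<le> HL_maximal \<omega> \<zeta>"
    unfolding HL_maximal_def using assms by (intro SUP_upper) (auto simp: nball_def)
  finally have "I / m * m \<le> HL_maximal \<omega> \<zeta> * m" by (rule mult_right_mono) simp
  moreover have "I / m * m = I"
  proof -
    have "m / m = 1" using m by (intro ennreal_divide_self) (auto simp: top.not_eq_extremum)
    then show ?thesis by (simp add: ennreal_divide_times)
  qed
  ultimately show ?thesis by (simp add: I_def m_def)
qed

lemma weight_borel_version:
  fixes \<omega> :: "complex^'n \<Rightarrow> real"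
  assumes "weight \<omega>"
  obtains \<omega>0 where "\<omega>0 \<in> borel_measurable borel" "AE \<zeta> in sig. \<omega> \<zeta> = \<omega>0 \<zeta>" "AE \<zeta> in sig. 0 < \<omega>0 \<zeta>"
    "(\<integral>\<^sup>+\<zeta>. ennreal (\<omega>0 \<zeta>) \<partial>sig) < \<infinity>" "0 < (\<integral>\<^sup>+\<zeta>. ennreal (\<omega>0 \<zeta>) \<partial>sig)"
proof -
  have int: "integrable sphere_measure \<omega>" and pos: "AE \<zeta> in sig. 0 < \<omega> \<zeta>"
    using assms by (auto simp: weight_def AE_sphere_measure)
  obtain \<omega>0 where w0: "\<omega>0 \<in> borel_measurable borel" "AE \<zeta> in sig. \<omega> \<zeta> = \<omega>0 \<zeta>"
    using borel_version_sphere[OF borel_measurable_integrable[OF int]] by blast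
  have [measurable]: "\<omega>0 \<in> borel_measurable borel" by (rule w0)
  have pos0: "AE \<zeta> in sig. 0 < \<omega>0 \<zeta>" using pos w0(2) by eventually_elim simp
  have "(\<integral>\<^sup>+\<zeta>. ennreal (\<omega>0 \<zeta>) \<partial>sig) = (\<integral>\<^sup>+\<zeta>. ennreal (norm (\<omega> \<zeta>)) \<partial>sphere_measure)"
    unfolding nn_integral_sphere_measure
    by (rule nn_integral_cong_AE) (use pos w0(2) in eventually_elim, simp)
  also have "\<dots> < \<infinity>" using int by (simp add: integrable_iff_bounded)
  finally have fin: "(\<integral>\<^sup>+\<zeta>. ennreal (\<omega>0 \<zeta>) \<partial>sig) < \<infinity>" .
  have "(\<integral>\<^sup>+\<zeta>. ennreal (\<omega>0 \<zeta>) \<partial>sig) \<noteq> 0"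
  proof
    assume "(\<integral>\<^sup>+\<zeta>. ennreal (\<omega>0 \<zeta>) \<partial>sig) = 0"
    then have "AE \<zeta> in sig. ennreal (\<omega>0 \<zeta>) = 0" by (subst (asm) nn_integral_0_iff_AE) auto
    then have "AE \<zeta> :: complex^'n in sig. False" using pos0 by eventually_elim simp
    then show False by simp
  qed
  then have "0 < (\<integral>\<^sup>+\<zeta>. ennreal (\<omega>0 \<zeta>) \<partial>sig)" by (simp add: zero_less_iff_neq_zero)
  with w0 pos0 fin show ?thesis using that by blast
qed

text \<open>
  The infimum defining the essential supremum is attained, so the constant itself is admissible.
\<close>
lemma A1_const_upper:
  fixes \<omega> :: "complex^'n \<Rightarrow> real"
  assumes w: "weight \<omega>" and C: "0 < C" and HL: "AE \<zeta> in sig. HL_maximal \<omega> \<zeta> \<le> ennreal (C * \<omega> \<zeta>)"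
  shows "A1_const \<omega> \<le> C" "AE \<zeta> in sig. HL_maximal \<omega> \<zeta> \<le> ennreal (A1_const \<omega> * \<omega> \<zeta>)"
proof -
  have pos: "AE \<zeta> in sig. 0 < \<omega> \<zeta>" and wm: "\<omega> \<in> borel_measurable sphere_measure"
    using w by (auto simp: weight_def AE_sphere_measure borel_measurable_integrable)
  define f where "f \<zeta> = HL_maximal \<omega> \<zeta> / ennreal (\<omega> \<zeta>)" for \<zeta>
  have f: "f \<in> borel_measurable sphere_measure"
    unfolding f_def by (intro borel_measurable_divide_ennreal HL_maximal_measurable measurable_compose[OF wm]) auto
  have "AE \<zeta> in sphere_measure. f \<zeta> \<le> ennreal C"
    unfolding AE_sphere_measure using HL pos
  proof eventually_elim
    case (elim \<zeta>)
    have "f \<zeta> \<le> ennreal (C * \<omega> \<zeta>) / ennreal (\<omega> \<zeta>)"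
      unfolding f_def by (rule divide_right_mono_ennreal) (rule elim(1))
    also have "\<dots> = ennreal C" using elim(2) C by (simp add: divide_ennreal)
    finally show ?case .
  qed
  then have le: "esssup sphere_measure f \<le> ennreal C" by (rule esssup_I[OF f])
  then have fin: "esssup sphere_measure f < top" by (rule order_le_less_trans) simp
  have A: "A1_const \<omega> = enn2real (esssup sphere_measure f)"
    unfolding A1_const_def f_def ..
  have eA: "esssup sphere_measure f = ennreal (A1_const \<omega>)" unfolding A using fin by simp
  show "A1_const \<omega> \<le> C" using le C unfolding eA by (subst (asm) ennreal_le_iff) auto
  have A0: "0 \<le> A1_const \<omega>" unfolding A by simp
  have "AE \<zeta> in sig. f \<zeta> \<le> ennreal (A1_const \<omega>)"
    using esssup_AE[of f sphere_measure] unfolding AE_sphere_measure eA .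
  then show "AE \<zeta> in sig. HL_maximal \<omega> \<zeta> \<le> ennreal (A1_const \<omega> * \<omega> \<zeta>)"
    using pos
  proof eventually_elim
    case (elim \<zeta>)
    have "HL_maximal \<omega> \<zeta> = f \<zeta> * ennreal (\<omega> \<zeta>)"
      using elim(2) by (simp add: f_def ennreal_divide_times)
    also have "\<dots> \<le> ennreal (A1_const \<omega>) * ennreal (\<omega> \<zeta>)" by (rule mult_right_mono[OF elim(1)]) simp
    also have "\<dots> = ennreal (A1_const \<omega> * \<omega> \<zeta>)" using A0 elim(2) by (simp add: ennreal_mult)
    finally show ?case .
  qed
qed

lemma A1_AE:
  fixes \<omega> :: "complex^'n \<Rightarrow> real"
  assumes "\<omega> \<in> A1"
  shows "weight \<omega>" "AE \<zeta> in sig. HL_maximal \<omega> \<zeta> \<le> ennreal (A1_const \<omega> * \<omega> \<zeta>)"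
proof -
  obtain C where "weight \<omega>" "0 < C" "AE \<zeta> in sig. HL_maximal \<omega> \<zeta> \<le> ennreal (C * \<omega> \<zeta>)"
    using assms by (auto simp: A1_def AE_sphere_measure)
  then show "weight \<omega>" "AE \<zeta> in sig. HL_maximal \<omega> \<zeta> \<le> ennreal (A1_const \<omega> * \<omega> \<zeta>)"
    using A1_const_upper(2) by blast+
qed

lemma norm_one_minus_hdot_lt_3: "norm \<xi> = 1 \<Longrightarrow> norm \<eta> = 1 \<Longrightarrow> norm (1 - hdot \<xi> \<eta>) < 3"
  using norm_triangle_ineq4[of 1 "hdot \<xi> \<eta>"] hdot_cauchy_schwarz[of \<xi> \<eta>] by simp

text \<open>
  A ball of radius three is the whole sphere.
\<close>
lemma A1_average_le:
  fixes \<omega> \<omega>0 :: "complex^'n \<Rightarrow> real"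
  assumes "\<omega> \<in> A1" and [measurable]: "\<omega>0 \<in> borel_measurable borel" and eq: "AE \<zeta> in sig. \<omega> \<zeta> = \<omega>0 \<zeta>"
  shows "AE \<zeta> in sig. (\<integral>\<^sup>+\<eta>. ennreal (\<omega>0 \<eta>) \<partial>sig) \<le> ennreal (A1_const \<omega> * \<omega>0 \<zeta>)"
  using A1_AE(2)[OF assms(1)] eq AE_sig_norm
proof eventually_elim
  case (elim \<zeta>)
  have "(\<integral>\<^sup>+\<eta>. ennreal (\<omega>0 \<eta>) \<partial>sig) \<le> (\<integral>\<^sup>+\<eta>. ennreal \<bar>\<omega> \<eta>\<bar> * (if norm (1 - hdot \<zeta> \<eta>) < 3 then 1 else 0) \<partial>sig)"
  proof (rule nn_integral_mono_AE, rule AE_mp[OF AE_sig_norm], rule AE_mp[OF eq], intro AE_I2 impI)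
    fix \<eta> :: "complex^'n" assume "norm \<eta> = 1" "\<omega> \<eta> = \<omega>0 \<eta>"
    then show "ennreal (\<omega>0 \<eta>) \<le> ennreal \<bar>\<omega> \<eta>\<bar> * (if norm (1 - hdot \<zeta> \<eta>) < 3 then 1 else 0)"
      using norm_one_minus_hdot_lt_3[OF elim(3), of \<eta>] by (simp add: ennreal_leI)
  qed
  also have "\<dots> \<le> HL_maximal \<omega> \<zeta> * emeasure sig {\<eta>. norm (1 - hdot \<zeta> \<eta>) < 3}"
    by (rule HL_maximal_ge) (use elim(3) in \<open>simp_all add: hdot_self\<close>)
  also have "\<dots> \<le> HL_maximal \<omega> \<zeta> * 1"
    by (intro mult_left_mono sig.emeasure_le_1) simp
  also have "\<dots> \<le> ennreal (A1_const \<omega> * \<omega>0 \<zeta>)" using elim by simp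
  finally show ?case .
qed

text \<open>
  Integrate \<open>A1_average_le\<close>: the mean of a weight is at most the constant times the mean, and it is positive and finite.
\<close>
lemma A1_const_ge_1:
  fixes \<omega> :: "complex^'n \<Rightarrow> real"
  assumes "\<omega> \<in> A1" shows "1 \<le> A1_const \<omega>"
proof -
  obtain \<omega>0 where w0: "\<omega>0 \<in> borel_measurable borel" "AE \<zeta> in sig. \<omega> \<zeta> = \<omega>0 \<zeta>"
    "(\<integral>\<^sup>+\<zeta>. ennreal (\<omega>0 \<zeta>) \<partial>sig) < \<infinity>" "0 < (\<integral>\<^sup>+\<zeta>. ennreal (\<omega>0 \<zeta>) \<partial>sig)"
    using weight_borel_version[OF A1_AE(1)[OF assms]] by metis
  note [measurable] = w0(1)
  define m where "m = enn2real (\<integral>\<^sup>+\<zeta>. ennreal (\<omega>0 \<zeta>) \<partial>sig)"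
  have m: "(\<integral>\<^sup>+\<zeta>. ennreal (\<omega>0 \<zeta>) \<partial>sig) = ennreal m" "0 < m"
    using w0(3,4) by (auto simp: m_def enn2real_positive_iff)
  define A where "A = A1_const \<omega>"
  have A: "0 \<le> A" by (simp add: A_def A1_const_def)
  have "ennreal m = (\<integral>\<^sup>+\<zeta>. ennreal m \<partial>(sig :: (complex^'n) measure))" by (rule nn_integral_const_sig[symmetric])
  also have "\<dots> \<le> (\<integral>\<^sup>+\<zeta>. ennreal A * ennreal (\<omega>0 \<zeta>) \<partial>sig)"
    by (rule nn_integral_mono_AE, rule eventually_mono[OF A1_average_le[OF assms w0(1,2)]])
      (use A in \<open>simp add: m(1) A_def[symmetric] ennreal_mult'\<close>)
  also have "\<dots> = ennreal A * ennreal m" unfolding m(1)[symmetric] by (rule nn_integral_cmult) measurable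
  also have "\<dots> = ennreal (A * m)" using A m by (simp add: ennreal_mult)
  finally have "m \<le> A * m" using A m by (subst (asm) ennreal_le_iff) auto
  then show ?thesis using m(2) by (simp add: A_def)
qed

lemma A1_imp_A1_bound:
  "\<exists>C>0. \<forall>(\<omega> :: complex^'n \<Rightarrow> real) \<omega>0. \<omega> \<in> A1 \<longrightarrow> \<omega>0 \<in> borel_measurable borel \<longrightarrow> (AE \<zeta> in sig. \<omega> \<zeta> = \<omega>0 \<zeta>) \<longrightarrow>
     A1_bound \<omega>0 (C * A1_const \<omega>)"
proof -
  obtain C where C: "C > 0" and CU: "\<And>(\<xi> :: complex^'n) r. norm \<xi> = 1 \<Longrightarrow> 0 < r \<Longrightarrow>
     emeasure sig {\<eta>. norm (1 - hdot \<xi> \<eta>) < r} \<le> ennreal (C * r ^ CARD('n))"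
    using sig_ball_upper[where 'n='n] by blast
  have "A1_bound \<omega>0 (C * A1_const \<omega>)"
    if A1: "\<omega> \<in> A1" and [measurable]: "\<omega>0 \<in> borel_measurable borel" and eq: "AE \<zeta> in sig. \<omega> \<zeta> = \<omega>0 \<zeta>" for \<omega> \<omega>0 :: "complex^'n \<Rightarrow> real"
    unfolding A1_bound_def using A1_AE(2)[OF A1] eq AE_sig_norm
  proof eventually_elim
    case (elim \<eta>)
    have A: "0 \<le> A1_const \<omega>" by (simp add: A1_const_def)
    show ?case
    proof (intro allI impI)
      fix r :: real assume r: "0 < r"
      have "(\<integral>\<^sup>+\<zeta>. ennreal (\<omega>0 \<zeta>) * (if norm (1 - hdot \<eta> \<zeta>) < r then 1 else 0) \<partial>sig)
         \<le> (\<integral>\<^sup>+\<zeta>. ennreal \<bar>\<omega> \<zeta>\<bar> * (if norm (1 - hdot \<eta> \<zeta>) < r then 1 else 0) \<partial>sig)"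
        by (rule nn_integral_mono_AE, rule eventually_mono[OF eq]) (auto intro: ennreal_leI)
      also have "\<dots> \<le> HL_maximal \<omega> \<eta> * emeasure sig {\<zeta>. norm (1 - hdot \<eta> \<zeta>) < r}"
        by (rule HL_maximal_ge) (use elim(3) r in \<open>simp_all add: hdot_self\<close>)
      also have "\<dots> \<le> ennreal (A1_const \<omega> * \<omega>0 \<eta>) * ennreal (C * r ^ CARD('n))"
        using elim r by (intro mult_mono CU) auto
      also have "\<dots> = ennreal (C * A1_const \<omega> * r ^ CARD('n)) * ennreal (\<omega>0 \<eta>)"
        using A C r by (simp add: ennreal_mult' mult_ac)
      finally show "(\<integral>\<^sup>+\<zeta>. ennreal (\<omega>0 \<zeta>) * (if norm (1 - hdot \<eta> \<zeta>) < r then 1 else 0) \<partial>sig) \<le> ennreal (C * A1_const \<omega> * r ^ CARD('n)) * ennreal (\<omega>0 \<eta>)" .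
    qed
  qed
  with C show ?thesis by blast
qed

section \<open>Operator norms\<close>

lemma wenergy_scale:
  fixes f :: "complex^'n \<Rightarrow> complex"
  assumes [measurable]: "f \<in> borel_measurable borel" "\<omega> \<in> borel_measurable borel" and p: "0 < p" and t: "0 < t"
  shows "wenergy p \<omega> (\<lambda>z. of_real t * f z) = ennreal (t powr p) * wenergy p \<omega> f"
proof -
  have "energy (\<lambda>z. of_real t * f z) \<zeta> = ennreal (t\<^sup>2) * energy f \<zeta>" for \<zeta>
  proof -
    have "energy (\<lambda>z. of_real t * f z) \<zeta> = (\<integral>\<^sup>+r. ennreal (t\<^sup>2) * ennreal ((norm (f (r *\<^sub>R \<zeta>)))\<^sup>2 * (rd CARD('n) r / (1 - r\<^sup>2))) \<partial>lborel)"
      unfolding energy_def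
      by (intro nn_integral_cong) (simp only: norm_mult norm_of_real power_mult_distrib power2_abs mult.assoc ennreal_mult' zero_le_power2)
    also have "\<dots> = ennreal (t\<^sup>2) * energy f \<zeta>" unfolding energy_def by (rule nn_integral_cmult) measurable
    finally show ?thesis .
  qed
  moreover have "epowr (ennreal (t\<^sup>2) * x) (p / 2) = ennreal (t powr p) * epowr x (p / 2)" for x
  proof -
    have "(t\<^sup>2) powr (p / 2) = t powr p" using t by (simp add: powr_powr flip: powr_numeral)
    then show ?thesis using p by (simp add: epowr_mult epowr_ennreal)
  qed
  ultimately show ?thesis
    unfolding wenergy_def by (simp add: mult.assoc nn_integral_cmult)
qed

lemma Top_scale: "Top (\<lambda>z. of_real t * f z) = (\<lambda>z. of_real t * Top f z)"
proof
  fix z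
  have "Sop (\<lambda>z. of_real t * f z) z = of_real t * Sop f z"
    unfolding Sop_def mult.assoc by (rule integral_mult_right_zero)
  then show "Top (\<lambda>z. of_real t * f z) z = of_real t * Top f z"
    by (simp add: Top_def mult_ac)
qed

lemma epowr_less_top: "epowr x a < top \<Longrightarrow> x < top"
  by (cases x) auto

lemma bergman_norm_leI:
  fixes \<omega> \<omega>0 :: "complex^'n \<Rightarrow> real"
  assumes p: "1 < p" and w0: "\<omega>0 \<in> borel_measurable borel" "AE \<zeta> in sig. \<omega> \<zeta> = \<omega>0 \<zeta>" "AE \<zeta> in sig. 0 < \<omega>0 \<zeta>"
    and dual: "(\<integral>\<^sup>+\<zeta>. ennreal (\<omega>0 \<zeta> powr (1 - p / (p - 1))) \<partial>sig) < \<infinity>"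
    and N: "0 < N" and T: "\<And>\<phi> :: complex^'n \<Rightarrow> complex. integrable nu \<phi> \<Longrightarrow> wenergy p \<omega>0 (Top \<phi>) \<le> ennreal (N powr p) * wenergy p \<omega>0 \<phi>"
  shows "bergman ` Lp2 p \<omega> \<subseteq> Fp2 p \<omega> \<and> bergman_norm p \<omega> \<le> ennreal N"
proof -
  have main: "cholomorphic_on (bergman \<phi>) (ball 0 1) \<and> Fp2_norm p \<omega> (bergman \<phi>) \<le> ennreal N * Lp2_norm p \<omega> \<phi>"
    if \<phi>: "\<phi> \<in> Lp2 p \<omega>" for \<phi> :: "complex^'n \<Rightarrow> complex"
  proof -
    have \<phi>m: "\<phi> \<in> borel_measurable (lebesgue_on (ball 0 1))" and fin: "Lp2_norm p \<omega> \<phi> < \<infinity>" using \<phi> by (auto simp: Lp2_def)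
    obtain \<phi>0 where p0: "\<phi>0 \<in> borel_measurable borel" "AE w in nu. \<phi> w = \<phi>0 w"
      using borel_version_ball[OF \<phi>m] by blast
    have L: "Lp2_norm p \<omega> \<phi> = epowr (wenergy p \<omega>0 \<phi>0) (1 / p)" by (rule Lp2_norm_eq[OF p0(2) w0(2)])
    have W: "wenergy p \<omega>0 \<phi>0 < \<infinity>" using fin unfolding L by (auto dest: epowr_less_top)
    have int: "integrable nu \<phi>0" by (rule integrable_of_wenergy[OF p0(1) w0(1) p w0(3) W dual])
    have B: "bergman \<phi> = bergman \<phi>0" by (rule bergman_cong_AE[OF \<phi>m p0])
    have "Fp2_norm p \<omega> (bergman \<phi>) = epowr (wenergy p \<omega>0 (Top \<phi>0)) (1 / p)"
      unfolding B by (rule Fp2_norm_bergman_eq[OF int w0(2)])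
    also have "\<dots> \<le> epowr (ennreal (N powr p) * wenergy p \<omega>0 \<phi>0) (1 / p)"
      using p by (intro epowr_mono T[OF int]) auto
    also have "\<dots> = ennreal N * Lp2_norm p \<omega> \<phi>"
      using p N by (simp add: L epowr_mult epowr_ennreal powr_powr)
    finally show ?thesis using bergman_holomorphic[OF int] by (simp add: B)
  qed
  have "bergman ` Lp2 p \<omega> \<subseteq> Fp2 p \<omega>"
  proof
    fix f assume "f \<in> bergman ` Lp2 p \<omega>"
    then obtain \<phi> where f: "f = bergman \<phi>" and \<phi>: "\<phi> \<in> Lp2 p \<omega>" by auto
    have "ennreal N * Lp2_norm p \<omega> \<phi> < \<infinity>" using \<phi> by (simp add: Lp2_def ennreal_mult_less_top)
    then have "Fp2_norm p \<omega> f < \<infinity>" unfolding f using main[OF \<phi>] by (blast intro: order_le_less_trans)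
    then show "f \<in> Fp2 p \<omega>" unfolding Fp2_def f using main[OF \<phi>] by simp
  qed
  moreover have "bergman_norm p \<omega> \<le> ennreal N"
    unfolding bergman_norm_def op_norm_def
  proof (rule SUP_least)
    fix \<phi> assume a: "\<phi> \<in> {x \<in> Lp2 p \<omega>. Lp2_norm p \<omega> x \<le> 1}"
    then have "Fp2_norm p \<omega> (bergman \<phi>) \<le> ennreal N * Lp2_norm p \<omega> \<phi>" using main by blast
    also have "\<dots> \<le> ennreal N * 1" using a by (intro mult_left_mono) auto
    finally show "Fp2_norm p \<omega> (bergman \<phi>) \<le> ennreal N" by simp
  qed
  ultimately show ?thesis by blast
qed

text \<open>
  The operator norm is a supremum over the unit ball, so \<open>\<phi>\<close> has to be scaled; a function of norm zero is scaled by
  arbitrarily large factors.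
\<close>
lemma bergman_norm_leD:
  fixes \<omega> \<omega>0 :: "complex^'n \<Rightarrow> real" and \<phi> :: "complex^'n \<Rightarrow> complex"
  assumes p: "1 < p" and w0: "\<omega>0 \<in> borel_measurable borel" "AE \<zeta> in sig. \<omega> \<zeta> = \<omega>0 \<zeta>"
    and N: "0 < N" and le: "bergman_norm p \<omega> \<le> ennreal N"
    and \<phi>: "integrable nu \<phi>" and W: "wenergy p \<omega>0 \<phi> < \<infinity>"
  shows "wenergy p \<omega>0 (Top \<phi>) \<le> ennreal (N powr p) * wenergy p \<omega>0 \<phi>"
proof -
  have \<phi>m [measurable]: "\<phi> \<in> borel_measurable borel" using \<phi> by (simp add: borel_measurable_integrable)
  have step: "ennreal (t powr p) * wenergy p \<omega>0 (Top \<phi>) \<le> ennreal (N powr p)"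
    if t: "0 < t" and W1: "ennreal (t powr p) * wenergy p \<omega>0 \<phi> \<le> 1" for t
  proof -
    define \<psi> where "\<psi> = (\<lambda>z. of_real t * \<phi> z)"
    have \<psi>m [measurable]: "\<psi> \<in> borel_measurable borel" unfolding \<psi>_def by measurable
    have \<psi>i: "integrable nu \<psi>" unfolding \<psi>_def using \<phi> by simp
    have "Lp2_norm p \<omega> \<psi> = epowr (wenergy p \<omega>0 \<psi>) (1 / p)" by (rule Lp2_norm_eq[OF _ w0(2)]) simp
    also have "wenergy p \<omega>0 \<psi> = ennreal (t powr p) * wenergy p \<omega>0 \<phi>"
      unfolding \<psi>_def by (rule wenergy_scale) (use w0 p t in auto)
    also have "epowr (ennreal (t powr p) * wenergy p \<omega>0 \<phi>) (1 / p) \<le> epowr (ennreal 1) (1 / p)"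
      using W1 p by (intro epowr_mono) auto
    also have "\<dots> = 1" by (subst epowr_ennreal) auto
    finally have L1: "Lp2_norm p \<omega> \<psi> \<le> 1" .
    have "\<psi> \<in> borel_measurable (lebesgue_on (ball 0 1))"
      by (intro measurable_restrict_space1 measurable_completion) simp
    moreover have "Lp2_norm p \<omega> \<psi> < \<infinity>" using L1 by (rule order_le_less_trans) simp
    ultimately have "\<psi> \<in> Lp2 p \<omega>" by (simp add: Lp2_def)
    then have "Fp2_norm p \<omega> (bergman \<psi>) \<le> bergman_norm p \<omega>"
      unfolding bergman_norm_def op_norm_def using L1 by (intro SUP_upper) auto
    then have "epowr (wenergy p \<omega>0 (Top \<psi>)) (1 / p) \<le> ennreal N"
      unfolding Fp2_norm_bergman_eq[OF \<psi>i w0(2)] using le by (rule order_trans)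
    then have "epowr (epowr (wenergy p \<omega>0 (Top \<psi>)) (1 / p)) p \<le> epowr (ennreal N) p"
      using p by (intro epowr_mono) auto
    then have "wenergy p \<omega>0 (Top \<psi>) \<le> ennreal (N powr p)"
      using p N by (simp add: epowr_epowr epowr_ennreal)
    moreover have "wenergy p \<omega>0 (Top \<psi>) = ennreal (t powr p) * wenergy p \<omega>0 (Top \<phi>)"
      unfolding \<psi>_def Top_scale by (rule wenergy_scale) (use w0 p t in auto)
    ultimately show ?thesis by simp
  qed
  obtain x where x: "wenergy p \<omega>0 \<phi> = ennreal x" "0 \<le> x" using W by (cases "wenergy p \<omega>0 \<phi>") auto
  define y where "y = enn2real (wenergy p \<omega>0 (Top \<phi>))"
  have Np: "0 < N powr p" using N by simp
  show ?thesis
  proof (cases "x = 0")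
    case False
    define t where "t = x powr (- (1 / p))"
    have t: "t > 0" using False x by (simp add: t_def)
    have "- (1 / p) * p = - 1" using p by simp
    then have "t powr p = x powr (- 1)" by (simp only: t_def powr_powr)
    then have t2: "t powr p = 1 / x" using False x by (simp add: powr_minus_divide)
    have "ennreal (t powr p) * wenergy p \<omega>0 \<phi> = ennreal (1 / x * x)"
      unfolding t2 x(1) using x(2) by (intro ennreal_mult[symmetric]) auto
    then have "ennreal (1 / x) * wenergy p \<omega>0 (Top \<phi>) \<le> ennreal (N powr p)"
      using step[OF t] False unfolding t2 by simp
    then have "ennreal x * (ennreal (1 / x) * wenergy p \<omega>0 (Top \<phi>)) \<le> ennreal x * ennreal (N powr p)"
      by (rule mult_left_mono) simp
    moreover have "ennreal x * ennreal (1 / x) = 1"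
      using False x(2) by (simp add: ennreal_mult[symmetric])
    ultimately show ?thesis unfolding x(1) by (simp add: mult.assoc[symmetric] mult.commute)
  next
    case True
    have all: "ennreal (t powr p) * wenergy p \<omega>0 (Top \<phi>) \<le> ennreal (N powr p)" if "0 < t" for t
      by (rule step[OF that]) (simp add: x True)
    have fin: "wenergy p \<omega>0 (Top \<phi>) < top" using all[of 1] by (auto intro: order_le_less_trans)
    then have y: "wenergy p \<omega>0 (Top \<phi>) = ennreal y" "0 \<le> y" by (auto simp: y_def)
    have "y = 0"
    proof (rule ccontr)
      assume "y \<noteq> 0"
      then have yp: "y > 0" using y(2) by simp
      define t where "t = (2 * N powr p / y) powr (1 / p)"
      have "t > 0" "t powr p = 2 * N powr p / y" using yp N p by (auto simp: t_def powr_powr)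
      then have "ennreal (2 * N powr p / y * y) \<le> ennreal (N powr p)"
        using all[of t] yp Np unfolding y(1) by (subst ennreal_mult) auto
      then have "2 * N powr p \<le> N powr p" using yp Np by (subst (asm) ennreal_le_iff) auto
      then show False using Np by simp
    qed
    then show ?thesis by (simp add: y)
  qed
qed

section \<open>Power weights\<close>

text \<open>
  The nonisotropic distance from \<^term>\<open>e1\<close>, called the pole below.
\<close>
definition dist1 :: "complex^'n \<Rightarrow> real" where
  "dist1 \<zeta> = norm (1 - hdot \<zeta> e1)"

text \<open>
  The exponent \<open>n\<close> is the first one for which the power of the distance is not integrable.
\<close>
definition pweight :: "real \<Rightarrow> complex^'n \<Rightarrow> real" where
  "pweight \<epsilon> \<zeta> = dist1 \<zeta> powr (- (real CARD('n) * (1 - \<epsilon>)))"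

lemma dist1_measurable [measurable]: "dist1 \<in> borel_measurable borel"
  unfolding dist1_def by measurable

lemma pweight_measurable [measurable]: "pweight \<epsilon> \<in> borel_measurable borel"
  unfolding pweight_def by measurable

lemma dist1_nonneg [simp]: "0 \<le> dist1 \<zeta>"
  by (simp add: dist1_def)

lemma pweight_nonneg [simp]: "0 \<le> pweight \<epsilon> \<zeta>"
  by (simp add: pweight_def)

lemma dist1_set: "{\<eta> :: complex^'n. dist1 \<eta> < r} = {\<eta>. norm (1 - hdot e1 \<eta>) < r}"
  unfolding dist1_def norm_one_minus_hdot_commute[of e1] ..

lemma AE_dist1_pos: "AE \<zeta> in sig. 0 < dist1 (\<zeta> :: complex^'n)"
proof -
  obtain C where C: "C > 0" and CU: "\<And>(\<xi> :: complex^'n) r. norm \<xi> = 1 \<Longrightarrow> 0 < r \<Longrightarrow>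
     emeasure sig {\<eta>. norm (1 - hdot \<xi> \<eta>) < r} \<le> ennreal (C * r ^ CARD('n))"
    using sig_ball_upper[where 'n='n] by blast
  define m where "m = measure sig {\<zeta> :: complex^'n. dist1 \<zeta> = 0}"
  have le: "m \<le> C * r" if r: "0 < r" "r \<le> 1" for r
  proof -
    have "ennreal m = emeasure sig {\<zeta> :: complex^'n. dist1 \<zeta> = 0}" by (simp add: m_def sig.emeasure_eq_measure)
    also have "\<dots> \<le> emeasure sig {\<eta> :: complex^'n. dist1 \<eta> < r}" using r by (intro emeasure_mono) auto
    also have "\<dots> \<le> ennreal (C * r ^ CARD('n))" unfolding dist1_set using r by (intro CU) auto
    finally have "m \<le> C * r ^ CARD('n)" using C r by (subst (asm) ennreal_le_iff) auto
    also have "\<dots> \<le> C * r ^ 1"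
      using C r by (intro mult_left_mono power_decreasing) (auto simp: Suc_le_eq)
    finally show ?thesis by simp
  qed
  have "m = 0"
  proof (rule ccontr)
    assume "m \<noteq> 0"
    then have m: "m > 0" using measure_nonneg[of sig "{\<zeta> :: complex^'n. dist1 \<zeta> = 0}"] by (simp add: m_def less_le)
    define r where "r = min 1 (m / (2 * C))"
    have r: "0 < r" "r \<le> 1" "r \<le> m / (2 * C)" using m C by (auto simp: r_def)
    then have "C * r \<le> C * (m / (2 * C))" using C by (intro mult_left_mono) auto
    also have "\<dots> = m / 2" using C by simp
    finally show False using le[OF r(1,2)] m by simp
  qed
  then have "{\<zeta> :: complex^'n. dist1 \<zeta> = 0} \<in> null_sets sig"
    by (intro null_setsI) (auto simp: m_def sig.emeasure_eq_measure)
  then show ?thesis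
    by (rule AE_I') (auto simp: less_le)
qed

lemma AE_pweight_pos: "AE \<zeta> in sig. 0 < pweight \<epsilon> (\<zeta> :: complex^'n)"
  using AE_dist1_pos by (rule eventually_mono) (simp add: pweight_def)

text \<open>
  Layer-cake formula: a negative power of the distance is an integral over the radii exceeding it.
\<close>
lemma nn_integral_pweight_layers:
  fixes \<epsilon> R :: real
  assumes \<epsilon>: "0 < \<epsilon>" "\<epsilon> < 1" and R: "0 < R"
  defines "a \<equiv> real CARD('n::finite) * (1 - \<epsilon>)"
  shows "(\<integral>\<^sup>+\<zeta>. ennreal (pweight \<epsilon> \<zeta>) * (if dist1 \<zeta> < R then 1 else 0) \<partial>(sig :: (complex^'n) measure))
    = ennreal a * (\<integral>\<^sup>+s. ennreal (s powr (- a - 1)) * indicator {0<..} s * emeasure sig {\<zeta> :: complex^'n. dist1 \<zeta> < min s R} \<partial>lborel)"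
proof -
  have a: "a > 0" using \<epsilon> by (simp add: a_def)
  have "(\<integral>\<^sup>+\<zeta>. ennreal (pweight \<epsilon> \<zeta>) * (if dist1 \<zeta> < R then 1 else 0) \<partial>(sig :: (complex^'n) measure))
    = (\<integral>\<^sup>+\<zeta>. (\<integral>\<^sup>+s. ennreal a * (ennreal (s powr (- a - 1)) * indicator {0<..} s * indicator {\<zeta>. dist1 \<zeta> < min s R} \<zeta>) \<partial>lborel) \<partial>(sig :: (complex^'n) measure))"
  proof (rule nn_integral_cong_AE, rule AE_mp[OF AE_dist1_pos], intro AE_I2 impI)
    fix \<zeta> :: "complex^'n" assume d: "0 < dist1 \<zeta>"
    have "(\<integral>\<^sup>+s. ennreal a * (ennreal (s powr (- a - 1)) * indicator {0<..} s * indicator {\<zeta>. dist1 \<zeta> < min s R} \<zeta>) \<partial>lborel)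
      = (\<integral>\<^sup>+s. ennreal a * (if dist1 \<zeta> < R then 1 else 0) * (ennreal (s powr (- a - 1)) * indicator {dist1 \<zeta><..} s) \<partial>lborel)"
      by (rule nn_integral_cong) (use d in \<open>auto simp: indicator_def\<close>)
    also have "\<dots> = ennreal a * (if dist1 \<zeta> < R then 1 else 0) * ennreal (dist1 \<zeta> powr (- a - 1 + 1) / (- (- a - 1) - 1))"
      using d a by (subst nn_integral_cmult, measurable) (subst nn_integral_powr_to_inf, auto)
    also have "\<dots> = (if dist1 \<zeta> < R then 1 else 0) * (ennreal a * ennreal (dist1 \<zeta> powr (- a) / a))"
      by (simp add: mult_ac)
    also have "ennreal a * ennreal (dist1 \<zeta> powr (- a) / a) = ennreal (a * (dist1 \<zeta> powr (- a) / a))"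
      using a by (intro ennreal_mult[symmetric]) auto
    also have "a * (dist1 \<zeta> powr (- a) / a) = pweight \<epsilon> \<zeta>"
      using a \<epsilon> by (simp add: pweight_def a_def)
    finally show "ennreal (pweight \<epsilon> \<zeta>) * (if dist1 \<zeta> < R then 1 else 0)
      = (\<integral>\<^sup>+s. ennreal a * (ennreal (s powr (- a - 1)) * indicator {0<..} s * indicator {\<zeta>. dist1 \<zeta> < min s R} \<zeta>) \<partial>lborel)"
      by (simp add: mult.commute)
  qed
  also have "\<dots> = (\<integral>\<^sup>+s. (\<integral>\<^sup>+\<zeta>. ennreal a * (ennreal (s powr (- a - 1)) * indicator {0<..} s * indicator {\<zeta>. dist1 \<zeta> < min s R} \<zeta>) \<partial>(sig :: (complex^'n) measure)) \<partial>lborel)"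
  proof -
    interpret pair_sigma_finite "lborel :: real measure" "sig :: (complex^'n) measure" ..
    have [measurable]: "Measurable.pred (borel \<Otimes>\<^sub>M borel) (\<lambda>x. snd x \<in> {\<zeta> :: complex^'n. dist1 \<zeta> < min (fst x) R})"
      unfolding mem_Collect_eq by measurable
    show ?thesis by (rule Fubini') measurable
  qed
  also have "\<dots> = (\<integral>\<^sup>+s. ennreal a * (ennreal (s powr (- a - 1)) * indicator {0<..} s * emeasure sig {\<zeta> :: complex^'n. dist1 \<zeta> < min s R}) \<partial>lborel)"
    by (intro nn_integral_cong) (simp add: nn_integral_cmult)
  also have "\<dots> = ennreal a * (\<integral>\<^sup>+s. ennreal (s powr (- a - 1)) * indicator {0<..} s * emeasure sig {\<zeta> :: complex^'n. dist1 \<zeta> < min s R} \<partial>lborel)"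
  proof (rule nn_integral_cmult)
    have "(\<lambda>s. emeasure sig {\<zeta> :: complex^'n. dist1 \<zeta> < min s R}) = (\<lambda>s. \<integral>\<^sup>+\<zeta>. (if dist1 \<zeta> < min s R then 1 else 0) \<partial>(sig :: (complex^'n) measure))"
    proof
      fix s
      have "(\<integral>\<^sup>+\<zeta>. (if dist1 \<zeta> < min s R then 1 else 0) \<partial>(sig :: (complex^'n) measure)) = (\<integral>\<^sup>+\<zeta>. indicator {\<zeta>. dist1 \<zeta> < min s R} \<zeta> \<partial>(sig :: (complex^'n) measure))"
        by (intro nn_integral_cong) (simp add: indicator_def)
      then show "emeasure sig {\<zeta> :: complex^'n. dist1 \<zeta> < min s R} = (\<integral>\<^sup>+\<zeta>. (if dist1 \<zeta> < min s R then 1 else 0) \<partial>(sig :: (complex^'n) measure))"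
        by simp
    qed
    also have "\<dots> \<in> borel_measurable lborel" by measurable
    finally show "(\<lambda>s. ennreal (s powr (- a - 1)) * indicator {0<..} s * emeasure sig {\<zeta> :: complex^'n. dist1 \<zeta> < min s R}) \<in> borel_measurable lborel"
      by measurable
  qed
  finally show ?thesis .
qed

lemma pweight_integral_upper:
  "\<exists>C>0. \<forall>\<epsilon> R. 0 < \<epsilon> \<longrightarrow> \<epsilon> < 1 \<longrightarrow> 0 < R \<longrightarrow>
    (\<integral>\<^sup>+\<zeta>. ennreal (pweight \<epsilon> \<zeta>) * (if dist1 \<zeta> < R then 1 else 0) \<partial>(sig :: (complex^'n) measure)) \<le> ennreal (C / \<epsilon> * R powr (real CARD('n) * \<epsilon>))"
proof -
  obtain C where C: "C > 0" and CU: "\<And>(\<xi> :: complex^'n) r. norm \<xi> = 1 \<Longrightarrow> 0 < r \<Longrightarrow>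
     emeasure sig {\<eta>. norm (1 - hdot \<xi> \<eta>) < r} \<le> ennreal (C * r ^ CARD('n))"
    using sig_ball_upper[where 'n='n] by blast
  have "(\<integral>\<^sup>+\<zeta>. ennreal (pweight \<epsilon> \<zeta>) * (if dist1 \<zeta> < R then 1 else 0) \<partial>(sig :: (complex^'n) measure)) \<le> ennreal (C / \<epsilon> * R powr (real CARD('n) * \<epsilon>))"
    if \<epsilon>: "0 < \<epsilon>" "\<epsilon> < 1" and R: "0 < R" for \<epsilon> R
  proof -
    define n where "n = real CARD('n)"
    define a where "a = n * (1 - \<epsilon>)"
    have n: "n > 0" by (simp add: n_def)
    have a: "a > 0" "n - a = n * \<epsilon>" using \<epsilon> n by (auto simp: a_def algebra_simps)
    have na: "n * \<epsilon> > 0" using n \<epsilon> by simp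
    have "(\<integral>\<^sup>+s. ennreal (s powr (- a - 1)) * indicator {0<..} s * emeasure sig {\<zeta> :: complex^'n. dist1 \<zeta> < min s R} \<partial>lborel)
      \<le> (\<integral>\<^sup>+s. ennreal C * (ennreal (s powr (n * \<epsilon> - 1)) * indicator {0<..<R} s) + ennreal (C * R powr n) * (ennreal (s powr (- a - 1)) * indicator {R<..} s) \<partial>lborel)"
    proof (rule nn_integral_mono_AE, rule AE_mp[OF AE_lborel_singleton[of R]], intro AE_I2 impI)
      fix s :: real assume "s \<noteq> R"
      then consider "s \<le> 0" | "0 < s" "s < R" | "R < s" by linarith
      then show "ennreal (s powr (- a - 1)) * indicator {0<..} s * emeasure sig {\<zeta> :: complex^'n. dist1 \<zeta> < min s R}
        \<le> ennreal C * (ennreal (s powr (n * \<epsilon> - 1)) * indicator {0<..<R} s) + ennreal (C * R powr n) * (ennreal (s powr (- a - 1)) * indicator {R<..} s)"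
      proof cases
        case 2
        have "emeasure sig {\<zeta> :: complex^'n. dist1 \<zeta> < min s R} \<le> ennreal (C * s ^ CARD('n))"
          unfolding dist1_set using 2 CU[of e1 s] by simp
        then have "ennreal (s powr (- a - 1)) * emeasure sig {\<zeta> :: complex^'n. dist1 \<zeta> < min s R} \<le> ennreal (s powr (- a - 1)) * ennreal (C * s ^ CARD('n))"
          by (rule mult_left_mono) simp
        also have "\<dots> = ennreal (s powr (- a - 1) * (C * s ^ CARD('n)))" using C 2 by (intro ennreal_mult[symmetric]) auto
        also have "s powr (- a - 1) * (C * s ^ CARD('n)) = C * (s powr (- a - 1) * s powr n)"
          using 2 by (simp add: n_def powr_realpow)
        also have "s powr (- a - 1) * s powr n = s powr (n * \<epsilon> - 1)"
          unfolding powr_add[symmetric] a(2)[symmetric] by (simp add: algebra_simps)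
        also have "ennreal (C * s powr (n * \<epsilon> - 1)) = ennreal C * ennreal (s powr (n * \<epsilon> - 1))" using C by (intro ennreal_mult) auto
        finally show ?thesis using 2 by simp
      next
        case 3
        have "emeasure sig {\<zeta> :: complex^'n. dist1 \<zeta> < min s R} \<le> ennreal (C * R ^ CARD('n))"
          unfolding dist1_set using 3 R CU[of e1 R] by simp
        then have "ennreal (s powr (- a - 1)) * emeasure sig {\<zeta> :: complex^'n. dist1 \<zeta> < min s R} \<le> ennreal (s powr (- a - 1)) * ennreal (C * R ^ CARD('n))"
          by (rule mult_left_mono) simp
        then show ?thesis using 3 R by (simp add: n_def powr_realpow mult.commute)
      qed simp
    qed
    also have "\<dots> = ennreal C * ennreal (R powr (n * \<epsilon> - 1 + 1) / (n * \<epsilon> - 1 + 1)) + ennreal (C * R powr n) * ennreal (R powr (- a - 1 + 1) / (- (- a - 1) - 1))"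
      using R na a by (subst nn_integral_add, measurable) (simp add: nn_integral_cmult nn_integral_powr_from_0 nn_integral_powr_to_inf del: minus_add_distrib)
    also have "\<dots> = ennreal (C * (R powr (n * \<epsilon>) / (n * \<epsilon>)) + C * R powr n * (R powr (- a) / a))"
      using C a na by (simp add: ennreal_mult[symmetric] ennreal_plus[symmetric] del: ennreal_plus)
    finally have le: "(\<integral>\<^sup>+s. ennreal (s powr (- a - 1)) * indicator {0<..} s * emeasure sig {\<zeta> :: complex^'n. dist1 \<zeta> < min s R} \<partial>lborel)
      \<le> ennreal (C * (R powr (n * \<epsilon>) / (n * \<epsilon>)) + C * R powr n * (R powr (- a) / a))" .
    have "(\<integral>\<^sup>+\<zeta>. ennreal (pweight \<epsilon> \<zeta>) * (if dist1 \<zeta> < R then 1 else 0) \<partial>(sig :: (complex^'n) measure))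
      \<le> ennreal a * ennreal (C * (R powr (n * \<epsilon>) / (n * \<epsilon>)) + C * R powr n * (R powr (- a) / a))"
      unfolding nn_integral_pweight_layers[OF \<epsilon> R] a_def[unfolded n_def, symmetric] by (rule mult_left_mono[OF le]) simp
    also have "\<dots> = ennreal (a * (C * (R powr (n * \<epsilon>) / (n * \<epsilon>)) + C * R powr n * (R powr (- a) / a)))"
      using a C na by (intro ennreal_mult[symmetric]) auto
    also have "a * (C * (R powr (n * \<epsilon>) / (n * \<epsilon>)) + C * R powr n * (R powr (- a) / a)) = C / \<epsilon> * R powr (n * \<epsilon>)"
    proof -
      have "R powr n * R powr (- a) = R powr (n * \<epsilon>)" unfolding powr_add[symmetric] a(2)[symmetric] by simp
      then have "a * (C * (R powr (n * \<epsilon>) / (n * \<epsilon>)) + C * R powr n * (R powr (- a) / a)) = C * R powr (n * \<epsilon>) * (a / (n * \<epsilon>) + 1)"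
        using a(1) by (simp add: distrib_left mult_ac)
      also have "a / (n * \<epsilon>) + 1 = 1 / \<epsilon>" using n \<epsilon> by (simp add: a_def field_simps)
      finally show ?thesis by simp
    qed
    finally show ?thesis by (simp add: n_def)
  qed
  with C show ?thesis by blast
qed

lemma pweight_integral_lower:
  "\<exists>c>0. \<forall>\<epsilon> R. 0 < \<epsilon> \<longrightarrow> \<epsilon> \<le> 1/2 \<longrightarrow> 0 < R \<longrightarrow> R \<le> 3 \<longrightarrow>
    ennreal (c / \<epsilon> * R powr (real CARD('n) * \<epsilon>)) \<le> (\<integral>\<^sup>+\<zeta>. ennreal (pweight \<epsilon> \<zeta>) * (if dist1 \<zeta> < R then 1 else 0) \<partial>(sig :: (complex^'n) measure))"
proof -
  obtain c where c: "c > 0" and cL: "\<And>(\<xi> :: complex^'n) r. norm \<xi> = 1 \<Longrightarrow> 0 < r \<Longrightarrow> r \<le> 3 \<Longrightarrow>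
     ennreal (c * r ^ CARD('n)) \<le> emeasure sig {\<eta>. norm (1 - hdot \<xi> \<eta>) < r}"
    using sig_ball_lower[where 'n='n] by blast
  have "ennreal (c / 2 / \<epsilon> * R powr (real CARD('n) * \<epsilon>)) \<le> (\<integral>\<^sup>+\<zeta>. ennreal (pweight \<epsilon> \<zeta>) * (if dist1 \<zeta> < R then 1 else 0) \<partial>(sig :: (complex^'n) measure))"
    if \<epsilon>: "0 < \<epsilon>" "\<epsilon> \<le> 1/2" and R: "0 < R" "R \<le> 3" for \<epsilon> R
  proof -
    have \<epsilon>1: "\<epsilon> < 1" using \<epsilon> by simp
    define n where "n = real CARD('n)"
    define a where "a = n * (1 - \<epsilon>)"
    have n: "n > 0" by (simp add: n_def)
    have a: "a > 0" "n - a = n * \<epsilon>" using \<epsilon> n by (auto simp: a_def algebra_simps)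
    have na: "n * \<epsilon> > 0" using n \<epsilon> by simp
    have "ennreal c * ennreal (R powr (n * \<epsilon> - 1 + 1) / (n * \<epsilon> - 1 + 1)) = (\<integral>\<^sup>+s. ennreal c * (ennreal (s powr (n * \<epsilon> - 1)) * indicator {0<..<R} s) \<partial>lborel)"
      using R na by (subst nn_integral_cmult, measurable) (subst nn_integral_powr_from_0, auto)
    also have "\<dots> \<le> (\<integral>\<^sup>+s. ennreal (s powr (- a - 1)) * indicator {0<..} s * emeasure sig {\<zeta> :: complex^'n. dist1 \<zeta> < min s R} \<partial>lborel)"
    proof (rule nn_integral_mono)
      fix s :: real
      show "ennreal c * (ennreal (s powr (n * \<epsilon> - 1)) * indicator {0<..<R} s) \<le> ennreal (s powr (- a - 1)) * indicator {0<..} s * emeasure sig {\<zeta> :: complex^'n. dist1 \<zeta> < min s R}"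
      proof (cases "0 < s \<and> s < R")
        case True
        have "s powr (n * \<epsilon> - 1) = s powr (- a - 1) * s powr n"
          unfolding powr_add[symmetric] a(2)[symmetric] by (simp add: algebra_simps)
        then have "c * s powr (n * \<epsilon> - 1) = s powr (- a - 1) * (c * s ^ CARD('n))"
          using True by (simp add: n_def powr_realpow)
        then have "ennreal c * ennreal (s powr (n * \<epsilon> - 1)) = ennreal (s powr (- a - 1)) * ennreal (c * s ^ CARD('n))"
          using c True by (simp add: ennreal_mult[symmetric])
        also have "\<dots> \<le> ennreal (s powr (- a - 1)) * emeasure sig {\<zeta> :: complex^'n. dist1 \<zeta> < min s R}"
          unfolding dist1_set using True R cL[of e1 s] by (intro mult_left_mono) auto
        finally show ?thesis using True by simp
      qed auto
    qed
    finally have le: "ennreal c * ennreal (R powr (n * \<epsilon> - 1 + 1) / (n * \<epsilon> - 1 + 1)) \<le> (\<integral>\<^sup>+s. ennreal (s powr (- a - 1)) * indicator {0<..} s * emeasure sig {\<zeta> :: complex^'n. dist1 \<zeta> < min s R} \<partial>lborel)" .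
    have "c / 2 / \<epsilon> * R powr (n * \<epsilon>) \<le> a * (c * (R powr (n * \<epsilon>) / (n * \<epsilon>)))"
    proof -
      have "a * (c * (R powr (n * \<epsilon>) / (n * \<epsilon>))) = (1 - \<epsilon>) * (c / \<epsilon> * R powr (n * \<epsilon>))"
        using n by (simp add: a_def)
      moreover have "1/2 * (c / \<epsilon> * R powr (n * \<epsilon>)) \<le> (1 - \<epsilon>) * (c / \<epsilon> * R powr (n * \<epsilon>))"
        using \<epsilon> c by (intro mult_right_mono) auto
      ultimately show ?thesis by simp
    qed
    then have "ennreal (c / 2 / \<epsilon> * R powr (n * \<epsilon>)) \<le> ennreal (a * (c * (R powr (n * \<epsilon>) / (n * \<epsilon>))))"
      by (rule ennreal_leI)
    also have "\<dots> = ennreal a * (ennreal c * ennreal (R powr (n * \<epsilon> - 1 + 1) / (n * \<epsilon> - 1 + 1)))"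
      using a c na by (simp add: ennreal_mult[symmetric])
    also have "\<dots> \<le> ennreal a * (\<integral>\<^sup>+s. ennreal (s powr (- a - 1)) * indicator {0<..} s * emeasure sig {\<zeta> :: complex^'n. dist1 \<zeta> < min s R} \<partial>lborel)"
      by (rule mult_left_mono[OF le]) simp
    also have "\<dots> = (\<integral>\<^sup>+\<zeta>. ennreal (pweight \<epsilon> \<zeta>) * (if dist1 \<zeta> < R then 1 else 0) \<partial>(sig :: (complex^'n) measure))"
      unfolding nn_integral_pweight_layers[OF \<epsilon>(1) \<epsilon>1 R(1)] a_def n_def ..
    finally show ?thesis by (simp add: n_def)
  qed
  with c show ?thesis by (intro exI[of _ "c / 2"]) auto
qed

lemma dist1_le_2: "norm \<zeta> = 1 \<Longrightarrow> dist1 \<zeta> \<le> 2"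
  unfolding dist1_def using norm_triangle_ineq4[of 1 "hdot \<zeta> e1"] hdot_cauchy_schwarz[of \<zeta> e1] by simp

lemma dist1_triangle:
  fixes \<zeta> \<eta> :: "complex^'n"
  assumes "norm \<zeta> = 1" "norm \<eta> = 1"
  shows "dist1 \<zeta> \<le> 2 * (norm (1 - hdot \<zeta> \<eta>) + dist1 \<eta>)"
  unfolding dist1_def using assms by (intro norm_one_minus_hdot_triangle) auto

lemma weight_pweight:
  assumes "0 < \<epsilon>" "\<epsilon> < 1"
  shows "weight (pweight \<epsilon> :: complex^'n \<Rightarrow> real)"
  unfolding weight_def
proof
  obtain C where C: "\<And>R. 0 < R \<Longrightarrow> (\<integral>\<^sup>+\<zeta>. ennreal (pweight \<epsilon> \<zeta>) * (if dist1 \<zeta> < R then 1 else 0) \<partial>(sig :: (complex^'n) measure)) \<le> ennreal (C / \<epsilon> * R powr (real CARD('n) * \<epsilon>))"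
    using pweight_integral_upper[where 'n='n] assms by blast
  have m: "pweight \<epsilon> \<in> borel_measurable (sphere_measure :: (complex^'n) measure)"
    unfolding sphere_measure_alt by (intro measurable_completion measurable_restrict_space1) simp
  have "(\<integral>\<^sup>+\<zeta>. ennreal (norm (pweight \<epsilon> \<zeta>)) \<partial>(sphere_measure :: (complex^'n) measure)) \<le> (\<integral>\<^sup>+\<zeta>. ennreal (pweight \<epsilon> \<zeta>) * (if dist1 \<zeta> < 3 then 1 else 0) \<partial>(sig :: (complex^'n) measure))"
    unfolding nn_integral_sphere_measure
  proof (rule nn_integral_sig_mono)
    fix \<zeta> :: "complex^'n" assume "norm \<zeta> = 1"
    then show "ennreal (norm (pweight \<epsilon> \<zeta>)) \<le> ennreal (pweight \<epsilon> \<zeta>) * (if dist1 \<zeta> < 3 then 1 else 0)"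
      using dist1_le_2[of \<zeta>] by (simp add: pweight_def)
  qed
  also have "\<dots> < \<infinity>" using C[of 3] by (auto intro: order_le_less_trans)
  finally show "integrable sphere_measure (pweight \<epsilon> :: complex^'n \<Rightarrow> real)"
    by (rule integrableI_bounded[OF m])
  show "AE \<zeta> in sphere_measure. 0 < pweight \<epsilon> (\<zeta> :: complex^'n)"
    unfolding AE_sphere_measure by (rule AE_pweight_pos)
qed

text \<open>
  On a ball that is small compared with the distance of its points from the pole the weight is almost constant. Any other ball lies in a comparable ball
  around the pole, where \<open>pweight_integral_upper\<close> gives the mean; this is the only source of the factor \<open>1/\<epsilon>\<close>.
\<close>
lemma pweight_HL:
  "\<exists>K>0. \<forall>\<epsilon> (\<zeta> :: complex^'n). 0 < \<epsilon> \<longrightarrow> \<epsilon> \<le> 1/2 \<longrightarrow> norm \<zeta> = 1 \<longrightarrow> 0 < dist1 \<zeta> \<longrightarrow>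
     HL_maximal (pweight \<epsilon>) \<zeta> \<le> ennreal (K / \<epsilon> * pweight \<epsilon> \<zeta>)"
proof -
  define n where "n = real CARD('n)"
  have n: "n > 0" by (simp add: n_def)
  obtain C where C: "C > 0" and CU: "\<And>\<epsilon> R. 0 < \<epsilon> \<Longrightarrow> \<epsilon> < 1 \<Longrightarrow> 0 < R \<Longrightarrow>
    (\<integral>\<^sup>+\<zeta>. ennreal (pweight \<epsilon> \<zeta>) * (if dist1 \<zeta> < R then 1 else 0) \<partial>(sig :: (complex^'n) measure)) \<le> ennreal (C / \<epsilon> * R powr (n * \<epsilon>))"
    using pweight_integral_upper[where 'n='n] unfolding n_def by blast
  obtain c where c: "c > 0" and cL: "\<And>(\<xi> :: complex^'n) r. norm \<xi> = 1 \<Longrightarrow> 0 < r \<Longrightarrow> r \<le> 3 \<Longrightarrow>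
     ennreal (c * r ^ CARD('n)) \<le> emeasure sig {\<eta>. norm (1 - hdot \<xi> \<eta>) < r}"
    using sig_ball_lower[where 'n='n] by blast
  define K where "K = 4 powr n + C / c * 640 powr n"
  have K: "K > 0" using C c by (simp add: K_def add_pos_nonneg)
  have "HL_maximal (pweight \<epsilon>) \<zeta> \<le> ennreal (K / \<epsilon> * pweight \<epsilon> \<zeta>)"
    if \<epsilon>: "0 < \<epsilon>" "\<epsilon> \<le> 1/2" and z: "norm \<zeta> = 1" and d: "0 < dist1 \<zeta>" for \<epsilon> and \<zeta> :: "complex^'n"
    unfolding HL_maximal_def
  proof (rule SUP_least)
    fix E assume "E \<in> {nball \<xi> r |\<xi> r. \<xi> \<in> sphere 0 1 \<and> 0 < r \<and> \<zeta> \<in> nball \<xi> r}"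
    then obtain \<xi> r0 where E: "E = nball \<xi> r0" and x: "norm \<xi> = 1" and r0: "0 < r0" and zB: "\<zeta> \<in> nball \<xi> r0"
      by auto
    define a where "a = n * (1 - \<epsilon>)"
    have a: "0 < a" "a \<le> n" "n - a = n * \<epsilon>" using n \<epsilon> by (auto simp: a_def algebra_simps)
    define r where "r = min r0 3"
    have r: "0 < r" "r \<le> 3" using r0 by (auto simp: r_def)
    have B: "nball \<xi> r0 = nball \<xi> r"
      unfolding nball_def r_def using norm_one_minus_hdot_lt_3[OF x] by (intro Collect_cong conj_cong refl) auto
    have zr: "norm (1 - hdot \<xi> \<zeta>) < r" using zB unfolding B by (simp add: nball_def)
    define m where "m = emeasure sig {\<eta>. norm (1 - hdot \<xi> \<eta>) < r}"
    have m0: "m \<noteq> 0" "m < top" using nball_measure_pos[OF x r(1)] by (auto simp: m_def top.not_eq_extremum[symmetric])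
    define I where "I = (\<integral>\<^sup>+\<eta>. ennreal (pweight \<epsilon> \<eta>) * (if norm (1 - hdot \<xi> \<eta>) < r then 1 else 0) \<partial>sig)"
    have near: "norm (1 - hdot \<eta> \<zeta>) < 4 * r" if "norm \<eta> = 1" "norm (1 - hdot \<xi> \<eta>) < r" for \<eta>
      using norm_one_minus_hdot_triangle[of \<eta> \<zeta> \<xi>] that x z zr by (simp add: norm_one_minus_hdot_commute[of \<eta> \<xi>])
    have "I \<le> ennreal (K / \<epsilon> * pweight \<epsilon> \<zeta>) * m"
    proof (cases "16 * r \<le> dist1 \<zeta>")
      case True
      have "I \<le> (\<integral>\<^sup>+\<eta>. ennreal (4 powr n * pweight \<epsilon> \<zeta>) * indicator {\<eta>. norm (1 - hdot \<xi> \<eta>) < r} \<eta> \<partial>sig)"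
        unfolding I_def
      proof (rule nn_integral_sig_mono)
        fix \<eta> :: "complex^'n" assume e: "norm \<eta> = 1"
        show "ennreal (pweight \<epsilon> \<eta>) * (if norm (1 - hdot \<xi> \<eta>) < r then 1 else 0) \<le> ennreal (4 powr n * pweight \<epsilon> \<zeta>) * indicator {\<eta>. norm (1 - hdot \<xi> \<eta>) < r} \<eta>"
        proof (cases "norm (1 - hdot \<xi> \<eta>) < r")
          case True': True
          have "dist1 \<zeta> / 4 \<le> dist1 \<eta>"
            using dist1_triangle[OF z e] near[OF e True'] True by (simp add: norm_one_minus_hdot_commute[of \<eta> \<zeta>])
          then have "pweight \<epsilon> \<eta> \<le> (dist1 \<zeta> / 4) powr (- a)"
            unfolding pweight_def n_def[symmetric] a_def[symmetric] using d a by (intro powr_mono2') auto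
          also have "\<dots> = 4 powr a * pweight \<epsilon> \<zeta>"
            unfolding pweight_def n_def[symmetric] a_def[symmetric] by (simp add: powr_divide powr_minus_divide)
          also have "\<dots> \<le> 4 powr n * pweight \<epsilon> \<zeta>"
            using a by (intro mult_right_mono powr_mono) (auto simp: pweight_def)
          finally show ?thesis using True' by (simp add: ennreal_leI)
        qed simp
      qed
      also have "\<dots> = ennreal (4 powr n * pweight \<epsilon> \<zeta>) * m"
        unfolding m_def by (rule nn_integral_cmult_indicator) measurable
      also have "\<dots> \<le> ennreal (K / \<epsilon> * pweight \<epsilon> \<zeta>) * m"
      proof (intro mult_right_mono ennreal_leI)
        have "4 powr n \<le> K" using C c by (simp add: K_def)
        also have "K \<le> K / \<epsilon>" using K \<epsilon> by (simp add: le_divide_eq)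
        finally show "4 powr n \<le> K / \<epsilon>" .
      qed (auto simp: pweight_def)
      finally show ?thesis .
    next
      case False
      have "I \<le> (\<integral>\<^sup>+\<eta>. ennreal (pweight \<epsilon> \<eta>) * (if dist1 \<eta> < 40 * r then 1 else 0) \<partial>(sig :: (complex^'n) measure))"
        unfolding I_def
      proof (rule nn_integral_sig_mono)
        fix \<eta> :: "complex^'n" assume e: "norm \<eta> = 1"
        show "ennreal (pweight \<epsilon> \<eta>) * (if norm (1 - hdot \<xi> \<eta>) < r then 1 else 0) \<le> ennreal (pweight \<epsilon> \<eta>) * (if dist1 \<eta> < 40 * r then 1 else 0)"
          using dist1_triangle[OF e z] near[OF e] False by auto
      qed
      also have "\<dots> \<le> ennreal (C / \<epsilon> * (40 * r) powr (n * \<epsilon>))" using \<epsilon> r by (intro CU) auto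
      also have "\<dots> \<le> ennreal ((K / \<epsilon> * pweight \<epsilon> \<zeta>) * (c * r ^ CARD('n)))"
      proof (rule ennreal_leI)
        have "(40 * r) powr (n * \<epsilon>) = 40 powr (n * \<epsilon>) * r powr (n * \<epsilon>)" using r by (simp add: powr_mult)
        also have "\<dots> \<le> 40 powr n * r powr (n * \<epsilon>)" using n \<epsilon> by (intro mult_right_mono powr_mono) (auto simp: mult_left_le)
        finally have 1: "(40 * r) powr (n * \<epsilon>) \<le> 40 powr n * r powr (n * \<epsilon>)" .
        have "16 powr (- n) * r powr (- a) \<le> 16 powr (- a) * r powr (- a)" using a by (intro mult_right_mono powr_mono) auto
        also have "\<dots> = (16 * r) powr (- a)" using r by (simp add: powr_mult)
        also have "\<dots> \<le> pweight \<epsilon> \<zeta>"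
          unfolding pweight_def n_def[symmetric] a_def[symmetric] using d a False by (intro powr_mono2') auto
        finally have 2: "16 powr (- n) * r powr (- a) \<le> pweight \<epsilon> \<zeta>" .
        have ra: "r powr (- a) * r ^ CARD('n) = r powr (n * \<epsilon>)"
        proof -
          have "r ^ CARD('n) = r powr n" using r by (simp add: n_def powr_realpow)
          then show ?thesis unfolding a(3)[symmetric] by (simp add: powr_add[symmetric])
        qed
        have "(640 :: real) powr n = 40 powr n * 16 powr n" using powr_mult[of 40 16 n] by simp
        then have "40 powr n = 640 powr n * 16 powr (- n)" by (simp add: powr_minus)
        then have "C / \<epsilon> * (40 powr n * r powr (n * \<epsilon>)) = (C / c * 640 powr n) / \<epsilon> * ((16 powr (- n) * r powr (- a)) * (c * r ^ CARD('n)))"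
          unfolding ra[symmetric] using c by simp
        also have "\<dots> \<le> K / \<epsilon> * (pweight \<epsilon> \<zeta> * (c * r ^ CARD('n)))"
        proof (intro mult_mono divide_right_mono)
          show "C / c * 640 powr n \<le> K" by (simp add: K_def)
          show "0 \<le> K / \<epsilon>" using K \<epsilon> by simp
        qed (use 2 c C r \<epsilon> in auto)
        finally have "C / \<epsilon> * (40 powr n * r powr (n * \<epsilon>)) \<le> K / \<epsilon> * (pweight \<epsilon> \<zeta> * (c * r ^ CARD('n)))" .
        moreover have "C / \<epsilon> * (40 * r) powr (n * \<epsilon>) \<le> C / \<epsilon> * (40 powr n * r powr (n * \<epsilon>))"
          using 1 C \<epsilon> by (intro mult_left_mono) auto
        ultimately show "C / \<epsilon> * (40 * r) powr (n * \<epsilon>) \<le> (K / \<epsilon> * pweight \<epsilon> \<zeta>) * (c * r ^ CARD('n))"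
          by (simp only: mult.assoc)
      qed
      also have "\<dots> = ennreal (K / \<epsilon> * pweight \<epsilon> \<zeta>) * ennreal (c * r ^ CARD('n))"
        using K \<epsilon> c r by (intro ennreal_mult) (auto simp: pweight_def)
      also have "\<dots> \<le> ennreal (K / \<epsilon> * pweight \<epsilon> \<zeta>) * m"
        unfolding m_def using x r by (intro mult_left_mono cL) auto
      finally show ?thesis .
    qed
    then have "I / m \<le> ennreal (K / \<epsilon> * pweight \<epsilon> \<zeta>) * m / m" by (rule divide_right_mono_ennreal)
    also have "\<dots> = ennreal (K / \<epsilon> * pweight \<epsilon> \<zeta>)" using m0 by (intro mult_divide_eq_ennreal) auto
    finally have Im: "I / m \<le> ennreal (K / \<epsilon> * pweight \<epsilon> \<zeta>)" .
    have "(\<integral>\<^sup>+\<eta>\<in>nball \<xi> r0. ennreal \<bar>pweight \<epsilon> \<eta>\<bar> \<partial>sphere_measure) = I"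
      unfolding I_def nn_integral_sphere_measure B
    proof (rule nn_integral_sig_cong)
      fix \<eta> :: "complex^'n" assume "norm \<eta> = 1"
      then show "ennreal \<bar>pweight \<epsilon> \<eta>\<bar> * indicator (nball \<xi> r) \<eta> = ennreal (pweight \<epsilon> \<eta>) * (if norm (1 - hdot \<xi> \<eta>) < r then 1 else 0)"
        by (simp add: nball_def indicator_def pweight_def)
    qed
    then show "(\<integral>\<^sup>+\<eta>\<in>E. ennreal \<bar>pweight \<epsilon> \<eta>\<bar> \<partial>sphere_measure) / emeasure sphere_measure E \<le> ennreal (K / \<epsilon> * pweight \<epsilon> \<zeta>)"
      unfolding E using Im by (simp add: B emeasure_nball m_def)
  qed
  with K show ?thesis by blast
qed

lemma pweight_A1:
  "\<exists>K>0. \<forall>\<epsilon>. 0 < \<epsilon> \<longrightarrow> \<epsilon> \<le> 1/2 \<longrightarrow> (pweight \<epsilon> :: complex^'n \<Rightarrow> real) \<in> A1 \<and> A1_const (pweight \<epsilon> :: complex^'n \<Rightarrow> real) \<le> K / \<epsilon>"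
proof -
  obtain K where K: "K > 0" and HL: "\<And>\<epsilon> (\<zeta> :: complex^'n). 0 < \<epsilon> \<Longrightarrow> \<epsilon> \<le> 1/2 \<Longrightarrow> norm \<zeta> = 1 \<Longrightarrow> 0 < dist1 \<zeta> \<Longrightarrow>
     HL_maximal (pweight \<epsilon>) \<zeta> \<le> ennreal (K / \<epsilon> * pweight \<epsilon> \<zeta>)"
    using pweight_HL[where 'n='n] by blast
  have "(pweight \<epsilon> :: complex^'n \<Rightarrow> real) \<in> A1 \<and> A1_const (pweight \<epsilon> :: complex^'n \<Rightarrow> real) \<le> K / \<epsilon>"
    if \<epsilon>: "0 < \<epsilon>" "\<epsilon> \<le> 1/2" for \<epsilon>
  proof -
    have w: "weight (pweight \<epsilon> :: complex^'n \<Rightarrow> real)" using \<epsilon> by (intro weight_pweight) auto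
    have ae: "AE \<zeta> in sig. HL_maximal (pweight \<epsilon>) \<zeta> \<le> ennreal (K / \<epsilon> * pweight \<epsilon> (\<zeta> :: complex^'n))"
      using AE_sig_norm AE_dist1_pos by eventually_elim (rule HL[OF \<epsilon>])
    have pos: "0 < K / \<epsilon>" using K \<epsilon> by simp
    have "(pweight \<epsilon> :: complex^'n \<Rightarrow> real) \<in> A1"
      unfolding A1_def AE_sphere_measure using w pos ae by blast
    then show ?thesis using A1_const_upper(1)[OF w pos ae] by blast
  qed
  with K show ?thesis by blast
qed

section \<open>A lacunary test function\<close>

text \<open>
  Near the positive axis the kernel is close to its positive value on the axis, at the scale of the distance to \<open>1\<close>.
\<close>
lemma kfun_Re_lower:
  "\<exists>\<kappa>>0. \<forall>h u. 0 < h \<longrightarrow> h \<le> 1 \<longrightarrow> norm (u - of_real (1 - h)) \<le> \<kappa> * h \<longrightarrow> 3/16 / h ^ (n + 2) \<le> Re (kfun n u)"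
proof -
  have "isCont (\<lambda>\<tau> :: complex. 1 / (1 - \<tau>) ^ (n + 2)) 0" by (intro continuous_intros) auto
  then obtain \<delta> where \<delta>: "\<delta> > 0" and dl: "\<And>\<tau> :: complex. norm \<tau> < \<delta> \<Longrightarrow> norm (1 / (1 - \<tau>) ^ (n + 2) - 1) < 1/4"
    unfolding continuous_at_eps_delta dist_norm by (metis (no_types, lifting) diff_zero div_by_1 power_one zero_less_divide_1_iff zero_less_numeral)
  define \<kappa> where "\<kappa> = min (\<delta> / 2) (1/4)"
  have \<kappa>: "\<kappa> > 0" "\<kappa> < \<delta>" "\<kappa> \<le> 1/4" using \<delta> by (auto simp: \<kappa>_def)
  have "3/16 / h ^ (n + 2) \<le> Re (kfun n u)"
    if h: "0 < h" "h \<le> 1" and u: "norm (u - of_real (1 - h)) \<le> \<kappa> * h" for h u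
  proof -
    define \<tau> where "\<tau> = (u - of_real (1 - h)) / of_real h"
    have n\<tau>: "norm \<tau> \<le> \<kappa>" using u h by (simp add: \<tau>_def norm_divide divide_le_eq del: of_real_diff)
    have u1: "u = of_real (1 - h) + of_real h * \<tau>" using h by (simp add: \<tau>_def)
    have u2: "1 - u = of_real h * (1 - \<tau>)" unfolding u1 by (simp add: algebra_simps)
    define X where "X = 1 / (1 - \<tau>) ^ (n + 2)"
    define Y where "Y = 1 + u / of_nat n"
    define Y0 where "Y0 = 1 + (1 - h) / real n"
    have X: "norm (X - 1) \<le> 1/4" unfolding X_def using dl[of \<tau>] n\<tau> \<kappa> by simp
    have q: "0 \<le> 1 / real n" "1 / real n \<le> 1" by (cases n; simp)+
    have Y0: "1 \<le> Y0" "Y0 \<le> 2" using h q mult_mono[of "1 - h" 1 "1 / real n" 1] by (auto simp: Y0_def)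
    have "Y - of_real Y0 = (of_real h * \<tau>) * of_real (1 / real n)" unfolding Y_def Y0_def u1 by (simp add: add_divide_distrib)
    then have "norm (Y - of_real Y0) = (h * norm \<tau>) * (1 / real n)" using h by (simp add: norm_mult norm_divide)
    also have "\<dots> \<le> (1 * (1/4)) * 1" using h n\<tau> \<kappa> q by (intro mult_mono) auto
    finally have Y: "norm (Y - of_real Y0) \<le> 1/4" by simp
    have nY: "norm Y \<le> 9/4" using norm_triangle_ineq[of "Y - of_real Y0" "of_real Y0"] Y Y0 by simp
    have "norm (X * Y - of_real Y0) \<le> norm ((X - 1) * Y) + norm (Y - of_real Y0)"
      using norm_triangle_ineq[of "(X - 1) * Y" "Y - of_real Y0"] by (simp add: algebra_simps)
    also have "norm ((X - 1) * Y) \<le> 1/4 * (9/4)" unfolding norm_mult by (intro mult_mono X nY) auto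
    finally have XY: "norm (X * Y - of_real Y0) \<le> 13/16" using Y by linarith
    have "\<bar>Re (X * Y - of_real Y0)\<bar> \<le> 13/16" by (rule order_trans[OF abs_Re_le_cmod XY])
    then have R: "3/16 \<le> Re (X * Y)" using Y0 unfolding minus_complex.sel Re_complex_of_real by linarith
    have "kfun n u = X * Y / of_real (h ^ (n + 2))"
      unfolding kfun_def u2 power_mult_distrib X_def Y_def of_real_power by simp
    then have "Re (kfun n u) = Re (X * Y) / h ^ (n + 2)" by (simp only: Re_divide_of_real)
    then show ?thesis using divide_right_mono[OF R, of "h ^ (n + 2)"] h by simp
  qed
  with \<kappa> show ?thesis by blast
qed

lemma hdot_split:
  fixes z w :: "complex^'n"
  shows "(norm (hdot z w - z $ j1 * cnj (w $ j1)))\<^sup>2 \<le> ((norm z)\<^sup>2 - (norm (z $ j1))\<^sup>2) * ((norm w)\<^sup>2 - (norm (w $ j1))\<^sup>2)"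
proof -
  define P where "P z = z - (z $ j1) *s e1" for z :: "complex^'n"
  have e: "hdot e1 w = cnj (w $ j1)" for w :: "complex^'n" by (subst hdot_commute) (simp add: hdot_e1)
  have PP: "hdot (P z) (P w) = hdot z w - z $ j1 * cnj (w $ j1)" for z w :: "complex^'n"
    unfolding P_def by (simp add: hdot_diff_left hdot_diff_right hdot_mult_left hdot_mult_right hdot_e1 e e1_nth algebra_simps)
  have nP: "(norm (P z))\<^sup>2 = (norm z)\<^sup>2 - (norm (z $ j1))\<^sup>2" for z :: "complex^'n"
  proof -
    have "complex_of_real ((norm (P z))\<^sup>2) = of_real ((norm z)\<^sup>2) - of_real ((norm (z $ j1))\<^sup>2)"
      unfolding hdot_self[symmetric] PP by (simp add: complex_norm_square[symmetric] del: of_real_power)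
    then show ?thesis unfolding of_real_diff[symmetric] of_real_eq_iff .
  qed
  have "(norm (hdot (P z) (P w)))\<^sup>2 \<le> (norm (P z) * norm (P w))\<^sup>2"
    by (intro power_mono hdot_cauchy_schwarz) simp
  then show ?thesis by (simp add: PP power_mult_distrib nP)
qed

text \<open>
  The product of two vectors close to the axis is close to the product of their first coordinates: by \<open>hdot_split\<close> the remaining
  coordinates contribute at most the product of two defects \<open>O(sqrt q)\<close>.
\<close>
lemma hdot_near_axis:
  fixes \<zeta> w :: "complex^'n"
  assumes \<zeta>: "norm \<zeta> = 1" "dist1 \<zeta> \<le> q" and w: "norm w < 1" "norm (1 - w $ j1) \<le> q" and r: "0 \<le> r" "r \<le> 1"
  shows "norm (hdot (r *\<^sub>R \<zeta>) w - of_real r) \<le> 4 * q"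
proof -
  have q: "0 \<le> q" using norm_ge_zero w(2) by (rule order_trans)
  have defect: "1 - (norm x)\<^sup>2 \<le> 2 * norm (1 - x)" if "norm x \<le> 1" for x :: complex
  proof -
    have "1 - (norm x)\<^sup>2 = (1 - norm x) * (1 + norm x)" by (simp add: power2_eq_square algebra_simps)
    also have "\<dots> \<le> norm (1 - x) * 2"
      using that norm_triangle_ineq2[of 1 x] by (intro mult_mono) auto
    finally show ?thesis by simp
  qed
  have z1: "norm (\<zeta> $ j1) \<le> 1" "norm (1 - \<zeta> $ j1) \<le> q"
    using Finite_Cartesian_Product.norm_nth_le[of \<zeta> j1] \<zeta> by (auto simp: dist1_def hdot_e1)
  have w1: "norm (w $ j1) \<le> 1" using Finite_Cartesian_Product.norm_nth_le[of w j1] w by simp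
  have A: "(norm (r *\<^sub>R \<zeta>))\<^sup>2 - (norm ((r *\<^sub>R \<zeta>) $ j1))\<^sup>2 \<le> 2 * q"
  proof -
    have "(norm (r *\<^sub>R \<zeta>))\<^sup>2 - (norm ((r *\<^sub>R \<zeta>) $ j1))\<^sup>2 = r\<^sup>2 * (1 - (norm (\<zeta> $ j1))\<^sup>2)"
      using \<zeta> r by (simp add: power_mult_distrib right_diff_distrib)
    also have "\<dots> \<le> 1 * (1 - (norm (\<zeta> $ j1))\<^sup>2)"
      using r z1 by (intro mult_right_mono) (auto simp: power_le_one)
    finally show ?thesis using defect[OF z1(1)] z1(2) by simp
  qed
  have "(norm w)\<^sup>2 \<le> 1" using w by (simp add: power_le_one)
  then have B: "(norm w)\<^sup>2 - (norm (w $ j1))\<^sup>2 \<le> 2 * q" using defect[OF w1] w(2) by simp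
  have B0: "0 \<le> (norm w)\<^sup>2 - (norm (w $ j1))\<^sup>2" using Finite_Cartesian_Product.norm_nth_le[of w j1] by (simp add: power_mono)
  define R where "R = hdot (r *\<^sub>R \<zeta>) w - (r *\<^sub>R \<zeta>) $ j1 * cnj (w $ j1)"
  have "(norm R)\<^sup>2 \<le> (2 * q) * (2 * q)"
    unfolding R_def by (rule order_trans[OF hdot_split]) (use A B B0 q in \<open>intro mult_mono, auto\<close>)
  then have "(norm R)\<^sup>2 \<le> (2 * q)\<^sup>2" by (simp only: power2_eq_square)
  then have R: "norm R \<le> 2 * q" by (rule power2_le_imp_le) (use q in simp)
  have "norm (\<zeta> $ j1 * cnj (w $ j1) - 1) \<le> norm ((\<zeta> $ j1 - 1) * cnj (w $ j1)) + norm (cnj (w $ j1) - 1)"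
    using norm_triangle_ineq[of "(\<zeta> $ j1 - 1) * cnj (w $ j1)" "cnj (w $ j1) - 1"] by (simp add: algebra_simps)
  also have "norm (cnj (w $ j1) - 1) = norm (1 - w $ j1)"
    by (metis complex_cnj_diff complex_cnj_one complex_mod_cnj norm_minus_commute)
  also have "norm ((\<zeta> $ j1 - 1) * cnj (w $ j1)) \<le> q * 1"
    unfolding norm_mult using z1 w1 q by (intro mult_mono) (auto simp: norm_minus_commute)
  finally have S: "norm (\<zeta> $ j1 * cnj (w $ j1) - 1) \<le> 2 * q" using w(2) by simp
  have "hdot (r *\<^sub>R \<zeta>) w - of_real r = R + of_real r * (\<zeta> $ j1 * cnj (w $ j1) - 1)"
    unfolding R_def vector_scaleR_component by (simp add: scaleR_conv_of_real[of r "\<zeta> $ j1"] algebra_simps)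
  then have "norm (hdot (r *\<^sub>R \<zeta>) w - of_real r) \<le> norm R + norm (of_real r * (\<zeta> $ j1 * cnj (w $ j1) - 1))"
    by (simp only: norm_triangle_ineq)
  also have "norm (of_real r * (\<zeta> $ j1 * cnj (w $ j1) - 1)) \<le> 1 * (2 * q)"
    unfolding norm_mult using r S by (intro mult_mono) auto
  finally show ?thesis using R by linarith
qed

text \<open>
  Points at height comparable to \<open>b s\<close> whose projection has distance between \<open>a s\<close> and \<open>b s\<close> from the pole. The lower bound on the distance
  keeps the shells away from the approach regions of the pole; without it the test function would have a large square function itself.
\<close>
definition shell :: "real \<Rightarrow> real \<Rightarrow> real \<Rightarrow> complex^'n \<Rightarrow> bool" where
  "shell a b s w \<longleftrightarrow> b * s / 2 \<le> 1 - norm w \<and> 1 - norm w < b * s \<and> a * s \<le> dist1 (sgn w) \<and> dist1 (sgn w) < b * s"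

definition lacunary :: "real \<Rightarrow> real \<Rightarrow> real \<Rightarrow> complex^'n \<Rightarrow> complex" where
  "lacunary a b l w = (if \<exists>k. shell a b (l ^ k) w then 1 else 0)"

lemma shell_measurable [measurable]: "Measurable.pred borel (shell a b s)"
  unfolding shell_def by measurable

lemma lacunary_measurable [measurable]: "lacunary a b l \<in> borel_measurable borel"
  unfolding lacunary_def by measurable

text \<open>
  If \<open>\<alpha>\<close> is small, then the ball of radius \<open>\<alpha> b s\<close> removes at most half of the mass of the ball of radius \<open>b s\<close>.
\<close>
lemma nu_shell_lower:
  "\<exists>\<alpha>>0. \<exists>c>0. \<alpha> \<le> 1 \<and> (\<forall>b s. 0 < b \<longrightarrow> b \<le> 1/2 \<longrightarrow> 0 < s \<longrightarrow> s \<le> 1 \<longrightarrow>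
     c * (b * s) ^ (CARD('n) + 1) \<le> measure nu {w :: complex^'n. shell (\<alpha> * b) b s w})"
proof -
  define n where "n = CARD('n)"
  have n: "n \<ge> 1" by (simp add: n_def Suc_le_eq)
  obtain C where C: "C > 0" and CU: "\<And>(\<xi> :: complex^'n) r. norm \<xi> = 1 \<Longrightarrow> 0 < r \<Longrightarrow>
     emeasure sig {\<eta>. norm (1 - hdot \<xi> \<eta>) < r} \<le> ennreal (C * r ^ n)"
    using sig_ball_upper[where 'n='n] unfolding n_def by blast
  obtain c where c: "c > 0" and cL: "\<And>(\<xi> :: complex^'n) r. norm \<xi> = 1 \<Longrightarrow> 0 < r \<Longrightarrow> r \<le> 3 \<Longrightarrow>
     ennreal (c * r ^ n) \<le> emeasure sig {\<eta>. norm (1 - hdot \<xi> \<eta>) < r}"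
    using sig_ball_lower[where 'n='n] unfolding n_def by blast
  define \<alpha> where "\<alpha> = min 1 (c / (2 * C))"
  have \<alpha>: "0 < \<alpha>" "\<alpha> \<le> 1" "\<alpha> \<le> c / (2 * C)" using c C by (auto simp: \<alpha>_def)
  define c2 where "c2 = real n * (1/2) ^ (2 * n - 1)"
  have c2: "c2 > 0" using n by (simp add: c2_def)
  have "c / 2 * c2 * (b * s) ^ (n + 1) \<le> measure nu {w :: complex^'n. shell (\<alpha> * b) b s w}"
    if b: "0 < b" "b \<le> 1/2" and s: "0 < s" "s \<le> 1" for b s
  proof -
    define t where "t = b * s"
    have t: "0 < t" "t \<le> 1/2" using b s mult_mono[of b "1/2" s 1] by (auto simp: t_def)
    define S where "S = {\<eta> :: complex^'n. \<alpha> * t \<le> dist1 \<eta> \<and> dist1 \<eta> < t}"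
    have [measurable]: "S \<in> sets borel" unfolding S_def by measurable
    have "c * t ^ n \<le> measure sig S + C * (\<alpha> * t) ^ n"
    proof -
      have "ennreal (c * t ^ n) \<le> emeasure sig {\<eta> :: complex^'n. dist1 \<eta> < t}"
        unfolding dist1_set using t by (intro cL) auto
      also have "\<dots> \<le> emeasure sig (S \<union> {\<eta> :: complex^'n. dist1 \<eta> < \<alpha> * t})"
        by (intro emeasure_mono) (auto simp: S_def)
      also have "\<dots> \<le> emeasure sig S + emeasure sig {\<eta> :: complex^'n. dist1 \<eta> < \<alpha> * t}"
        by (intro emeasure_subadditive) auto
      also have "\<dots> \<le> ennreal (measure sig S) + ennreal (C * (\<alpha> * t) ^ n)"
        unfolding dist1_set sig.emeasure_eq_measure[where 'n='n, symmetric] using t \<alpha> by (intro add_left_mono CU) auto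
      also have "\<dots> = ennreal (measure sig S + C * (\<alpha> * t) ^ n)"
        using C t \<alpha> by (intro ennreal_plus[symmetric]) auto
      finally show ?thesis using C t \<alpha> by (subst (asm) ennreal_le_iff) auto
    qed
    moreover have "C * (\<alpha> * t) ^ n \<le> c / 2 * t ^ n"
    proof -
      have "\<alpha> ^ n \<le> \<alpha> ^ 1" using \<alpha> n by (intro power_decreasing) auto
      then have "C * \<alpha> ^ n \<le> C * (c / (2 * C))" using C \<alpha> by (intro mult_left_mono) auto
      also have "\<dots> = c / 2" using C by simp
      finally show ?thesis using t by (simp add: power_mult_distrib mult.assoc[symmetric] mult_right_mono)
    qed
    ultimately have S: "c / 2 * t ^ n \<le> measure sig S" by simp
    have "ennreal (c2 * t) = (\<integral>\<^sup>+r. ennreal (2 * c2) * indicator {1 - t<..1 - t / 2} r \<partial>lborel)"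
      using t c2 by (subst nn_integral_cmult_indicator) (auto simp: ennreal_mult[symmetric])
    also have "\<dots> \<le> (\<integral>\<^sup>+r. (if t / 2 \<le> 1 - r \<and> 1 - r < t then 1 else 0) * ennreal (rd n r) \<partial>lborel)"
    proof (rule nn_integral_mono)
      fix r :: real
      show "ennreal (2 * c2) * indicator {1 - t<..1 - t / 2} r \<le> (if t / 2 \<le> 1 - r \<and> 1 - r < t then 1 else 0) * ennreal (rd n r)"
      proof (cases "r \<in> {1 - t<..1 - t / 2}")
        case True
        then have r: "1/2 \<le> r" "r < 1" "t / 2 \<le> 1 - r" "1 - r < t" using t by auto
        have "(1/2) ^ (2 * n - 1) \<le> r ^ (2 * n - 1)" using r by (intro power_mono) auto
        then have "2 * real n * (1/2) ^ (2 * n - 1) \<le> 2 * real n * r ^ (2 * n - 1)" by (rule mult_left_mono) simp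
        then have "2 * c2 \<le> rd n r" using r by (simp add: c2_def rd_def)
        then show ?thesis using r True by (simp add: ennreal_leI)
      qed simp
    qed
    finally have R: "ennreal (c2 * t) \<le> (\<integral>\<^sup>+r. (if t / 2 \<le> 1 - r \<and> 1 - r < t then 1 else 0) * ennreal (rd n r) \<partial>lborel)" .
    have "ennreal (c / 2 * c2 * t ^ (n + 1)) = ennreal (c / 2 * t ^ n) * ennreal (c2 * t)"
      using c c2 t by (simp add: ennreal_mult[symmetric] mult_ac)
    also have "\<dots> \<le> emeasure sig S * (\<integral>\<^sup>+r. (if t / 2 \<le> 1 - r \<and> 1 - r < t then 1 else 0) * ennreal (rd n r) \<partial>lborel)"
      unfolding sig.emeasure_eq_measure using S R by (intro mult_mono ennreal_leI) auto
    also have "\<dots> = (\<integral>\<^sup>+\<zeta>. indicator S \<zeta> \<partial>sig) * (\<integral>\<^sup>+r. (if t / 2 \<le> 1 - r \<and> 1 - r < t then 1 else 0) * ennreal (rd n r) \<partial>lborel)"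
      by simp
    also have "\<dots> = (\<integral>\<^sup>+w. indicator S (sgn w) * (if t / 2 \<le> 1 - norm w \<and> 1 - norm w < t then 1 else 0) \<partial>nu)"
      unfolding n_def by (rule polar_product[symmetric]) measurable
    also have "\<dots> = (\<integral>\<^sup>+w. indicator {w. shell (\<alpha> * b) b s w} w \<partial>(nu :: (complex^'n) measure))"
      by (intro nn_integral_cong) (auto simp: S_def shell_def t_def mult_ac split: split_indicator)
    also have "\<dots> = emeasure nu {w :: complex^'n. shell (\<alpha> * b) b s w}" by simp
    finally show ?thesis unfolding nu.emeasure_eq_measure t_def by (subst (asm) ennreal_le_iff) auto
  qed
  moreover have "c / 2 * c2 > 0" using c c2 by simp
  ultimately show ?thesis using \<alpha> unfolding n_def by blast
qed

lemma shell_unique: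
  assumes "shell a b (l ^ j) w" "a * l ^ k \<le> dist1 (sgn w)" "dist1 (sgn w) < b * l ^ k"
    and "0 < l" "l \<le> 1" "b * l \<le> a" "0 < a" "0 < b"
  shows "j = k"
proof (rule ccontr)
  have *: False if "i < m" "a * l ^ i \<le> d" "d < b * l ^ m" for i m d
  proof -
    have "b * l ^ m \<le> b * l ^ Suc i" using that assms by (intro mult_left_mono power_decreasing) auto
    also have "\<dots> = (b * l) * l ^ i" by simp
    also have "\<dots> \<le> a * l ^ i" using assms by (intro mult_right_mono) auto
    finally show False using that by simp
  qed
  assume "j \<noteq> k"
  then show False using *[of j k] *[of k j] assms by (auto simp: shell_def neq_iff)
qed

text \<open>
  By \<open>shell_unique\<close> a radius meets one shell at most, and there the density is \<open>O(1 / (b s))\<close> on an interval of length \<open>b s / 2\<close>.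
\<close>
lemma energy_lacunary:
  fixes \<zeta> :: "complex^'n"
  assumes l: "0 < l" "l \<le> 1" and ab: "b * l \<le> a" "0 < a" "0 < b" and z: "norm \<zeta> = 1"
  shows "energy (lacunary a b l) \<zeta> \<le> ennreal (2 * real CARD('n))"
proof (cases "\<exists>k. a * l ^ k \<le> dist1 \<zeta> \<and> dist1 \<zeta> < b * l ^ k")
  case False
  have "energy (lacunary a b l) \<zeta> = (\<integral>\<^sup>+r. 0 \<partial>(lborel :: real measure))"
    unfolding energy_def
  proof (rule nn_integral_cong)
    fix r :: real
    show "ennreal ((norm (lacunary a b l (r *\<^sub>R \<zeta>)))\<^sup>2 * (rd CARD('n) r / (1 - r\<^sup>2))) = 0"
    proof (cases "0 < r")
      case True
      then have "\<not> shell a b (l ^ k) (r *\<^sub>R \<zeta>)" for k using False z by (auto simp: shell_def sgn_scaleR_unit)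
      then show ?thesis by (simp add: lacunary_def)
    qed (simp add: rd_def)
  qed
  then show ?thesis by simp
next
  case True
  then obtain k where k: "a * l ^ k \<le> dist1 \<zeta>" "dist1 \<zeta> < b * l ^ k" by blast
  define t where "t = b * l ^ k"
  have t: "t > 0" using ab l by (simp add: t_def)
  define n where "n = CARD('n)"
  have "energy (lacunary a b l) \<zeta> \<le> (\<integral>\<^sup>+r. ennreal (2 * n / (t / 2)) * indicator {1 - t<..1 - t / 2} r \<partial>lborel)"
    unfolding energy_def
  proof (rule nn_integral_mono)
    fix r :: real
    show "ennreal ((norm (lacunary a b l (r *\<^sub>R \<zeta>)))\<^sup>2 * (rd CARD('n) r / (1 - r\<^sup>2))) \<le> ennreal (2 * n / (t / 2)) * indicator {1 - t<..1 - t / 2} r"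
    proof (cases "0 < r \<and> r < 1 \<and> (\<exists>j. shell a b (l ^ j) (r *\<^sub>R \<zeta>))")
      case False
      then show ?thesis by (auto simp: rd_def lacunary_def)
    next
      case True
      then obtain j where r: "0 < r" "r < 1" and j: "shell a b (l ^ j) (r *\<^sub>R \<zeta>)" by blast
      have s: "sgn (r *\<^sub>R \<zeta>) = \<zeta>" using z r by (intro sgn_scaleR_unit)
      have jk: "j = k" using j k l ab by (intro shell_unique[of a b l j "r *\<^sub>R \<zeta>" k]) (simp_all add: s)
      have rt: "t / 2 \<le> 1 - r" "1 - r < t" using j r z unfolding jk by (auto simp: shell_def t_def)
      have "rd n r \<le> 2 * n" using r by (auto simp: rd_def intro!: mult_left_le power_le_one)
      moreover have "r * r \<le> r * 1" using r by (intro mult_left_mono) auto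
      then have "t / 2 \<le> 1 - r\<^sup>2" using rt unfolding power2_eq_square by linarith
      ultimately have "rd n r / (1 - r\<^sup>2) \<le> 2 * n / (t / 2)" using t by (intro frac_le) auto
      moreover have "norm (lacunary a b l (r *\<^sub>R \<zeta>)) \<le> 1" by (simp add: lacunary_def)
      then have "(norm (lacunary a b l (r *\<^sub>R \<zeta>)))\<^sup>2 * (rd n r / (1 - r\<^sup>2)) \<le> 1 * (rd n r / (1 - r\<^sup>2))"
        by (intro mult_right_mono) (auto simp: power_le_one)
      ultimately show ?thesis using rt unfolding n_def by (simp add: ennreal_leI del: divide_divide_eq_right)
    qed
  qed
  also have "\<dots> = ennreal (2 * n)"
    using t by (subst nn_integral_cmult_indicator) (auto simp: ennreal_mult[symmetric])
  finally show ?thesis by (simp add: n_def)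
qed

lemma lacunary_integrable: "integrable nu (lacunary a b l :: complex^'n \<Rightarrow> complex)"
  by (rule nu.integrable_const_bound[of _ 1]) (auto simp: lacunary_def[abs_def])

text \<open>
  At a point of height comparable to \<open>s = l^k\<close> above the axis the shell of scale \<open>s\<close> contributes a positive multiple of \<open>1 / s\<close> to the
  integral, as the kernel is almost positive there. Shells of smaller scale lie below the height \<open>b l s\<close>, and those of
  larger scale above the height \<open>b s / (2 l)\<close>; both contribute \<open>O(sqrt l / s)\<close>. So a small ratio \<open>l\<close> makes the main term dominate.
\<close>
lemma Top_lacunary_lower:
  "\<exists>a b l c. 0 < a \<and> 0 < b \<and> b \<le> 1 \<and> 0 < l \<and> l \<le> 1/4 \<and> b * l \<le> a \<and> 0 < c \<and>
     (\<forall>k (\<zeta> :: complex^'n) r. norm \<zeta> = 1 \<longrightarrow> dist1 \<zeta> \<le> b * l ^ k \<longrightarrow> 0 \<le> r \<longrightarrow> l ^ k / 2 \<le> 1 - r \<longrightarrow> 1 - r \<le> l ^ k \<longrightarrow>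
        c \<le> norm (Top (lacunary a b l) (r *\<^sub>R \<zeta>)))"
proof -
  define n where "n = CARD('n)"
  obtain \<kappa> where \<kappa>: "\<kappa> > 0" and K: "\<And>h u. 0 < h \<Longrightarrow> h \<le> 1 \<Longrightarrow> norm (u - of_real (1 - h)) \<le> \<kappa> * h \<Longrightarrow> 3/16 / h ^ (n + 2) \<le> Re (kfun n u)"
    using kfun_Re_lower[of n] by blast
  \<comment> \<open>The factor \<open>16\<close> is the product of \<open>4\<close> from \<open>hdot_near_axis\<close>, \<open>2\<close> from the radius \<open>2 b s\<close> in its hypotheses and \<open>2\<close> from \<open>s \<le> 2 h\<close>.\<close>
  define b where "b = min (1/2) (\<kappa> / 16)"
  have b: "0 < b" "b \<le> 1/2" "16 * b \<le> \<kappa>" using \<kappa> by (auto simp: b_def)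
  obtain \<alpha> c1 where \<alpha>: "0 < \<alpha>" "\<alpha> \<le> 1" and c1: "0 < c1" and shell: "\<And>s. 0 < s \<Longrightarrow> s \<le> 1 \<Longrightarrow>
     c1 * (b * s) ^ (n + 1) \<le> measure nu {w :: complex^'n. shell (\<alpha> * b) b s w}"
    using nu_shell_lower[where 'n='n] b unfolding n_def by blast
  define a where "a = \<alpha> * b"
  have a: "0 < a" using \<alpha> b by (simp add: a_def)
  obtain Cm where Cm: "Cm > 0" and m: "\<And>z :: complex^'n. norm z < 1 \<Longrightarrow>
     (\<integral>\<^sup>+w. ennreal ((1 - norm w) powr (- (1/2)) * kern z w) \<partial>nu) \<le> ennreal (Cm * (1 - norm z) powr (- (3/2)))"
    using ball_kernel_upper[where 'n='n, of "- (1/2)"] by auto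
  obtain Cp where Cp: "Cp > 0" and p: "\<And>z :: complex^'n. norm z < 1 \<Longrightarrow>
     (\<integral>\<^sup>+w. ennreal ((1 - norm w) powr (1/2) * kern z w) \<partial>nu) \<le> ennreal (Cp * (1 - norm z) powr (- (1/2)))"
    using ball_kernel_upper[where 'n='n, of "1/2"] by auto
  define m0 where "m0 = 3/16 * (c1 * b ^ (n + 1))"
  have m0: "m0 > 0" using c1 b by (simp add: m0_def)
  define E where "E = 2 * (b powr (1/2) * (Cm * (1/2) powr (- (3/2))) + (b / 2) powr (- (1/2)) * (Cp * (1/2) powr (- (1/2))))"
  have E: "E > 0" using b Cm Cp by (auto simp: E_def intro!: add_pos_pos mult_pos_pos)
  define l where "l = min (1/4) (min \<alpha> ((m0 / (2 * E))\<^sup>2))"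
  have l: "0 < l" "l \<le> 1/4" "l \<le> \<alpha>" "l \<le> (m0 / (2 * E))\<^sup>2" using \<alpha> m0 E by (auto simp: l_def)
  have bl: "b * l \<le> a" using l b by (simp add: a_def mult.commute)
  have lE: "E * l powr (1/2) \<le> m0 / 2"
  proof -
    have "l powr (1/2) = sqrt l" using l by (simp add: powr_half_sqrt)
    also have "\<dots> \<le> sqrt ((m0 / (2 * E))\<^sup>2)" using l(4) by (rule real_sqrt_le_mono)
    also have "\<dots> = m0 / (2 * E)" using m0 E by simp
    finally have "E * l powr (1/2) \<le> E * (m0 / (2 * E))" using E by (intro mult_left_mono) auto
    then show ?thesis using E by simp
  qed
  have "m0 / 4 \<le> norm (Top (lacunary a b l) (r *\<^sub>R \<zeta>))"
    if z: "norm \<zeta> = 1" "dist1 \<zeta> \<le> b * l ^ k" and r: "0 \<le> r" "l ^ k / 2 \<le> 1 - r" "1 - r \<le> l ^ k"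
    for k and \<zeta> :: "complex^'n" and r
  proof -
    define s where "s = l ^ k"
    define h where "h = 1 - r"
    have s: "0 < s" "s \<le> 1" using l by (auto simp: s_def power_le_one)
    have h: "0 < h" "h \<le> 1" "s / 2 \<le> h" "h \<le> s" using r s by (auto simp: h_def s_def)
    define z where "z = r *\<^sub>R \<zeta>"
    have nz: "norm z = r" "r < 1" using z r h by (auto simp: z_def h_def)
    define S where "S = {w :: complex^'n. shell a b s w}"
    have [measurable]: "S \<in> sets borel" unfolding S_def by measurable
    define \<psi> where "\<psi> w = (if (\<exists>j. shell a b (l ^ j) w) \<and> w \<notin> S then 1 else 0 :: complex)" for w
    have [measurable]: "\<psi> \<in> borel_measurable borel" unfolding \<psi>_def by measurable
    have split: "lacunary a b l w = indicator S w + \<psi> w" for w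
      by (auto simp: lacunary_def \<psi>_def S_def s_def split: split_indicator)
    let ?k = "\<lambda>w. kfun n (hdot z w)"
    have kb: "norm (?k w) \<le> 2 * (1 - r) powr (- (real n + 2))" if "norm w < 1" for w :: "complex^'n"
      unfolding n_def using nz that by (intro kfun_bound_cball) auto
    have i1: "integrable nu (\<lambda>w. indicator S w * ?k w)"
    proof (rule integrable_kernel[OF _ _ kb])
      show "integrable nu (indicator S :: complex^'n \<Rightarrow> complex)"
        by (rule nu.integrable_const_bound[of _ 1]) (auto split: split_indicator)
    qed measurable
    have i2: "integrable nu (\<lambda>w. \<psi> w * ?k w)"
    proof (rule integrable_kernel[OF _ _ kb])
      show "integrable nu \<psi>" by (rule nu.integrable_const_bound[of _ 1]) (auto simp: \<psi>_def)
    qed measurable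
    have Sop: "Sop (lacunary a b l) z = (LINT w|nu. indicator S w * ?k w) + (LINT w|nu. \<psi> w * ?k w)"
      unfolding Sop_def split distrib_right n_def[symmetric] by (rule Bochner_Integration.integral_add[OF i1 i2])
    have main: "m0 / s \<le> Re (LINT w|nu. indicator S w * ?k w)"
    proof -
      have Rk: "3/16 / h ^ (n + 2) \<le> Re (?k w)" if w: "w \<in> S" for w
      proof (rule K[OF h(1,2)])
        have sh: "1 - norm w < b * s" "dist1 (sgn w) < b * s" "norm w < 1" using w b s by (auto simp: S_def shell_def)
        have "1 - w $ j1 = of_real (1 - norm w) + of_real (norm w) * (1 - sgn w $ j1)"
          by (subst nth_eq_norm_sgn) (simp add: algebra_simps)
        then have "norm (1 - w $ j1) \<le> norm (of_real (1 - norm w) :: complex) + norm (of_real (norm w) * (1 - sgn w $ j1))"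
          by (simp only: norm_triangle_ineq)
        also have "norm (of_real (norm w) * (1 - sgn w $ j1)) \<le> 1 * (b * s)"
          unfolding norm_mult using sh by (intro mult_mono) (auto simp: dist1_def hdot_e1)
        also have "norm (of_real (1 - norm w) :: complex) = 1 - norm w" using sh by (simp del: of_real_diff)
        finally have w1: "norm (1 - w $ j1) \<le> 2 * (b * s)" using sh by linarith
        have "dist1 \<zeta> \<le> 2 * (b * s)" using z b s unfolding s_def[symmetric] by (smt (verit) mult_pos_pos)
        then have "norm (hdot z w - of_real r) \<le> 4 * (2 * (b * s))"
          unfolding z_def using z r nz sh w1 by (intro hdot_near_axis) auto
        also have "\<dots> \<le> (16 * b) * h" using h b mult_left_mono[of "s / 2" h "16 * b"] by simp
        also have "\<dots> \<le> \<kappa> * h" using b h by (intro mult_right_mono) auto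
        finally show "norm (hdot z w - of_real (1 - h)) \<le> \<kappa> * h" by (simp add: h_def)
      qed
      have "m0 / s = 3/16 / s ^ (n + 2) * (c1 * (b * s) ^ (n + 1))"
        using s by (simp add: m0_def power_mult_distrib)
      also have "\<dots> \<le> 3/16 / h ^ (n + 2) * measure nu S"
        using h s b c1 shell[OF s] by (intro mult_mono divide_left_mono power_mono) (auto simp: S_def a_def)
      also have "\<dots> = (LINT w|nu. indicator S w * (3/16 / h ^ (n + 2)))" by simp
      also have "\<dots> \<le> (LINT w|nu. Re (indicator S w * ?k w))"
      proof (rule integral_mono)
        show "integrable nu (\<lambda>w. indicator S w * (3/16 / h ^ (n + 2)))"
          by (intro integrable_mult_left) (auto intro!: nu.integrable_const_bound[of _ 1] split: split_indicator)
        show "integrable nu (\<lambda>w. Re (indicator S w * ?k w))" using i1 by (rule integrable_Re)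
        show "indicator S w * (3/16 / h ^ (n + 2)) \<le> Re (indicator S w * ?k w)" for w
          using Rk[of w] by (auto split: split_indicator)
      qed
      also have "\<dots> = Re (LINT w|nu. indicator S w * ?k w)" using i1 by (rule integral_Re)
      finally show ?thesis .
    qed
    have err: "norm (LINT w|nu. \<psi> w * ?k w) \<le> E * l powr (1/2) / s"
    proof -
      have far: "norm (\<psi> w) \<le> (b * l * s) powr (1/2) * (1 - norm w) powr (- (1/2)) + (b * s / (2 * l)) powr (- (1/2)) * (1 - norm w) powr (1/2)"
        if w: "norm w < 1" for w :: "complex^'n"
      proof (cases "\<psi> w = 0")
        case False
        then obtain j where j: "shell a b (l ^ j) w" and jk: "j \<noteq> k" by (auto simp: \<psi>_def S_def s_def split: if_splits)
        have nn: "norm (\<psi> w) \<le> 1" by (simp add: \<psi>_def)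
        consider "Suc k \<le> j" | "Suc j \<le> k" using jk by linarith
        then show ?thesis
        proof cases
          case 1
          have "1 - norm w \<le> b * l ^ j" using j by (simp add: shell_def)
          also have "\<dots> \<le> b * l ^ Suc k" using 1 l b by (intro mult_left_mono power_decreasing) auto
          finally have "1 - norm w \<le> b * l * s" by (simp add: s_def)
          then have "1 \<le> (b * l * s / (1 - norm w)) powr (1/2)" using w by (intro ge_one_powr_ge_zero) (auto simp: le_divide_eq)
          also have "\<dots> = (b * l * s) powr (1/2) * (1 - norm w) powr (- (1/2))"
            using w b l s by (simp add: powr_divide powr_minus_divide)
          finally have "1 \<le> (b * l * s) powr (1/2) * (1 - norm w) powr (- (1/2))" .
          then show ?thesis using nn by (smt (verit) mult_nonneg_nonneg powr_ge_zero)
        next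
          case 2
          have "b * l ^ k \<le> b * l ^ Suc j" using 2 l b by (intro mult_left_mono power_decreasing) auto
          then have "b * s / (2 * l) \<le> b * l ^ j / 2" using l by (simp add: s_def divide_le_eq mult_ac)
          also have "\<dots> \<le> 1 - norm w" using j by (simp add: shell_def)
          finally have "b * s / (2 * l) \<le> 1 - norm w" .
          moreover have bs: "0 < b * s / (2 * l)" using b s l by simp
          ultimately have "1 \<le> ((1 - norm w) / (b * s / (2 * l))) powr (1/2)" by (intro ge_one_powr_ge_zero) (simp_all only: le_divide_eq_1_pos)
          also have "\<dots> = (b * s / (2 * l)) powr (- (1/2)) * (1 - norm w) powr (1/2)"
            using w bs by (simp only: powr_divide powr_minus_divide less_imp_le) simp
          finally have "1 \<le> (b * s / (2 * l)) powr (- (1/2)) * (1 - norm w) powr (1/2)" .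
          then show ?thesis using nn by (smt (verit) mult_nonneg_nonneg powr_ge_zero)
        qed
      qed simp
      define X where "X = 2 * (b * l * s) powr (1/2)"
      define Y where "Y = 2 * (b * s / (2 * l)) powr (- (1/2))"
      have XY: "0 \<le> X" "0 \<le> Y" by (auto simp: X_def Y_def)
      have "ennreal (norm (LINT w|nu. \<psi> w * ?k w)) \<le> (\<integral>\<^sup>+w. ennreal (norm (\<psi> w * ?k w)) \<partial>nu)"
        by (rule integral_norm_bound_ennreal[OF i2])
      also have "\<dots> \<le> (\<integral>\<^sup>+w. ennreal X * ennreal ((1 - norm w) powr (- (1/2)) * kern z w) + ennreal Y * ennreal ((1 - norm w) powr (1/2) * kern z w) \<partial>nu)"
      proof (rule nn_integral_nu_mono)
        fix w :: "complex^'n" assume "norm w < 1 \<and> w \<noteq> 0"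
        then have w: "norm w < 1" by simp
        have "norm (\<psi> w * ?k w) \<le> ((b * l * s) powr (1/2) * (1 - norm w) powr (- (1/2)) + (b * s / (2 * l)) powr (- (1/2)) * (1 - norm w) powr (1/2)) * (2 * kern z w)"
          unfolding norm_mult n_def using nz w by (intro mult_mono far kfun_bound) auto
        also have "\<dots> = X * ((1 - norm w) powr (- (1/2)) * kern z w) + Y * ((1 - norm w) powr (1/2) * kern z w)"
          by (simp add: X_def Y_def distrib_left distrib_right mult_ac)
        finally show "ennreal (norm (\<psi> w * ?k w)) \<le> ennreal X * ennreal ((1 - norm w) powr (- (1/2)) * kern z w) + ennreal Y * ennreal ((1 - norm w) powr (1/2) * kern z w)"
          using XY by (simp add: ennreal_mult[symmetric] ennreal_plus[symmetric] ennreal_leI del: ennreal_plus)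
      qed
      also have "\<dots> = ennreal X * (\<integral>\<^sup>+w. ennreal ((1 - norm w) powr (- (1/2)) * kern z w) \<partial>nu) + ennreal Y * (\<integral>\<^sup>+w. ennreal ((1 - norm w) powr (1/2) * kern z w) \<partial>nu)"
        by (subst nn_integral_add, measurable) (simp add: nn_integral_cmult)
      also have "\<dots> \<le> ennreal X * ennreal (Cm * h powr (- (3/2))) + ennreal Y * ennreal (Cp * h powr (- (1/2)))"
        using m[of z] p[of z] nz unfolding h_def by (intro add_mono mult_left_mono) auto
      also have "\<dots> = ennreal (X * (Cm * h powr (- (3/2))) + Y * (Cp * h powr (- (1/2))))"
        using XY Cm Cp by (simp add: ennreal_mult[symmetric] ennreal_plus[symmetric] del: ennreal_plus)
      finally have "norm (LINT w|nu. \<psi> w * ?k w) \<le> X * (Cm * h powr (- (3/2))) + Y * (Cp * h powr (- (1/2)))"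
        using XY Cm Cp by (subst (asm) ennreal_le_iff) auto
      also have "\<dots> \<le> X * (Cm * (s / 2) powr (- (3/2))) + Y * (Cp * (s / 2) powr (- (1/2)))"
        using XY Cm Cp h s by (intro add_mono mult_left_mono powr_mono2') auto
      also have "\<dots> = E * l powr (1/2) / s"
      proof -
        have s1: "s powr (1/2) * s powr (- (3/2)) = 1 / s" unfolding powr_add[symmetric] using s by (simp add: powr_minus_divide)
        have s2: "s powr (- (1/2)) * s powr (- (1/2)) = 1 / s" unfolding powr_add[symmetric] using s by (simp add: powr_minus_divide)
        have X: "X = 2 * b powr (1/2) * l powr (1/2) * s powr (1/2)"
          using b l s by (simp add: X_def powr_mult)
        have "b * s / (2 * l) = (b / 2) * s * (1 / l)" by simp
        then have "(b * s / (2 * l)) powr (- (1/2)) = (b / 2) powr (- (1/2)) * s powr (- (1/2)) * (1 / l) powr (- (1/2))"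
          using b s l by (simp only: powr_mult)
        also have "(1 / l) powr (- (1/2)) = l powr (1/2)" using l by (simp add: powr_divide powr_minus_divide)
        finally have Y: "Y = 2 * (b / 2) powr (- (1/2)) * s powr (- (1/2)) * l powr (1/2)" by (simp add: Y_def)
        have h1: "(s / 2) powr q = s powr q * (1/2) powr q" for q using powr_mult[of s "1/2" q] s by simp
        have "X * (Cm * (s / 2) powr (- (3/2))) = 2 * (b powr (1/2) * (Cm * (1/2) powr (- (3/2)))) * l powr (1/2) * (s powr (1/2) * s powr (- (3/2)))"
          unfolding X h1 by (simp only: mult_ac)
        moreover have "Y * (Cp * (s / 2) powr (- (1/2))) = 2 * ((b / 2) powr (- (1/2)) * (Cp * (1/2) powr (- (1/2)))) * l powr (1/2) * (s powr (- (1/2)) * s powr (- (1/2)))"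
          unfolding Y h1 by (simp only: mult_ac)
        ultimately show ?thesis unfolding s1 s2 E_def by (simp only: distrib_right distrib_left times_divide_eq_right mult_1_right add_divide_distrib)
      qed
      finally show ?thesis .
    qed
    have "norm (LINT w|nu. \<psi> w * ?k w) \<le> m0 / 2 / s"
      using err divide_right_mono[OF lE, of s] s by simp
    moreover have "Re (LINT w|nu. indicator S w * ?k w) - norm (LINT w|nu. \<psi> w * ?k w) \<le> norm (Sop (lacunary a b l) z)"
      unfolding Sop using complex_Re_le_cmod[of "LINT w|nu. indicator S w * ?k w"] norm_diff_ineq[of "LINT w|nu. indicator S w * ?k w" "LINT w|nu. \<psi> w * ?k w"] by linarith
    ultimately have "m0 / s - m0 / 2 / s \<le> norm (Sop (lacunary a b l) z)" using main by linarith
    then have L: "m0 / 2 / s \<le> norm (Sop (lacunary a b l) z)" by (simp add: field_simps)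
    have "r * r \<le> r * 1" using nz r by (intro mult_left_mono) auto
    then have r2: "s / 2 \<le> 1 - r\<^sup>2" using h unfolding h_def power2_eq_square by linarith
    have "m0 / 4 = (s / 2) * (m0 / 2 / s)" using s by simp
    also have "\<dots> \<le> (1 - r\<^sup>2) * norm (Sop (lacunary a b l) z)"
      using r2 L s m0 by (intro mult_mono) auto
    also have "\<dots> = norm (Top (lacunary a b l) z)"
      using r2 s by (simp add: Top_def norm_mult nz del: of_real_diff of_real_power)
    finally show ?thesis by (simp add: z_def)
  qed
  then show ?thesis using a b l bl m0 by (intro exI[of _ a] exI[of _ b] exI[of _ l] exI[of _ "m0 / 4"]) auto
qed

text \<open>
  Each of the disjoint intervals \<open>l^k / 2 \<le> 1 - r \<le> l^k\<close> contributes a fixed amount, since the radial density is of order \<open>1 / (1 - r)\<close>.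
\<close>
lemma energy_lower:
  fixes F :: "complex^'n \<Rightarrow> complex"
  assumes [measurable]: "F \<in> borel_measurable borel" and c: "0 \<le> c" and l: "0 < l" "l \<le> 1/4"
    and F: "\<And>k r. 1 \<le> k \<Longrightarrow> k \<le> N \<Longrightarrow> 0 \<le> r \<Longrightarrow> l ^ k / 2 \<le> 1 - r \<Longrightarrow> 1 - r \<le> l ^ k \<Longrightarrow> c \<le> norm (F (r *\<^sub>R \<zeta>))"
  shows "ennreal (real N * (c\<^sup>2 * (real CARD('n) * (1/2) ^ (2 * CARD('n) - 1) / 2))) \<le> energy F \<zeta>"
proof -
  define n where "n = CARD('n)"
  define c4 where "c4 = real n * (1/2) ^ (2 * n - 1) / 2"
  have c4: "c4 \<ge> 0" by (simp add: c4_def)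
  define G where "G r = ennreal ((norm (F (r *\<^sub>R \<zeta>)))\<^sup>2 * (rd n r / (1 - r\<^sup>2)))" for r
  have [measurable]: "G \<in> borel_measurable borel" unfolding G_def by measurable
  have single: "ennreal (c\<^sup>2 * c4) \<le> (\<integral>\<^sup>+r. G r * indicator {1 - l ^ k..1 - l ^ k / 2} r \<partial>lborel)" if k: "1 \<le> k" "k \<le> N" for k
  proof -
    define s where "s = l ^ k"
    have "s \<le> l ^ 1" unfolding s_def using l k by (intro power_decreasing) auto
    then have s: "0 < s" "s \<le> 1/4" using l by (auto simp: s_def)
    have "ennreal (c\<^sup>2 * c4) = ennreal (c\<^sup>2 * (2 * c4 / s)) * ennreal (s / 2)"
      using s c4 by (subst ennreal_mult[symmetric]) auto
    also have "\<dots> = (\<integral>\<^sup>+r. ennreal (c\<^sup>2 * (2 * c4 / s)) * indicator {1 - s..1 - s / 2} r \<partial>lborel)"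
      using s by (subst nn_integral_cmult_indicator) auto
    also have "\<dots> \<le> (\<integral>\<^sup>+r. G r * indicator {1 - s..1 - s / 2} r \<partial>lborel)"
    proof (rule nn_integral_mono)
      fix r :: real
      show "ennreal (c\<^sup>2 * (2 * c4 / s)) * indicator {1 - s..1 - s / 2} r \<le> G r * indicator {1 - s..1 - s / 2} r"
      proof (cases "r \<in> {1 - s..1 - s / 2}")
        case True
        then have r: "1/2 \<le> r" "r < 1" "s / 2 \<le> 1 - r" "1 - r \<le> s" using s by auto
        have "c \<le> norm (F (r *\<^sub>R \<zeta>))" using F[OF k, of r] r by (simp add: s_def)
        then have 1: "c\<^sup>2 \<le> (norm (F (r *\<^sub>R \<zeta>)))\<^sup>2" using c by (rule power_mono)
        have "(1/2) ^ (2 * n - 1) \<le> r ^ (2 * n - 1)" using r by (intro power_mono) auto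
        then have "2 * real n * (1/2) ^ (2 * n - 1) \<le> 2 * real n * r ^ (2 * n - 1)" by (rule mult_left_mono) simp
        then have 2: "4 * c4 \<le> rd n r" using r by (simp add: c4_def rd_def)
        have "(1 - r) * (1 + r) \<le> s * 2" using r s by (intro mult_mono) auto
        then have 3: "1 - r\<^sup>2 \<le> 2 * s" by (simp add: power2_eq_square algebra_simps)
        have "0 < (1 - r) * (1 + r)" using r by simp
        then have 4: "0 < 1 - r\<^sup>2" by (simp add: power2_eq_square algebra_simps)
        have "2 * c4 / s = 4 * c4 / (2 * s)" by simp
        also have "\<dots> \<le> rd n r / (1 - r\<^sup>2)" using 2 3 4 c4 by (intro frac_le) auto
        finally have "c\<^sup>2 * (2 * c4 / s) \<le> (norm (F (r *\<^sub>R \<zeta>)))\<^sup>2 * (rd n r / (1 - r\<^sup>2))"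
          using 1 c4 s by (intro mult_mono) auto
        then show ?thesis using True by (simp add: G_def ennreal_leI)
      qed simp
    qed
    finally show ?thesis by (simp add: s_def)
  qed
  have "ennreal (real m * (c\<^sup>2 * c4)) \<le> (\<integral>\<^sup>+r. G r * indicator {..1 - l ^ m / 2} r \<partial>lborel)" if "m \<le> N" for m
    using that
  proof (induction m)
    case 0
    then show ?case by simp
  next
    case (Suc m)
    have "ennreal (real (Suc m) * (c\<^sup>2 * c4)) = ennreal (real m * (c\<^sup>2 * c4)) + ennreal (c\<^sup>2 * c4)"
      using c4 by (subst ennreal_plus[symmetric]) (auto simp: distrib_right)
    also have "\<dots> \<le> (\<integral>\<^sup>+r. G r * indicator {..1 - l ^ m / 2} r \<partial>lborel) + (\<integral>\<^sup>+r. G r * indicator {1 - l ^ Suc m..1 - l ^ Suc m / 2} r \<partial>lborel)"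
      using Suc by (intro add_mono single) auto
    also have "\<dots> = (\<integral>\<^sup>+r. G r * indicator {..1 - l ^ m / 2} r + G r * indicator {1 - l ^ Suc m..1 - l ^ Suc m / 2} r \<partial>lborel)"
      by (rule nn_integral_add[symmetric]) measurable
    also have "\<dots> \<le> (\<integral>\<^sup>+r. G r * indicator {..1 - l ^ Suc m / 2} r \<partial>lborel)"
    proof (rule nn_integral_mono)
      fix r :: real
      have "l * l ^ m \<le> 1/4 * l ^ m" using l by (intro mult_right_mono) auto
      moreover have "0 < l ^ m" using l by simp
      ultimately have "l ^ Suc m < l ^ m / 2" "0 < l ^ Suc m" using l by auto
      then show "G r * indicator {..1 - l ^ m / 2} r + G r * indicator {1 - l ^ Suc m..1 - l ^ Suc m / 2} r \<le> G r * indicator {..1 - l ^ Suc m / 2} r"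
        unfolding indicator_def by (simp del: power_Suc)
    qed
    finally show ?case .
  qed
  from this[of N] have "ennreal (real N * (c\<^sup>2 * c4)) \<le> (\<integral>\<^sup>+r. G r * indicator {..1 - l ^ N / 2} r \<partial>lborel)" by simp
  also have "\<dots> \<le> (\<integral>\<^sup>+r. G r \<partial>lborel)" by (rule nn_integral_mono) (simp split: split_indicator)
  finally show ?thesis unfolding energy_def G_def c4_def n_def .
qed

text \<open>
  With \<open>\<epsilon> = 1/N\<close> the set where the distance to the pole is less than \<open>b l^N\<close> has weight at least
  a constant times \<open>N (b l^N) powr (n/N)\<close>, hence at least a constant times \<open>N\<close>, which is the order of the total mass. There the energy of the image is
  at least a constant times \<open>N\<close>.
\<close>
lemma lacunary_blowup:
  assumes P: "0 < P"
  shows "\<exists>(\<phi> :: complex^'n \<Rightarrow> complex) c. 0 < c \<and> integrable nu \<phi> \<and>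
     (\<forall>N\<ge>2. wenergy P (pweight (1 / real N)) \<phi> < \<infinity> \<and>
       (\<forall>M>0. wenergy P (pweight (1 / real N)) (Top \<phi>) \<le> ennreal (M powr P) * wenergy P (pweight (1 / real N)) \<phi> \<longrightarrow> c * sqrt (real N) \<le> M))"
proof -
  define n where "n = real CARD('n)"
  have n: "n \<ge> 1" by (simp add: n_def Suc_le_eq)
  obtain a b l c0 where ab: "0 < a" "0 < b" "b \<le> 1" "b * l \<le> a" and l: "0 < l" "l \<le> 1/4" and c0: "0 < c0"
    and T: "\<And>k (\<zeta> :: complex^'n) r. norm \<zeta> = 1 \<Longrightarrow> dist1 \<zeta> \<le> b * l ^ k \<Longrightarrow> 0 \<le> r \<Longrightarrow> l ^ k / 2 \<le> 1 - r \<Longrightarrow> 1 - r \<le> l ^ k \<Longrightarrow>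
        c0 \<le> norm (Top (lacunary a b l) (r *\<^sub>R \<zeta>))"
    using Top_lacunary_lower[where 'n='n] by blast
  obtain C where C: "C > 0" and up: "\<And>\<epsilon> R. 0 < \<epsilon> \<Longrightarrow> \<epsilon> < 1 \<Longrightarrow> 0 < R \<Longrightarrow>
    (\<integral>\<^sup>+\<zeta>. ennreal (pweight \<epsilon> \<zeta>) * (if dist1 \<zeta> < R then 1 else 0) \<partial>(sig :: (complex^'n) measure)) \<le> ennreal (C / \<epsilon> * R powr (n * \<epsilon>))"
    using pweight_integral_upper[where 'n='n] unfolding n_def by blast
  obtain c where c: "c > 0" and low: "\<And>\<epsilon> R. 0 < \<epsilon> \<Longrightarrow> \<epsilon> \<le> 1/2 \<Longrightarrow> 0 < R \<Longrightarrow> R \<le> 3 \<Longrightarrow>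
    ennreal (c / \<epsilon> * R powr (n * \<epsilon>)) \<le> (\<integral>\<^sup>+\<zeta>. ennreal (pweight \<epsilon> \<zeta>) * (if dist1 \<zeta> < R then 1 else 0) \<partial>(sig :: (complex^'n) measure))"
    using pweight_integral_lower[where 'n='n] unfolding n_def by blast
  define \<phi> :: "complex^'n \<Rightarrow> complex" where "\<phi> = lacunary a b l"
  have [measurable]: "\<phi> \<in> borel_measurable borel" unfolding \<phi>_def by simp
  define c3 where "c3 = c0\<^sup>2 * (real CARD('n) * (1/2) ^ (2 * CARD('n) - 1) / 2)"
  have c3: "c3 > 0" using c0 by (simp add: c3_def)
  define U where "U = (2 * n) powr (P / 2) * (C * 3 powr n)"
  have U: "U > 0" using C n by (simp add: U_def)
  define L where "L = c3 powr (P / 2) * (c * (b powr n * l powr n))"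
  have L: "L > 0" using c3 c ab l by (simp add: L_def)
  have upper: "wenergy P (pweight (1 / real N)) \<phi> \<le> ennreal (U * real N)"
    and lower: "ennreal (L * real N powr (P / 2) * real N) \<le> wenergy P (pweight (1 / real N)) (Top \<phi>)" if N: "2 \<le> N" for N
  proof -
    define \<epsilon> where "\<epsilon> = 1 / real N"
    have \<epsilon>: "0 < \<epsilon>" "\<epsilon> \<le> 1/2" "1 / \<epsilon> = real N" using N by (auto simp: \<epsilon>_def)
    have nN: "n * \<epsilon> \<le> n" "0 \<le> n * \<epsilon>" using n \<epsilon> by (auto simp: mult_left_le)
    have "wenergy P (pweight \<epsilon>) \<phi> \<le> (\<integral>\<^sup>+\<zeta>. ennreal ((2 * n) powr (P / 2)) * (ennreal (pweight \<epsilon> \<zeta>) * (if dist1 \<zeta> < 3 then 1 else 0)) \<partial>(sig :: (complex^'n) measure))"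
      unfolding wenergy_def
    proof (rule nn_integral_sig_mono)
      fix \<zeta> :: "complex^'n" assume z: "norm \<zeta> = 1"
      have "epowr (energy \<phi> \<zeta>) (P / 2) \<le> epowr (ennreal (2 * n)) (P / 2)"
        unfolding \<phi>_def n_def using P l ab z by (intro epowr_mono energy_lacunary) auto
      also have "\<dots> = ennreal ((2 * n) powr (P / 2))" using n by (intro epowr_ennreal) simp
      finally show "epowr (energy \<phi> \<zeta>) (P / 2) * ennreal (pweight \<epsilon> \<zeta>) \<le> ennreal ((2 * n) powr (P / 2)) * (ennreal (pweight \<epsilon> \<zeta>) * (if dist1 \<zeta> < 3 then 1 else 0))"
        using dist1_le_2[OF z] by (simp add: mult_right_mono)
    qed
    also have "\<dots> = ennreal ((2 * n) powr (P / 2)) * (\<integral>\<^sup>+\<zeta>. ennreal (pweight \<epsilon> \<zeta>) * (if dist1 \<zeta> < 3 then 1 else 0) \<partial>(sig :: (complex^'n) measure))"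
      by (rule nn_integral_cmult) measurable
    also have "\<dots> \<le> ennreal ((2 * n) powr (P / 2)) * ennreal (C / \<epsilon> * 3 powr (n * \<epsilon>))"
      using \<epsilon> by (intro mult_left_mono up) auto
    also have "\<dots> = ennreal ((2 * n) powr (P / 2) * (C / \<epsilon> * 3 powr (n * \<epsilon>)))"
      using C \<epsilon> by (intro ennreal_mult[symmetric]) auto
    also have "\<dots> \<le> ennreal ((2 * n) powr (P / 2) * (C / \<epsilon> * 3 powr n))"
      using C \<epsilon> nN by (intro ennreal_leI mult_left_mono powr_mono) auto
    also have "(2 * n) powr (P / 2) * (C / \<epsilon> * 3 powr n) = U * (1 / \<epsilon>)" by (simp add: U_def)
    finally show "wenergy P (pweight (1 / real N)) \<phi> \<le> ennreal (U * real N)" unfolding \<epsilon>(3) unfolding \<epsilon>_def .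
    define \<rho> where "\<rho> = b * l ^ N"
    have "l ^ N \<le> 1" using l by (intro power_le_one) auto
    then have \<rho>: "0 < \<rho>" "\<rho> \<le> 3" using ab l mult_mono[of b 1 "l ^ N" 1] by (auto simp: \<rho>_def)
    have en: "ennreal (real N * c3) \<le> energy (Top \<phi>) \<zeta>" if z: "norm \<zeta> = 1" "dist1 \<zeta> < \<rho>" for \<zeta> :: "complex^'n"
      unfolding c3_def
    proof (rule energy_lower[of _ _ l])
      fix k r assume k: "1 \<le> k" "k \<le> N" and r: "0 \<le> r" "l ^ k / 2 \<le> 1 - r" "1 - r \<le> l ^ k"
      have "b * l ^ N \<le> b * l ^ k" using ab l k by (intro mult_left_mono power_decreasing) auto
      then have "dist1 \<zeta> \<le> b * l ^ k" using z by (simp add: \<rho>_def)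
      then show "c0 \<le> norm (Top \<phi> (r *\<^sub>R \<zeta>))" unfolding \<phi>_def by (intro T[of \<zeta> k r] z r)
    qed (use c0 l in auto)
    have "L * real N powr (P / 2) * real N \<le> (real N * c3) powr (P / 2) * (c / \<epsilon> * \<rho> powr (n * \<epsilon>))"
    proof -
      have ln: "l powr n = (l ^ N) powr (n * \<epsilon>)"
      proof -
        have "(l ^ N) powr (n * \<epsilon>) = (l powr real N) powr (n * \<epsilon>)" using l by (simp add: powr_realpow)
        also have "\<dots> = l powr (real N * (n * \<epsilon>))" by (rule powr_powr)
        also have "real N * (n * \<epsilon>) = n" using N by (simp add: \<epsilon>_def)
        finally show ?thesis by simp
      qed
      have "b powr n * l powr n \<le> b powr (n * \<epsilon>) * l powr n"
        using ab nN by (intro mult_right_mono powr_mono') auto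
      also have "\<dots> = \<rho> powr (n * \<epsilon>)"
        unfolding ln using ab l by (simp add: \<rho>_def powr_mult)
      finally have 1: "b powr n * l powr n \<le> \<rho> powr (n * \<epsilon>)" .
      have "L * real N powr (P / 2) * real N = (c3 powr (P / 2) * real N powr (P / 2)) * (c * (b powr n * l powr n) * (1 / \<epsilon>))"
        unfolding L_def \<epsilon>(3) by (simp only: mult_ac)
      also have "\<dots> \<le> (c3 powr (P / 2) * real N powr (P / 2)) * (c * \<rho> powr (n * \<epsilon>) * (1 / \<epsilon>))"
        using 1 c \<epsilon> by (intro mult_left_mono mult_right_mono) auto
      also have "\<dots> = (real N * c3) powr (P / 2) * (c / \<epsilon> * \<rho> powr (n * \<epsilon>))"
        using c3 by (simp add: powr_mult mult_ac)
      finally show ?thesis .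
    qed
    then have "ennreal (L * real N powr (P / 2) * real N) \<le> ennreal ((real N * c3) powr (P / 2) * (c / \<epsilon> * \<rho> powr (n * \<epsilon>)))"
      by (rule ennreal_leI)
    also have "\<dots> = ennreal ((real N * c3) powr (P / 2)) * ennreal (c / \<epsilon> * \<rho> powr (n * \<epsilon>))"
      using c \<epsilon> by (intro ennreal_mult) auto
    also have "\<dots> \<le> ennreal ((real N * c3) powr (P / 2)) * (\<integral>\<^sup>+\<zeta>. ennreal (pweight \<epsilon> \<zeta>) * (if dist1 \<zeta> < \<rho> then 1 else 0) \<partial>(sig :: (complex^'n) measure))"
      using \<epsilon> \<rho> by (intro mult_left_mono low) auto
    also have "\<dots> = (\<integral>\<^sup>+\<zeta>. ennreal ((real N * c3) powr (P / 2)) * (ennreal (pweight \<epsilon> \<zeta>) * (if dist1 \<zeta> < \<rho> then 1 else 0)) \<partial>(sig :: (complex^'n) measure))"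
      by (rule nn_integral_cmult[symmetric]) measurable
    also have "\<dots> \<le> wenergy P (pweight \<epsilon>) (Top \<phi>)"
      unfolding wenergy_def
    proof (rule nn_integral_sig_mono)
      fix \<zeta> :: "complex^'n" assume z: "norm \<zeta> = 1"
      show "ennreal ((real N * c3) powr (P / 2)) * (ennreal (pweight \<epsilon> \<zeta>) * (if dist1 \<zeta> < \<rho> then 1 else 0)) \<le> epowr (energy (Top \<phi>) \<zeta>) (P / 2) * ennreal (pweight \<epsilon> \<zeta>)"
      proof (cases "dist1 \<zeta> < \<rho>")
        case True
        have "ennreal ((real N * c3) powr (P / 2)) = epowr (ennreal (real N * c3)) (P / 2)"
          using c3 by (intro epowr_ennreal[symmetric]) simp
        also have "\<dots> \<le> epowr (energy (Top \<phi>) \<zeta>) (P / 2)" using P en[OF z True] by (intro epowr_mono) auto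
        finally show ?thesis using True by (simp add: mult_right_mono)
      qed simp
    qed
    finally show "ennreal (L * real N powr (P / 2) * real N) \<le> wenergy P (pweight (1 / real N)) (Top \<phi>)" unfolding \<epsilon>_def .
  qed
  define c7 where "c7 = (L / U) powr (1 / P)"
  have "c7 * sqrt (real N) \<le> M" if N: "2 \<le> N" and M: "0 < M"
    and le: "wenergy P (pweight (1 / real N)) (Top \<phi>) \<le> ennreal (M powr P) * wenergy P (pweight (1 / real N)) \<phi>" for N M
  proof -
    have "ennreal (L * real N powr (P / 2) * real N) \<le> ennreal (M powr P) * ennreal (U * real N)"
      by (rule order_trans[OF lower[OF N] order_trans[OF le mult_left_mono[OF upper[OF N]]]]) simp
    also have "\<dots> = ennreal (M powr P * (U * real N))" using U by (intro ennreal_mult[symmetric]) auto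
    finally have "L * real N powr (P / 2) * real N \<le> M powr P * (U * real N)"
      using U by (subst (asm) ennreal_le_iff) auto
    then have "(L * real N powr (P / 2)) * real N \<le> (M powr P * U) * real N" by (simp only: mult_ac)
    then have "L * real N powr (P / 2) \<le> M powr P * U" using N by (subst (asm) mult_le_cancel_right_pos) auto
    then have "L / U * real N powr (P / 2) \<le> M powr P" using U by (simp add: divide_le_eq)
    then have "(L / U * real N powr (P / 2)) powr (1 / P) \<le> (M powr P) powr (1 / P)"
      using P L U by (intro powr_mono2) auto
    moreover have "(M powr P) powr (1 / P) = M" using P M by (simp add: powr_powr)
    moreover have "(L / U * real N powr (P / 2)) powr (1 / P) = c7 * sqrt (real N)"
    proof -
      have "(L / U * real N powr (P / 2)) powr (1 / P) = c7 * (real N powr (P / 2)) powr (1 / P)"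
        using L U by (simp only: c7_def powr_mult)
      also have "(real N powr (P / 2)) powr (1 / P) = real N powr (1 / 2)" using P by (simp add: powr_powr)
      finally show ?thesis using N by (simp add: powr_half_sqrt)
    qed
    ultimately show ?thesis by simp
  qed
  moreover have "wenergy P (pweight (1 / real N)) \<phi> < \<infinity>" if "2 \<le> N" for N
    using upper[OF that] by (rule order_le_less_trans) simp
  moreover have "0 < c7" using L U by (simp add: c7_def)
  moreover have "integrable nu \<phi>" unfolding \<phi>_def by (rule lacunary_integrable)
  ultimately show ?thesis by blast
qed

lemma wenergy_Top_upper:
  assumes p: "2 < p"
  shows "\<exists>C>0. \<forall>(\<omega> :: complex^'n \<Rightarrow> real) \<omega>0 (\<phi> :: complex^'n \<Rightarrow> complex).
    \<omega> \<in> A1 \<longrightarrow> \<omega>0 \<in> borel_measurable borel \<longrightarrow> (AE \<zeta> in sig. \<omega> \<zeta> = \<omega>0 \<zeta>) \<longrightarrow> (\<integral>\<^sup>+\<zeta>. ennreal (\<omega>0 \<zeta>) \<partial>sig) < \<infinity> \<longrightarrow> integrable nu \<phi> \<longrightarrow>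
    wenergy p \<omega>0 (Top \<phi>) \<le> ennreal ((C * A1_const \<omega> powr (1/2)) powr p) * wenergy p \<omega>0 \<phi>"
proof -
  obtain C0 where C0: "C0 > 0" and D: "\<And>(\<omega> :: complex^'n \<Rightarrow> real) A (\<phi> :: complex^'n \<Rightarrow> complex) \<psi>.
     \<omega> \<in> borel_measurable borel \<Longrightarrow> A1_bound \<omega> A \<Longrightarrow> 0 < A \<Longrightarrow> (\<integral>\<^sup>+\<zeta>. ennreal (\<omega> \<zeta>) \<partial>sig) < \<infinity> \<Longrightarrow>
     \<phi> \<in> borel_measurable borel \<Longrightarrow>
     (\<forall>z. norm z < 1 \<longrightarrow> ennreal (norm (\<psi> z)) \<le> ennreal (2 * (1 - (norm z)\<^sup>2)) * (\<integral>\<^sup>+w. ennreal (norm (\<phi> w) * kern z w) \<partial>nu)) \<Longrightarrow>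
     wenergy p \<omega> \<psi> \<le> ennreal (C0 * A powr (p / 2)) * wenergy p \<omega> \<phi>"
    using dominated_upper[OF p, where 'n='n] by blast
  obtain C1 where C1: "C1 > 0" and B: "\<And>(\<omega> :: complex^'n \<Rightarrow> real) \<omega>0. \<omega> \<in> A1 \<Longrightarrow> \<omega>0 \<in> borel_measurable borel \<Longrightarrow>
     (AE \<zeta> in sig. \<omega> \<zeta> = \<omega>0 \<zeta>) \<Longrightarrow> A1_bound \<omega>0 (C1 * A1_const \<omega>)"
    using A1_imp_A1_bound[where 'n='n] by blast
  define C where "C = C0 powr (1 / p) * C1 powr (1/2)"
  have "wenergy p \<omega>0 (Top \<phi>) \<le> ennreal ((C * A1_const \<omega> powr (1/2)) powr p) * wenergy p \<omega>0 \<phi>"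
    if w: "\<omega> \<in> A1" "\<omega>0 \<in> borel_measurable borel" "AE \<zeta> in sig. \<omega> \<zeta> = \<omega>0 \<zeta>" "(\<integral>\<^sup>+\<zeta>. ennreal (\<omega>0 \<zeta>) \<partial>sig) < \<infinity>" and \<phi>: "integrable nu \<phi>"
    for \<omega> \<omega>0 :: "complex^'n \<Rightarrow> real" and \<phi> :: "complex^'n \<Rightarrow> complex"
  proof -
    define A where "A = A1_const \<omega>"
    have A: "A \<ge> 1" unfolding A_def using w(1) by (rule A1_const_ge_1)
    have [measurable]: "\<phi> \<in> borel_measurable borel" using \<phi> by (simp add: borel_measurable_integrable)
    have "wenergy p \<omega>0 (Top \<phi>) \<le> ennreal (C0 * (C1 * A) powr (p / 2)) * wenergy p \<omega>0 \<phi>"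
      using A C1 B[OF w(1-3)] Top_dominated[of \<phi>] by (intro D w) (auto simp: A_def)
    also have "C0 * (C1 * A) powr (p / 2) = (C * A powr (1/2)) powr p"
    proof -
      have "(C * A powr (1/2)) powr p = (C0 powr (1 / p)) powr p * (C1 powr (1/2)) powr p * (A powr (1/2)) powr p"
        unfolding C_def by (simp only: powr_mult powr_ge_zero mult_nonneg_nonneg)
      also have "\<dots> = C0 * C1 powr (p / 2) * A powr (p / 2)" using C0 p by (simp add: powr_powr)
      finally show ?thesis using C1 A by (simp add: powr_mult)
    qed
    finally show ?thesis unfolding A_def .
  qed
  moreover have "C > 0" using C0 C1 by (simp add: C_def)
  ultimately show ?thesis by blast
qed

text \<open>
  By \<open>A1_average_le\<close> an \<open>A1\<close> weight is bounded below by a positive constant.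
\<close>
lemma A1_negative_power_integrable:
  fixes \<omega> \<omega>0 :: "complex^'n \<Rightarrow> real"
  assumes "\<omega> \<in> A1" and [measurable]: "\<omega>0 \<in> borel_measurable borel" and eq: "AE \<zeta> in sig. \<omega> \<zeta> = \<omega>0 \<zeta>"
    and int: "(\<integral>\<^sup>+\<zeta>. ennreal (\<omega>0 \<zeta>) \<partial>sig) < \<infinity>" "0 < (\<integral>\<^sup>+\<zeta>. ennreal (\<omega>0 \<zeta>) \<partial>sig)" and q: "q \<le> 0"
  shows "(\<integral>\<^sup>+\<zeta>. ennreal (\<omega>0 \<zeta> powr q) \<partial>sig) < \<infinity>"
proof -
  define m where "m = enn2real (\<integral>\<^sup>+\<zeta>. ennreal (\<omega>0 \<zeta>) \<partial>sig)"
  have m: "(\<integral>\<^sup>+\<zeta>. ennreal (\<omega>0 \<zeta>) \<partial>sig) = ennreal m" "m > 0"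
    using int by (auto simp: m_def enn2real_positive_iff)
  define A where "A = A1_const \<omega>"
  have A: "A \<ge> 1" unfolding A_def using assms(1) by (rule A1_const_ge_1)
  have "(\<integral>\<^sup>+\<zeta>. ennreal (\<omega>0 \<zeta> powr q) \<partial>sig) \<le> (\<integral>\<^sup>+\<zeta>. ennreal ((m / A) powr q) \<partial>(sig :: (complex^'n) measure))"
  proof (rule nn_integral_mono_AE, rule AE_mp[OF A1_average_le[OF assms(1,2) eq]], intro AE_I2 impI ennreal_leI)
    fix \<zeta> :: "complex^'n"
    assume "(\<integral>\<^sup>+\<zeta>. ennreal (\<omega>0 \<zeta>) \<partial>sig) \<le> ennreal (A1_const \<omega> * \<omega>0 \<zeta>)"
    then have le: "ennreal m \<le> ennreal (A * \<omega>0 \<zeta>)" unfolding m A_def .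
    then have "m \<le> A * \<omega>0 \<zeta>" using m by (simp add: ennreal_le_iff2)
    then have "m / A \<le> \<omega>0 \<zeta>" using A by (simp add: divide_le_eq mult.commute)
    then show "\<omega>0 \<zeta> powr q \<le> (m / A) powr q" using q m A by (intro powr_mono2') auto
  qed
  also have "\<dots> < \<infinity>" unfolding nn_integral_const_sig by simp
  finally show ?thesis .
qed

lemma sqrt_beats_power:
  assumes s: "s < 1/2" and c: "0 < c"
  shows "\<exists>N::nat. 2 \<le> N \<and> D * real N powr s < c * sqrt (real N)"
proof -
  define e where "e = 1/2 - s"
  have e: "e > 0" using s by (simp add: e_def)
  define x where "x = max 1 (D / c) powr (1 / e)"
  obtain N :: nat where N: "max 2 x < real N" using reals_Archimedean2 by blast
  have "D / c \<le> max 1 (D / c)" by simp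
  also have "\<dots> = x powr e" using e by (simp add: x_def powr_powr)
  also have "\<dots> < real N powr e" using e N by (intro powr_less_mono2) (auto simp: x_def)
  finally have "D < c * real N powr e" using c by (simp add: divide_less_eq mult.commute)
  then have "D * real N powr s < (c * real N powr e) * real N powr s" using N by (intro mult_strict_right_mono) auto
  also have "\<dots> = c * sqrt (real N)"
    using N by (simp add: e_def powr_add[symmetric] powr_half_sqrt[symmetric] mult.assoc)
  finally show ?thesis using N by (intro exI[of _ N]) simp
qed

lemma wenergy_Top_sharp:
  assumes P: "0 < P" and s: "s < 1/2" and D: "0 < D"
  shows "\<exists>\<epsilon> (\<phi> :: complex^'n \<Rightarrow> complex). 0 < \<epsilon> \<and> \<epsilon> < 1 \<and> integrable nu \<phi> \<and> (pweight \<epsilon> :: complex^'n \<Rightarrow> real) \<in> A1 \<and>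
    wenergy P (pweight \<epsilon>) \<phi> < \<infinity> \<and>
    \<not> wenergy P (pweight \<epsilon>) (Top \<phi>) \<le> ennreal ((D * A1_const (pweight \<epsilon> :: complex^'n \<Rightarrow> real) powr s) powr P) * wenergy P (pweight \<epsilon>) \<phi>"
proof -
  obtain \<phi> :: "complex^'n \<Rightarrow> complex" and c where c: "0 < c" and \<phi>: "integrable nu \<phi>" and
    fin: "\<And>N. 2 \<le> N \<Longrightarrow> wenergy P (pweight (1 / real N)) \<phi> < \<infinity>" and
    low: "\<And>N M. 2 \<le> N \<Longrightarrow> 0 < M \<Longrightarrow> wenergy P (pweight (1 / real N)) (Top \<phi>) \<le> ennreal (M powr P) * wenergy P (pweight (1 / real N)) \<phi> \<Longrightarrow> c * sqrt (real N) \<le> M"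
    using lacunary_blowup[OF P, where 'n='n] by blast
  obtain K where K: "K > 0" and A1: "\<And>\<epsilon>. 0 < \<epsilon> \<Longrightarrow> \<epsilon> \<le> 1/2 \<Longrightarrow>
    (pweight \<epsilon> :: complex^'n \<Rightarrow> real) \<in> A1 \<and> A1_const (pweight \<epsilon> :: complex^'n \<Rightarrow> real) \<le> K / \<epsilon>"
    using pweight_A1[where 'n='n] by blast
  define t where "t = max s 0"
  have t: "s \<le> t" "0 \<le> t" "t < 1/2" using s by (auto simp: t_def)
  obtain N where N: "2 \<le> N" and lt: "(D * K powr t) * real N powr t < c * sqrt (real N)"
    using sqrt_beats_power[OF t(3) c] by blast
  define A where "A = A1_const (pweight (1 / real N) :: complex^'n \<Rightarrow> real)"
  have A1N: "(pweight (1 / real N) :: complex^'n \<Rightarrow> real) \<in> A1" "A \<le> K * real N"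
    using A1[of "1 / real N"] N by (auto simp: A_def)
  have A: "1 \<le> A" unfolding A_def by (rule A1_const_ge_1[OF A1N(1)])
  have "D * A powr s \<le> D * A powr t" using A D t by (intro mult_left_mono powr_mono) auto
  also have "\<dots> \<le> D * (K * real N) powr t" using A A1N D t by (intro mult_left_mono powr_mono2) auto
  also have "\<dots> = (D * K powr t) * real N powr t" using K by (simp add: powr_mult)
  also have "\<dots> < c * sqrt (real N)" by (rule lt)
  finally have "\<not> c * sqrt (real N) \<le> D * A powr s" by simp
  then have "\<not> wenergy P (pweight (1 / real N)) (Top \<phi>) \<le> ennreal ((D * A powr s) powr P) * wenergy P (pweight (1 / real N)) \<phi>"
    using low[OF N, of "D * A powr s"] D A by auto
  then show ?thesis using N \<phi> A1N(1) fin[OF N] unfolding A_def by (intro exI[of _ "1 / real N"] exI[of _ \<phi>]) auto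
qed

text \<open>
  The map from a weight to its dual weight is inverted by the dual exponent, so the power weights are dual weights.
\<close>
lemma weight_pweight_dual:
  assumes p: "1 < p" and \<epsilon>: "0 < \<epsilon>" "\<epsilon> < 1"
  shows "weight (\<lambda>\<zeta> :: complex^'n. pweight \<epsilon> \<zeta> powr (1 - p))"
    "dual_weight p (\<lambda>\<zeta> :: complex^'n. pweight \<epsilon> \<zeta> powr (1 - p)) = pweight \<epsilon>"
proof -
  define a where "a = real CARD('n) * (1 - \<epsilon>) * (p - 1)"
  have a: "0 \<le> a" using p \<epsilon> by (simp add: a_def)
  have pw: "pweight \<epsilon> \<zeta> powr (1 - p) = dist1 \<zeta> powr a" for \<zeta> :: "complex^'n"
  proof -
    have "- (real CARD('n) * (1 - \<epsilon>)) * (1 - p) = a" by (simp add: a_def algebra_simps)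
    then show ?thesis by (simp only: pweight_def powr_powr)
  qed
  have [measurable]: "(\<lambda>\<zeta> :: complex^'n. pweight \<epsilon> \<zeta> powr (1 - p)) \<in> borel_measurable borel" by measurable
  show "weight (\<lambda>\<zeta> :: complex^'n. pweight \<epsilon> \<zeta> powr (1 - p))"
    unfolding weight_def
  proof
    have m: "(\<lambda>\<zeta>. pweight \<epsilon> \<zeta> powr (1 - p)) \<in> borel_measurable (sphere_measure :: (complex^'n) measure)"
      unfolding sphere_measure_alt by (intro measurable_completion measurable_restrict_space1) simp
    have "(\<integral>\<^sup>+\<zeta>. ennreal (norm (pweight \<epsilon> \<zeta> powr (1 - p))) \<partial>(sphere_measure :: (complex^'n) measure)) \<le> (\<integral>\<^sup>+\<zeta>. ennreal (2 powr a) \<partial>(sig :: (complex^'n) measure))"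
      unfolding nn_integral_sphere_measure
    proof (rule nn_integral_sig_mono, rule ennreal_leI)
      fix \<zeta> :: "complex^'n" assume "norm \<zeta> = 1"
      then have "dist1 \<zeta> powr a \<le> 2 powr a" using a by (intro powr_mono2 dist1_le_2) auto
      then show "norm (pweight \<epsilon> \<zeta> powr (1 - p)) \<le> 2 powr a" by (simp add: pw)
    qed
    also have "\<dots> < \<infinity>" unfolding nn_integral_const_sig by simp
    finally show "integrable sphere_measure (\<lambda>\<zeta> :: complex^'n. pweight \<epsilon> \<zeta> powr (1 - p))"
      by (rule integrableI_bounded[OF m])
    show "AE \<zeta> in sphere_measure. 0 < pweight \<epsilon> (\<zeta> :: complex^'n) powr (1 - p)"
      unfolding AE_sphere_measure using AE_pweight_pos[of \<epsilon>] by (rule eventually_mono) simp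
  qed
  have "(1 - p) * (1 - conj_exponent p) = 1" using p by (simp add: conj_exponent_def field_simps)
  then show "dual_weight p (\<lambda>\<zeta> :: complex^'n. pweight \<epsilon> \<zeta> powr (1 - p)) = pweight \<epsilon>"
    by (simp add: dual_weight_def powr_powr)
qed

lemma weight_nn_integral_finite:
  fixes \<omega> \<omega>0 :: "complex^'n \<Rightarrow> real"
  assumes "weight \<omega>" and eq: "AE \<zeta> in sig. \<omega> \<zeta> = \<omega>0 \<zeta>"
  shows "(\<integral>\<^sup>+\<zeta>. ennreal (\<omega>0 \<zeta>) \<partial>sig) < \<infinity>"
proof -
  have "(\<integral>\<^sup>+\<zeta>. ennreal (\<omega>0 \<zeta>) \<partial>sig) \<le> (\<integral>\<^sup>+\<zeta>. ennreal (norm (\<omega> \<zeta>)) \<partial>sig)"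
    by (rule nn_integral_mono_AE, rule AE_mp[OF eq]) (auto intro!: AE_I2 ennreal_leI)
  also have "\<dots> < \<infinity>" using assms(1) unfolding nn_integral_sphere_measure[symmetric] weight_def by (simp add: integrable_iff_bounded)
  finally show ?thesis .
qed

theorem theorem1p4:
  fixes p :: real
  assumes "1 < p"
  shows
    "(2 < p \<longrightarrow>
        (\<exists>C. \<forall>\<omega> :: complex^'n \<Rightarrow> real. weight \<omega> \<and> \<omega> \<in> A1 \<longrightarrow>
           bergman ` Lp2 p \<omega> \<subseteq> Fp2 p \<omega> \<and>
           bergman_norm p \<omega> \<le> ennreal (C * A1_const \<omega> powr (1 / 2))) \<and>
        (\<forall>s < 1 / 2. \<not> (\<exists>C. \<forall>\<omega> :: complex^'n \<Rightarrow> real. weight \<omega> \<and> \<omega> \<in> A1 \<longrightarrow>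
           bergman_norm p \<omega> \<le> ennreal (C * A1_const \<omega> powr s))))
     \<and> (p < 2 \<longrightarrow>
        (\<exists>C. \<forall>\<omega> :: complex^'n \<Rightarrow> real. weight \<omega> \<and> dual_weight p \<omega> \<in> A1 \<longrightarrow>
           bergman ` Lp2 p \<omega> \<subseteq> Fp2 p \<omega> \<and>
           bergman_norm p \<omega> \<le> ennreal (C * A1_const (dual_weight p \<omega>) powr (1 / 2))) \<and>
        (\<forall>s < 1 / 2. \<not> (\<exists>C. \<forall>\<omega> :: complex^'n \<Rightarrow> real. weight \<omega> \<and> dual_weight p \<omega> \<in> A1 \<longrightarrow>
           bergman_norm p \<omega> \<le> ennreal (C * A1_const (dual_weight p \<omega>) powr s))))"
proof (intro conjI impI allI notI)
  assume p2: "2 < p"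
  obtain C where C: "C > 0" and up: "\<And>(\<omega> :: complex^'n \<Rightarrow> real) \<omega>0 (\<phi> :: complex^'n \<Rightarrow> complex).
    \<omega> \<in> A1 \<Longrightarrow> \<omega>0 \<in> borel_measurable borel \<Longrightarrow> (AE \<zeta> in sig. \<omega> \<zeta> = \<omega>0 \<zeta>) \<Longrightarrow> (\<integral>\<^sup>+\<zeta>. ennreal (\<omega>0 \<zeta>) \<partial>sig) < \<infinity> \<Longrightarrow> integrable nu \<phi> \<Longrightarrow>
    wenergy p \<omega>0 (Top \<phi>) \<le> ennreal ((C * A1_const \<omega> powr (1/2)) powr p) * wenergy p \<omega>0 \<phi>"
    using wenergy_Top_upper[OF p2, where 'n='n] by blast
  have "bergman ` Lp2 p \<omega> \<subseteq> Fp2 p \<omega> \<and> bergman_norm p \<omega> \<le> ennreal (C * A1_const \<omega> powr (1 / 2))"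
    if w: "weight \<omega>" "\<omega> \<in> A1" for \<omega> :: "complex^'n \<Rightarrow> real"
  proof -
    obtain \<omega>0 where w0: "\<omega>0 \<in> borel_measurable borel" "AE \<zeta> in sig. \<omega> \<zeta> = \<omega>0 \<zeta>" "AE \<zeta> in sig. 0 < \<omega>0 \<zeta>"
      "(\<integral>\<^sup>+\<zeta>. ennreal (\<omega>0 \<zeta>) \<partial>sig) < \<infinity>" "0 < (\<integral>\<^sup>+\<zeta>. ennreal (\<omega>0 \<zeta>) \<partial>sig)"
      using weight_borel_version[OF w(1)] .
    have "1 - p / (p - 1) \<le> 0" using p2 by (simp add: le_divide_eq)
    then have dual: "(\<integral>\<^sup>+\<zeta>. ennreal (\<omega>0 \<zeta> powr (1 - p / (p - 1))) \<partial>sig) < \<infinity>"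
      by (rule A1_negative_power_integrable[OF w(2) w0(1,2,4,5)])
    have "0 < C * A1_const \<omega> powr (1 / 2)" using C A1_const_ge_1[OF w(2)] by auto
    then show ?thesis by (rule bergman_norm_leI[OF assms w0(1,2,3) dual _ up[OF w(2) w0(1,2,4)]])
  qed
  then show "\<exists>C. \<forall>\<omega> :: complex^'n \<Rightarrow> real. weight \<omega> \<and> \<omega> \<in> A1 \<longrightarrow>
           bergman ` Lp2 p \<omega> \<subseteq> Fp2 p \<omega> \<and>
           bergman_norm p \<omega> \<le> ennreal (C * A1_const \<omega> powr (1 / 2))" by blast
next
  fix s :: real
  assume s: "s < 1/2" and "\<exists>C. \<forall>\<omega> :: complex^'n \<Rightarrow> real. weight \<omega> \<and> \<omega> \<in> A1 \<longrightarrow>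
           bergman_norm p \<omega> \<le> ennreal (C * A1_const \<omega> powr s)"
  then obtain C where C: "\<And>\<omega> :: complex^'n \<Rightarrow> real. weight \<omega> \<Longrightarrow> \<omega> \<in> A1 \<Longrightarrow> bergman_norm p \<omega> \<le> ennreal (C * A1_const \<omega> powr s)"
    by blast
  define D where "D = max C 1"
  have D: "D > 0" "C \<le> D" by (auto simp: D_def)
  obtain \<epsilon> and \<phi> :: "complex^'n \<Rightarrow> complex" where \<epsilon>: "0 < \<epsilon>" "\<epsilon> < 1" and \<phi>: "integrable nu \<phi>"
    and A1: "(pweight \<epsilon> :: complex^'n \<Rightarrow> real) \<in> A1" and fin: "wenergy p (pweight \<epsilon>) \<phi> < \<infinity>"
    and no: "\<not> wenergy p (pweight \<epsilon>) (Top \<phi>) \<le> ennreal ((D * A1_const (pweight \<epsilon> :: complex^'n \<Rightarrow> real) powr s) powr p) * wenergy p (pweight \<epsilon>) \<phi>"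
    using wenergy_Top_sharp[of p s D, where 'n='n] assms s D by auto
  define N where "N = D * A1_const (pweight \<epsilon> :: complex^'n \<Rightarrow> real) powr s"
  have N: "0 < N" using D A1_const_ge_1[OF A1] by (auto simp: N_def)
  have "bergman_norm p (pweight \<epsilon> :: complex^'n \<Rightarrow> real) \<le> ennreal N"
    by (rule order_trans[OF C[OF weight_pweight[OF \<epsilon>] A1]]) (use D in \<open>auto simp: N_def intro!: ennreal_leI mult_right_mono\<close>)
  then have "wenergy p (pweight \<epsilon>) (Top \<phi>) \<le> ennreal (N powr p) * wenergy p (pweight \<epsilon>) \<phi>"
    by (intro bergman_norm_leD[OF assms _ _ N _ \<phi> fin]) auto
  with no show False unfolding N_def by blast
next
  assume p2: "p < 2"
  define P where "P = p / (p - 1)"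
  have P: "2 < P" "1 < P" "p = P / (P - 1)" using assms p2 by (auto simp: P_def field_simps)
  show "\<exists>C. \<forall>\<omega> :: complex^'n \<Rightarrow> real. weight \<omega> \<and> dual_weight p \<omega> \<in> A1 \<longrightarrow>
           bergman ` Lp2 p \<omega> \<subseteq> Fp2 p \<omega> \<and>
           bergman_norm p \<omega> \<le> ennreal (C * A1_const (dual_weight p \<omega>) powr (1 / 2))"
  proof -
    obtain C where C: "C > 0" and up: "\<And>(\<omega> :: complex^'n \<Rightarrow> real) \<omega>0 (\<phi> :: complex^'n \<Rightarrow> complex).
      \<omega> \<in> A1 \<Longrightarrow> \<omega>0 \<in> borel_measurable borel \<Longrightarrow> (AE \<zeta> in sig. \<omega> \<zeta> = \<omega>0 \<zeta>) \<Longrightarrow> (\<integral>\<^sup>+\<zeta>. ennreal (\<omega>0 \<zeta>) \<partial>sig) < \<infinity> \<Longrightarrow> integrable nu \<phi> \<Longrightarrow>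
      wenergy P \<omega>0 (Top \<phi>) \<le> ennreal ((C * A1_const \<omega> powr (1/2)) powr P) * wenergy P \<omega>0 \<phi>"
      using wenergy_Top_upper[OF P(1), where 'n='n] by blast
    have "bergman ` Lp2 p \<omega> \<subseteq> Fp2 p \<omega> \<and> bergman_norm p \<omega> \<le> ennreal (2 * C * A1_const (dual_weight p \<omega>) powr (1 / 2))"
      if w: "weight \<omega>" "dual_weight p \<omega> \<in> A1" for \<omega> :: "complex^'n \<Rightarrow> real"
    proof -
      obtain \<omega>0 where w0: "\<omega>0 \<in> borel_measurable borel" "AE \<zeta> in sig. \<omega> \<zeta> = \<omega>0 \<zeta>" "AE \<zeta> in sig. 0 < \<omega>0 \<zeta>"
        "(\<integral>\<^sup>+\<zeta>. ennreal (\<omega>0 \<zeta>) \<partial>sig) < \<infinity>"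
        using weight_borel_version[OF w(1)] .
      define \<omega>' where "\<omega>' \<zeta> = \<omega>0 \<zeta> powr (1 - P)" for \<zeta>
      have m: "\<omega>' \<in> borel_measurable borel" unfolding \<omega>'_def using w0(1) by measurable
      have eq: "AE \<zeta> in sig. dual_weight p \<omega> \<zeta> = \<omega>' \<zeta>"
        using w0(2) by (rule eventually_mono) (simp add: dual_weight_def conj_exponent_def \<omega>'_def P_def)
      have fin: "(\<integral>\<^sup>+\<zeta>. ennreal (\<omega>' \<zeta>) \<partial>sig) < \<infinity>"
        using A1_AE(1)[OF w(2)] eq by (rule weight_nn_integral_finite)
      define N where "N = C * A1_const (dual_weight p \<omega>) powr (1 / 2)"
      have N: "0 < N" using C A1_const_ge_1[OF w(2)] by (auto simp: N_def)
      have T: "wenergy P (\<lambda>\<zeta>. \<omega>0 \<zeta> powr (1 - P)) (Top \<psi>) \<le> ennreal (N powr P) * wenergy P (\<lambda>\<zeta>. \<omega>0 \<zeta> powr (1 - P)) \<psi>"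
        if "integrable nu \<psi>" for \<psi> :: "complex^'n \<Rightarrow> complex"
        using up[OF w(2) m eq fin that] unfolding N_def \<omega>'_def .
      have "bergman ` Lp2 p \<omega> \<subseteq> Fp2 p \<omega> \<and> bergman_norm p \<omega> \<le> ennreal (2 * N)"
      proof (rule bergman_norm_leI[OF assms w0(1,2,3)])
        show "(\<integral>\<^sup>+\<zeta>. ennreal (\<omega>0 \<zeta> powr (1 - p / (p - 1))) \<partial>sig) < \<infinity>"
          using fin unfolding \<omega>'_def P_def .
        show "wenergy p \<omega>0 (Top \<phi>) \<le> ennreal ((2 * N) powr p) * wenergy p \<omega>0 \<phi>" if "integrable nu \<phi>" for \<phi> :: "complex^'n \<Rightarrow> complex"
          by (rule wenergy_duality[OF w0(1) P(2,3) w0(3,4) N T that])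
      qed (use N in simp)
      then show ?thesis by (simp add: N_def mult.assoc)
    qed
    then show ?thesis by blast
  qed
next
  fix s :: real
  assume p2: "p < 2" and s: "s < 1/2" and "\<exists>C. \<forall>\<omega> :: complex^'n \<Rightarrow> real. weight \<omega> \<and> dual_weight p \<omega> \<in> A1 \<longrightarrow>
           bergman_norm p \<omega> \<le> ennreal (C * A1_const (dual_weight p \<omega>) powr s)"
  then obtain C where C: "\<And>\<omega> :: complex^'n \<Rightarrow> real. weight \<omega> \<Longrightarrow> dual_weight p \<omega> \<in> A1 \<Longrightarrow>
      bergman_norm p \<omega> \<le> ennreal (C * A1_const (dual_weight p \<omega>) powr s)"
    by blast
  define P where "P = p / (p - 1)"
  have P: "0 < P" using assms by (simp add: P_def)
  define D where "D = max C 1"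
  have D: "D > 0" "C \<le> D" by (auto simp: D_def)
  obtain \<epsilon> and \<phi> :: "complex^'n \<Rightarrow> complex" where \<epsilon>: "0 < \<epsilon>" "\<epsilon> < 1" and \<phi>: "integrable nu \<phi>"
    and A1: "(pweight \<epsilon> :: complex^'n \<Rightarrow> real) \<in> A1"
    and no: "\<not> wenergy P (pweight \<epsilon>) (Top \<phi>) \<le> ennreal ((2 * D * A1_const (pweight \<epsilon> :: complex^'n \<Rightarrow> real) powr s) powr P) * wenergy P (pweight \<epsilon>) \<phi>"
    using wenergy_Top_sharp[of P s "2 * D", where 'n='n] P s D by auto
  define N where "N = D * A1_const (pweight \<epsilon> :: complex^'n \<Rightarrow> real) powr s"
  have N: "0 < N" using D A1_const_ge_1[OF A1] by (auto simp: N_def)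
  let ?\<omega> = "\<lambda>\<zeta> :: complex^'n. pweight \<epsilon> \<zeta> powr (1 - p)"
  note dual = weight_pweight_dual[OF assms \<epsilon>, where 'n='n]
  have "bergman_norm p ?\<omega> \<le> ennreal (C * A1_const (dual_weight p ?\<omega>) powr s)"
    by (rule C) (use dual A1 in simp_all)
  also have "\<dots> \<le> ennreal N"
    unfolding dual(2) N_def using D by (intro ennreal_leI mult_right_mono) auto
  finally have norm: "bergman_norm p ?\<omega> \<le> ennreal N" .
  have "wenergy P (pweight \<epsilon>) (Top \<phi>) \<le> ennreal ((2 * N) powr P) * wenergy P (pweight \<epsilon>) \<phi>"
  proof (rule wenergy_duality[OF _ assms P_def AE_pweight_pos _ N _ \<phi>])
    show "(\<integral>\<^sup>+\<zeta>. ennreal (pweight \<epsilon> (\<zeta> :: complex^'n)) \<partial>sig) < \<infinity>"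
      by (rule weight_nn_integral_finite[OF weight_pweight[OF \<epsilon>]]) simp
    show "wenergy p ?\<omega> (Top \<psi>) \<le> ennreal (N powr p) * wenergy p ?\<omega> \<psi>"
      if "integrable nu \<psi>" "wenergy p ?\<omega> \<psi> < \<infinity>" for \<psi> :: "complex^'n \<Rightarrow> complex"
      by (rule bergman_norm_leD[OF assms _ _ N norm that]) auto
  qed simp
  with no show False unfolding N_def by (simp add: mult.assoc)
qed

end
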